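(* The operator $K(q)$ satisfies the following linear evolution called the Cut-and-Join equation \begin{equation*} \frac{d K}{dq}(q) = W_1 K(q). \end{equation*} With the initial condition $K(0)=\mathrm{id}$, and then \begin{equation*} K(q)=\exp(qW_1). \end{equation*}
   Context: Let $V=\mathbb{Q}[L]$ and let $\hat{S}(V)$ be the formal bosonic Fock space (formal symmetric series in arbitrarily many variables), identified with $\mathbb{Q}[[\mathbf{t}]]$, $\mathbf{t}=(t_0,t_1,\dots)$, via the basis $e_k=L^k/k!$ ($e_k\mapsto t_k$). For $2g-2+n^++n^->0$, $K_{g,n^+,n^-}$ is the integral operator $\hat S_{n^-}(V)\to\hat S_{n^+}(V)$, $P\mapsto \frac{1}{n^-!}\int_{L^-\in|L^+|\cdot\Delta_{n^-}}\prod_iL_i^+\,V_{g,n^+,n^-}(L^+|L^-)P(L^-)\,d\sigma$, where $V_{g,n^+,n^-}$ is the volume of the moduli space of directed four-valent metric ribbon graphs of genus $g$ with $n^\pm$ boundaries of sign $\pm$; $K_{0,1,1}$ is the identity on $\hat S_1(V)=\hat V$. Set $K(q)=\exp_{\sqcup}\big(\sum_{g,n^+,n^-} q^{2g-2+n^++n^-}K_{g,n^+,n^-}\big)$, the sum including $(0,1,1)$, where $\exp_\sqcup$ is the exponential for the disjoint-union (symmetric) product of operators; equivalently $K$ is the sum over all (possibly disconnected) directed surfaces. The operator $W_1=P_++P_-$ with $P_+=K_{0,2,1}\sqcup\mathrm{id}$, $P_-=K_{0,1,2}\sqcup\mathrm{id}$, i.e. on $\hat S(V)$: $P_+F(L)=\frac12\sum_{i\neq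 j}L_iL_jF(L_i+L_j,L_{\{i,j\}^c})$, $P_-F(L)=\frac12\sum_iL_i\int_0^{L_i}F(x,L_i-x,L_{\{i\}^c})dx$; as differential operators $W_1=\frac12\sum_{i,j}(i+1)(j+1)t_{i+1}t_{j+1}\partial_{i+j}+\frac12\sum_{i,j}(i+j+2)t_{i+j+2}\partial_i\partial_j$. *)

theory Defs
  imports
    "HOL-Analysis.Analysis"
    "HOL-Combinatorics.Orbits"
    "HOL-Computational_Algebra.Formal_Power_Series"
begin

section \<open>Directed metric ribbon graphs\<close>

text \<open>
  A ribbon graph is given by its half-edges, the permutation \<open>vperm\<close> turning around the
  vertices and the involution \<open>einv\<close> exchanging the two halves of an edge. The boundary
  components are the orbits of \<open>vperm \<circ> einv\<close>. The label of a half-edge \<open>h\<close> is the boundary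
  containing \<open>h\<close>: \<open>Inl i\<close> is the \<open>i\<close>-th positive boundary, \<open>Inr j\<close> the \<open>j\<close>-th negative one.
\<close>

record 'h ribbon_graph =
  half_edges :: "'h set"
  vperm :: "'h \<Rightarrow> 'h"
  einv :: "'h \<Rightarrow> 'h"
  bdry :: "'h \<Rightarrow> nat + nat"

definition bperm :: "'h ribbon_graph \<Rightarrow> 'h \<Rightarrow> 'h" where
  "bperm G = vperm G \<circ> einv G"

definition verts :: "'h ribbon_graph \<Rightarrow> 'h set set" where
  "verts G = orbit (vperm G) ` half_edges G"

definition edge_at :: "'h ribbon_graph \<Rightarrow> 'h \<Rightarrow> 'h set" where
  "edge_at G h = {h, einv G h}"

definition edges :: "'h ribbon_graph \<Rightarrow> 'h set set" where
  "edges G = edge_at G ` half_edges G"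

definition is_ribbon_graph :: "'h ribbon_graph \<Rightarrow> bool" where
  "is_ribbon_graph G \<longleftrightarrow>
     finite (half_edges G) \<and> half_edges G \<noteq> {} \<and>
     vperm G permutes half_edges G \<and>
     einv G permutes half_edges G \<and>
     (\<forall>h\<in>half_edges G. einv G h \<noteq> h \<and> einv G (einv G h) = h)"

definition rg_connected :: "'h ribbon_graph \<Rightarrow> bool" where
  "rg_connected G \<longleftrightarrow>
     (\<forall>h\<in>half_edges G. \<forall>h'\<in>half_edges G.
        (h, h') \<in> {(x, y). x \<in> half_edges G \<and> (y = vperm G x \<or> y = einv G x)}\<^sup>*)"

definition boundary_labelled :: "nat \<Rightarrow> nat \<Rightarrow> 'h ribbon_graph \<Rightarrow> bool" where
  "boundary_labelled np nm G \<longleftrightarrow>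
     bdry G \<in> extensional (half_edges G) \<and>
     bdry G ` half_edges G = {..<np} <+> {..<nm} \<and>
     (\<forall>h\<in>half_edges G. \<forall>h'\<in>half_edges G.
        bdry G h = bdry G h' \<longleftrightarrow> h' \<in> orbit (bperm G) h)"

definition directed :: "'h ribbon_graph \<Rightarrow> bool" where
  "directed G \<longleftrightarrow> (\<forall>h\<in>half_edges G. isl (bdry G h) \<noteq> isl (bdry G (einv G h)))"

definition four_valent :: "'h ribbon_graph \<Rightarrow> bool" where
  "four_valent G \<longleftrightarrow> (\<forall>v\<in>verts G. card v = 4)"

text \<open>
  Every finite ribbon graph is isomorphic to one whose set of half-edges is an initial
  segment of the natural numbers.
\<close>

definition directed_graphs :: "nat \<Rightarrow> nat \<Rightarrow> nat \<Rightarrow> nat ribbon_graph set" where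
  "directed_graphs g np nm =
     {G. (\<exists>N. half_edges G = {..<N}) \<and> is_ribbon_graph G \<and> rg_connected G \<and>
         boundary_labelled np nm G \<and> directed G \<and> four_valent G \<and>
         int (card (verts G)) - int (card (edges G)) + int (np + nm) = 2 - 2 * int g}"

definition is_rg_iso :: "'h ribbon_graph \<Rightarrow> 'k ribbon_graph \<Rightarrow> ('h \<Rightarrow> 'k) \<Rightarrow> bool" where
  "is_rg_iso G G' f \<longleftrightarrow>
     bij_betw f (half_edges G) (half_edges G') \<and>
     (\<forall>h\<in>half_edges G. f (vperm G h) = vperm G' (f h) \<and>
                        f (einv G h) = einv G' (f h) \<and>
                        bdry G' (f h) = bdry G h)"

definition iso_rel :: "nat \<Rightarrow> nat \<Rightarrow> nat \<Rightarrow> (nat ribbon_graph \<times> nat ribbon_graph) set" where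
  "iso_rel g np nm =
     {(G, G'). G \<in> directed_graphs g np nm \<and> G' \<in> directed_graphs g np nm \<and>
               (\<exists>f. is_rg_iso G G' f)}"

definition rg_aut :: "'h ribbon_graph \<Rightarrow> ('h \<Rightarrow> 'h) set" where
  "rg_aut G = {f. f permutes half_edges G \<and> is_rg_iso G G f}"


section \<open>Lebesgue measure normalised by integer points\<close>

text \<open>
  For an affine subspace \<open>A\<close> of \<open>\<real>\<^sup>I\<close> whose direction is spanned by integer vectors,
  \<open>affine_measure I A\<close> is the translation invariant measure on \<open>A\<close> for which a fundamental
  domain of the lattice of integer vectors of the direction has mass 1. Points of \<open>\<real>\<^sup>I\<close> are
  extensional functions; lattice vectors vanish outside \<open>I\<close>. If \<open>A\<close> is a point, this is
  the Dirac measure. The choices of base point and of lattice basis are immaterial.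
\<close>

definition int_dirs :: "'i set \<Rightarrow> ('i \<Rightarrow> real) set \<Rightarrow> ('i \<Rightarrow> real) set" where
  "int_dirs I A =
     {v. (\<forall>i\<in>I. v i \<in> \<int>) \<and> (\<forall>i. i \<notin> I \<longrightarrow> v i = 0) \<and>
         (\<forall>a\<in>A. (\<lambda>i\<in>I. a i + v i) \<in> A)}"

definition int_basis :: "('i \<Rightarrow> real) set \<Rightarrow> ('i \<Rightarrow> real) list \<Rightarrow> bool" where
  "int_basis \<Lambda> bs \<longleftrightarrow>
     bij_betw (\<lambda>c i. \<Sum>k<length bs. of_int (c k) * (bs ! k) i)
       ({..<length bs} \<rightarrow>\<^sub>E (UNIV :: int set)) \<Lambda>"

definition affine_measure :: "'i set \<Rightarrow> ('i \<Rightarrow> real) set \<Rightarrow> ('i \<Rightarrow> real) measure" where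
  "affine_measure I A =
     (let a = (SOME a. a \<in> A); bs = (SOME bs. int_basis (int_dirs I A) bs)
      in distr (\<Pi>\<^sub>M k\<in>{..<length bs}. lborel) (\<Pi>\<^sub>M i\<in>I. borel)
           (\<lambda>x. \<lambda>i\<in>I. a i + (\<Sum>k<length bs. x k * (bs ! k) i)))"


section \<open>Volumes of the moduli spaces\<close>

definition bdry_length :: "'h ribbon_graph \<Rightarrow> ('h set \<Rightarrow> real) \<Rightarrow> nat + nat \<Rightarrow> real" where
  "bdry_length G l \<beta> = (\<Sum>h\<in>{h\<in>half_edges G. bdry G h = \<beta>}. l (edge_at G h))"

definition length_fiber ::
  "nat \<Rightarrow> nat \<Rightarrow> 'h ribbon_graph \<Rightarrow> (nat \<Rightarrow> real) \<Rightarrow> (nat \<Rightarrow> real) \<Rightarrow> ('h set \<Rightarrow> real) set" where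
  "length_fiber np nm G Lp Lm =
     {l \<in> extensional (edges G).
        (\<forall>i<np. bdry_length G l (Inl i) = Lp i) \<and>
        (\<forall>j<nm. bdry_length G l (Inr j) = Lm j)}"

definition cell_volume ::
  "nat \<Rightarrow> nat \<Rightarrow> 'h ribbon_graph \<Rightarrow> (nat \<Rightarrow> real) \<Rightarrow> (nat \<Rightarrow> real) \<Rightarrow> real" where
  "cell_volume np nm G Lp Lm =
     measure (affine_measure (edges G) (length_fiber np nm G Lp Lm))
       {l \<in> length_fiber np nm G Lp Lm. \<forall>e\<in>edges G. 0 < l e}"

definition volume ::
  "nat \<Rightarrow> nat \<Rightarrow> nat \<Rightarrow> (nat \<Rightarrow> real) \<Rightarrow> (nat \<Rightarrow> real) \<Rightarrow> real" where
  "volume g np nm Lp Lm =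
     (\<Sum>C\<in>directed_graphs g np nm // iso_rel g np nm.
        let G = (SOME G. G \<in> C) in cell_volume np nm G Lp Lm / real (card (rg_aut G)))"


section \<open>The formal bosonic Fock space\<close>

text \<open>
  A formal symmetric series \<open>F\<close> in arbitrarily many variables is represented by its
  coefficients in the basis \<open>e\<^sub>k = L\<^sup>k/k!\<close>: \<open>F [k\<^sub>1, \<dots>, k\<^sub>n]\<close> is the coefficient of
  \<open>e\<^sub>k\<^sub>1(L\<^sub>1) \<cdots> e\<^sub>k\<^sub>n(L\<^sub>n)\<close>. The product of the Fock space is the shuffle product, so that
  \<open>t\<^sub>k\<^sub>1 \<cdots> t\<^sub>k\<^sub>n\<close> corresponds to \<open>\<Sum>\<^sub>\<sigma> \<Prod>\<^sub>i e\<^sub>k\<^sub>\<sigma>\<^sub>(\<^sub>i\<^sub>)(L\<^sub>i)\<close>, the sum being over all permutations.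
\<close>

type_synonym series = "nat list \<Rightarrow> rat"
type_synonym op = "series \<Rightarrow> series"

definition fock :: "series set" where
  "fock = {F. \<forall>xs ys. mset xs = mset ys \<longrightarrow> F xs = F ys}"

definition e_monom :: "nat list \<Rightarrow> (nat \<Rightarrow> real) \<Rightarrow> real" where
  "e_monom a L = (\<Prod>i<length a. L i ^ (a ! i) / fact (a ! i))"

text \<open>
  The coefficients in the basis \<open>e\<close> of a function that is polynomial, with rational
  coefficients, on the positive orthant of \<open>\<real>\<^sup>n\<close>.
\<close>

definition e_coeffs :: "nat \<Rightarrow> ((nat \<Rightarrow> real) \<Rightarrow> real) \<Rightarrow> series" where
  "e_coeffs n f =
     (THE c. finite {b. c b \<noteq> 0} \<and> (\<forall>b. c b \<noteq> 0 \<longrightarrow> length b = n) \<and>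
             (\<forall>L. (\<forall>i<n. 0 < L i) \<longrightarrow>
                  f L = (\<Sum>b | c b \<noteq> 0. of_rat (c b) * e_monom b L)))"


section \<open>The operators associated with directed surfaces\<close>

definition sum_plane :: "nat \<Rightarrow> real \<Rightarrow> (nat \<Rightarrow> real) set" where
  "sum_plane m s = {x \<in> extensional {..<m}. (\<Sum>j<m. x j) = s}"

definition simplex_integral :: "nat \<Rightarrow> real \<Rightarrow> ((nat \<Rightarrow> real) \<Rightarrow> real) \<Rightarrow> real" where
  "simplex_integral m s f =
     set_lebesgue_integral (affine_measure {..<m} (sum_plane m s))
       {x \<in> sum_plane m s. \<forall>j<m. 0 \<le> x j} f"

definition K_integral ::
  "nat \<Rightarrow> nat \<Rightarrow> nat \<Rightarrow> ((nat \<Rightarrow> real) \<Rightarrow> real) \<Rightarrow> (nat \<Rightarrow> real) \<Rightarrow> real" where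
  "K_integral g np nm P Lp =
     1 / fact nm * simplex_integral nm (\<Sum>i<np. Lp i)
       (\<lambda>Lm. (\<Prod>i<np. Lp i) * volume g np nm Lp Lm * P Lm)"

text \<open>
  The operator on formal series is the extension of the integral operator from polynomials
  by its matrix in the basis \<open>e\<close>. The integral operator maps polynomials to polynomials and
  is homogeneous of degree \<open>2(2g-2+n\<^sup>++n\<^sup>-)\<close>, so the sum below is finite. The operator depends
  on the component of \<open>F\<close> with \<open>n\<^sup>-\<close> variables only, and its image has \<open>n\<^sup>+\<close> variables.
\<close>

definition K_op :: "nat \<Rightarrow> nat \<Rightarrow> nat \<Rightarrow> op" where
  "K_op g np nm F b =
     (if (g, np, nm) = (0, 1, 1) then (if length b = 1 then F b else 0)
      else (\<Sum>a | length a = nm \<and> e_coeffs np (K_integral g np nm (e_monom a)) b \<noteq> 0.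
              e_coeffs np (K_integral g np nm (e_monom a)) b * F a))"

text \<open>
  The disjoint union product \<open>A \<squnion> B\<close>: the output variables are distributed in all possible
  ways over \<open>A\<close> and \<open>B\<close>, which act on disjoint sets of input variables.
\<close>

definition disj_union :: "op \<Rightarrow> op \<Rightarrow> op" where
  "disj_union A B F xs =
     (\<Sum>I\<in>Pow {..<length xs}.
        B (\<lambda>ys. A (\<lambda>zs. F (zs @ ys)) (nths xs I)) (nths xs (- I)))"

definition vacuum_op :: op where
  "vacuum_op F xs = (if xs = [] then F [] else 0)"

text \<open>A formal power series in \<open>q\<close> with operator coefficients is the sequence of its coefficients.\<close>

type_synonym op_series = "nat \<Rightarrow> op"

definition disj_union_series :: "op_series \<Rightarrow> op_series \<Rightarrow> op_series" where
  "disj_union_series A B k F xs = (\<Sum>i\<le>k. disj_union (A i) (B (k - i)) F xs)"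

primrec disj_power :: "op_series \<Rightarrow> nat \<Rightarrow> op_series" where
  "disj_power A 0 = (\<lambda>k F xs. if k = 0 then vacuum_op F xs else 0)"
| "disj_power A (Suc m) = disj_union_series A (disj_power A m)"

text \<open>
  The exponential for \<open>\<squnion>\<close>. It is only used for series all of whose coefficients have
  images without component in 0 variables; then the \<open>m\<close>-th power has no
  component in fewer than \<open>m\<close> variables and the terms with \<open>m > length xs\<close> vanish.
\<close>

definition disj_exp :: "op_series \<Rightarrow> op_series" where
  "disj_exp A k F xs = (\<Sum>m\<le>length xs. disj_power A m k F xs / fact m)"

definition K_connected :: op_series where
  "K_connected k F xs =
     (\<Sum>(g, np, nm)\<in>{(g, np, nm). 0 < np \<and> 0 < nm \<and> 2 * g + np + nm = k + 2}.
        K_op g np nm F xs)"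

text \<open>\<open>K(q) F\<close> is an element of the Fock space with coefficients in the power series in \<open>q\<close>.\<close>

definition K_series :: "series \<Rightarrow> nat list \<Rightarrow> rat fps" where
  "K_series F xs = Abs_fps (\<lambda>k. disj_exp K_connected k F xs)"


section \<open>The Cut-and-Join operator\<close>

definition t_mult :: "nat \<Rightarrow> op" where
  "t_mult k F xs = (\<Sum>i | i < length xs \<and> xs ! i = k. F (take i xs @ drop (Suc i) xs))"

definition t_deriv :: "nat \<Rightarrow> op" where
  "t_deriv k F xs = F (k # xs)"

text \<open>
  In the coefficient at \<open>xs\<close>, the terms of the infinite sums over \<open>i, j\<close> vanish
  when \<open>i\<close> or \<open>j\<close> exceeds \<open>sum_list xs\<close>.
\<close>

definition P_plus :: op where
  "P_plus F xs = 1 / 2 * (\<Sum>i\<le>sum_list xs. \<Sum>j\<le>sum_list xs.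
     of_nat ((i + 1) * (j + 1)) * t_mult (i + 1) (t_mult (j + 1) (t_deriv (i + j) F)) xs)"

definition P_minus :: op where
  "P_minus F xs = 1 / 2 * (\<Sum>i\<le>sum_list xs. \<Sum>j\<le>sum_list xs.
     of_nat (i + j + 2) * t_mult (i + j + 2) (t_deriv i (t_deriv j F)) xs)"

definition W1 :: op where
  "W1 F xs = P_plus F xs + P_minus F xs"

definition apply_q :: "op \<Rightarrow> (nat list \<Rightarrow> rat fps) \<Rightarrow> nat list \<Rightarrow> rat fps" where
  "apply_q W G xs = Abs_fps (\<lambda>k. W (\<lambda>ys. fps_nth (G ys) k) xs)"

definition exp_q :: "op \<Rightarrow> series \<Rightarrow> nat list \<Rightarrow> rat fps" where
  "exp_q W F xs = Abs_fps (\<lambda>k. (W ^^ k) F xs / fact k)"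

end

theory Submission
 imports Defs
begin

text \<open>
 In the basis \<open>e\<^sub>k\<close> the integral of a monomial over a cell of the moduli space is a sum over integral metrics:
 by Dirichlet's integral the matrix entry of \<open>K\<^sub>g\<^sub>,\<^sub>n\<^sub>+\<^sub>,\<^sub>n\<^sub>-\<close> at \<open>b\<close> and \<open>a\<close> is \<open>\<Prod> b\<^sub>i\<close> times a weighted count of directed
 four-valent graphs with edge lengths \<open>c\<^sub>e + 1\<close> such that the sums of the \<open>c\<^sub>e + 1\<close> along the positive boundaries are
 the \<open>b\<^sub>i\<close> and the sums of the \<open>c\<^sub>e\<close> along the negative boundaries are the \<open>a\<^sub>j\<close>.

 The factor \<open>\<Prod> b\<^sub>i\<close> marks a point on every positive boundary. Cut the \<open>i\<close>-th positive boundary into \<open>b\<^sub>i\<close> cells, and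
 let \<open>\<sigma>\<close> rotate the cells of each boundary. The graph amounts to the involution \<open>\<tau>\<close> which pairs, at each of the \<open>k\<close>
 vertices, the last cells of the two edges arriving there along positive boundaries; the negative
 boundaries are the cycles of \<open>\<sigma> \<circ> \<tau>\<close>, the cells moved by \<open>\<tau>\<close> not being counted. So \<open>K\<^sub>g\<^sub>,\<^sub>n\<^sub>+\<^sub>,\<^sub>n\<^sub>-\<close> is a sum
 over connected matchings, the genus being determined by Euler's formula, and the disconnected operator is the sum over
 all matchings by the exponential formula.

 Composing \<open>\<sigma>\<close> with a transposition cuts a cycle or joins two cycles, and summing over all transpositions of
 counted cells gives \<open>W\<^sub>1\<close>. Applying \<open>W\<^sub>1\<close> \<open>k\<close> times builds every matching with \<open>k\<close> pairs \<open>k!\<close> times, once for each order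
 of its pairs.
\<close>


section \<open>Lebesgue measure normalised by lattices, without determinants\<close>

section \<open>Translation invariant measures and lattices\<close>

text \<open>The volumes are measures on fibres, normalised through arbitrary base points and lattice
  bases, and \<open>K_integral\<close> integrates them over a simplex normalised in the same way.
  Dirichlet's integral lives elsewhere: on the edge lengths with given positive boundaries, a
  product of simplices. To compare the two, the lattices of fibre and base must fit together into
  the full lattice with index one. This is where connectedness enters: it allows a unit of length to
  be moved between any two negative boundaries while all positive ones are kept. The second obstacle
  is the weight 1/|Aut|. Isomorphism classes are replaced by all graphs on a fixed set of 4k
  half-edges; marked positions on the positive boundaries then remove the symmetries, and
  \<open>fact nm\<close> and \<open>fact (4 * k)\<close> cancel against labellings and numberings.
  Variables of exponent 0 have to be carried along as well: they are circles without live cells,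
  represented by one dead cell, so that a cycle may have length 0.\<close>

interpretation lborel_prod: product_sigma_finite "\<lambda>_. lborel :: real measure"
 by (simp add: product_sigma_finite_def sigma_finite_lborel)

abbreviation lebs :: "'i set => ('i => real) measure" where
 "lebs J \<equiv> \<Pi>\<^sub>M i\<in>J. lborel"

definition shift :: "'i set => ('i => real) => ('i => real) => 'i => real" where
 "shift J w x = (\<lambda>i\<in>J. x i + w i)"

text \<open>Half-open, so that its translates by integer vectors partition the space.\<close>

definition unit_cube :: "'i set => ('i => real) set" where
 "unit_cube J = (\<Pi>\<^sub>E i\<in>J. {0..<1})"

lemma space_lebs: "space (lebs J) = (\<Pi>\<^sub>E i\<in>J. UNIV)"
 by (simp add: space_PiM)

lemma shift_measurable [measurable]: "shift J w \<in> lebs J \<rightarrow>\<^sub>M lebs J"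
 unfolding shift_def by measurable

lemma shift2_measurable [measurable]:
 "(\<lambda>p. shift J (snd p) (fst p)) \<in> lebs J \<Otimes>\<^sub>M lebs J \<rightarrow>\<^sub>M lebs J"
 unfolding shift_def by measurable

lemma unit_cube_sets [measurable]: "finite J ==> unit_cube J \<in> sets (lebs J)"
 unfolding unit_cube_def by (rule sets_PiM_I_finite) auto

lemma emeasure_unit_cube: "finite J ==> emeasure (lebs J) (unit_cube J) = 1"
 unfolding unit_cube_def by (subst lborel_prod.emeasure_PiM) auto

text \<open>Product measures are determined by their values on boxes, and there the shift acts on
  every factor separately.\<close>

lemma distr_shift:
 assumes "finite J"
 shows "distr (lebs J) (lebs J) (shift J w) = lebs J"
proof (rule lborel_prod.PiM_eqI[OF assms])
 show "sets (distr (lebs J) (lebs J) (shift J w)) = sets (lebs J)" by simp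
next
 fix A :: "'a => real set" assume A: "\<And>i. i \<in> J ==> A i \<in> sets lborel"
 have pre: "shift J w -` (\<Pi>\<^sub>E i\<in>J. A i) \<inter> space (lebs J) = (\<Pi>\<^sub>E i\<in>J. (\<lambda>x. x + w i) -` A i)"
  by (auto simp: shift_def space_lebs PiE_iff)
 have m: "(\<lambda>x. x + w i) -` A i \<in> sets lborel" if "i \<in> J" for i
  using measurable_sets[of "\<lambda>x. x + w i" borel borel "A i"] A[OF that] by simp
 have "emeasure (distr (lebs J) (lebs J) (shift J w)) (Pi\<^sub>E J A)
   = emeasure (lebs J) (\<Pi>\<^sub>E i\<in>J. (\<lambda>x. x + w i) -` A i)"
  using A assms by (subst emeasure_distr) (auto simp: pre intro!: sets_PiM_I_finite)
 also have "... = (\<Prod>i\<in>J. emeasure lborel ((\<lambda>x. x + w i) -` A i))"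
  using m by (intro lborel_prod.emeasure_PiM assms) auto
 also have "... = (\<Prod>i\<in>J. emeasure lborel (A i))"
 proof (rule prod.cong)
  fix i assume i: "i \<in> J"
  have "emeasure lborel (A i) = emeasure (distr lborel borel ((+) (w i))) (A i)"
   by (simp add: lborel_distr_plus)
  also have "... = emeasure lborel ((+) (w i) -` A i)"
   using A[OF i] by (subst emeasure_distr) auto
  finally show "emeasure lborel ((\<lambda>x. x + w i) -` A i) = emeasure lborel (A i)"
   by (simp add: vimage_def add.commute)
 qed simp
 finally show "emeasure (distr (lebs J) (lebs J) (shift J w)) (Pi\<^sub>E J A)
   = (\<Prod>i\<in>J. emeasure lborel (A i))" .
qed

lemma nn_integral_shift:
 assumes "sets \<nu> = sets (lebs J)" "distr \<nu> (lebs J) (shift J w) = \<nu>" "f \<in> borel_measurable (lebs J)"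
 shows "(\<integral>\<^sup>+x. f (shift J w x) \<partial>\<nu>) = (\<integral>\<^sup>+x. f x \<partial>\<nu>)"
proof -
 have "shift J w \<in> measurable \<nu> (lebs J)"
  using shift_measurable measurable_cong_sets[OF assms(1) refl] by blast
 hence "(\<integral>\<^sup>+x. f x \<partial>distr \<nu> (lebs J) (shift J w)) = (\<integral>\<^sup>+x. f (shift J w x) \<partial>\<nu>)"
  by (intro nn_integral_distr) (use assms(3) in auto)
 thus ?thesis using assms(2) by simp
qed

text \<open>Uniqueness of Haar measure, by Fubini: integrating \<open>\<nu> B\<close> over the translates of the
 unit cube exhibits it as a constant multiple of the Lebesgue measure of \<open>B\<close>.\<close>

lemma haar_unique:
 fixes \<nu> :: "('i => real) measure"
 assumes J: "finite J" and sets: "sets \<nu> = sets (lebs J)"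
  and inv: "\<And>w. distr \<nu> (lebs J) (shift J w) = \<nu>"
  and one: "emeasure \<nu> (unit_cube J) = 1"
 shows "\<nu> = lebs J"
proof -
 note [measurable_cong] = sets
 have space: "space \<nu> = (\<Pi>\<^sub>E i\<in>J. UNIV)" using sets_eq_imp_space_eq[OF sets] space_lebs by metis
 have em: "emeasure \<nu> (shift J w -` A \<inter> space \<nu>) = emeasure \<nu> A" if "A \<in> sets (lebs J)" for A w
 proof -
  have "shift J w \<in> measurable \<nu> (lebs J)" by measurable
  thus ?thesis using emeasure_distr[OF _ that, of "shift J w" \<nu>] inv by simp
 qed
 define Q where "Q w = shift J (\<lambda>i. - of_int (w i)) -` unit_cube J \<inter> space \<nu>" for w :: "'i => int"
 \<comment> \<open>Fubini needs sigma-finiteness of \<nu>: by invariance the countably many integer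
   translates of the cube all have mass 1, and they cover the space.\<close>
 interpret \<nu>: sigma_finite_measure \<nu>
 proof
  let ?W = "J \<rightarrow>\<^sub>E (UNIV :: int set)"
  have "x \<in> Q (\<lambda>i\<in>J. \<lfloor>x i\<rfloor>)" if "x \<in> space \<nu>" for x
   using that J unfolding Q_def unit_cube_def shift_def space by (auto simp: PiE_iff) linarith
  moreover have "(\<lambda>i\<in>J. \<lfloor>x i\<rfloor>) \<in> ?W" for x :: "'i => real" by auto
  ultimately have "space \<nu> \<subseteq> (\<Union>(Q ` ?W))" by blast
  moreover have "Q w \<subseteq> space \<nu>" for w by (auto simp: Q_def)
  moreover have "Q w \<in> sets \<nu>" for w
   using J unfolding Q_def by measurable
  moreover have "emeasure \<nu> (Q w) = 1" for w
   unfolding Q_def using em[of "unit_cube J"] J one by simp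
  moreover have "countable ?W" using J by (intro countable_PiE) auto
  ultimately show "\<exists>A. countable A \<and> A \<subseteq> sets \<nu> \<and> \<Union>A = space \<nu> \<and> (\<forall>a\<in>A. emeasure \<nu> a \<noteq> \<infinity>)"
   by (intro exI[of _ "Q ` ?W"]) auto
 qed
 interpret \<mu>: sigma_finite_measure "lebs J" by (rule lborel_prod.sigma_finite[OF J])
 interpret P: pair_sigma_finite \<nu> "lebs J" ..
 \<comment> \<open>The mass that \<nu> gives to the reflected cube; testing \<open>key\<close> on
   the cube itself forces it to be 1.\<close>
 define \<kappa> where "\<kappa> = emeasure \<nu> {x \<in> space \<nu>. shift J (\<lambda>i. - x i) (\<lambda>i. 0) \<in> unit_cube J}"
 have key: "emeasure \<nu> B = \<kappa> * emeasure (lebs J) B" if B: "B \<in> sets (lebs J)" for B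
 proof -
  have [measurable]: "B \<in> sets (lebs J)" by fact
  have [measurable]: "unit_cube J \<in> sets (lebs J)" using J by simp
  have [measurable]: "(\<lambda>p. shift J (\<lambda>i. - fst p i) (snd p)) \<in> lebs J \<Otimes>\<^sub>M lebs J \<rightarrow>\<^sub>M lebs J"
   unfolding shift_def by measurable
  have [measurable]: "(\<lambda>x. shift J (\<lambda>i. - x i) z) \<in> lebs J \<rightarrow>\<^sub>M lebs J" for z
   unfolding shift_def by measurable
  have "emeasure \<nu> B = (\<integral>\<^sup>+y. indicator (unit_cube J) y * emeasure \<nu> B \<partial>lebs J)"
   using J by (simp add: nn_integral_multc emeasure_unit_cube)
  also have "... = (\<integral>\<^sup>+y. \<integral>\<^sup>+x. indicator (unit_cube J) y * indicator B (shift J y x) \<partial>\<nu> \<partial>lebs J)"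
  proof (rule nn_integral_cong)
   fix y
   have "(\<integral>\<^sup>+x. indicator B (shift J y x) \<partial>\<nu>) = emeasure \<nu> B"
    by (subst nn_integral_shift[OF sets inv]) (use B sets in \<open>auto\<close>)
   moreover have "(\<lambda>x. indicator B (shift J y x) :: ennreal) \<in> borel_measurable \<nu>" by measurable
   ultimately show "indicator (unit_cube J) y * emeasure \<nu> B =
     (\<integral>\<^sup>+x. indicator (unit_cube J) y * indicator B (shift J y x) \<partial>\<nu>)"
    by (simp add: nn_integral_cmult)
  qed
  also have "... = (\<integral>\<^sup>+x. \<integral>\<^sup>+y. indicator (unit_cube J) y * indicator B (shift J y x) \<partial>lebs J \<partial>\<nu>)"
   by (rule P.Fubini') measurable
  also have "... = (\<integral>\<^sup>+x. \<integral>\<^sup>+z. indicator (unit_cube J) (shift J (\<lambda>i. - x i) z) * indicator B z \<partial>lebs J \<partial>\<nu>)"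
  proof (rule nn_integral_cong)
   fix x assume x: "x \<in> space \<nu>"
   have "(\<integral>\<^sup>+y. indicator (unit_cube J) y * indicator B (shift J y x) \<partial>lebs J)
     = (\<integral>\<^sup>+y. indicator (unit_cube J) (shift J (\<lambda>i. - x i) (shift J x y)) * indicator B (shift J x y) \<partial>lebs J)"
   proof (rule nn_integral_cong)
    fix y assume "y \<in> space (lebs J)"
    hence "shift J (\<lambda>i. - x i) (shift J x y) = y" "shift J y x = shift J x y"
     by (auto simp: shift_def space_lebs PiE_iff extensional_def)
    thus "indicator (unit_cube J) y * indicator B (shift J y x) =
     (indicator (unit_cube J) (shift J (\<lambda>i. - x i) (shift J x y)) * indicator B (shift J x y) :: ennreal)" by simp
   qed
   also have "... = (\<integral>\<^sup>+z. indicator (unit_cube J) (shift J (\<lambda>i. - x i) z) * indicator B z \<partial>lebs J)"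
    by (rule nn_integral_shift[OF refl distr_shift[OF J]]) measurable
   finally show "(\<integral>\<^sup>+y. indicator (unit_cube J) y * indicator B (shift J y x) \<partial>lebs J) =
    (\<integral>\<^sup>+z. indicator (unit_cube J) (shift J (\<lambda>i. - x i) z) * indicator B z \<partial>lebs J)" .
  qed
  also have "... = (\<integral>\<^sup>+z. \<integral>\<^sup>+x. indicator (unit_cube J) (shift J (\<lambda>i. - x i) z) * indicator B z \<partial>\<nu> \<partial>lebs J)"
   by (rule P.Fubini'[symmetric]) measurable
  also have "... = (\<integral>\<^sup>+z. \<kappa> * indicator B z \<partial>lebs J)"
  proof (rule nn_integral_cong)
   fix z assume z: "z \<in> space (lebs J)"
   define f :: "('i => real) => ennreal" where "f x = indicator (unit_cube J) (shift J (\<lambda>i. - x i) (\<lambda>i. 0))" for x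
   have [measurable]: "f \<in> borel_measurable (lebs J)" unfolding f_def by measurable
   have "(\<integral>\<^sup>+x. indicator (unit_cube J) (shift J (\<lambda>i. - x i) z) \<partial>\<nu>) = (\<integral>\<^sup>+x. f (shift J (\<lambda>i. - z i) x) \<partial>\<nu>)"
    by (rule nn_integral_cong) (auto simp: f_def shift_def cong: restrict_cong)
   also have "... = (\<integral>\<^sup>+x. f x \<partial>\<nu>)"
    by (rule nn_integral_shift[OF sets inv]) measurable
   also have "... = (\<integral>\<^sup>+x. indicator {x \<in> space \<nu>. shift J (\<lambda>i. - x i) (\<lambda>i. 0) \<in> unit_cube J} x \<partial>\<nu>)"
    by (rule nn_integral_cong) (auto simp: f_def split: split_indicator)
   also have "... = \<kappa>" unfolding \<kappa>_def by (rule nn_integral_indicator) measurable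
   finally show "(\<integral>\<^sup>+x. indicator (unit_cube J) (shift J (\<lambda>i. - x i) z) * indicator B z \<partial>\<nu>) = \<kappa> * indicator B z"
    by (subst nn_integral_multc) (simp_all, measurable)
  qed
  also have "... = \<kappa> * emeasure (lebs J) B" by (simp add: nn_integral_cmult)
  finally show ?thesis .
 qed
 have "\<kappa> = 1" using key[of "unit_cube J"] one J by (simp add: emeasure_unit_cube)
 thus ?thesis using key by (intro measure_eqI) (simp_all add: sets)
qed

definition lcomb :: "'k set => ('k => 'i => real) => ('k => real) => 'i => real" where
 "lcomb A b x = (\<lambda>i. \<Sum>k\<in>A. x k * b k i)"

lemma lcomb_shift: "lcomb A b (shift A u x) = (\<lambda>i. lcomb A b x i + lcomb A b u i)"
 by (auto simp: lcomb_def shift_def algebra_simps sum.distrib cong: sum.cong)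

lemma bij_betw_ex: "bij_betw f A B ==> y \<in> B ==> \<exists>x\<in>A. f x = y"
 by (auto simp: bij_betw_def)

definition int_point :: "'k set => ('k => int) => 'k => real" where
 "int_point A \<zeta> = (\<lambda>k\<in>A. of_int (\<zeta> k))"

lemma lebs_pair_shift:
 assumes A: "finite A" and C: "finite C"
 shows "distr (lebs A \<Otimes>\<^sub>M lebs C) (lebs A \<Otimes>\<^sub>M lebs C) (\<lambda>(x, y). (shift A u x, shift C v y))
    = lebs A \<Otimes>\<^sub>M lebs C"
proof -
 interpret sigma_finite_measure "lebs C" by (rule lborel_prod.sigma_finite[OF C])
 have "distr (lebs A) (lebs A) (shift A u) \<Otimes>\<^sub>M distr (lebs C) (lebs C) (shift C v) =
   distr (lebs A \<Otimes>\<^sub>M lebs C) (lebs A \<Otimes>\<^sub>M lebs C) (\<lambda>(x, y). (shift A u x, shift C v y))"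
  by (rule pair_measure_distr) (auto simp: distr_shift[OF C] sigma_finite_measure_axioms)
 thus ?thesis by (simp add: distr_shift A C)
qed

text \<open>The measures of two fundamental domains of the same lattice agree.  Hence a linear map that
 is bijective between the lattices of integer points preserves Lebesgue measure; no determinant
 is needed.\<close>

lemma lattice_distr:
 fixes b :: "'k => 'i => real" and c :: "'l => 'i => real"
 assumes A: "finite A" and C: "finite C" and J: "finite J"
 defines "T \<equiv> \<lambda>(x, y). \<lambda>j\<in>J. lcomb A b x j + lcomb C c y j"
 assumes bij: "bij_betw (\<lambda>(\<zeta>, \<eta>). T (int_point A \<zeta>, int_point C \<eta>))
   ((A \<rightarrow>\<^sub>E UNIV) \<times> (C \<rightarrow>\<^sub>E UNIV)) (int_point J ` (J \<rightarrow>\<^sub>E UNIV))"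
 shows "distr (lebs A \<Otimes>\<^sub>M lebs C) (lebs J) T = lebs J"
proof -
 let ?M = "lebs A \<Otimes>\<^sub>M lebs C"
 let ?L = "(A \<rightarrow>\<^sub>E (UNIV :: int set)) \<times> (C \<rightarrow>\<^sub>E (UNIV :: int set))"
 define ip where "ip = (\<lambda>(\<zeta>, \<eta>). (int_point A \<zeta>, int_point C \<eta>))"
 define tr where "tr u = (\<lambda>(x, y). (shift A (fst u) x, shift C (snd u) y))" for u
 have bij': "bij_betw (\<lambda>z. T (ip z)) ?L (int_point J ` (J \<rightarrow>\<^sub>E UNIV))"
  using bij by (simp add: ip_def case_prod_unfold)
 have Tm[measurable]: "T \<in> ?M \<rightarrow>\<^sub>M lebs J"
  unfolding T_def lcomb_def case_prod_unfold by measurable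
 have trm[measurable]: "tr u \<in> ?M \<rightarrow>\<^sub>M ?M" for u
  unfolding tr_def by measurable
 have space: "space ?M = (\<Pi>\<^sub>E i\<in>A. UNIV) \<times> (\<Pi>\<^sub>E i\<in>C. UNIV)"
  by (simp add: space_pair_measure space_lebs)
 have trd: "distr ?M ?M (tr u) = ?M" for u
  unfolding tr_def by (rule lebs_pair_shift[OF A C])
 have em: "emeasure ?M (tr u -` X \<inter> space ?M) = emeasure ?M X" if "X \<in> sets ?M" for X u
  using emeasure_distr[OF trm that, of u] by (simp add: trd)
 have Ttr: "T (tr u z) = shift J (T u) (T z)" for u z
  by (auto simp: T_def tr_def case_prod_unfold lcomb_shift shift_def[of J] fun_eq_iff)
 \<comment> \<open>Integer preimages of the unit vectors, combined with real coefficients, are real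
   preimages: surjectivity on integer points yields surjectivity on real ones.\<close>
 have surj: "\<exists>u. T u = w" if w: "w \<in> (\<Pi>\<^sub>E i\<in>J. UNIV)" for w
 proof -
  have "\<exists>z\<in>?L. T (ip z) = int_point J (\<lambda>i. if i = j then 1 else 0)" if "j \<in> J" for j
  proof -
   have "int_point J (restrict (\<lambda>i. if i = j then 1 else 0) J) \<in> int_point J ` (J \<rightarrow>\<^sub>E UNIV)"
    by (intro imageI) auto
   moreover have "int_point J (restrict (\<lambda>i. if i = j then 1 else 0) J)
     = int_point J (\<lambda>i. if i = j then 1 else 0)"
    by (auto simp: int_point_def)
   ultimately show ?thesis using bij_betw_ex[OF bij'] by simp
  qed
  then obtain z where z: "\<And>j. j \<in> J ==> T (ip (z j)) = int_point J (\<lambda>i. if i = j then 1 else 0)"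
   by metis
  define u where "u = ((\<lambda>k. \<Sum>j\<in>J. w j * fst (ip (z j)) k), (\<lambda>k. \<Sum>j\<in>J. w j * snd (ip (z j)) k))"
  have "T u i = w i" if i: "i \<in> J" for i
  proof -
   have "T u i = (\<Sum>k\<in>A. \<Sum>j\<in>J. w j * fst (ip (z j)) k * b k i) +
     (\<Sum>k\<in>C. \<Sum>j\<in>J. w j * snd (ip (z j)) k * c k i)"
    using i by (simp add: T_def u_def lcomb_def sum_distrib_right)
   also have "... = (\<Sum>j\<in>J. \<Sum>k\<in>A. w j * fst (ip (z j)) k * b k i) +
     (\<Sum>j\<in>J. \<Sum>k\<in>C. w j * snd (ip (z j)) k * c k i)"
    by (simp add: sum.swap[of _ A J] sum.swap[of _ C J])
   also have "... = (\<Sum>j\<in>J. w j * T (ip (z j)) i)"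
    using i by (simp add: T_def case_prod_unfold lcomb_def sum_distrib_left distrib_left
      sum.distrib mult.assoc)
   also have "... = (\<Sum>j\<in>J. if i = j then w j else 0)"
    using i by (intro sum.cong) (auto simp: z int_point_def)
   also have "... = w i" using i J by simp
   finally show ?thesis .
  qed
  hence "T u = w" using w
   by (auto simp: T_def case_prod_unfold fun_eq_iff PiE_iff extensional_def)
  thus ?thesis by blast
 qed
 define \<nu> where "\<nu> = distr ?M (lebs J) T"
 define Q where "Q = T -` unit_cube J \<inter> space ?M"
 define D where "D = unit_cube A \<times> unit_cube C"
 define neg where "neg = (\<lambda>u :: ('k => real) \<times> ('l => real). ((\<lambda>k. - fst u k), (\<lambda>k. - snd u k)))"
 \<comment> \<open>The translate of the fundamental domain \<open>D\<close> by the integer point z;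
   these translates partition the source.\<close>
 define DD where "DD z = tr (neg (ip z)) -` D \<inter> space ?M" for z
 have Qm[measurable]: "Q \<in> sets ?M" unfolding Q_def using J by measurable
 have Dm[measurable]: "D \<in> sets ?M" unfolding D_def using A C by measurable
 have DDm[measurable]: "DD z \<in> sets ?M" for z unfolding DD_def by measurable
 have cL: "countable ?L" using A C by (intro countable_SIGMA countable_PiE) auto
 have tr_tr: "tr u (tr (neg u) x) = x" "tr (neg u) (tr u x) = x" if "x \<in> space ?M" for u x
  using that by (auto simp: tr_def neg_def shift_def space PiE_iff extensional_def fun_eq_iff split: prod.splits)
 have tr_sp: "tr u x \<in> space ?M" for u x
  by (auto simp: tr_def shift_def space PiE_iff extensional_def split: prod.splits)
 have Dsp: "D \<subseteq> space ?M" unfolding D_def space unit_cube_def by auto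
 have fl: "x \<in> DD (\<zeta>, \<eta>) \<longleftrightarrow> x \<in> space ?M \<and> (\<forall>k\<in>A. \<zeta> k = \<lfloor>fst x k\<rfloor>) \<and> (\<forall>k\<in>C. \<eta> k = \<lfloor>snd x k\<rfloor>)" for x \<zeta> \<eta>
 proof -
  have fl1: "(of_int z \<le> a \<and> a - of_int z < 1) = (z = \<lfloor>a\<rfloor>)" for a :: real and z :: int
   by linarith
  obtain a a' where x: "x = (a, a')" by force
  have *: "shift X (\<lambda>k. - int_point X z k) y \<in> unit_cube X \<longleftrightarrow> (\<forall>k\<in>X. z k = \<lfloor>y k\<rfloor>)"
   for X :: "'m set" and z y
   by (simp add: shift_def unit_cube_def PiE_iff int_point_def fl1)
  show ?thesis
   by (auto simp: DD_def D_def tr_def neg_def ip_def x *)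
 qed
 have DD_union: "(\<Union>z\<in>?L. DD z) = space ?M"
 proof -
  have "x \<in> DD (\<lambda>k\<in>A. \<lfloor>fst x k\<rfloor>, \<lambda>k\<in>C. \<lfloor>snd x k\<rfloor>)" if "x \<in> space ?M" for x
   using that by (simp add: fl)
  moreover have "(\<lambda>k\<in>A. \<lfloor>fst x k\<rfloor>, \<lambda>k\<in>C. \<lfloor>snd x k\<rfloor>) \<in> ?L" for x :: "('k => real) \<times> ('l => real)" by auto
  moreover have "DD z \<subseteq> space ?M" for z unfolding DD_def by auto
  ultimately show ?thesis by blast
 qed
 have DD_disj: "disjoint_family_on DD ?L"
  unfolding disjoint_family_on_def
 proof (intro ballI impI)
  fix z z' assume z: "z \<in> ?L" "z' \<in> ?L" "z \<noteq> z'"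
  have "z = z'" if x: "x \<in> DD z" "x \<in> DD z'" for x
  proof (rule prod_eqI)
   have m: "\<forall>k\<in>A. fst z k = fst z' k" "\<forall>k\<in>C. snd z k = snd z' k"
    using x fl[of x "fst z" "snd z"] fl[of x "fst z'" "snd z'"] by simp_all
   show "fst z = fst z'" using z(1,2) m(1) by (intro PiE_ext[of _ A "\<lambda>_. UNIV"]) (auto simp: mem_Times_iff)
   show "snd z = snd z'" using z(1,2) m(2) by (intro PiE_ext[of _ C "\<lambda>_. UNIV"]) (auto simp: mem_Times_iff)
  qed
  thus "DD z \<inter> DD z' = {}" using z(3) by blast
 qed
 \<comment> \<open>Cut \<open>Q\<close> along the translates of \<open>D\<close> and move every
   piece back into \<open>D\<close>. The moved pieces are disjoint because \<open>T\<close> is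
   injective on integer points, and fill \<open>D\<close> because it is surjective onto them; so
   \<open>Q\<close> has the mass 1 of \<open>D\<close>.\<close>
 have "emeasure ?M Q = emeasure ?M (\<Union>z\<in>?L. Q \<inter> DD z)"
 proof -
  have "Q \<subseteq> (\<Union>z\<in>?L. DD z)" unfolding DD_union Q_def by blast
  thus ?thesis by (simp add: inf.absorb1 flip: Int_UN_distrib)
 qed
 also have "... = (\<integral>\<^sup>+z. emeasure ?M (Q \<inter> DD z) \<partial>count_space ?L)"
 proof (rule emeasure_UN_countable)
  show "disjoint_family_on (\<lambda>z. Q \<inter> DD z) ?L"
   using DD_disj unfolding disjoint_family_on_def by blast
 qed (use cL in auto)
 also have "... = (\<integral>\<^sup>+z. emeasure ?M (tr (ip z) -` Q \<inter> D) \<partial>count_space ?L)"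
 proof (rule nn_integral_cong)
  fix z
  have "tr (ip z) -` (Q \<inter> DD z) \<inter> space ?M = tr (ip z) -` Q \<inter> D"
  proof (intro set_eqI iffI)
   fix x assume x: "x \<in> tr (ip z) -` (Q \<inter> DD z) \<inter> space ?M"
   hence "tr (neg (ip z)) (tr (ip z) x) \<in> D" "tr (ip z) x \<in> Q" by (simp_all add: DD_def)
   thus "x \<in> tr (ip z) -` Q \<inter> D" using x tr_tr(2) by simp
  next
   fix x assume x: "x \<in> tr (ip z) -` Q \<inter> D"
   hence "x \<in> space ?M" using Dsp by blast
   thus "x \<in> tr (ip z) -` (Q \<inter> DD z) \<inter> space ?M"
    using x tr_tr(2) tr_sp by (simp add: DD_def)
  qed
  thus "emeasure ?M (Q \<inter> DD z) = emeasure ?M (tr (ip z) -` Q \<inter> D)"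
   using em[of "Q \<inter> DD z" "ip z"] by simp
 qed
 also have "... = emeasure ?M (\<Union>z\<in>?L. tr (ip z) -` Q \<inter> D)"
 proof (rule emeasure_UN_countable[symmetric])
  show "tr (ip z) -` Q \<inter> D \<in> sets ?M" for z
  proof -
   have "tr (ip z) -` Q \<inter> D = tr (ip z) -` Q \<inter> space ?M \<inter> D" using Dsp by auto
   also have "... \<in> sets ?M" by measurable
   finally show ?thesis .
  qed
  show "disjoint_family_on (\<lambda>z. tr (ip z) -` Q \<inter> D) ?L"
   unfolding disjoint_family_on_def
  proof (intro ballI impI)
   fix z z' assume z: "z \<in> ?L" "z' \<in> ?L" "z \<noteq> z'"
   have "T (ip z) = T (ip z')" if "x \<in> tr (ip z) -` Q" "x \<in> tr (ip z') -` Q" for x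
   proof -
    have 1: "\<forall>j\<in>J. 0 \<le> T x j + T (ip z) j \<and> T x j + T (ip z) j < 1"
     and 2: "\<forall>j\<in>J. 0 \<le> T x j + T (ip z') j \<and> T x j + T (ip z') j < 1"
     using that by (auto simp: Q_def Ttr unit_cube_def shift_def PiE_iff)
    obtain m m' where m: "T (ip z) = int_point J m" "T (ip z') = int_point J m'"
     using bij_betwE[OF bij'] z by blast
    have "m j = m' j" if "j \<in> J" for j
     using 1 2 that unfolding m int_point_def by force
    thus ?thesis unfolding m int_point_def by auto
   qed
   hence "T (ip z) = T (ip z')" if "x \<in> (tr (ip z) -` Q \<inter> D) \<inter> (tr (ip z') -` Q \<inter> D)" for x
    using that by blast
   moreover have "T (ip z) \<noteq> T (ip z')"
    using bij' z unfolding bij_betw_def inj_on_def by blast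
   ultimately show "(tr (ip z) -` Q \<inter> D) \<inter> (tr (ip z') -` Q \<inter> D) = {}" by blast
  qed
 qed (use cL in auto)
 also have "(\<Union>z\<in>?L. tr (ip z) -` Q \<inter> D) = D"
 proof -
  have "\<exists>z\<in>?L. tr (ip z) x \<in> Q" if x: "x \<in> D" for x
  proof -
   \<comment> \<open>The integer vector that brings \<open>T x\<close> into the unit cube; its
     preimage under \<open>T\<close> tells which moved piece contains x.\<close>
   define m where "m = (\<lambda>j\<in>J. - \<lfloor>T x j\<rfloor>)"
   have "int_point J m \<in> int_point J ` (J \<rightarrow>\<^sub>E UNIV)" by (auto simp: m_def)
   then obtain z where z: "z \<in> ?L" "T (ip z) = int_point J m"
    using bij_betw_ex[OF bij'] by blast
   have "T (tr (ip z) x) \<in> unit_cube J"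
    unfolding Ttr z(2) unit_cube_def shift_def int_point_def m_def
    by (auto simp: PiE_iff) linarith
   thus ?thesis using z(1) tr_sp by (auto simp: Q_def)
  qed
  note ex = this
  show ?thesis
  proof (intro set_eqI iffI)
   fix x assume x: "x \<in> D"
   from ex[OF x] obtain z where "z \<in> ?L" "tr (ip z) x \<in> Q" by (rule bexE)
   with x show "x \<in> (\<Union>z\<in>?L. tr (ip z) -` Q \<inter> D)" by (intro UN_I[of z]) simp_all
  qed simp
 qed
 also have "emeasure ?M D = 1"
 proof -
  interpret sigma_finite_measure "lebs C" by (rule lborel_prod.sigma_finite[OF C])
  show ?thesis unfolding D_def using A C
   by (subst emeasure_pair_measure_Times) (auto simp: emeasure_unit_cube)
 qed
 finally have "emeasure ?M Q = 1" .
 hence one: "emeasure \<nu> (unit_cube J) = 1"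
  unfolding \<nu>_def Q_def using J by (subst emeasure_distr) auto
 show ?thesis unfolding \<nu>_def[symmetric]
 proof (rule haar_unique[OF J _ _ one])
  show "sets \<nu> = sets (lebs J)" by (simp add: \<nu>_def)
  fix w
  \<comment> \<open>Invariance under w in the target follows from invariance in the source under any
    lift u of w.\<close>
  obtain u where u: "T u = restrict w J" using surj[of "restrict w J"] by auto
  have sw: "shift J w = shift J (restrict w J)" by (auto simp: shift_def fun_eq_iff)
  have "distr \<nu> (lebs J) (shift J w) = distr ?M (lebs J) (shift J w \<circ> T)"
   unfolding \<nu>_def by (subst distr_distr) auto
  also have "shift J w \<circ> T = T \<circ> tr u"
   by (auto simp: fun_eq_iff Ttr u sw)
  also have "distr ?M (lebs J) (T \<circ> tr u) = distr (distr ?M ?M (tr u)) (lebs J) T"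
   by (subst distr_distr) auto
  also have "distr ?M ?M (tr u) = ?M"
   by (rule trd)
  finally show "distr \<nu> (lebs J) (shift J w) = \<nu>" by (simp add: \<nu>_def)
 qed
qed

section \<open>Bases of lattices\<close>

definition int_subgroup :: "'i set => ('i => real) set => bool" where
 "int_subgroup I \<Lambda> \<longleftrightarrow> (\<forall>v\<in>\<Lambda>. (\<forall>i\<in>I. v i \<in> \<int>) \<and> (\<forall>i. i \<notin> I --> v i = 0)) \<and>
   (\<lambda>i. 0) \<in> \<Lambda> \<and> (\<forall>v\<in>\<Lambda>. \<forall>w\<in>\<Lambda>. (\<lambda>i. v i - w i) \<in> \<Lambda>)"

lemma int_subgroup_diff:
 "int_subgroup I \<Lambda> ==> v \<in> \<Lambda> ==> w \<in> \<Lambda> ==> (\<lambda>i. v i - w i) \<in> \<Lambda>"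
 unfolding int_subgroup_def by simp

lemma int_subgroup_add:
 assumes "int_subgroup I \<Lambda>" "v \<in> \<Lambda>" "w \<in> \<Lambda>" shows "(\<lambda>i. v i + w i) \<in> \<Lambda>"
proof -
 have "(\<lambda>i. 0) \<in> \<Lambda>" using assms(1) by (simp add: int_subgroup_def)
 hence "(\<lambda>i. v i - (0 - w i)) \<in> \<Lambda>"
  using int_subgroup_diff[OF assms(1,2) int_subgroup_diff[OF assms(1) _ assms(3)]] by blast
 thus ?thesis by simp
qed

lemma int_subgroup_scale:
 assumes "int_subgroup I \<Lambda>" "v \<in> \<Lambda>" shows "(\<lambda>i. of_int n * v i) \<in> \<Lambda>"
proof (induction n rule: int_induct[where k = 0])
 case base thus ?case using assms by (simp add: int_subgroup_def)
next
 case (step1 n) thus ?case using int_subgroup_add[OF assms(1) step1(2) assms(2)] by (simp add: algebra_simps)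
next
 case (step2 n)
 hence "(\<lambda>i. of_int n * v i - v i) \<in> \<Lambda>"
  using int_subgroup_diff[OF assms(1) step2(2) assms(2)] by simp
 thus ?case by (simp add: algebra_simps)
qed

text \<open>Subgroups of Z^I are free. The vectors vanishing at i form a subgroup for the smaller
  index set. Its basis is completed by a vector \<open>v0\<close> whose i-th entry is the least
  positive one that occurs, since by division with remainder all i-th entries are multiples of
  it.\<close>

lemma int_basis_exists:
 assumes "finite I" "int_subgroup I \<Lambda>"
 shows "\<exists>bs. int_basis \<Lambda> bs"
 using assms
proof (induction I arbitrary: \<Lambda> rule: finite_induct)
 case empty
 hence "\<Lambda> = {\<lambda>i. 0}" by (auto simp: int_subgroup_def fun_eq_iff)
 hence "int_basis \<Lambda> []" by (auto simp: int_basis_def bij_betw_def)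
 thus ?case by blast
next
 case (insert i I)
 define \<Lambda>' where "\<Lambda>' = {v \<in> \<Lambda>. v i = 0}"
 have sub: "int_subgroup I \<Lambda>'"
  using insert.prems unfolding int_subgroup_def \<Lambda>'_def by auto
 obtain bs where bs: "int_basis \<Lambda>' bs" using insert.IH[OF sub] by blast
 show ?case
 proof (cases "\<Lambda>' = \<Lambda>")
  case True thus ?thesis using bs by blast
 next
  case False
  define P where "P d \<longleftrightarrow> d > 0 \<and> (\<exists>v\<in>\<Lambda>. v i = real d)" for d :: nat
  obtain v where v: "v \<in> \<Lambda>" "v i \<noteq> 0" using False by (auto simp: \<Lambda>'_def)
  have vi: "v i \<in> \<int>" if "v \<in> \<Lambda>" for v using that insert.prems by (auto simp: int_subgroup_def)
  have "\<exists>d. P d"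
  proof -
   obtain n where n: "v i = of_int n" using vi[OF v(1)] by (auto elim: Ints_cases)
   have "(\<lambda>j. of_int (sgn n) * v j) \<in> \<Lambda>" by (rule int_subgroup_scale[OF insert.prems v(1)])
   moreover have "of_int (sgn n) * v i = real (nat \<bar>n\<bar>)" by (simp add: n sgn_if)
   ultimately have "\<exists>w\<in>\<Lambda>. w i = real (nat \<bar>n\<bar>)"
    by (intro bexI[of _ "\<lambda>j. of_int (sgn n) * v j"])
   moreover have "nat \<bar>n\<bar> > 0" using n v(2) by simp
   ultimately have "P (nat \<bar>n\<bar>)" by (simp add: P_def)
   thus ?thesis ..
  qed
  define d where "d = (LEAST d. P d)"
  have Pd: "P d" unfolding d_def by (rule LeastI_ex[OF \<open>\<exists>d. P d\<close>])
  then obtain v0 where v0: "v0 \<in> \<Lambda>" "v0 i = real d" "d > 0" by (auto simp: P_def)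
  have dvd: "\<exists>q. v i = of_int q * real d" if v: "v \<in> \<Lambda>" for v
  proof -
   obtain n where n: "v i = of_int n" using vi[OF v] by (auto elim: Ints_cases)
   have "(\<lambda>j. v j - of_int (n div int d) * v0 j) \<in> \<Lambda>"
    using int_subgroup_diff[OF insert.prems v int_subgroup_scale[OF insert.prems v0(1)]] .
   moreover have "v i - of_int (n div int d) * v0 i = real (nat (n mod int d))"
   proof -
    have "of_int n = of_int (n div int d) * real d + of_int (n mod int d)"
     by (metis div_mult_mod_eq of_int_add of_int_mult of_int_of_nat_eq)
    thus ?thesis using n v0 by simp
   qed
   ultimately have ex: "\<exists>w\<in>\<Lambda>. w i = real (nat (n mod int d))"
    by (intro bexI[of _ "\<lambda>j. v j - of_int (n div int d) * v0 j"])
   have "nat (n mod int d) < d" using v0(3) by (simp add: nat_less_iff)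
   hence "\<not> P (nat (n mod int d))" unfolding d_def by (rule not_less_Least)
   moreover have "P m" if "0 < m" "\<exists>w\<in>\<Lambda>. w i = real m" for m
    using that by (simp add: P_def)
   ultimately have "nat (n mod int d) = 0" using ex by blast
   hence "n mod int d = 0" using v0(3) by (simp add: pos_mod_sign order.antisym)
   hence "n = (n div int d) * int d" by (metis add.right_neutral div_mult_mod_eq)
   thus ?thesis unfolding n by (metis of_int_mult of_int_of_nat_eq)
  qed
  let ?n = "length bs"
  define g where "g = (\<lambda>c :: nat => int. \<lambda>j. \<Sum>k<?n. of_int (c k) * (bs ! k) j)"
  have g: "bij_betw g ({..<?n} \<rightarrow>\<^sub>E UNIV) \<Lambda>'" using bs unfolding int_basis_def g_def .
  define f where "f = (\<lambda>c :: nat => int. \<lambda>j. g (restrict c {..<?n}) j + of_int (c ?n) * v0 j)"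
  have feq: "f = (\<lambda>c j. \<Sum>k<length (bs @ [v0]). of_int (c k) * ((bs @ [v0]) ! k) j)"
   unfolding f_def g_def by (auto simp: fun_eq_iff nth_append intro!: sum.cong)
  have g0: "g (restrict c {..<?n}) \<in> \<Lambda>'" for c
   using bij_betwE[OF g] by auto
  have "bij_betw f ({..<Suc ?n} \<rightarrow>\<^sub>E UNIV) \<Lambda>"
  proof (rule bij_betw_imageI)
   show "inj_on f ({..<Suc ?n} \<rightarrow>\<^sub>E UNIV)"
   proof (rule inj_onI)
    fix c c' assume c: "c \<in> {..<Suc ?n} \<rightarrow>\<^sub>E UNIV" "c' \<in> {..<Suc ?n} \<rightarrow>\<^sub>E UNIV" and eq: "f c = f c'"
    have "f c i = of_int (c ?n) * real d" "f c' i = of_int (c' ?n) * real d"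
     using g0[of c] g0[of c'] by (auto simp: f_def \<Lambda>'_def v0)
    hence n: "c ?n = c' ?n" using eq v0(3) by simp
    hence "g (restrict c {..<?n}) = g (restrict c' {..<?n})"
     using eq by (auto simp: f_def fun_eq_iff)
    hence "restrict c {..<?n} = restrict c' {..<?n}"
     using g unfolding bij_betw_def inj_on_def by auto
    hence "c k = c' k" if "k < ?n" for k using that by (metis lessThan_iff restrict_apply')
    thus "c = c'" using n c by (intro PiE_ext[OF c]) (auto simp: less_Suc_eq)
   qed
   show "f ` ({..<Suc ?n} \<rightarrow>\<^sub>E UNIV) = \<Lambda>"
   proof
    show "f ` ({..<Suc ?n} \<rightarrow>\<^sub>E UNIV) \<subseteq> \<Lambda>"
    proof clarify
     fix c
     have "g (restrict c {..<?n}) \<in> \<Lambda>" using g0 by (auto simp: \<Lambda>'_def)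
     thus "f c \<in> \<Lambda>" unfolding f_def
      by (rule int_subgroup_add[OF insert.prems _ int_subgroup_scale[OF insert.prems v0(1)]])
    qed
    show "\<Lambda> \<subseteq> f ` ({..<Suc ?n} \<rightarrow>\<^sub>E UNIV)"
    proof
     fix v assume v: "v \<in> \<Lambda>"
     obtain q where q: "v i = of_int q * real d" using dvd[OF v] by blast
     have "(\<lambda>j. v j - of_int q * v0 j) \<in> \<Lambda>"
      using int_subgroup_diff[OF insert.prems v int_subgroup_scale[OF insert.prems v0(1)]] .
     hence "(\<lambda>j. v j - of_int q * v0 j) \<in> \<Lambda>'" using q v0 by (simp add: \<Lambda>'_def)
     then obtain c where c: "c \<in> {..<?n} \<rightarrow>\<^sub>E UNIV" "g c = (\<lambda>j. v j - of_int q * v0 j)"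
      using bij_betw_ex[OF g] by blast
     have "restrict (c(?n := q)) {..<?n} = c"
      using c(1) by (auto simp: fun_eq_iff PiE_iff extensional_def)
     hence "f (c(?n := q)) = v" unfolding f_def by (simp only: c(2)) simp
     moreover have "c(?n := q) \<in> {..<Suc ?n} \<rightarrow>\<^sub>E UNIV"
      using c(1) by (auto simp: PiE_iff extensional_def)
     ultimately show "v \<in> f ` ({..<Suc ?n} \<rightarrow>\<^sub>E UNIV)" by blast
    qed
   qed
  qed
  hence "int_basis \<Lambda> (bs @ [v0])" unfolding int_basis_def feq by simp
  thus ?thesis by blast
 qed
qed

definition real_span :: "('i => real) set => ('i => real) set" where
 "real_span \<Lambda> = {v. \<exists>n w x. (\<forall>k<n. w k \<in> \<Lambda>) \<and> v = lcomb {..<n :: nat} w x}"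

text \<open>Adding one integral equation \<open>\<phi> = 0\<close>: if \<open>v = \<Sum> x\<^sub>k w\<^sub>k\<close> with \<open>\<phi> v = 0\<close> and \<open>\<phi> w\<^sub>0 \<noteq> 0\<close>, then
 \<open>\<phi> w\<^sub>0 \<cdot> v = \<Sum> x\<^sub>k (\<phi> w\<^sub>0 \<cdot> w\<^sub>k - \<phi> w\<^sub>k \<cdot> w\<^sub>0)\<close>.\<close>

lemma real_span_equation:
 fixes a :: "'i => int"
 assumes I: "finite I" and \<Lambda>: "int_subgroup I \<Lambda>" and v: "v \<in> real_span \<Lambda>"
  and eq: "(\<Sum>i\<in>I. of_int (a i) * v i) = 0"
 shows "v \<in> real_span {v \<in> \<Lambda>. (\<Sum>i\<in>I. of_int (a i) * v i) = 0}"
proof -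
 define \<phi> where "\<phi> v = (\<Sum>i\<in>I. of_int (a i) * v i)" for v :: "'i => real"
 obtain n w x where w: "\<forall>k<n. w k \<in> \<Lambda>" and vv: "v = lcomb {..<n :: nat} w x"
  using v unfolding real_span_def by blast
 have \<phi>lin: "\<phi> (\<lambda>i. c * u i - d * u' i) = c * \<phi> u - d * \<phi> u'" for c d u u'
  by (simp add: \<phi>_def algebra_simps sum_subtractf sum_distrib_left)
 have \<phi>v: "(\<Sum>k<n. x k * \<phi> (w k)) = 0"
 proof -
  have "(\<Sum>k<n. x k * \<phi> (w k)) = \<phi> v"
   unfolding vv lcomb_def \<phi>_def sum_distrib_left
   by (subst sum.swap) (simp add: algebra_simps)
  thus ?thesis using eq by (simp add: \<phi>_def)
 qed
 show ?thesis
 proof (cases "\<forall>k<n. \<phi> (w k) = 0")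
  case True
  thus ?thesis using w vv unfolding real_span_def \<phi>_def by blast
 next
  case False
  then obtain k0 where k0: "k0 < n" "\<phi> (w k0) \<noteq> 0" by blast
  have "\<exists>m. \<phi> (w k) = of_int m" if "k < n" for k
  proof -
   have "\<phi> (w k) \<in> \<int>" unfolding \<phi>_def using w that \<Lambda>
    by (intro Ints_sum Ints_mult) (auto simp: int_subgroup_def)
   thus ?thesis by (auto elim: Ints_cases)
  qed
  then obtain m where m: "\<And>k. k < n ==> \<phi> (w k) = of_int (m k)" by metis
  define u where "u k = (\<lambda>i. of_int (m k0) * w k i - of_int (m k) * w k0 i)" for k
  have "u k \<in> {v \<in> \<Lambda>. \<phi> v = 0}" if k: "k < n" for k
  proof -
   have "u k \<in> \<Lambda>" unfolding u_def
    using k k0 w by (intro int_subgroup_diff[OF \<Lambda>] int_subgroup_scale[OF \<Lambda>]) auto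
   moreover have "\<phi> (u k) = 0" unfolding u_def \<phi>lin using k k0 m by simp
   ultimately show ?thesis by simp
  qed
  moreover have "v = lcomb {..<n} u (\<lambda>k. x k / of_int (m k0))"
  proof
   fix i
   have m0: "real_of_int (m k0) \<noteq> 0" using k0 m by simp
   have "lcomb {..<n} u (\<lambda>k. x k / of_int (m k0)) i
     = (\<Sum>k<n. x k * w k i - (w k0 i / of_int (m k0)) * (x k * \<phi> (w k)))"
    unfolding lcomb_def u_def using m m0 by (intro sum.cong) (auto simp: field_simps)
   also have "... = v i - (w k0 i / of_int (m k0)) * (\<Sum>k<n. x k * \<phi> (w k))"
    by (simp add: sum_subtractf sum_distrib_left vv lcomb_def)
   finally show "v i = lcomb {..<n} u (\<lambda>k. x k / of_int (m k0)) i" using \<phi>v by simp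
  qed
  ultimately show ?thesis unfolding real_span_def \<phi>_def by blast
 qed
qed

definition kernel_lattice :: "'i set => 'e set => ('e => 'i => int) => ('i => real) set" where
 "kernel_lattice I K a = {v. (\<forall>i\<in>I. v i \<in> \<int>) \<and> (\<forall>i. i \<notin> I --> v i = 0) \<and>
   (\<forall>\<kappa>\<in>K. (\<Sum>i\<in>I. of_int (a \<kappa> i) * v i) = 0)}"

lemma kernel_lattice_subgroup: "int_subgroup I (kernel_lattice I K a)"
 unfolding int_subgroup_def kernel_lattice_def
 by (auto simp: right_diff_distrib sum_subtractf)

text \<open>A homogeneous system with integer coefficients has enough integer solutions: start from
  the unit vectors and impose one equation at a time by \<open>real_span_equation\<close>.\<close>

lemma kernel_lattice_span:
 assumes I: "finite I" and K: "finite K"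
  and v: "\<forall>i. i \<notin> I --> v i = 0" "\<forall>\<kappa>\<in>K. (\<Sum>i\<in>I. of_int (a \<kappa> i) * v i) = 0"
 shows "v \<in> real_span (kernel_lattice I K a)"
 using K v(2)
proof (induction K rule: finite_induct)
 case empty
 obtain f where f: "bij_betw f {..<card I} I"
  using I by (metis ex_bij_betw_nat_finite atLeast0LessThan)
 define w where "w k = (\<lambda>i. if i = f k then 1 else (0 :: real))" for k
 have "w k \<in> kernel_lattice I {} a" if "k < card I" for k
  using bij_betwE[OF f] that by (auto simp: kernel_lattice_def w_def)
 moreover have "v = lcomb {..<card I} w (\<lambda>k. v (f k))"
 proof
  fix i
  have "lcomb {..<card I} w (\<lambda>k. v (f k)) i = (\<Sum>k<card I. v (f k) * (if i = f k then 1 else 0))"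
   by (simp add: lcomb_def w_def)
  also have "... = (\<Sum>j\<in>I. v j * (if i = j then 1 else 0))"
   by (rule sum.reindex_bij_betw[OF f])
  also have "... = (\<Sum>j\<in>I. if i = j then v j else 0)" by (intro sum.cong) auto
  also have "... = v i" using I v(1) by simp
  finally show "v i = lcomb {..<card I} w (\<lambda>k. v (f k)) i" by simp
 qed
 ultimately show ?case unfolding real_span_def by blast
next
 case (insert \<kappa> K)
 have "{v \<in> kernel_lattice I K a. (\<Sum>i\<in>I. of_int (a \<kappa> i) * v i) = 0} = kernel_lattice I (insert \<kappa> K) a"
  by (auto simp: kernel_lattice_def)
 thus ?case
  using real_span_equation[OF I kernel_lattice_subgroup, of v K a "a \<kappa>"] insert by simp
qed

text \<open>With this, a change of base point inside an affine subspace becomes a translation of the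
  real parameters.\<close>

lemma lcomb_real_span:
 assumes bs: "int_basis \<Lambda> bs" and v: "v \<in> real_span \<Lambda>"
 shows "\<exists>x. v = lcomb {..<length bs} ((!) bs) x"
proof -
 obtain n w x where w: "\<forall>k<n. w k \<in> \<Lambda>" and vv: "v = lcomb {..<n :: nat} w x"
  using v unfolding real_span_def by blast
 have "\<exists>c. w k = lcomb {..<length bs} ((!) bs) (\<lambda>l. of_int (c l))" if "k < n" for k
  using bij_betw_ex[OF bs[unfolded int_basis_def], of "w k"] w that unfolding lcomb_def by metis
 then obtain c where c: "\<And>k. k < n ==> w k = lcomb {..<length bs} ((!) bs) (\<lambda>l. of_int (c k l :: int))"
  by metis
 have "v i = lcomb {..<length bs} ((!) bs) (\<lambda>l. \<Sum>k<n. x k * of_int (c k l)) i" for i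
 proof -
  have "v i = (\<Sum>k<n. \<Sum>l<length bs. x k * of_int (c k l) * (bs ! l) i)"
   unfolding vv by (simp add: lcomb_def[of "{..<n}"] c) (simp add: lcomb_def sum_distrib_left mult.assoc)
  also have "... = (\<Sum>l<length bs. \<Sum>k<n. x k * of_int (c k l) * (bs ! l) i)" by (rule sum.swap)
  finally show ?thesis by (simp add: lcomb_def sum_distrib_right)
 qed
 thus ?thesis by blast
qed

section \<open>Integrals of monomials over moduli cells\<close>

section \<open>Dirichlet integrals in the basis of divided powers\<close>

text \<open>Divided powers, the basis in which series are written; with them neither the beta
  integral nor the multinomial theorem has numerical coefficients.\<close>

definition dpow :: "nat => real => real" where
 "dpow n x = x ^ n / fact n"

lemma dpow_nonneg: "0 \<le> x ==> 0 \<le> dpow n x"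
 by (simp add: dpow_def)

lemma dpow_measurable [measurable]: "dpow n \<in> borel_measurable borel"
 unfolding dpow_def by measurable

lemma e_monom_dpow: "e_monom a L = (\<Prod>i<length a. dpow (a ! i) (L i))"
 by (simp add: e_monom_def dpow_def)

lemma dpow_deriv:
 "(dpow n has_real_derivative (if n = 0 then 0 else dpow (n - 1) x)) (at x within S)"
proof (cases n)
 case 0
 thus ?thesis by (simp add: dpow_def[abs_def])
next
 case (Suc m)
 have "((\<lambda>x. x ^ Suc m / fact (Suc m)) has_real_derivative (real (Suc m) * x ^ m) / fact (Suc m)) (at x within S)"
  by (rule derivative_eq_intros refl | simp)+
 moreover have "(real (Suc m) * x ^ m) / fact (Suc m) = x ^ m / fact m"
  by (simp add: divide_simps del: of_nat_Suc)
 ultimately show ?thesis using Suc by (simp add: dpow_def[abs_def])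
qed

lemma dpow_add: "dpow n (x + y) = (\<Sum>k\<le>n. dpow k x * dpow (n - k) y)"
proof -
 have "dpow n (x + y) = (\<Sum>k\<le>n. of_nat (n choose k) * x ^ k * y ^ (n - k)) / fact n"
  by (simp add: dpow_def binomial_ring)
 also have "... = (\<Sum>k\<le>n. of_nat (n choose k) * x ^ k * y ^ (n - k) / fact n)"
  by (rule sum_divide_distrib)
 also have "... = (\<Sum>k\<le>n. dpow k x * dpow (n - k) y)"
  by (intro sum.cong refl) (simp add: dpow_def binomial_fact)
 finally show ?thesis .
qed

text \<open>Iterated integration by parts trades powers of x for powers of L - x. The antiderivative
  \<open>G\<close> collects the boundary terms, and its derivative telescopes.\<close>

lemma beta_integral:
 assumes L: "0 < L"
 shows "(\<integral>\<^sup>+x. indicator {0<..<L} x * ennreal (dpow c x * dpow d (L - x)) \<partial>lborel)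
    = ennreal (dpow (c + d + 1) L)"
proof -
 define G where "G x = - (\<Sum>k\<le>c. dpow (c - k) x * dpow (d + k + 1) (L - x))" for x
 \<comment> \<open>The value 0 for k > c stands for the derivative of the constant
   \<open>dpow 0\<close>; with it the sum over k telescopes down to the integrand
   \<open>g 0\<close>.\<close>
 define g where "g k x = (if k \<le> c then dpow (c - k) x * dpow (d + k) (L - x) else 0)" for k x
 have der: "(G has_real_derivative dpow c x * dpow d (L - x)) (at x within S)" for x S
 proof -
  have "((\<lambda>x. dpow (c - k) x * dpow (d + k + 1) (L - x)) has_real_derivative (g (Suc k) x - g k x)) (at x within S)"
   if "k \<le> c" for k
  proof -
   have "((\<lambda>x. dpow (d + k + 1) (L - x)) has_real_derivative dpow (d + k) (L - x) * (0 - 1)) (at x within S)"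
   proof (rule DERIV_chain2[where f = "dpow (d + k + 1)" and g = "\<lambda>x. L - x"])
    show "(dpow (d + k + 1) has_real_derivative dpow (d + k) (L - x)) (at (L - x))"
     using dpow_deriv[of "d + k + 1"] by simp
    show "((\<lambda>x. L - x) has_real_derivative 0 - 1) (at x within S)"
     by (intro DERIV_diff DERIV_const DERIV_ident)
   qed
   from DERIV_mult[OF dpow_deriv[of "c - k" x S] this]
   show ?thesis using that by (auto simp: g_def algebra_simps elim!: DERIV_cong)
  qed
  hence "((\<lambda>x. \<Sum>k\<le>c. dpow (c - k) x * dpow (d + k + 1) (L - x)) has_real_derivative (\<Sum>k\<le>c. g (Suc k) x - g k x)) (at x within S)"
   by (intro DERIV_sum) auto
  moreover have "(\<Sum>k\<le>c. g (Suc k) x - g k x) = g (Suc c) x - g 0 x"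
   by (induction c) auto
  ultimately have "(G has_real_derivative - (g (Suc c) x - g 0 x)) (at x within S)"
   unfolding G_def[abs_def] by (intro DERIV_minus) simp
  thus ?thesis by (simp add: g_def)
 qed
 have "(\<integral>\<^sup>+x. indicator {0<..<L} x * ennreal (dpow c x * dpow d (L - x)) \<partial>lborel)
   = (\<integral>\<^sup>+x. ennreal (dpow c x * dpow d (L - x)) * indicator {0..L} x \<partial>lborel)"
  using AE_lborel_singleton[of 0] AE_lborel_singleton[of L]
  by (intro nn_integral_cong_AE) (auto elim!: eventually_elim2 split: split_indicator)
 also have "... = ennreal (G L - G 0)"
  using L by (intro nn_integral_FTC_Icc der) (auto intro!: mult_nonneg_nonneg dpow_nonneg)
 also have "G L = 0" by (simp add: G_def dpow_def)
 also have "G 0 = - (\<Sum>k\<le>c. if k = c then dpow (d + k + 1) L else 0)"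
  unfolding G_def by (intro arg_cong[of _ _ uminus] sum.cong) (auto simp: dpow_def)
 also have "... = - dpow (c + d + 1) L" by (simp add: add.commute)
 finally show ?thesis by simp
qed

text \<open>Integrate out one variable y, in part \<open>p e0\<close>: what remains is an integral
  of the same kind with \<open>L (p e0)\<close> shortened by y, and the beta integral adds the
  exponents. The factor with exponent \<open>d i\<close> belongs to the coordinate of part i that is
  determined by the others.\<close>

lemma dirichlet_integral:
 assumes "finite J" and R: "finite R" and "p \<in> J \<rightarrow> R" and "\<And>i. i \<in> R ==> 0 < L i"
 shows "(\<integral>\<^sup>+z. indicator {z. (\<forall>e\<in>J. 0 < z e) \<and> (\<forall>i\<in>R. sum z {e\<in>J. p e = i} < L i)} z *
   ennreal ((\<Prod>e\<in>J. dpow (c e) (z e)) * (\<Prod>i\<in>R. dpow (d i) (L i - sum z {e\<in>J. p e = i}))) \<partial>lebs J)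
  = ennreal (\<Prod>i\<in>R. dpow (d i + (\<Sum>e\<in>{e\<in>J. p e = i}. c e + 1)) (L i))"
 using assms(1,3,4)
proof (induction J arbitrary: L rule: finite_induct)
 case empty
 thus ?case by (simp add: PiM_empty)
next
 case (insert e0 J)
 define i0 where "i0 = p e0"
 have i0: "i0 \<in> R" and pJ: "p \<in> J \<rightarrow> R" using insert.prems by (auto simp: i0_def)
 define X where "X K L z \<longleftrightarrow> (\<forall>e\<in>K. 0 < z e) \<and> (\<forall>i\<in>R. sum z {e\<in>K. p e = i} < L i)"
  for K and L :: "'b => real" and z :: "'a => real"
 define f where "f K L z = (\<Prod>e\<in>K. dpow (c e) (z e)) * (\<Prod>i\<in>R. dpow (d i) (L i - sum z {e\<in>K. p e = i}))"
  for K and L :: "'b => real" and z :: "'a => real"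
 define E where "E i = d i + (\<Sum>e\<in>{e\<in>J. p e = i}. c e + 1)" for i
 have IH: "(\<integral>\<^sup>+z. indicator {z. X J L z} z * ennreal (f J L z) \<partial>lebs J) = ennreal (\<Prod>i\<in>R. dpow (E i) (L i))"
  if "\<And>i. i \<in> R ==> 0 < L i" for L
  using insert.IH[OF pJ, of L] that by (simp add: X_def f_def E_def)
 have fin: "finite {e\<in>J. p e = i}" for i using insert.hyps by simp
 have sums: "sum (z(e0 := y)) {e \<in> insert e0 J. p e = i} = (if i = i0 then y else 0) + sum z {e\<in>J. p e = i}" for z y i
 proof -
  have "{e \<in> insert e0 J. p e = i} = (if i = i0 then insert e0 {e\<in>J. p e = i} else {e\<in>J. p e = i})"
   by (auto simp: i0_def)
  moreover have "sum (z(e0 := y)) {e\<in>J. p e = i} = sum z {e\<in>J. p e = i}"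
   using insert.hyps by (intro sum.cong) auto
  ultimately show ?thesis using insert.hyps fin by (auto simp: sum.insert_if)
 qed
 have Lsub: "L i - ((if i = i0 then y else 0) + s) = (L(i0 := L i0 - y)) i - s" for y s i by auto
 have Xins: "X (insert e0 J) L (z(e0 := y)) \<longleftrightarrow> 0 < y \<and> y < L i0 \<and> X J (L(i0 := L i0 - y)) z" for z y
 proof -
  have pos: "(\<forall>e\<in>insert e0 J. 0 < (z(e0 := y)) e) \<longleftrightarrow> 0 < y \<and> (\<forall>e\<in>J. 0 < z e)"
   using insert.hyps by auto
  have "(\<forall>i\<in>R. sum (z(e0 := y)) {e \<in> insert e0 J. p e = i} < L i) \<longleftrightarrow>
    (\<forall>i\<in>R. sum z {e\<in>J. p e = i} < (L(i0 := L i0 - y)) i)"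
   unfolding sums by (intro ball_cong refl) auto
  moreover have "y < L i0" if "\<forall>e\<in>J. 0 < z e" "\<forall>i\<in>R. sum z {e\<in>J. p e = i} < (L(i0 := L i0 - y)) i"
  proof -
   have "0 \<le> sum z {e\<in>J. p e = i0}" using that(1) by (intro sum_nonneg) auto
   thus ?thesis using that(2)[rule_format, OF i0] by simp
  qed
  ultimately show ?thesis unfolding X_def pos by blast
 qed
 have fins: "f (insert e0 J) L (z(e0 := y)) = dpow (c e0) y * f J (L(i0 := L i0 - y)) z" for z y
 proof -
  have "(\<Prod>e\<in>insert e0 J. dpow (c e) ((z(e0 := y)) e)) = dpow (c e0) y * (\<Prod>e\<in>J. dpow (c e) (z e))"
   using insert.hyps by (auto simp: intro!: prod.cong)
  thus ?thesis unfolding f_def sums Lsub by simp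
 qed
 have [measurable]: "Measurable.pred (lebs K) (X K L)" "f K L \<in> borel_measurable (lebs K)" if "finite K" for K L
  unfolding X_def f_def using that R by measurable
 have mX: "{z. X J L z} \<inter> space (lebs J) \<in> sets (lebs J)" for L
 proof -
  have "{z. X J L z} \<inter> space (lebs J) = {z \<in> space (lebs J). X J L z}" by auto
  also have "... \<in> sets (lebs J)" using insert.hyps(1) by measurable
  finally show ?thesis .
 qed
 have "(\<integral>\<^sup>+z. indicator {z. X (insert e0 J) L z} z * ennreal (f (insert e0 J) L z) \<partial>lebs (insert e0 J))
   = (\<integral>\<^sup>+y. \<integral>\<^sup>+z. indicator {z. X (insert e0 J) L z} (z(e0 := y)) * ennreal (f (insert e0 J) L (z(e0 := y))) \<partial>lebs J \<partial>lborel)"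
 proof (rule lborel_prod.product_nn_integral_insert_rev[OF insert.hyps])
  have "finite (insert e0 J)" using insert.hyps by simp
  note m = this
  have "(\<lambda>z. (if X (insert e0 J) L z then 1 else 0) * ennreal (f (insert e0 J) L z)) \<in> borel_measurable (lebs (insert e0 J))"
   using m by measurable
  thus "(\<lambda>z. indicator {z. X (insert e0 J) L z} z * ennreal (f (insert e0 J) L z)) \<in> borel_measurable (lebs (insert e0 J))"
   by (simp add: indicator_def[abs_def] of_bool_def)
 qed
 also have "... = (\<integral>\<^sup>+y. indicator {0<..<L i0} y * ennreal (dpow (c e0) y * dpow (E i0) (L i0 - y)) *
   ennreal (\<Prod>i\<in>R - {i0}. dpow (E i) (L i)) \<partial>lborel)"
 proof (rule nn_integral_cong)
  fix y :: real
  show "(\<integral>\<^sup>+z. indicator {z. X (insert e0 J) L z} (z(e0 := y)) * ennreal (f (insert e0 J) L (z(e0 := y))) \<partial>lebs J) =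
   indicator {0<..<L i0} y * ennreal (dpow (c e0) y * dpow (E i0) (L i0 - y)) *
   ennreal (\<Prod>i\<in>R - {i0}. dpow (E i) (L i))"
  proof (cases "0 < y \<and> y < L i0")
   case False
   hence "indicator {z. X (insert e0 J) L z} (z(e0 := y)) = (0 :: ennreal)" for z
    by (auto simp: Xins indicator_def)
   thus ?thesis using False by simp
  next
   case True
   let ?L = "L(i0 := L i0 - y)"
   have Lpos: "0 < ?L i" if "i \<in> R" for i using True insert.prems that by auto
   have "(\<integral>\<^sup>+z. indicator {z. X (insert e0 J) L z} (z(e0 := y)) * ennreal (f (insert e0 J) L (z(e0 := y))) \<partial>lebs J)
    = (\<integral>\<^sup>+z. ennreal (dpow (c e0) y) * (indicator {z. X J ?L z} z * ennreal (f J ?L z)) \<partial>lebs J)"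
   proof (rule nn_integral_cong)
    fix z
    show "indicator {z. X (insert e0 J) L z} (z(e0 := y)) * ennreal (f (insert e0 J) L (z(e0 := y))) =
     ennreal (dpow (c e0) y) * (indicator {z. X J ?L z} z * ennreal (f J ?L z))"
    proof (cases "X J ?L z")
     case True
     hence "0 \<le> f J ?L z" unfolding f_def X_def
      by (intro mult_nonneg_nonneg prod_nonneg) (auto intro!: dpow_nonneg simp: less_imp_le simp del: fun_upd_apply)
     thus ?thesis using True \<open>0 < y \<and> y < L i0\<close>
      by (simp add: Xins fins ennreal_mult dpow_nonneg del: fun_upd_apply)
    next
     case False
     thus ?thesis by (simp add: Xins del: fun_upd_apply)
    qed
   qed
   also have "... = ennreal (dpow (c e0) y) * (\<integral>\<^sup>+z. indicator {z. X J ?L z} z * ennreal (f J ?L z) \<partial>lebs J)"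
   proof (rule nn_integral_cmult)
    have "(\<lambda>z. (if X J ?L z then 1 else 0) * ennreal (f J ?L z)) \<in> borel_measurable (lebs J)"
     using insert.hyps(1) by measurable
    thus "(\<lambda>z. indicator {z. X J ?L z} z * ennreal (f J ?L z)) \<in> borel_measurable (lebs J)"
     by (simp add: indicator_def[abs_def] of_bool_def)
   qed
   also have "... = ennreal (dpow (c e0) y) * ennreal (\<Prod>i\<in>R. dpow (E i) (?L i))"
    by (subst IH[of ?L]) (use Lpos in auto)
   also have "(\<Prod>i\<in>R. dpow (E i) (?L i)) = dpow (E i0) (L i0 - y) * (\<Prod>i\<in>R - {i0}. dpow (E i) (L i))"
    by (subst prod.remove[OF R i0], intro arg_cong2[of _ _ _ _ "(*)"] prod.cong) auto
   also have "ennreal (dpow (c e0) y) * ennreal (dpow (E i0) (L i0 - y) * (\<Prod>i\<in>R - {i0}. dpow (E i) (L i))) =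
    indicator {0<..<L i0} y * ennreal (dpow (c e0) y * dpow (E i0) (L i0 - y)) *
    ennreal (\<Prod>i\<in>R - {i0}. dpow (E i) (L i))"
   proof -
    have "0 \<le> dpow (E i0) (L i0 - y)" "0 \<le> dpow (c e0) y"
     using True by (auto intro!: dpow_nonneg)
    moreover have "0 \<le> (\<Prod>i\<in>R - {i0}. dpow (E i) (L i))"
     using insert.prems by (intro prod_nonneg dpow_nonneg ballI) (auto intro: less_imp_le)
    ultimately show ?thesis using True by (simp add: ennreal_mult mult.assoc)
   qed
   finally show ?thesis .
  qed
 qed
 also have "... = (\<integral>\<^sup>+y. indicator {0<..<L i0} y * ennreal (dpow (c e0) y * dpow (E i0) (L i0 - y)) \<partial>lborel) *
   ennreal (\<Prod>i\<in>R - {i0}. dpow (E i) (L i))"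
  by (rule nn_integral_multc) measurable
 also have "... = ennreal (dpow (c e0 + E i0 + 1) (L i0)) * ennreal (\<Prod>i\<in>R - {i0}. dpow (E i) (L i))"
  using insert.prems i0 by (subst beta_integral) auto
 also have "... = ennreal (dpow (c e0 + E i0 + 1) (L i0) * (\<Prod>i\<in>R - {i0}. dpow (E i) (L i)))"
  using insert.prems i0 by (intro ennreal_mult[symmetric] dpow_nonneg prod_nonneg) (auto intro: less_imp_le)
 also have "dpow (c e0 + E i0 + 1) (L i0) * (\<Prod>i\<in>R - {i0}. dpow (E i) (L i)) =
   (\<Prod>i\<in>R. dpow (d i + (\<Sum>e\<in>{e\<in>insert e0 J. p e = i}. c e + 1)) (L i))"
 proof -
  have "{e \<in> insert e0 J. p e = i} = (if i = i0 then insert e0 {e\<in>J. p e = i} else {e\<in>J. p e = i})" for i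
   by (auto simp: i0_def)
  hence Ei: "d i + (\<Sum>e\<in>{e\<in>insert e0 J. p e = i}. c e + 1) = (if i = i0 then c e0 + E i0 + 1 else E i)" for i
   using fin insert.hyps by (auto simp: E_def)
  show ?thesis unfolding Ei
   by (subst prod.remove[OF R i0], intro arg_cong2[of _ _ _ _ "(*)"] prod.cong) auto
 qed
 finally show ?case by (simp add: X_def f_def)
qed

text \<open>The index set of a multinomial expansion: how the exponent of negative boundary j is
  shared among its edges.\<close>

definition distributions :: "'e set => ('e => 'j) => 'j set => ('j => nat) => ('e => nat) set" where
 "distributions E m N a = {c \<in> E \<rightarrow>\<^sub>E UNIV. \<forall>j\<in>N. sum c {e\<in>E. m e = j} = a j}"

lemma finite_distributions:
 assumes E: "finite E" and m: "m \<in> E \<rightarrow> N"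
 shows "finite (distributions E m N a)"
proof (rule finite_subset)
 show "distributions E m N a \<subseteq> (\<Pi>\<^sub>E e\<in>E. {..a (m e)})"
 proof
  fix c assume c: "c \<in> distributions E m N a"
  have "c e \<le> a (m e)" if e: "e \<in> E" for e
  proof -
   have "c e \<le> sum c {e'\<in>E. m e' = m e}" using E e by (intro member_le_sum) auto
   also have "... = a (m e)" using c m e by (auto simp: distributions_def)
   finally show ?thesis .
  qed
  thus "c \<in> (\<Pi>\<^sub>E e\<in>E. {..a (m e)})" using c by (auto simp: distributions_def PiE_iff)
 qed
qed (use E in \<open>auto intro!: finite_PiE\<close>)

text \<open>One application of \<open>dpow_add\<close> per edge. It turns a monomial in the negative
  boundary lengths into monomials in the edge lengths.\<close>

lemma multinomial_dpow:
 assumes "finite E" and N: "finite N" and "m \<in> E \<rightarrow> N"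
 shows "(\<Prod>j\<in>N. dpow (a j) (sum l {e\<in>E. m e = j})) = (\<Sum>c\<in>distributions E m N a. \<Prod>e\<in>E. dpow (c e) (l e))"
 using assms(1,3)
proof (induction E arbitrary: a rule: finite_induct)
 case empty
 show ?case
 proof (cases "\<forall>j\<in>N. a j = 0")
  case True
  hence "distributions {} m N a = {\<lambda>x. undefined}" by (auto simp: distributions_def)
  thus ?thesis using True by (simp add: dpow_def)
 next
  case False
  hence "distributions {} m N a = {}" by (auto simp: distributions_def)
  moreover have "\<exists>j\<in>N. dpow (a j) 0 = 0" using False by (auto simp: dpow_def)
  ultimately show ?thesis using N by simp
 qed
next
 case (insert e0 E)
 define j0 where "j0 = m e0"
 have j0: "j0 \<in> N" and mE: "m \<in> E \<rightarrow> N" using insert.prems by (auto simp: j0_def)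
 have set: "{e \<in> insert e0 E. m e = j} = (if j = j0 then insert e0 {e\<in>E. m e = j} else {e\<in>E. m e = j})" for j
  by (auto simp: j0_def)
 have fin: "finite {e\<in>E. m e = j}" for j using insert.hyps by simp
 have sums: "sum f {e \<in> insert e0 E. m e = j} = (if j = j0 then f e0 else 0) + sum f {e\<in>E. m e = j}" for f :: "'a => 'c :: comm_monoid_add" and j
  unfolding set using insert.hyps fin by simp
 define A where "A t = a(j0 := a j0 - t)" for t
 have "(\<Prod>j\<in>N. dpow (a j) (sum l {e\<in>insert e0 E. m e = j}))
   = dpow (a j0) (l e0 + sum l {e\<in>E. m e = j0}) * (\<Prod>j\<in>N - {j0}. dpow (a j) (sum l {e\<in>E. m e = j}))"
  unfolding sums by (subst prod.remove[OF N j0], intro arg_cong2[of _ _ _ _ "(*)"] prod.cong) auto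
 also have "... = (\<Sum>t\<le>a j0. dpow t (l e0) * (dpow (a j0 - t) (sum l {e\<in>E. m e = j0}) * (\<Prod>j\<in>N - {j0}. dpow (a j) (sum l {e\<in>E. m e = j}))))"
  by (simp add: dpow_add sum_distrib_right mult.assoc)
 also have "... = (\<Sum>t\<le>a j0. dpow t (l e0) * (\<Prod>j\<in>N. dpow (A t j) (sum l {e\<in>E. m e = j})))"
  by (subst prod.remove[OF N j0], intro sum.cong arg_cong2[of _ _ _ _ "(*)"] prod.cong) (auto simp: A_def)
 also have "... = (\<Sum>t\<le>a j0. \<Sum>c\<in>distributions E m N (A t). dpow t (l e0) * (\<Prod>e\<in>E. dpow (c e) (l e)))"
  by (simp add: insert.IH[OF mE] sum_distrib_left)
 also have "... = (\<Sum>(t, c)\<in>(SIGMA t:{..a j0}. distributions E m N (A t)). dpow t (l e0) * (\<Prod>e\<in>E. dpow (c e) (l e)))"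
  using insert.hyps mE by (subst sum.Sigma) (auto simp: finite_distributions)
 also have "... = (\<Sum>c\<in>distributions (insert e0 E) m N a. \<Prod>e\<in>insert e0 E. dpow (c e) (l e))"
 proof (rule sum.reindex_bij_witness[of _ "\<lambda>c. (c e0, restrict c E)" "\<lambda>(t, c). c(e0 := t)"])
  fix z assume "z \<in> (SIGMA t:{..a j0}. distributions E m N (A t))"
  then obtain t c where z: "z = (t, c)" "t \<le> a j0" "c \<in> E \<rightarrow>\<^sub>E UNIV" "\<forall>j\<in>N. sum c {e\<in>E. m e = j} = A t j"
   by (auto simp: distributions_def)
  have eq: "sum (c(e0 := t)) {e\<in>E. m e = j} = sum c {e\<in>E. m e = j}" for j
   using insert.hyps by (intro sum.cong) auto
  show "((case z of (t, c) => c(e0 := t)) e0, restrict (case z of (t, c) => c(e0 := t)) E) = z"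
   using z insert.hyps by (auto simp: fun_eq_iff PiE_iff extensional_def)
  show "(case z of (t, c) => c(e0 := t)) \<in> distributions (insert e0 E) m N a"
  proof -
   have "c(e0 := t) \<in> insert e0 E \<rightarrow>\<^sub>E UNIV" using z by (auto simp: PiE_iff extensional_def)
   moreover have "\<forall>j\<in>N. (if j = j0 then (c(e0 := t)) e0 else 0) + sum (c(e0 := t)) {e\<in>E. m e = j} = a j"
    unfolding eq using z by (auto simp: A_def)
   ultimately show ?thesis unfolding distributions_def sums z(1) by simp
  qed
  show "(\<Prod>e\<in>insert e0 E. dpow ((case z of (t, c) => c(e0 := t)) e) (l e)) =
   (case z of (t, c) => dpow t (l e0) * (\<Prod>e\<in>E. dpow (c e) (l e)))"
   using z(1) insert.hyps by (auto intro!: prod.cong)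
 next
  fix c assume "c \<in> distributions (insert e0 E) m N a"
  hence c: "c \<in> insert e0 E \<rightarrow>\<^sub>E UNIV" "\<And>j. j \<in> N ==> (if j = j0 then c e0 else 0) + sum c {e\<in>E. m e = j} = a j"
   unfolding distributions_def sums by auto
  show "(case (c e0, restrict c E) of (t, c) => c(e0 := t)) = c"
   using c(1) by (auto simp: fun_eq_iff PiE_iff extensional_def)
  have "sum (restrict c E) {e\<in>E. m e = j} = sum c {e\<in>E. m e = j}" for j by (intro sum.cong) auto
  moreover have "c e0 \<le> a j0" "sum c {e\<in>E. m e = j0} = a j0 - c e0" using c(2)[OF j0] by auto
  moreover have "sum c {e\<in>E. m e = j} = a j" if "j \<in> N" "j \<noteq> j0" for j using c(2)[OF that(1)] that(2) by simp
  ultimately show "(c e0, restrict c E) \<in> (SIGMA t:{..a j0}. distributions E m N (A t))"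
   unfolding distributions_def by (auto simp: A_def)
 qed
 finally show ?case .
qed

section \<open>Integration over the cell of a ribbon graph\<close>

lemma affine_measure_eq:
 assumes "int_dirs I A = \<Lambda>" and "bs = (SOME bs. int_basis \<Lambda> bs)"
 shows "affine_measure I A = distr (lebs {..<length bs}) (\<Pi>\<^sub>M i\<in>I. borel)
   (\<lambda>x. \<lambda>i\<in>I. (SOME a. a \<in> A) i + lcomb {..<length bs} ((!) bs) x i)"
 unfolding affine_measure_def Let_def lcomb_def assms ..

lemma sum_of_bool_mult: "finite E ==> (\<Sum>e\<in>E. of_bool (P e) * v e) = sum v {e\<in>E. P e}"
 for v :: "'e => real"
 by (simp add: Int_def)

lemma int_basis_nth:
 assumes "int_basis \<Lambda> bs" "k < length bs"
 shows "bs ! k \<in> \<Lambda>"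
proof -
 define c where "c = (\<lambda>l\<in>{..<length bs}. if l = k then 1 else (0 :: int))"
 have "(\<lambda>i. \<Sum>l<length bs. of_int (c l) * (bs ! l) i) \<in> \<Lambda>"
  using bij_betwE[OF assms(1)[unfolded int_basis_def], rule_format, of c] by (auto simp: c_def)
 moreover have "(\<Sum>l<length bs. of_int (c l) * (bs ! l) i) = (bs ! k) i" for i
 proof -
  have "(\<Sum>l<length bs. of_int (c l) * (bs ! l) i) = (\<Sum>l<length bs. if l = k then (bs ! l) i else 0)"
   by (intro sum.cong) (auto simp: c_def)
  thus ?thesis using assms(2) by simp
 qed
 ultimately show ?thesis by simp
qed

lemma int_basis_lcomb:
 assumes "int_basis \<Lambda> bs"
 shows "bij_betw (\<lambda>\<zeta>. lcomb {..<length bs} ((!) bs) (int_point {..<length bs} \<zeta>)) ({..<length bs} \<rightarrow>\<^sub>E UNIV) \<Lambda>"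
proof -
 have "(\<lambda>\<zeta>. lcomb {..<length bs} ((!) bs) (int_point {..<length bs} \<zeta>)) =
   (\<lambda>c i. \<Sum>k<length bs. of_int (c k) * (bs ! k) i)"
  by (auto simp: lcomb_def int_point_def fun_eq_iff)
 thus ?thesis using assms by (simp add: int_basis_def)
qed

lemma e_monom_measurable [measurable]:
 assumes "length a \<le> n" "sets M = sets (\<Pi>\<^sub>M i\<in>{..<n}. borel)"
 shows "e_monom a \<in> borel_measurable M"
proof -
 have "(\<lambda>L. \<Prod>i<length a. dpow (a ! i) (L i)) \<in> borel_measurable (\<Pi>\<^sub>M i\<in>{..<n}. borel)"
 proof (rule borel_measurable_prod)
  fix i assume "i \<in> {..<length a}"
  hence "i \<in> {..<n}" using assms(1) by simp
  hence [measurable]: "(\<lambda>L. L i) \<in> borel_measurable (\<Pi>\<^sub>M i\<in>{..<n}. borel :: real measure)" by measurable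
  show "(\<lambda>L. dpow (a ! i) (L i)) \<in> borel_measurable (\<Pi>\<^sub>M i\<in>{..<n}. borel)" by measurable
 qed
 thus ?thesis using assms(2) by (simp add: e_monom_dpow[abs_def] cong: measurable_cong_sets)
qed

text \<open>The combinatorics of a cell: \<open>p e\<close> and \<open>m e\<close> are the positive
  and the negative boundary along edge e. The assumption \<open>lift\<close> is what connectedness
  provides: a unit of length can be moved from negative boundary 0 to negative boundary j by an
  integer vector that keeps all positive boundary lengths.\<close>

locale incidence =
 fixes E :: "'e set" and p m :: "'e => nat" and np nm :: nat
 assumes E: "finite E" and p: "p \<in> E \<rightarrow> {..<np}" and m: "m \<in> E \<rightarrow> {..<nm}"
  and psurj: "{..<np} \<subseteq> p ` E" and nm0: "0 < nm"
  and lift: "\<And>j. j < nm ==> \<exists>v :: 'e => int. (\<forall>i<np. sum v {e\<in>E. p e = i} = 0) \<and>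
     (\<forall>t<nm. sum v {e\<in>E. m e = t} = of_bool (t = j) - of_bool (t = 0))"
begin

abbreviation psum :: "('e => real) => nat => real" where "psum v i \<equiv> sum v {e\<in>E. p e = i}"
abbreviation msum :: "('e => real) => nat => real" where "msum v j \<equiv> sum v {e\<in>E. m e = j}"

text \<open>One edge on each positive boundary is solved for. The remaining edges \<open>J\<close>
  are free coordinates on the lengths with prescribed positive boundaries; as the solved coefficient
  is 1, integer points correspond to integer points.\<close>

definition root :: "nat => 'e" where "root i = (SOME e. e \<in> E \<and> p e = i)"

lemma root: assumes "i < np" shows "root i \<in> E" "p (root i) = i"
proof -
 have "\<exists>e. e \<in> E \<and> p e = i" using psurj assms by blast
 hence "root i \<in> E \<and> p (root i) = i" unfolding root_def by (rule someI_ex)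
 thus "root i \<in> E" "p (root i) = i" by auto
qed

definition J :: "'e set" where "J = E - root ` {..<np}"

lemma finJ [simp]: "finite J" using E by (simp add: J_def)

lemma boundary_split:
 assumes "i < np" shows "{e\<in>E. p e = i} = insert (root i) {e\<in>J. p e = i}" "root i \<notin> J"
 using assms root by (auto simp: J_def)

lemma E_split: "E = J \<union> root ` {..<np}" "J \<inter> root ` {..<np} = {}"
 using root by (auto simp: J_def)

lemma inj_root: "inj_on root {..<np}"
 using root by (metis inj_onI lessThan_iff)

definition ell :: "(nat => real) => ('e => real) => 'e => real" where
 "ell L z = (\<lambda>e\<in>E. if e \<in> J then z e else L (p e) - sum z {e'\<in>J. p e' = p e})"

lemma ell_J: "e \<in> J ==> ell L z e = z e"
 by (simp add: ell_def J_def)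

lemma ell_root: "i < np ==> ell L z (root i) = L i - sum z {e\<in>J. p e = i}"
 using root[of i] boundary_split(2)[of i] by (simp add: ell_def)

lemma psum_ell: "i < np ==> psum (ell L z) i = L i"
proof -
 assume i: "i < np"
 have "psum (ell L z) i = ell L z (root i) + sum (ell L z) {e\<in>J. p e = i}"
  using boundary_split[OF i] by simp
 also have "sum (ell L z) {e\<in>J. p e = i} = sum z {e\<in>J. p e = i}" by (intro sum.cong) (auto simp: ell_J)
 finally show ?thesis by (simp add: ell_root i)
qed

lemma ell_unique:
 assumes "\<And>i. i < np ==> psum v i = L i" "e \<in> E"
 shows "v e = ell L v e"
proof (cases "e \<in> J")
 case True thus ?thesis by (simp add: ell_J)
next
 case False
 then obtain i where i: "i < np" "e = root i" using assms(2) E_split by auto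
 hence "psum v i = v (root i) + sum v {e\<in>J. p e = i}" using boundary_split[OF i(1)] by simp
 thus ?thesis using assms(1)[OF i(1)] by (simp add: i ell_root)
qed

lemma ell_cong: "(\<And>e. e \<in> J ==> z e = z' e) ==> ell L z = ell L z'"
 unfolding ell_def by (intro restrict_ext) (auto intro!: sum.cong)

lemma sum_msum: "(\<Sum>j<nm. msum v j) = sum v E"
proof -
 have "m ` E \<subseteq> {..<nm}" using m by auto
 thus ?thesis by (rule sum.group[OF E finite_lessThan])
qed

lemma sum_psum: "(\<Sum>i<np. psum v i) = sum v E"
proof -
 have "p ` E \<subseteq> {..<np}" using p by auto
 thus ?thesis by (rule sum.group[OF E finite_lessThan])
qed

definition exponent :: "('e => nat) => nat => nat" where
 "exponent c i = (\<Sum>e\<in>{e\<in>E. p e = i}. c e + 1)"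

abbreviation cell_coeffs :: "nat list => ('e => nat) set" where
 "cell_coeffs a \<equiv> distributions E m {..<nm} ((!) a)"

text \<open>Expanding the monomial in the negative lengths gives one Dirichlet integral per
  distribution c, with the root edges as dependent coordinates.\<close>

lemma core_integral:
 assumes a: "length a = nm" and L: "\<And>i. i < np ==> 0 < L i"
 shows "(\<integral>\<^sup>+z. indicator {z. \<forall>e\<in>E. 0 < ell L z e} z * ennreal (e_monom a (msum (ell L z))) \<partial>lebs J)
   = ennreal (\<Sum>c\<in>cell_coeffs a. \<Prod>i<np. dpow (exponent c i - 1) (L i))"
proof -
 let ?C = "cell_coeffs a"
 have C: "finite ?C" by (rule finite_distributions[OF E m])
 define D where "D = {z. (\<forall>e\<in>J. 0 < z e) \<and> (\<forall>i\<in>{..<np}. sum z {e\<in>J. p e = i} < L i)}"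
 have D: "(\<forall>e\<in>E. 0 < ell L z e) \<longleftrightarrow> z \<in> D" for z
  by (subst E_split(1)) (auto simp: ball_Un ell_J ell_root D_def)
 have P: "(\<Prod>e\<in>E. dpow (c e) (ell L z e)) =
   (\<Prod>e\<in>J. dpow (c e) (z e)) * (\<Prod>i<np. dpow (c (root i)) (L i - sum z {e\<in>J. p e = i}))" for c z
 proof -
  have "(\<Prod>e\<in>E. dpow (c e) (ell L z e)) =
   (\<Prod>e\<in>J. dpow (c e) (ell L z e)) * (\<Prod>e\<in>root ` {..<np}. dpow (c e) (ell L z e))"
   by (subst E_split(1), rule prod.union_disjoint) (auto simp: E_split(2))
  also have "(\<Prod>e\<in>root ` {..<np}. dpow (c e) (ell L z e)) = (\<Prod>i<np. dpow (c (root i)) (ell L z (root i)))"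
   by (simp add: prod.reindex[OF inj_root])
  finally show ?thesis by (simp add: ell_J ell_root)
 qed
 \<comment> \<open>A root edge is not integrated over, so its exponent comes without the 1 that
   every other edge adds.\<close>
 have ex: "c (root i) + (\<Sum>e\<in>{e\<in>J. p e = i}. c e + 1) = exponent c i - 1" if "i < np" for c :: "'e => nat" and i
  unfolding exponent_def boundary_split(1)[OF that] using boundary_split(2)[OF that] by simp
 have m1: "{z \<in> space (lebs J). z \<in> D} \<in> sets (lebs J)"
  unfolding D_def mem_Collect_eq by measurable
 have m2: "(\<lambda>z. \<Prod>e\<in>E. dpow (c e) (ell L z e)) \<in> borel_measurable (lebs J)" for c
  unfolding P by measurable
 have m3: "(\<lambda>z. indicator D z * ennreal (\<Prod>e\<in>E. dpow (c e) (ell L z e))) \<in> borel_measurable (lebs J)" for c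
 proof -
  have "(\<lambda>z. (if z \<in> D then 1 else 0) * ennreal (\<Prod>e\<in>E. dpow (c e) (ell L z e))) \<in> borel_measurable (lebs J)"
   using m1 m2 by measurable
  thus ?thesis by (simp add: indicator_def[abs_def] of_bool_def)
 qed
 have "(\<integral>\<^sup>+z. indicator {z. \<forall>e\<in>E. 0 < ell L z e} z * ennreal (e_monom a (msum (ell L z))) \<partial>lebs J)
   = (\<integral>\<^sup>+z. (\<Sum>c\<in>?C. indicator D z * ennreal (\<Prod>e\<in>E. dpow (c e) (ell L z e))) \<partial>lebs J)"
 proof (rule nn_integral_cong)
  fix z
  have "e_monom a (msum (ell L z)) = (\<Sum>c\<in>?C. \<Prod>e\<in>E. dpow (c e) (ell L z e))"
   unfolding e_monom_dpow a by (rule multinomial_dpow[OF E finite_lessThan m])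
  moreover have "ennreal (\<Sum>c\<in>?C. \<Prod>e\<in>E. dpow (c e) (ell L z e)) = (\<Sum>c\<in>?C. ennreal (\<Prod>e\<in>E. dpow (c e) (ell L z e)))"
   if "z \<in> D"
   using D[of z] that by (intro sum_ennreal[symmetric] prod_nonneg dpow_nonneg ballI) (auto intro: less_imp_le)
  ultimately show "indicator {z. \<forall>e\<in>E. 0 < ell L z e} z * ennreal (e_monom a (msum (ell L z))) =
    (\<Sum>c\<in>?C. indicator D z * ennreal (\<Prod>e\<in>E. dpow (c e) (ell L z e)))"
   using D[of z] by (cases "z \<in> D") simp_all
 qed
 also have "... = (\<Sum>c\<in>?C. \<integral>\<^sup>+z. indicator D z * ennreal (\<Prod>e\<in>E. dpow (c e) (ell L z e)) \<partial>lebs J)"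
  using m3 by (intro nn_integral_sum)
 also have "... = (\<Sum>c\<in>?C. ennreal (\<Prod>i<np. dpow (exponent c i - 1) (L i)))"
 proof (rule sum.cong[OF refl])
  fix c
  have "p \<in> J \<rightarrow> {..<np}" using p by (auto simp: J_def)
  from dirichlet_integral[OF finJ finite_lessThan this, of L c "\<lambda>i. c (root i)"] L
  have "(\<integral>\<^sup>+z. indicator D z * ennreal (\<Prod>e\<in>E. dpow (c e) (ell L z e)) \<partial>lebs J)
   = ennreal (\<Prod>i<np. dpow (c (root i) + (\<Sum>e\<in>{e\<in>J. p e = i}. c e + 1)) (L i))"
   by (simp add: P D_def)
  also have "(\<Prod>i<np. dpow (c (root i) + (\<Sum>e\<in>{e\<in>J. p e = i}. c e + 1)) (L i)) =
    (\<Prod>i<np. dpow (exponent c i - 1) (L i))"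
   by (intro prod.cong refl) (simp only: ex lessThan_iff)
  finally show "(\<integral>\<^sup>+z. indicator D z * ennreal (\<Prod>e\<in>E. dpow (c e) (ell L z e)) \<partial>lebs J)
   = ennreal (\<Prod>i<np. dpow (exponent c i - 1) (L i))" .
 qed
 also have "... = ennreal (\<Sum>c\<in>?C. \<Prod>i<np. dpow (exponent c i - 1) (L i))"
  using L by (intro sum_ennreal prod_nonneg dpow_nonneg ballI) (auto intro: less_imp_le)
 finally show ?thesis .
qed

definition fib :: "(nat => real) => (nat => real) => ('e => real) set" where
 "fib L M = {l \<in> extensional E. (\<forall>i<np. psum l i = L i) \<and> (\<forall>j<nm. msum l j = M j)}"

definition cell_vol :: "(nat => real) => (nat => real) => real" where
 "cell_vol L M = measure (affine_measure E (fib L M)) {l \<in> fib L M. \<forall>e\<in>E. 0 < l e}"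

definition dirs :: "('e => real) set" where
 "dirs = kernel_lattice E (Inl ` {..<np} \<union> Inr ` {..<nm})
   (\<lambda>\<kappa> e. case \<kappa> of Inl i => of_bool (p e = i) | Inr j => of_bool (m e = j))"

lemma dirs_iff: "v \<in> dirs \<longleftrightarrow> (\<forall>e\<in>E. v e \<in> \<int>) \<and> (\<forall>e. e \<notin> E --> v e = 0) \<and>
  (\<forall>i<np. psum v i = 0) \<and> (\<forall>j<nm. msum v j = 0)"
 unfolding dirs_def kernel_lattice_def by (auto simp: sum_of_bool_mult[OF E] ball_Un)

lemma dirs_span:
 assumes "\<forall>e. e \<notin> E --> v e = 0" "\<forall>i<np. psum v i = 0" "\<forall>j<nm. msum v j = 0"
 shows "v \<in> real_span dirs"
 unfolding dirs_def using assms
 by (intro kernel_lattice_span[OF E]) (auto simp: sum_of_bool_mult[OF E] ball_Un)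

lemma int_dirs_fib:
 assumes "l \<in> fib L M" shows "int_dirs E (fib L M) = dirs"
proof -
 have "(\<forall>a\<in>fib L M. (\<lambda>i\<in>E. a i + v i) \<in> fib L M) \<longleftrightarrow> (\<forall>i<np. psum v i = 0) \<and> (\<forall>j<nm. msum v j = 0)" for v
  using assms by (auto simp: fib_def sum.distrib)
 thus ?thesis unfolding int_dirs_def by (auto simp: dirs_iff)
qed

end

definition sum_dirs :: "nat => (nat => real) set" where
 "sum_dirs n = kernel_lattice {..<n} {()} (\<lambda>_ _. 1)"

lemma sum_dirs_iff: "v \<in> sum_dirs n \<longleftrightarrow> (\<forall>i<n. v i \<in> \<int>) \<and> (\<forall>i. i \<ge> n --> v i = 0) \<and> (\<Sum>i<n. v i) = 0"
 by (auto simp: sum_dirs_def kernel_lattice_def not_less)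

lemma sum_plane_nonempty: "0 < n ==> \<exists>a. a \<in> sum_plane n s"
 by (intro exI[of _ "\<lambda>j\<in>{..<n}. if j = 0 then s else 0"]) (auto simp: sum_plane_def)

lemma int_dirs_sum_plane:
 assumes "0 < n" shows "int_dirs {..<n} (sum_plane n s) = sum_dirs n"
proof -
 have "(\<forall>a\<in>sum_plane n s. (\<lambda>i\<in>{..<n}. a i + v i) \<in> sum_plane n s) \<longleftrightarrow> (\<Sum>i<n. v i) = 0" for v
  using sum_plane_nonempty[OF assms, of s] by (auto simp: sum_plane_def sum.distrib)
 thus ?thesis unfolding int_dirs_def by (auto simp: sum_dirs_iff)
qed

lemma int_point_Ints: "k \<in> A ==> int_point A \<zeta> k \<in> \<int>"
 by (simp add: int_point_def)

context incidence
begin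

definition lv :: "nat => 'e => real" where
 "lv j e = (if e \<in> E then of_int ((SOME v. (\<forall>i<np. sum v {e\<in>E. p e = i} = 0) \<and>
     (\<forall>t<nm. sum v {e\<in>E. m e = t} = of_bool (t = j) - of_bool (t = 0))) e) else 0)"

lemma lv:
 assumes j: "j < nm"
 shows "lv j e \<in> \<int>" "e \<notin> E ==> lv j e = 0" "i < np ==> psum (lv j) i = 0"
  "t < nm ==> msum (lv j) t = of_bool (t = j) - of_bool (t = 0)"
proof -
 define v :: "'e => int" where "v = (SOME v. (\<forall>i<np. sum v {e\<in>E. p e = i} = 0) \<and>
     (\<forall>t<nm. sum v {e\<in>E. m e = t} = of_bool (t = j) - of_bool (t = 0)))"
 have v: "(\<forall>i<np. sum v {e\<in>E. p e = i} = 0) \<and>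
     (\<forall>t<nm. sum v {e\<in>E. m e = t} = of_bool (t = j) - of_bool (t = 0))"
  unfolding v_def using lift[OF j] by (rule someI_ex)
 have lv: "lv j e = (if e \<in> E then of_int (v e) else 0)" for e by (simp add: lv_def v_def)
 show "lv j e \<in> \<int>" "e \<notin> E ==> lv j e = 0" by (auto simp: lv)
 have "psum (lv j) i = of_int (sum v {e\<in>E. p e = i})" by (simp add: lv)
 thus "i < np ==> psum (lv j) i = 0" using v by simp
 have "msum (lv j) t = of_int (sum v {e\<in>E. m e = t})" by (simp add: lv)
 thus "t < nm ==> msum (lv j) t = of_bool (t = j) - of_bool (t = 0)" using v by simp
qed

lemma lcomb_sum: "sum (lcomb A b x) S = (\<Sum>k\<in>A. x k * sum (b k) S)"
 unfolding lcomb_def by (subst sum.swap) (simp add: sum_distrib_left)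

text \<open>A linear section, over vectors of sum 0, of the map from edge vectors with zero positive
  sums to their negative sums. It maps integer vectors to integer vectors.\<close>

definition lift_real :: "(nat => real) => 'e => real" where
 "lift_real d = lcomb {..<nm} lv d"

lemma lift_real:
 shows "e \<notin> E ==> lift_real d e = 0" "i < np ==> psum (lift_real d) i = 0"
  "\<forall>j<nm. d j \<in> \<int> ==> lift_real d e \<in> \<int>"
  "(\<Sum>j<nm. d j) = 0 ==> t < nm ==> msum (lift_real d) t = d t"
proof -
 show "e \<notin> E ==> lift_real d e = 0" by (simp add: lift_real_def lcomb_def lv)
 show "i < np ==> psum (lift_real d) i = 0" by (simp add: lift_real_def lcomb_sum lv)
 show "\<forall>j<nm. d j \<in> \<int> ==> lift_real d e \<in> \<int>"
  unfolding lift_real_def lcomb_def by (intro Ints_sum Ints_mult) (auto simp: lv)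
 assume d: "(\<Sum>j<nm. d j) = 0" and t: "t < nm"
 have "msum (lift_real d) t = (\<Sum>j<nm. d j * (of_bool (t = j) - of_bool (t = 0)))"
  unfolding lift_real_def lcomb_sum using t by (intro sum.cong) (auto simp: lv)
 also have "... = (\<Sum>j<nm. if t = j then d j else 0) - (\<Sum>j<nm. d j) * of_bool (t = 0)"
  by (auto simp: algebra_simps sum_subtractf sum_distrib_left intro!: sum.cong)
 finally show "msum (lift_real d) t = d t" using d t by simp
qed

text \<open>Integer edge vectors with zero positive sums form Z^J, their root entries being
  determined. This lattice is an extension of \<open>sum_dirs nm\<close> by \<open>dirs\<close>,
  split by \<open>lift_real\<close>; hence the product of the normalised measures of fibre and base
  is Lebesgue measure on \<open>J\<close>.\<close>

lemma lattice_split: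
 assumes bA: "int_basis dirs bA" and bS: "int_basis (sum_dirs nm) bS"
 defines "T \<equiv> \<lambda>(x, y). \<lambda>e\<in>J. lcomb {..<length bA} ((!) bA) x e + lcomb {..<length bS} (\<lambda>k. lift_real (bS ! k)) y e"
 shows "distr (lebs {..<length bA} \<Otimes>\<^sub>M lebs {..<length bS}) (lebs J) T = lebs J"
 unfolding T_def
proof (rule lattice_distr)
 let ?A = "{..<length bA}" and ?C = "{..<length bS}"
 let ?ip = "\<lambda>X. int_point X"
 define u where "u \<zeta> = lcomb ?A ((!) bA) (int_point ?A \<zeta>)" for \<zeta>
 define ct where "ct k = lift_real (bS ! k)" for k
 define w where "w \<eta> = lcomb ?C ct (int_point ?C \<eta>)" for \<eta>
 define d where "d \<eta> = lcomb ?C ((!) bS) (int_point ?C \<eta>)" for \<eta>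
 have ubij: "bij_betw u (?A \<rightarrow>\<^sub>E UNIV) dirs" unfolding u_def by (rule int_basis_lcomb[OF bA])
 have dbij: "bij_betw d (?C \<rightarrow>\<^sub>E UNIV) (sum_dirs nm)" unfolding d_def by (rule int_basis_lcomb[OF bS])
 have bSk: "bS ! k \<in> sum_dirs nm" if "k \<in> ?C" for k using int_basis_nth[OF bS] that by simp
 have ct: "e \<notin> E ==> ct k e = 0" "i < np ==> psum (ct k) i = 0" "ct k e \<in> \<int>"
   "t < nm ==> msum (ct k) t = (bS ! k) t" if "k \<in> ?C" for k e i t
  using bSk[OF that] unfolding ct_def sum_dirs_iff by (auto simp: lift_real)
 have w: "e \<notin> E ==> w \<eta> e = 0" "i < np ==> psum (w \<eta>) i = 0" "w \<eta> e \<in> \<int>"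
   "t < nm ==> msum (w \<eta>) t = d \<eta> t" for \<eta> e i t
 proof -
  show "e \<notin> E ==> w \<eta> e = 0" unfolding w_def lcomb_def by (intro sum.neutral) (simp add: ct)
  show "i < np ==> psum (w \<eta>) i = 0" unfolding w_def lcomb_sum by (intro sum.neutral) (simp add: ct)
  show "w \<eta> e \<in> \<int>" unfolding w_def lcomb_def by (intro Ints_sum Ints_mult ct int_point_Ints)
  show "t < nm ==> msum (w \<eta>) t = d \<eta> t"
   unfolding w_def lcomb_sum unfolding d_def lcomb_def by (intro sum.cong) (auto simp: ct)
 qed
 have u: "u \<zeta> \<in> dirs" if "\<zeta> \<in> ?A \<rightarrow>\<^sub>E UNIV" for \<zeta> using bij_betwE[OF ubij] that by blast
 have dd: "d \<eta> \<in> sum_dirs nm" if "\<eta> \<in> ?C \<rightarrow>\<^sub>E UNIV" for \<eta> using bij_betwE[OF dbij] that by blast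
 define T' where "T' = (\<lambda>(\<zeta>, \<eta>). \<lambda>e\<in>J. u \<zeta> e + w \<eta> e)"
 have "bij_betw T' ((?A \<rightarrow>\<^sub>E UNIV) \<times> (?C \<rightarrow>\<^sub>E UNIV)) (int_point J ` (J \<rightarrow>\<^sub>E UNIV))"
 proof (rule bij_betw_imageI)
  show "inj_on T' ((?A \<rightarrow>\<^sub>E UNIV) \<times> (?C \<rightarrow>\<^sub>E UNIV))"
  proof (rule inj_onI, clarify)
   fix \<zeta> \<eta> \<zeta>' \<eta>' assume z: "\<zeta> \<in> ?A \<rightarrow>\<^sub>E UNIV" "\<zeta>' \<in> ?A \<rightarrow>\<^sub>E UNIV" and y: "\<eta> \<in> ?C \<rightarrow>\<^sub>E UNIV" "\<eta>' \<in> ?C \<rightarrow>\<^sub>E UNIV"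
    and eq: "T' (\<zeta>, \<eta>) = T' (\<zeta>', \<eta>')"
   let ?v = "\<lambda>e. u \<zeta> e + w \<eta> e" and ?v' = "\<lambda>e. u \<zeta>' e + w \<eta>' e"
   have J: "?v e = ?v' e" if "e \<in> J" for e
    using fun_cong[OF eq, of e] that by (simp add: T'_def)
   have EE: "?v e = ?v' e" for e
   proof (cases "e \<in> E")
    case True
    have "psum ?v i = 0" "psum ?v' i = 0" if "i < np" for i
     using u[OF z(1)] u[OF z(2)] that by (auto simp: sum.distrib dirs_iff w)
    hence "?v e = ell (\<lambda>_. 0) ?v e" "?v' e = ell (\<lambda>_. 0) ?v' e"
     using True by (intro ell_unique; simp)+
    moreover have "ell (\<lambda>_. 0) ?v = ell (\<lambda>_. 0) ?v'" using J by (rule ell_cong)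
    ultimately show ?thesis by simp
   next
    case False
    thus ?thesis using u[OF z(1)] u[OF z(2)] by (simp add: w dirs_iff)
   qed
   have "d \<eta> t = d \<eta>' t" for t
   proof (cases "t < nm")
    case True
    have "msum ?v t = msum ?v' t" by (simp add: EE)
    thus ?thesis using u[OF z(1)] u[OF z(2)] True by (simp add: sum.distrib w dirs_iff)
   next
    case False thus ?thesis using dd[OF y(1)] dd[OF y(2)] by (simp add: sum_dirs_iff)
   qed
   hence "d \<eta> = d \<eta>'" ..
   hence 1: "\<eta> = \<eta>'" using dbij y unfolding bij_betw_def inj_on_def by blast
   have "u \<zeta> e = u \<zeta>' e" for e using EE[of e] 1 by simp
   hence "u \<zeta> = u \<zeta>'" ..
   hence "\<zeta> = \<zeta>'" using ubij z unfolding bij_betw_def inj_on_def by blast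
   with 1 show "\<zeta> = \<zeta>' \<and> \<eta> = \<eta>'" by simp
  qed
  show "T' ` ((?A \<rightarrow>\<^sub>E UNIV) \<times> (?C \<rightarrow>\<^sub>E UNIV)) = int_point J ` (J \<rightarrow>\<^sub>E UNIV)"
  proof (intro equalityI subsetI)
   fix z assume "z \<in> T' ` ((?A \<rightarrow>\<^sub>E UNIV) \<times> (?C \<rightarrow>\<^sub>E UNIV))"
   then obtain \<zeta> \<eta> where z: "\<zeta> \<in> ?A \<rightarrow>\<^sub>E UNIV" "z = (\<lambda>e\<in>J. u \<zeta> e + w \<eta> e)" by (auto simp: T'_def)
   have int: "u \<zeta> e + w \<eta> e \<in> \<int>" if "e \<in> J" for e
    using u[OF z(1)] that w by (auto simp: dirs_iff J_def)
   have "z = int_point J (\<lambda>e\<in>J. \<lfloor>u \<zeta> e + w \<eta> e\<rfloor>)"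
    using int unfolding z by (auto simp: int_point_def fun_eq_iff)
   thus "z \<in> int_point J ` (J \<rightarrow>\<^sub>E UNIV)" by (auto intro!: imageI)
  next
   fix z assume "z \<in> int_point J ` (J \<rightarrow>\<^sub>E (UNIV :: int set))"
   then obtain \<xi> where z: "z = int_point J \<xi>" by blast
   \<comment> \<open>The extension of z to all edges with positive sums 0. Subtracting the lift of
     its negative sums \<delta> leaves an element of \<open>dirs\<close>.\<close>
   define v where "v e = (if e \<in> E then ell (\<lambda>_. 0) z e else 0)" for e
   have zint: "z e \<in> \<int>" if "e \<in> J" for e using that by (simp add: z int_point_Ints)
   have vint: "v e \<in> \<int>" for e
    unfolding v_def ell_def by (auto intro!: zint Ints_sum Ints_diff)
   have psum: "psum v i = 0" if "i < np" for i
    using psum_ell[OF that, of "\<lambda>_. 0" z] by (simp add: v_def)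
   define \<delta> where "\<delta> j = (if j < nm then msum v j else 0)" for j
   have "sum v E = 0" using sum_psum[of v] psum by simp
   hence "(\<Sum>j<nm. \<delta> j) = 0" using sum_msum[of v] by (simp add: \<delta>_def)
   hence "\<delta> \<in> sum_dirs nm" by (auto simp: sum_dirs_iff \<delta>_def intro!: Ints_sum vint)
   then obtain \<eta> where y: "\<eta> \<in> ?C \<rightarrow>\<^sub>E UNIV" "d \<eta> = \<delta>" using bij_betw_ex[OF dbij] by blast
   have "(\<lambda>e. v e - w \<eta> e) \<in> dirs"
    unfolding dirs_iff
   proof (intro conjI ballI allI impI)
    show "v e - w \<eta> e \<in> \<int>" for e by (intro Ints_diff vint w)
    show "v e - w \<eta> e = 0" if "e \<notin> E" for e using that by (simp add: w v_def)
    show "psum (\<lambda>e. v e - w \<eta> e) i = 0" if "i < np" for i using that by (simp add: sum_subtractf w psum)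
    show "msum (\<lambda>e. v e - w \<eta> e) j = 0" if "j < nm" for j using that y(2) by (simp add: sum_subtractf w \<delta>_def)
   qed
   then obtain \<zeta> where x: "\<zeta> \<in> ?A \<rightarrow>\<^sub>E UNIV" "u \<zeta> = (\<lambda>e. v e - w \<eta> e)" using bij_betw_ex[OF ubij] by blast
   have "T' (\<zeta>, \<eta>) = z"
   proof
    fix e
    have "u \<zeta> e + w \<eta> e = z e" if "e \<in> J"
     using that by (simp add: x(2) v_def ell_J) (auto simp: J_def)
    thus "T' (\<zeta>, \<eta>) e = z e" by (simp add: T'_def z int_point_def)
   qed
   thus "z \<in> T' ` ((?A \<rightarrow>\<^sub>E UNIV) \<times> (?C \<rightarrow>\<^sub>E UNIV))" using x(1) y(1) by force
  qed
 qed
 thus "bij_betw (\<lambda>(\<zeta>, \<eta>). (\<lambda>(x, y). \<lambda>e\<in>J. lcomb ?A ((!) bA) x e + lcomb ?C (\<lambda>k. lift_real (bS ! k)) y e)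
    (int_point ?A \<zeta>, int_point ?C \<eta>)) ((?A \<rightarrow>\<^sub>E UNIV) \<times> (?C \<rightarrow>\<^sub>E UNIV)) (int_point J ` (J \<rightarrow>\<^sub>E UNIV))"
  unfolding T'_def u_def w_def ct_def[abs_def] by simp
qed auto

end

context incidence
begin

lemma e_monom_cong: "(\<And>j. j < length a ==> M j = M' j) ==> e_monom a M = e_monom a M'"
 by (simp add: e_monom_def)

lemma ell_measurable [measurable]: "e \<in> E ==> (\<lambda>z. ell L z e) \<in> borel_measurable (lebs J)"
proof -
 assume e: "e \<in> E"
 have [measurable]: "(\<lambda>z. sum z {e'\<in>J. p e' = i}) \<in> borel_measurable (lebs J)" for i
  by (intro borel_measurable_sum) auto
 have "(\<lambda>z. if e \<in> J then z e else L (p e) - sum z {e'\<in>J. p e' = p e}) \<in> borel_measurable (lebs J)"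
  by (cases "e \<in> J") auto
 thus ?thesis using e by (simp add: ell_def)
qed

text \<open>Replaces the arbitrarily chosen base point of the fibre by an explicit one: the two
  differ by a vector in the real span of \<open>dirs\<close>, which a shift of the parameters
  absorbs. Fubini will need base points that depend affinely on the boundary lengths.\<close>

lemma emeasure_cell:
 assumes bA: "bA = (SOME bs. int_basis dirs bs)"
  and sec: "\<And>i. i < np ==> psum sec i = L i" "\<And>j. j < nm ==> msum sec j = M j"
 shows "emeasure (affine_measure E (fib L M)) {l \<in> fib L M. \<forall>e\<in>E. 0 < l e} =
   emeasure (lebs {..<length bA}) {x \<in> space (lebs {..<length bA}). \<forall>e\<in>E. 0 < sec e + lcomb {..<length bA} ((!) bA) x e}"
proof -
 let ?A = "{..<length bA}" let ?b = "(!) bA"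
 have basis: "int_basis dirs bA"
  unfolding bA dirs_def by (rule someI_ex[OF int_basis_exists[OF E kernel_lattice_subgroup]])
 have r: "restrict sec E \<in> fib L M" using sec by (simp add: fib_def)
 define a where "a = (SOME a. a \<in> fib L M)"
 have a: "a \<in> fib L M" unfolding a_def by (rule someI[of "\<lambda>a. a \<in> fib L M", OF r])
 have b0: "psum (lcomb ?A ?b x) i = 0" "t < nm ==> msum (lcomb ?A ?b x) t = 0" if "i < np" for x i t
  unfolding lcomb_sum using int_basis_nth[OF basis] that by (auto intro!: sum.neutral simp: dirs_iff)
 have b1: "msum (lcomb ?A ?b x) t = 0" if "t < nm" for x t
  unfolding lcomb_sum using int_basis_nth[OF basis] that by (auto intro!: sum.neutral simp: dirs_iff)
 have "(\<lambda>e. if e \<in> E then a e - sec e else 0) \<in> real_span dirs"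
  using a sec by (intro dirs_span) (auto simp: fib_def sum_subtractf)
 then obtain u where u: "(\<lambda>e. if e \<in> E then a e - sec e else 0) = lcomb ?A ?b u"
  using lcomb_real_span[OF basis] by blast
 have au: "a e = sec e + lcomb ?A ?b u e" if "e \<in> E" for e using fun_cong[OF u, of e] that by simp
 define g where "g = (\<lambda>x. \<lambda>e\<in>E. a e + lcomb ?A ?b x e)"
 have g[measurable]: "g \<in> lebs ?A \<rightarrow>\<^sub>M (\<Pi>\<^sub>M e\<in>E. borel)" unfolding g_def lcomb_def by measurable
 have am: "affine_measure E (fib L M) = distr (lebs ?A) (\<Pi>\<^sub>M e\<in>E. borel) g"
  unfolding g_def a_def using affine_measure_eq[OF int_dirs_fib[OF r] bA] by simp
 have m: "{l \<in> fib L M. \<forall>e\<in>E. 0 < l e} \<in> sets (\<Pi>\<^sub>M e\<in>E. borel)"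
 proof -
  have [measurable]: "(\<lambda>l. sum l F) \<in> borel_measurable (\<Pi>\<^sub>M e\<in>E. borel :: real measure)" if "F \<subseteq> E" for F
   by (intro borel_measurable_sum measurable_component_singleton) (use that in auto)
  have "{l \<in> fib L M. \<forall>e\<in>E. 0 < l e} = {l \<in> space (\<Pi>\<^sub>M e\<in>E. borel).
    (\<forall>i\<in>{..<np}. psum l i = L i) \<and> (\<forall>j\<in>{..<nm}. msum l j = M j) \<and> (\<forall>e\<in>E. 0 < l e)}"
   by (auto simp: fib_def space_PiM PiE_def)
  also have "... \<in> sets (\<Pi>\<^sub>M e\<in>E. borel)" using E by measurable
  finally show ?thesis .
 qed
 define W where "W = {x \<in> space (lebs ?A). \<forall>e\<in>E. 0 < sec e + lcomb ?A ?b x e}"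
 have Wm: "W \<in> sets (lebs ?A)" unfolding W_def lcomb_def using E by measurable
 have "emeasure (affine_measure E (fib L M)) {l \<in> fib L M. \<forall>e\<in>E. 0 < l e}
   = emeasure (lebs ?A) (g -` {l \<in> fib L M. \<forall>e\<in>E. 0 < l e} \<inter> space (lebs ?A))"
  unfolding am by (rule emeasure_distr[OF g m])
 also have "g -` {l \<in> fib L M. \<forall>e\<in>E. 0 < l e} \<inter> space (lebs ?A) = shift ?A u -` W \<inter> space (lebs ?A)"
 proof -
  have "g x \<in> fib L M" for x
   using a by (auto simp: fib_def g_def sum.distrib b0 b1)
  moreover have "(\<forall>e\<in>E. 0 < g x e) \<longleftrightarrow> (\<forall>e\<in>E. 0 < sec e + lcomb ?A ?b (shift ?A u x) e)" for x
   by (intro ball_cong refl) (simp add: g_def lcomb_shift au add.commute add.left_commute)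
  ultimately show ?thesis
   by (auto simp: W_def space_lebs shift_def)
 qed
 also have "emeasure (lebs ?A) ... = emeasure (distr (lebs ?A) (lebs ?A) (shift ?A u)) W"
  by (rule emeasure_distr[symmetric, OF shift_measurable Wm])
 also have "... = emeasure (lebs ?A) W" by (simp add: distr_shift)
 finally show ?thesis unfolding W_def .
qed

text \<open>Fubini: the fibres over all points M of the simplex sweep out the lengths with positive
  boundaries L, where \<open>core_integral\<close> applies.\<close>

lemma fiber_integral:
 assumes L: "\<And>i. i < np ==> 0 < L i" and a: "length a = nm"
 defines "s \<equiv> \<Sum>i<np. L i"
 defines "\<mu> \<equiv> affine_measure {..<nm} (sum_plane nm s)" and "X \<equiv> {x \<in> sum_plane nm s. \<forall>j<nm. 0 \<le> x j}"
 shows "set_integrable \<mu> X (\<lambda>M. cell_vol L M * e_monom a M)"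
  and "set_lebesgue_integral \<mu> X (\<lambda>M. cell_vol L M * e_monom a M) =
   (\<Sum>c\<in>cell_coeffs a. \<Prod>i<np. dpow (exponent c i - 1) (L i))"
proof -
 define bA where "bA = (SOME bs. int_basis dirs bs)"
 define bS where "bS = (SOME bs. int_basis (sum_dirs nm) bs)"
 define aS where "aS = (SOME a. a \<in> sum_plane nm s)"
 let ?A = "{..<length bA}" and ?b = "(!) bA" and ?S = "{..<length bS}"
 have basisA: "int_basis dirs bA"
  unfolding bA_def dirs_def by (rule someI_ex[OF int_basis_exists[OF E kernel_lattice_subgroup]])
 have basisS: "int_basis (sum_dirs nm) bS"
  unfolding bS_def sum_dirs_def by (rule someI_ex[OF int_basis_exists[OF _ kernel_lattice_subgroup]]) simp
 have aS: "aS \<in> sum_plane nm s" unfolding aS_def by (rule someI_ex[OF sum_plane_nonempty[OF nm0]])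
 interpret A: sigma_finite_measure "lebs ?A" by (rule lborel_prod.sigma_finite) simp
 interpret S: sigma_finite_measure "lebs ?S" by (rule lborel_prod.sigma_finite) simp
 interpret AS: pair_sigma_finite "lebs ?A" "lebs ?S" ..
 define l0 where "l0 = ell L (\<lambda>_. 0)"
 \<comment> \<open>A point with boundary lengths L and M, affine in M.\<close>
 define sec where "sec M = (\<lambda>e. l0 e + lift_real (\<lambda>j. M j - msum l0 j) e)" for M
 have sl0: "(\<Sum>j<nm. msum l0 j) = s"
  unfolding sum_msum sum_psum[symmetric] s_def by (intro sum.cong) (auto simp: l0_def psum_ell)
 have sec: "i < np ==> psum (sec M) i = L i" "t < nm ==> msum (sec M) t = M t"
  if "(\<Sum>j<nm. M j) = s" for M i t
  using that sl0 by (auto simp: sec_def sum.distrib lift_real l0_def psum_ell sum_subtractf)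
 define ct where "ct k = lift_real (bS ! k)" for k
 define Lm where "Lm y = (\<lambda>j\<in>{..<nm}. aS j + lcomb ?S ((!) bS) y j)" for y
 have Lm_plane: "Lm y \<in> sum_plane nm s" for y
 proof -
  have "(\<Sum>j<nm. lcomb ?S ((!) bS) y j) = 0"
   unfolding lcomb_sum using int_basis_nth[OF basisS] by (auto intro!: sum.neutral simp: sum_dirs_iff)
  thus ?thesis using aS by (auto simp: Lm_def sum_plane_def sum.distrib)
 qed
 hence Lm_sum: "(\<Sum>j<nm. Lm y j) = s" for y by (simp add: sum_plane_def)
 have secLm: "sec (Lm y) e = sec aS e + lcomb ?S ct y e" for y e
 proof -
  have "lift_real (\<lambda>j. Lm y j - msum l0 j) e = lift_real (\<lambda>j. aS j - msum l0 j) e + lift_real (lcomb ?S ((!) bS) y) e"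
   by (simp add: lift_real_def lcomb_def[of "{..<nm}"] Lm_def algebra_simps sum.distrib sum_subtractf)
  moreover have "lift_real (lcomb ?S ((!) bS) y) e = lcomb ?S ct y e"
   unfolding lift_real_def ct_def lcomb_def
   by (simp add: sum_distrib_right sum_distrib_left mult.assoc) (rule sum.swap)
  ultimately show ?thesis by (simp add: sec_def)
 qed
 \<comment> \<open>The fibre volume with values in [0, \<infinity>], so that integrals can be
   exchanged before finiteness is known.\<close>
 define W where "W M = (\<integral>\<^sup>+x. indicator {x. \<forall>e\<in>E. 0 < sec M e + lcomb ?A ?b x e} x \<partial>lebs ?A)" for M
 have W_em: "W M = emeasure (lebs ?A) {x \<in> space (lebs ?A). \<forall>e\<in>E. 0 < sec M e + lcomb ?A ?b x e}" for M
 proof -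
  have "{x \<in> space (lebs ?A). \<forall>e\<in>E. 0 < sec M e + lcomb ?A ?b x e} \<in> sets (lebs ?A)"
   unfolding lcomb_def using E by measurable
  from nn_integral_indicator[OF this] show ?thesis
   unfolding W_def by (subst (asm) eq_commute) (auto intro!: nn_integral_cong split: split_indicator)
 qed
 have cell: "cell_vol L M = enn2real (W M)" if "(\<Sum>j<nm. M j) = s" for M
  unfolding cell_vol_def measure_def W_em
  using emeasure_cell[OF bA_def, of "sec M" L M] sec[OF that] by simp
 define PB where "PB = (\<Pi>\<^sub>M j\<in>{..<nm}. borel :: real measure)"
 have \<mu>: "\<mu> = distr (lebs ?S) PB Lm"
  unfolding \<mu>_def PB_def Lm_def[abs_def] aS_def
  by (rule affine_measure_eq[OF int_dirs_sum_plane[OF nm0] bS_def])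
 have Lm_m[measurable]: "Lm \<in> lebs ?S \<rightarrow>\<^sub>M PB"
  unfolding PB_def Lm_def[abs_def] lcomb_def by measurable
 have [measurable]: "e_monom a \<in> borel_measurable PB"
  unfolding PB_def by (rule e_monom_measurable[of _ nm]) (simp_all add: a)
 have sec_m[measurable]: "(\<lambda>M. sec M e) \<in> borel_measurable PB" for e
  unfolding sec_def lift_real_def lcomb_def PB_def by measurable
 have W_m[measurable]: "W \<in> borel_measurable PB"
 proof -
  have "(\<lambda>q. if \<forall>e\<in>E. 0 < sec (fst q) e + (\<Sum>k\<in>?A. snd q k * ?b k e) then 1 else (0 :: ennreal)) \<in> borel_measurable (PB \<Otimes>\<^sub>M lebs ?A)"
   using E by measurable
  hence "(\<lambda>M. \<integral>\<^sup>+x. (if \<forall>e\<in>E. 0 < sec M e + (\<Sum>k\<in>?A. x k * ?b k e) then 1 else 0) \<partial>lebs ?A) \<in> borel_measurable PB"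
   by (intro A.borel_measurable_nn_integral) (simp add: case_prod_unfold)
  thus ?thesis by (simp add: W_def[abs_def] lcomb_def indicator_def[abs_def] of_bool_def)
 qed
 define ind where "ind M = (if (\<Sum>j<nm. M j) = s \<and> (\<forall>j\<in>{..<nm}. 0 \<le> M j) then 1 else (0 :: real))" for M
 have [measurable]: "ind \<in> borel_measurable PB" unfolding ind_def[abs_def] PB_def by measurable
 define h where "h M = ind M * (enn2real (W M) * e_monom a M)" for M
 have h_m[measurable]: "h \<in> borel_measurable PB" unfolding h_def[abs_def] by measurable
 have h_nonneg: "0 \<le> h M" for M
  unfolding h_def ind_def e_monom_dpow a by (auto intro!: mult_nonneg_nonneg prod_nonneg dpow_nonneg)
 have h_eq: "indicator X M *\<^sub>R (cell_vol L M * e_monom a M) = h M" if "M \<in> space \<mu>" for M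
 proof -
  have "M \<in> extensional {..<nm}" using that by (auto simp: \<mu> PB_def space_PiM PiE_def)
  hence "M \<in> X \<longleftrightarrow> (\<Sum>j<nm. M j) = s \<and> (\<forall>j\<in>{..<nm}. 0 \<le> M j)"
   by (auto simp: X_def sum_plane_def)
  thus ?thesis by (auto simp: h_def ind_def indicator_def cell)
 qed
 \<comment> \<open>The indicator of the simplex is redundant: a fibre containing a positive point lies over the simplex.\<close>
 have pos: "0 \<le> Lm y j" if "\<forall>e\<in>E. 0 < sec (Lm y) e + lcomb ?A ?b x e" "j < nm" for x y j
 proof -
  have "msum (lcomb ?A ?b x) j = 0"
   unfolding lcomb_sum using int_basis_nth[OF basisA] that by (auto intro!: sum.neutral simp: dirs_iff)
  hence "Lm y j = msum (\<lambda>e. sec (Lm y) e + lcomb ?A ?b x e) j"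
   using that by (simp add: sum.distrib sec[OF Lm_sum])
  also have "... \<ge> 0" using that(1) by (intro sum_nonneg) (auto intro: less_imp_le)
  finally show ?thesis .
 qed
 have indW: "ennreal (ind (Lm y)) * W (Lm y) = W (Lm y)" for y
 proof (cases "ind (Lm y) = 1")
  case False
  hence "\<not> (\<forall>j\<in>{..<nm}. 0 \<le> Lm y j)"
   by (cases "\<forall>j\<in>{..<nm}. 0 \<le> Lm y j") (simp_all add: ind_def Lm_sum)
  hence "\<not> (\<forall>j<nm. 0 \<le> Lm y j)" by blast
  hence "{x \<in> space (lebs ?A). \<forall>e\<in>E. 0 < sec (Lm y) e + lcomb ?A ?b x e} = {}"
   using pos by blast
  hence "W (Lm y) = 0" unfolding W_em by (simp only: emeasure_empty)
  thus ?thesis by simp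
 qed simp
 define T where "T = (\<lambda>(x, y). \<lambda>e\<in>J. lcomb ?A ?b x e + lcomb ?S ct y e)"
 have T_distr: "distr (lebs ?A \<Otimes>\<^sub>M lebs ?S) (lebs J) T = lebs J"
  unfolding T_def ct_def by (rule lattice_split[OF basisA basisS])
 have [measurable]: "T \<in> lebs ?A \<Otimes>\<^sub>M lebs ?S \<rightarrow>\<^sub>M lebs J"
  unfolding T_def lcomb_def case_prod_unfold by measurable
 have key: "(\<integral>\<^sup>+y. W (Lm y) * ennreal (e_monom b (Lm y)) \<partial>lebs ?S)
   = ennreal (\<Sum>c\<in>cell_coeffs b. \<Prod>i<np. dpow (exponent c i - 1) (L i))" if b: "length b = nm" for b
 proof -
  define g where "g z = (if \<forall>e\<in>E. 0 < ell L z e then 1 else 0) * ennreal (e_monom b (msum (ell L z)))" for z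
  have g_m[measurable]: "g \<in> borel_measurable (lebs J)"
   unfolding g_def[abs_def] e_monom_dpow using E by measurable
  have "W (Lm y) * ennreal (e_monom b (Lm y)) = (\<integral>\<^sup>+x. g (shift J (sec aS) (T (x, y))) \<partial>lebs ?A)" for y
  proof -
   have "W (Lm y) * ennreal (e_monom b (Lm y)) =
    (\<integral>\<^sup>+x. indicator {x. \<forall>e\<in>E. 0 < sec (Lm y) e + lcomb ?A ?b x e} x * ennreal (e_monom b (Lm y)) \<partial>lebs ?A)"
    unfolding W_def
   proof (rule nn_integral_multc[symmetric])
    have "(\<lambda>x. if \<forall>e\<in>E. 0 < sec (Lm y) e + (\<Sum>k\<in>?A. x k * ?b k e) then 1 else (0 :: ennreal)) \<in> borel_measurable (lebs ?A)"
     using E by measurable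
    thus "(indicator {x. \<forall>e\<in>E. 0 < sec (Lm y) e + lcomb ?A ?b x e} :: _ => ennreal) \<in> borel_measurable (lebs ?A)"
     by (simp add: lcomb_def indicator_def[abs_def] of_bool_def)
   qed
   also have "... = (\<integral>\<^sup>+x. g (shift J (sec aS) (T (x, y))) \<partial>lebs ?A)"
   proof (rule nn_integral_cong)
    fix x
    define l where "l e = sec (Lm y) e + lcomb ?A ?b x e" for e
    have "psum (lcomb ?A ?b x) i = 0" if "i < np" for i
     unfolding lcomb_sum using int_basis_nth[OF basisA] that by (auto intro!: sum.neutral simp: dirs_iff)
    hence psum: "psum l i = L i" if "i < np" for i
     using that by (simp add: l_def sum.distrib sec[OF Lm_sum])
    have "msum (lcomb ?A ?b x) t = 0" if "t < nm" for t
     unfolding lcomb_sum using int_basis_nth[OF basisA] that by (auto intro!: sum.neutral simp: dirs_iff)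
    hence msum: "msum l t = Lm y t" if "t < nm" for t
     using that by (simp add: l_def sum.distrib sec[OF Lm_sum])
    have ell: "l e = ell L (shift J (sec aS) (T (x, y))) e" if "e \<in> E" for e
    proof -
     have "l e = ell L l e" by (rule ell_unique[OF psum that])
     also have "ell L l = ell L (shift J (sec aS) (T (x, y)))"
      by (rule ell_cong) (simp add: l_def secLm shift_def T_def)
     finally show ?thesis .
    qed
    have "e_monom b (Lm y) = e_monom b (msum (ell L (shift J (sec aS) (T (x, y)))))"
    proof (rule e_monom_cong)
     fix j assume "j < length b"
     hence "Lm y j = msum l j" using msum b by simp
     also have "... = msum (ell L (shift J (sec aS) (T (x, y)))) j"
      by (intro sum.cong) (auto simp: ell)
     finally show "Lm y j = msum (ell L (shift J (sec aS) (T (x, y)))) j" .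
    qed
    moreover have "(\<forall>e\<in>E. 0 < l e) \<longleftrightarrow> (\<forall>e\<in>E. 0 < ell L (shift J (sec aS) (T (x, y))) e)"
     by (intro ball_cong refl) (simp add: ell)
    ultimately show "indicator {x. \<forall>e\<in>E. 0 < sec (Lm y) e + lcomb ?A ?b x e} x * ennreal (e_monom b (Lm y)) =
      g (shift J (sec aS) (T (x, y)))"
     by (simp add: g_def l_def indicator_def)
   qed
   finally show ?thesis .
  qed
  hence "(\<integral>\<^sup>+y. W (Lm y) * ennreal (e_monom b (Lm y)) \<partial>lebs ?S) =
    (\<integral>\<^sup>+y. \<integral>\<^sup>+x. g (shift J (sec aS) (T (x, y))) \<partial>lebs ?A \<partial>lebs ?S)" by simp
  also have "... = (\<integral>\<^sup>+q. g (shift J (sec aS) (T q)) \<partial>(lebs ?A \<Otimes>\<^sub>M lebs ?S))"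
   by (rule AS.nn_integral_snd[of "\<lambda>q. g (shift J (sec aS) (T q))", simplified]) measurable
  also have "... = (\<integral>\<^sup>+z. g (shift J (sec aS) z) \<partial>distr (lebs ?A \<Otimes>\<^sub>M lebs ?S) (lebs J) T)"
   by (rule nn_integral_distr[symmetric]) measurable
  also have "... = (\<integral>\<^sup>+z. g z \<partial>lebs J)"
   unfolding T_distr by (rule nn_integral_shift[OF refl distr_shift[OF finJ] g_m])
  also have "... = ennreal (\<Sum>c\<in>cell_coeffs b. \<Prod>i<np. dpow (exponent c i - 1) (L i))"
   using core_integral[OF b L] by (simp add: g_def[abs_def] indicator_def[abs_def] of_bool_def)
  finally show ?thesis .
 qed
 \<comment> \<open>The constant monomial has a finite integral by \<open>key\<close>, so almost
   every fibre has finite volume and passing to real values loses nothing.\<close>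
 have "AE y in lebs ?S. W (Lm y) * ennreal (e_monom (replicate nm 0) (Lm y)) \<noteq> \<infinity>"
 proof (rule nn_integral_noteq_infinite)
  have "e_monom (replicate nm 0) \<in> borel_measurable PB"
   unfolding PB_def by (rule e_monom_measurable[of _ nm]) simp_all
  thus "(\<lambda>y. W (Lm y) * ennreal (e_monom (replicate nm 0) (Lm y))) \<in> borel_measurable (lebs ?S)"
   by measurable
 qed (simp add: key)
 moreover have "e_monom (replicate nm 0) M = 1" for M by (simp add: e_monom_def)
 ultimately have Wfin: "AE y in lebs ?S. W (Lm y) \<noteq> \<infinity>" by simp
 have "(\<integral>\<^sup>+M. ennreal (h M) \<partial>\<mu>) = (\<integral>\<^sup>+y. ennreal (h (Lm y)) \<partial>lebs ?S)"
  unfolding \<mu> by (rule nn_integral_distr) measurable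
 also have "... = (\<integral>\<^sup>+y. W (Lm y) * ennreal (e_monom a (Lm y)) \<partial>lebs ?S)"
 proof (rule nn_integral_cong_AE, use Wfin in eventually_elim)
  fix y assume fin: "W (Lm y) \<noteq> \<infinity>"
  have "ennreal (h (Lm y)) = ennreal (ind (Lm y)) * (W (Lm y) * ennreal (e_monom a (Lm y)))"
  proof (cases "ind (Lm y) = 0")
   case False
   hence "0 \<le> e_monom a (Lm y)"
    by (auto simp: ind_def e_monom_dpow a split: if_splits intro!: prod_nonneg dpow_nonneg)
   moreover have "0 \<le> ind (Lm y)" by (simp add: ind_def)
   ultimately show ?thesis using fin
    by (simp add: h_def ennreal_mult top.not_eq_extremum)
  qed (simp add: h_def)
  thus "ennreal (h (Lm y)) = W (Lm y) * ennreal (e_monom a (Lm y))"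
   using indW[of y] by (simp flip: mult.assoc)
 qed
 also have "... = ennreal (\<Sum>c\<in>cell_coeffs a. \<Prod>i<np. dpow (exponent c i - 1) (L i))" by (rule key[OF a])
 finally have nn: "(\<integral>\<^sup>+M. ennreal (h M) \<partial>\<mu>) = ennreal (\<Sum>c\<in>cell_coeffs a. \<Prod>i<np. dpow (exponent c i - 1) (L i))" .
 have hm: "h \<in> borel_measurable \<mu>" unfolding \<mu> by simp
 have "integrable \<mu> h"
  by (rule integrableI_nn_integral_finite[OF hm _ nn]) (simp_all add: h_nonneg sum_nonneg prod_nonneg dpow_nonneg L less_imp_le)
 thus "set_integrable \<mu> X (\<lambda>M. cell_vol L M * e_monom a M)"
  unfolding set_integrable_def using h_eq by (subst Bochner_Integration.integrable_cong[OF refl]) auto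
 have "set_lebesgue_integral \<mu> X (\<lambda>M. cell_vol L M * e_monom a M) = (\<integral>M. h M \<partial>\<mu>)"
  unfolding set_lebesgue_integral_def by (rule Bochner_Integration.integral_cong[OF refl h_eq])
 also have "... = enn2real (\<integral>\<^sup>+M. ennreal (h M) \<partial>\<mu>)"
  by (rule integral_eq_nn_integral[OF hm]) (simp add: h_nonneg)
 also have "... = (\<Sum>c\<in>cell_coeffs a. \<Prod>i<np. dpow (exponent c i - 1) (L i))"
  unfolding nn using L by (intro enn2real_ennreal sum_nonneg prod_nonneg dpow_nonneg ballI) (auto intro: less_imp_le)
 finally show "set_lebesgue_integral \<mu> X (\<lambda>M. cell_vol L M * e_monom a M) =
   (\<Sum>c\<in>cell_coeffs a. \<Prod>i<np. dpow (exponent c i - 1) (L i))" .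
qed

end

section \<open>From weighted sums over graphs to counts of integral metrics\<close>

section \<open>Orbits of permutations of finite sets\<close>

lemma permutes_orbit_self: "finite S ==> f permutes S ==> x \<in> orbit f x"
 by (rule permutation_self_in_orbit) (auto simp: permutation_permutes)

lemma permutes_orbit_sub: "f permutes S ==> x \<in> S ==> orbit f x \<subseteq> S"
 using permutes_orbit_subset by metis

lemma permutes_orbit_eq:
 assumes "finite S" "f permutes S" "y \<in> orbit f x" shows "orbit f y = orbit f x"
proof -
 have "x \<in> orbit f y" by (rule orbit_swap[OF permutes_orbit_self[OF assms(1,2)] assms(3)])
 thus ?thesis using assms(3) orbit_trans by (metis subsetI subset_antisym)
qed

lemma permutes_orbit_eq_iff:
 assumes "finite S" "f permutes S" shows "orbit f y = orbit f x \<longleftrightarrow> y \<in> orbit f x"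
 using permutes_orbit_eq[OF assms] permutes_orbit_self[OF assms] by metis

lemma orbits_disjoint:
 assumes "finite S" "f permutes S" "A \<in> orbit f ` S" "B \<in> orbit f ` S" "A \<noteq> B"
 shows "A \<inter> B = {}"
 using assms(3-5) permutes_orbit_eq[OF assms(1,2)] by blast

lemma orbits_Union: "finite S ==> f permutes S ==> \<Union>(orbit f ` S) = S"
 using permutes_orbit_self permutes_orbit_sub by (metis UN_I UN_least subsetI subset_antisym)

lemma sum_over_orbits:
 assumes "finite S" "f permutes S" "T \<subseteq> S"
 shows "sum w T = (\<Sum>A\<in>orbit f ` S. sum w (A \<inter> T))"
proof -
 have "sum w T = sum w (\<Union>((\<lambda>A. A \<inter> T) ` (orbit f ` S)))"
  using orbits_Union[OF assms(1,2)] assms(3) by (intro arg_cong[of _ _ "sum w"]) auto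
 also have "... = (\<Sum>A\<in>orbit f ` S. sum w (A \<inter> T))"
 proof (rule sum.UNION_disjoint)
  show "\<forall>A\<in>orbit f ` S. finite (A \<inter> T)" using assms by (meson finite_Int finite_subset)
  show "\<forall>A\<in>orbit f ` S. \<forall>B\<in>orbit f ` S. A \<noteq> B --> A \<inter> T \<inter> (B \<inter> T) = {}"
   using orbits_disjoint[OF assms(1,2)] by blast
 qed (use assms in auto)
 finally show ?thesis .
qed

lemma card_by_orbits:
 assumes "finite S" "f permutes S" "T \<subseteq> S"
 shows "card T = (\<Sum>A\<in>orbit f ` S. card (A \<inter> T))"
 using sum_over_orbits[OF assms, of "\<lambda>_. 1 :: nat"] by simp

lemma orbit_image_step: "finite S ==> f permutes S ==> orbit f (f x) = orbit f x"
 by (rule permutes_orbit_eq) (auto intro: orbit.base)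

lemma orbit_invariant:
 assumes "\<And>y. y \<in> A ==> f y \<in> A" "x \<in> A" shows "orbit f x \<subseteq> A"
proof
 fix y assume "y \<in> orbit f x" thus "y \<in> A" by induction (auto simp: assms)
qed

lemma orbit_image_on:
 assumes "\<And>x. x \<in> S ==> g x \<in> S" "\<And>x. x \<in> S ==> f (g x) = g' (f x)" "x \<in> S"
 shows "orbit g' (f x) = f ` orbit g x"
proof (intro equalityI subsetI)
 have sub: "orbit g x \<subseteq> S" by (rule orbit_invariant[OF assms(1,3)])
 fix y assume "y \<in> orbit g' (f x)"
 thus "y \<in> f ` orbit g x"
 proof induction
  case base
  have "g' (f x) = f (g x)" using assms(2,3) by simp
  thus ?case by (auto intro: orbit.base)
 next
  case (step y)
  then obtain z where z: "z \<in> orbit g x" "y = f z" by blast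
  hence "g' y = f (g z)" using assms(2) sub by auto
  thus ?case using orbit.step[OF z(1)] by blast
 qed
next
 fix y assume "y \<in> f ` orbit g x"
 then obtain z where z: "z \<in> orbit g x" "y = f z" by blast
 have "z \<in> S \<and> f z \<in> orbit g' (f x)" using z(1)
 proof induction
  case base
  show ?case using assms orbit.base[of g' "f x"] by simp
 next
  case (step y)
  hence "f (g y) = g' (f y)" "g y \<in> S" using assms by auto
  thus ?case using step orbit.step[of "f y" g' "f x"] by simp
 qed
 thus "y \<in> orbit g' (f x)" using z by simp
qed

section \<open>Directed four-valent ribbon graphs\<close>

definition pos_half :: "'h ribbon_graph => 'h set" where
 "pos_half G = {h \<in> half_edges G. isl (bdry G h)}"

text \<open>In a directed graph every edge has exactly one positive half, so an edge carries one
  positive and one negative label.\<close>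

definition pos_of :: "'h ribbon_graph => 'h set => 'h" where
 "pos_of G e = (THE h. h \<in> e \<and> isl (bdry G h))"

definition pos_label :: "'h ribbon_graph => 'h set => nat" where
 "pos_label G e = projl (bdry G (pos_of G e))"

definition neg_label :: "'h ribbon_graph => 'h set => nat" where
 "neg_label G e = projr (bdry G (einv G (pos_of G e)))"

locale directed_graph =
 fixes np nm :: nat and G :: "'h ribbon_graph"
 assumes rg: "is_ribbon_graph G" and conn: "rg_connected G"
  and lab: "boundary_labelled np nm G" and dir: "directed G" and four: "four_valent G"
begin

abbreviation "H \<equiv> half_edges G"

lemma finH: "finite H" and H0: "H \<noteq> {}" and vperm: "vperm G permutes H" and einv: "einv G permutes H"
 and einv_neq: "h \<in> H ==> einv G h \<noteq> h" and einv_einv: "h \<in> H ==> einv G (einv G h) = h"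
 using rg by (auto simp: is_ribbon_graph_def)

lemma einv_in: "h \<in> H ==> einv G h \<in> H" and vperm_in: "h \<in> H ==> vperm G h \<in> H"
 using einv vperm by (auto simp: permutes_in_image)

lemma bperm: "bperm G permutes H"
 unfolding bperm_def by (rule permutes_compose[OF einv vperm])

lemma bperm_in: "h \<in> H ==> bperm G h \<in> H"
 using bperm by (auto simp: permutes_in_image)

lemma bdry_eq_iff: "h \<in> H ==> h' \<in> H ==> bdry G h = bdry G h' \<longleftrightarrow> h' \<in> orbit (bperm G) h"
 using lab by (auto simp: boundary_labelled_def)

lemma bdry_image: "bdry G ` H = {..<np} <+> {..<nm}"
 using lab by (auto simp: boundary_labelled_def)

lemma bdry_bperm: "h \<in> H ==> bdry G (bperm G h) = bdry G h"
proof -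
 assume h: "h \<in> H"
 have "bdry G h = bdry G (bperm G h)"
  unfolding bdry_eq_iff[OF h bperm_in[OF h]] by (rule orbit.base)
 thus ?thesis ..
qed

lemma isl_einv: "h \<in> H ==> isl (bdry G (einv G h)) \<longleftrightarrow> \<not> isl (bdry G h)"
 using dir by (auto simp: directed_def)

lemma pos_cases:
 assumes "h \<in> pos_half G" obtains i where "i < np" "bdry G h = Inl i"
proof -
 have "bdry G h \<in> {..<np} <+> {..<nm}" using assms bdry_image by (auto simp: pos_half_def)
 thus ?thesis using assms that by (auto simp: pos_half_def)
qed

lemma neg_cases:
 assumes "h \<in> pos_half G" obtains j where "j < nm" "bdry G (einv G h) = Inr j"
proof -
 have h: "h \<in> H" "isl (bdry G h)" using assms by (auto simp: pos_half_def)
 have "bdry G (einv G h) \<in> {..<np} <+> {..<nm}" using h einv_in bdry_image by blast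
 thus ?thesis using isl_einv[OF h(1)] h(2) that by auto
qed

lemma pos_of_edge: "h \<in> pos_half G ==> pos_of G (edge_at G h) = h"
 unfolding pos_of_def edge_at_def using isl_einv
 by (intro the_equality) (auto simp: pos_half_def)

lemma edge_at_einv: "h \<in> H ==> edge_at G (einv G h) = edge_at G h"
 by (auto simp: edge_at_def einv_einv)

lemma edges_pos: "edges G = edge_at G ` pos_half G"
proof -
 have "edge_at G h \<in> edge_at G ` pos_half G" if "h \<in> H" for h
 proof (cases "isl (bdry G h)")
  case True thus ?thesis using that by (auto simp: pos_half_def)
 next
  case False
  hence "einv G h \<in> pos_half G" using that isl_einv einv_in by (auto simp: pos_half_def)
  thus ?thesis using edge_at_einv[OF that] by (metis imageI)
 qed
 thus ?thesis by (auto simp: edges_def pos_half_def)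
qed

lemma edge_bij: "bij_betw (edge_at G) (pos_half G) (edges G)"
 by (rule bij_betw_byWitness[where f' = "pos_of G"]) (auto simp: edges_pos pos_of_edge)

lemma edge_labels:
 assumes "h \<in> pos_half G"
 shows "bdry G h = Inl (pos_label G (edge_at G h))" "bdry G (einv G h) = Inr (neg_label G (edge_at G h))"
  "pos_label G (edge_at G h) < np" "neg_label G (edge_at G h) < nm"
 using assms pos_cases neg_cases pos_of_edge[OF assms]
 by (metis pos_label_def neg_label_def sum.sel)+

lemma sum_pos_label:
 "(\<Sum>e\<in>{e\<in>edges G. pos_label G e = i}. f e) = (\<Sum>h\<in>{h\<in>pos_half G. bdry G h = Inl i}. f (edge_at G h))"
proof (rule sum.reindex_bij_betw[symmetric, OF bij_betw_subset[OF edge_bij]])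
 show "edge_at G ` {h \<in> pos_half G. bdry G h = Inl i} = {e \<in> edges G. pos_label G e = i}"
  using edge_labels(1) by (force simp: edges_pos)
qed auto

lemma sum_neg_label:
 "(\<Sum>e\<in>{e\<in>edges G. neg_label G e = j}. f e) = (\<Sum>h\<in>{h\<in>pos_half G. bdry G (einv G h) = Inr j}. f (edge_at G h))"
proof (rule sum.reindex_bij_betw[symmetric, OF bij_betw_subset[OF edge_bij]])
 show "edge_at G ` {h \<in> pos_half G. bdry G (einv G h) = Inr j} = {e \<in> edges G. neg_label G e = j}"
  using edge_labels(2) by (force simp: edges_pos)
qed auto

lemma bdry_length_pos: "bdry_length G l (Inl i) = sum l {e\<in>edges G. pos_label G e = i}"
 unfolding bdry_length_def sum_pos_label by (intro sum.cong) (auto simp: pos_half_def)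

lemma bdry_length_neg: "bdry_length G l (Inr j) = sum l {e\<in>edges G. neg_label G e = j}"
proof -
 have "bdry_length G l (Inr j) = (\<Sum>h\<in>{h\<in>pos_half G. bdry G (einv G h) = Inr j}. l (edge_at G h))"
  unfolding bdry_length_def
 proof (rule sum.reindex_bij_witness[where i = "einv G" and j = "einv G"])
  fix h assume "h \<in> {h \<in> H. bdry G h = Inr j}"
  thus "einv G (einv G h) = h" "einv G h \<in> {h \<in> pos_half G. bdry G (einv G h) = Inr j}"
   "l (edge_at G (einv G h)) = l (edge_at G h)"
   using isl_einv einv_in by (auto simp: pos_half_def einv_einv edge_at_einv)
 next
  fix h assume "h \<in> {h \<in> pos_half G. bdry G (einv G h) = Inr j}"
  thus "einv G (einv G h) = h" "einv G h \<in> {h \<in> H. bdry G h = Inr j}"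
   using einv_in by (auto simp: pos_half_def einv_einv)
 qed
 thus ?thesis by (simp add: sum_neg_label)
qed

lemma finite_edges: "finite (edges G)" using finH by (simp add: edges_def)

text \<open>Two consecutive edges of the graph share a positive or a negative boundary; in the first case
 the difference of their indicators moves one unit between their negative boundaries.\<close>

lemma lift_path:
 assumes "(h, h') \<in> {(x, y). x \<in> H \<and> (y = vperm G x \<or> y = einv G x)}\<^sup>*" "h \<in> H"
 shows "h' \<in> H \<and> (\<exists>v :: 'h set => int. (\<forall>i<np. sum v {e\<in>edges G. pos_label G e = i} = 0) \<and>
   (\<forall>t<nm. sum v {e\<in>edges G. neg_label G e = t} =
    of_bool (t = neg_label G (edge_at G h)) - of_bool (t = neg_label G (edge_at G h'))))"
 using assms
proof (induction rule: rtrancl_induct)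
 case base
 thus ?case by (auto intro!: exI[of _ "\<lambda>_. 0"])
next
 case (step y z)
 from step obtain v :: "'h set => int" where y: "y \<in> H" and
  v: "\<forall>i<np. sum v {e\<in>edges G. pos_label G e = i} = 0"
   "\<forall>t<nm. sum v {e\<in>edges G. neg_label G e = t} =
    of_bool (t = neg_label G (edge_at G h)) - of_bool (t = neg_label G (edge_at G y))" by blast
 have z: "z \<in> H" "z = einv G y \<or> z = vperm G y" using step.hyps y einv_in vperm_in by auto
 have "\<exists>w :: 'h set => int. (\<forall>i<np. sum w {e\<in>edges G. pos_label G e = i} = 0) \<and>
   (\<forall>t<nm. sum w {e\<in>edges G. neg_label G e = t} =
    of_bool (t = neg_label G (edge_at G y)) - of_bool (t = neg_label G (edge_at G z)))"
 proof (cases "neg_label G (edge_at G y) = neg_label G (edge_at G z)")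
  case True
  thus ?thesis by (intro exI[of _ "\<lambda>_. 0"]) simp
 next
  case False
  hence zv: "z = vperm G y" using z edge_at_einv[OF y] by auto
  let ?y = "einv G y"
  have yy: "?y \<in> H" "einv G ?y = y" using y einv_in einv_einv by auto
  \<comment> \<open>\<open>vperm\<close> is one step along the boundary of the opposite half-edge,
    so the opposite half of y and z are consecutive along one boundary.\<close>
  have "z = bperm G ?y" using zv yy by (simp add: bperm_def)
  hence b: "bdry G z = bdry G ?y" using bdry_bperm yy by simp
  have pl: "pos_label G (edge_at G y) = pos_label G (edge_at G z)"
  proof (cases "isl (bdry G z)")
   case True
   hence "z \<in> pos_half G" "?y \<in> pos_half G" using z yy b by (auto simp: pos_half_def)
   thus ?thesis using edge_labels(1) b edge_at_einv[OF y] by (metis sum.inject(1))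
  next
   case False
   hence "einv G z \<in> pos_half G" "y \<in> pos_half G"
    using z y yy b isl_einv[of z] isl_einv[of y] einv_in by (auto simp: pos_half_def)
   hence "bdry G z = Inr (neg_label G (edge_at G z))" "bdry G ?y = Inr (neg_label G (edge_at G y))"
    using edge_labels(2)[of "einv G z"] edge_labels(2)[of y] z einv_einv edge_at_einv by auto
   thus ?thesis using b \<open>neg_label G (edge_at G y) \<noteq> neg_label G (edge_at G z)\<close> by simp
  qed
  have ed: "edge_at G y \<in> edges G" "edge_at G z \<in> edges G" using y z by (auto simp: edges_def)
  define w :: "'h set => int" where "w e = of_bool (e = edge_at G y) - of_bool (e = edge_at G z)" for e
  have "sum w {e\<in>edges G. P e} = of_bool (P (edge_at G y)) - of_bool (P (edge_at G z))" for P
  proof -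
   have *: "(\<Sum>e\<in>{e\<in>edges G. P e}. of_bool (e = x)) = (of_bool (P x) :: int)" if "x \<in> edges G" for x
   proof -
    have "(\<Sum>e\<in>{e\<in>edges G. P e}. of_bool (e = x)) = (\<Sum>e\<in>{e\<in>edges G. P e}. if e = x then 1 else (0 :: int))"
     by (intro sum.cong) auto
    thus ?thesis using finite_edges that by simp
   qed
   show ?thesis unfolding w_def sum_subtractf using * ed by simp
  qed
  note ws = this
  show ?thesis
  proof (intro exI[of _ w] conjI allI impI)
   fix i show "sum w {e\<in>edges G. pos_label G e = i} = 0" unfolding ws using pl by simp
  next
   fix t show "sum w {e\<in>edges G. neg_label G e = t} =
    of_bool (t = neg_label G (edge_at G y)) - of_bool (t = neg_label G (edge_at G z))"
    unfolding ws by (simp add: eq_commute[of t])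
  qed
 qed
 then obtain w :: "'h set => int" where w: "\<forall>i<np. sum w {e\<in>edges G. pos_label G e = i} = 0"
   "\<forall>t<nm. sum w {e\<in>edges G. neg_label G e = t} =
    of_bool (t = neg_label G (edge_at G y)) - of_bool (t = neg_label G (edge_at G z))" by blast
 thus ?case using v z by (intro conjI exI[of _ "\<lambda>e. v e + w e"]) (auto simp: sum.distrib)
qed

lemma neg_surj: assumes "j < nm" shows "\<exists>h\<in>pos_half G. neg_label G (edge_at G h) = j"
proof -
 have "Inr j \<in> bdry G ` H" using bdry_image assms by auto
 then obtain h where h: "h \<in> H" "bdry G h = Inr j" by force
 hence "einv G h \<in> pos_half G" using isl_einv einv_in by (auto simp: pos_half_def)
 thus ?thesis using edge_labels(2)[of "einv G h"] h einv_einv by (intro bexI[of _ "einv G h"]) auto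
qed

lemma pos_surj: assumes "i < np" shows "\<exists>h\<in>pos_half G. pos_label G (edge_at G h) = i"
proof -
 have "Inl i \<in> bdry G ` H" using bdry_image assms by auto
 then obtain h where h: "h \<in> H" "bdry G h = Inl i" by force
 hence "h \<in> pos_half G" by (auto simp: pos_half_def)
 thus ?thesis using edge_labels(1)[of h] h by (intro bexI[of _ h]) auto
qed

lemma nm_pos: "0 < nm"
proof -
 obtain h where "h \<in> H" using H0 by blast
 hence "h \<in> pos_half G \<or> einv G h \<in> pos_half G" using isl_einv einv_in by (auto simp: pos_half_def)
 thus ?thesis using edge_labels(4) by fastforce
qed

text \<open>The integer vector asked for by \<open>lift\<close> comes from a path in the graph
  between an edge on negative boundary j and one on negative boundary 0.\<close>

lemma incidence: "incidence (edges G) (pos_label G) (neg_label G) np nm"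
proof
 show "finite (edges G)" by (rule finite_edges)
 show "pos_label G \<in> edges G \<rightarrow> {..<np}" "neg_label G \<in> edges G \<rightarrow> {..<nm}"
  by (auto simp: edges_pos edge_labels)
 show "{..<np} \<subseteq> pos_label G ` edges G"
  using pos_surj by (force simp: edges_pos)
 show "0 < nm" by (rule nm_pos)
 fix j assume j: "j < nm"
 obtain h h' where h: "h \<in> pos_half G" "neg_label G (edge_at G h) = j" "h' \<in> pos_half G" "neg_label G (edge_at G h') = 0"
  using neg_surj[OF j] neg_surj[OF nm_pos] by blast
 hence "(h, h') \<in> {(x, y). x \<in> H \<and> (y = vperm G x \<or> y = einv G x)}\<^sup>*" "h \<in> H"
  using conn by (auto simp: rg_connected_def pos_half_def)
 from lift_path[OF this, THEN conjunct2] show "\<exists>v :: 'h set => int. (\<forall>i<np. sum v {e\<in>edges G. pos_label G e = i} = 0) \<and>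
   (\<forall>t<nm. sum v {e\<in>edges G. neg_label G e = t} = of_bool (t = j) - of_bool (t = 0))"
  unfolding h(2) h(4) .
qed

sublocale I: incidence "edges G" "pos_label G" "neg_label G" np nm by (rule incidence)

lemma cell_volume_eq: "cell_volume np nm G L M = I.cell_vol L M"
 unfolding cell_volume_def I.cell_vol_def length_fiber_def I.fib_def bdry_length_pos bdry_length_neg ..

lemma card_H_verts: "card H = 4 * card (verts G)"
proof -
 have "card H = (\<Sum>A\<in>verts G. card (A \<inter> H))"
  unfolding verts_def by (rule card_by_orbits[OF finH vperm subset_refl])
 also have "... = (\<Sum>A\<in>verts G. 4)"
 proof (rule sum.cong[OF refl])
  fix A assume A: "A \<in> verts G"
  hence "A \<subseteq> H" using permutes_orbit_sub[OF vperm] by (auto simp: verts_def)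
  thus "card (A \<inter> H) = 4" using four A by (simp add: four_valent_def Int_absorb2)
 qed
 finally show ?thesis by simp
qed

lemma card_pos: "card H = 2 * card (pos_half G)"
proof -
 have "H = pos_half G \<union> einv G ` pos_half G"
 proof -
  have "h \<in> einv G ` pos_half G" if "h \<in> H" "\<not> isl (bdry G h)" for h
   using that isl_einv einv_in einv_einv by (intro image_eqI[of _ _ "einv G h"]) (auto simp: pos_half_def)
  thus ?thesis using einv_in by (auto simp: pos_half_def)
 qed
 moreover have "pos_half G \<inter> einv G ` pos_half G = {}" using isl_einv by (auto simp: pos_half_def)
 moreover have "card (einv G ` pos_half G) = card (pos_half G)"
  using permutes_inj[OF einv] by (simp add: card_image inj_on_def)
 moreover have "finite (pos_half G)" using finH by (simp add: pos_half_def)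
 ultimately show ?thesis by (metis card_Un_disjoint finite_imageI mult_2)
qed

lemma card_edges: "card (edges G) = card (pos_half G)"
 using bij_betw_same_card[OF edge_bij] by simp

end

text \<open>Four half-edges per vertex and two per edge give twice as many edges as vertices, so
  Euler's formula fixes the number of vertices to be 2g - 2 + np + nm.\<close>

lemma directed_graphs_iff: "G \<in> directed_graphs g np nm \<longleftrightarrow>
 directed_graph np nm G \<and> half_edges G = {..<4 * (2 * g + np + nm - 2)} \<and> 2 * g + np + nm > 2"
proof
 assume G: "G \<in> directed_graphs g np nm"
 then interpret directed_graph np nm G by (simp add: directed_graphs_def directed_graph_def)
 have "int (card (verts G)) - int (card (edges G)) + int (np + nm) = 2 - 2 * int g"
  using G by (simp add: directed_graphs_def)
 moreover have "card (edges G) = 2 * card (verts G)" using card_H_verts card_pos card_edges by simp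
 moreover have "card H > 0" using finH H0 by (simp add: card_gt_0_iff)
 ultimately have *: "card (verts G) = 2 * g + np + nm - 2" "2 * g + np + nm > 2" using card_H_verts by linarith+
 obtain N where "H = {..<N}" using G by (auto simp: directed_graphs_def)
 thus "directed_graph np nm G \<and> half_edges G = {..<4 * (2 * g + np + nm - 2)} \<and> 2 * g + np + nm > 2"
  using * card_H_verts directed_graph_axioms by simp
next
 assume G: "directed_graph np nm G \<and> half_edges G = {..<4 * (2 * g + np + nm - 2)} \<and> 2 * g + np + nm > 2"
 then interpret directed_graph np nm G by simp
 have "card (verts G) = 2 * g + np + nm - 2" using card_H_verts G by simp
 moreover have "card (edges G) = 2 * card (verts G)" using card_H_verts card_pos card_edges by simp
 ultimately show "G \<in> directed_graphs g np nm"
  using G rg conn lab dir four by (auto simp: directed_graphs_def)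
qed

lemma finite_directed_graphs: "finite (directed_graphs g np nm)"
proof -
 define N where "N = 4 * (2 * g + np + nm - 2)"
 let ?S = "{f. f permutes {..<N}} \<times> {f. f permutes {..<N}} \<times> ({..<N} \<rightarrow>\<^sub>E ({..<np} <+> {..<nm}))"
 have "directed_graphs g np nm \<subseteq> (\<lambda>(v, e, b). \<lparr>half_edges = {..<N}, vperm = v, einv = e, bdry = b\<rparr>) ` ?S"
 proof
  fix G assume G: "G \<in> directed_graphs g np nm"
  then interpret directed_graph np nm G by (simp add: directed_graphs_iff)
  have H: "H = {..<N}" using G by (simp add: directed_graphs_iff N_def)
  have "bdry G \<in> {..<N} \<rightarrow>\<^sub>E ({..<np} <+> {..<nm})"
   using lab bdry_image H by (auto simp: boundary_labelled_def PiE_def)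
  hence "(vperm G, einv G, bdry G) \<in> ?S" using vperm einv H by simp
  moreover have "G = \<lparr>half_edges = {..<N}, vperm = vperm G, einv = einv G, bdry = bdry G\<rparr>" using H by simp
  ultimately show "G \<in> (\<lambda>(v, e, b). \<lparr>half_edges = {..<N}, vperm = v, einv = e, bdry = b\<rparr>) ` ?S"
   by (intro image_eqI[of _ _ "(vperm G, einv G, bdry G)"]) auto
 qed
 moreover have "finite ?S"
  by (intro finite_cartesian_product finite_permutations finite_PiE) auto
 ultimately show ?thesis by (rule finite_surj[rotated])
qed

section \<open>The matrix of the operators\<close>

lemma dpow_sum_zero:
 assumes K: "finite K" and z: "\<And>t. 0 < t ==> (\<Sum>k\<in>K. y k * dpow k t) = 0" and k: "k \<in> K"
 shows "y k = 0"
proof -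
 define q where "q = (\<Sum>k\<in>K. monom (y k / fact k) k)"
 have "poly q t = 0" if "0 < t" for t
  using z[OF that] by (simp add: q_def poly_sum poly_monom dpow_def)
 hence "{0<..} \<subseteq> {t. poly q t = 0}" by auto
 hence "infinite {t. poly q t = 0}" using infinite_Ioi infinite_super by blast
 hence "q = 0" using poly_roots_finite by blast
 hence "coeff q k = 0" by simp
 moreover have "coeff q k = (\<Sum>i\<in>K. if i = k then y i / fact i else 0)"
  unfolding q_def coeff_sum by (intro sum.cong) auto
 ultimately show ?thesis using K k by simp
qed

lemma e_monom_snoc: "length b = n ==> e_monom (b @ [k]) L = e_monom b L * dpow k (L n)"
 by (simp add: e_monom_dpow nth_append)

text \<open>Linear independence on the open positive orthant: with all variables but the last
  frozen, a one-variable polynomial vanishes on the positive half-line. This is the uniqueness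
  behind \<open>e_coeffs\<close>.\<close>

lemma e_monom_sum_zero:
 assumes "finite B" "\<And>b. b \<in> B ==> length b = n"
  "\<And>L. (\<And>i. i < n ==> 0 < L i) ==> (\<Sum>b\<in>B. x b * e_monom b L) = 0" "b \<in> B"
 shows "x b = 0"
 using assms
proof (induction n arbitrary: B x b)
 case 0
 hence "B = {[]}" by auto
 thus ?case using 0(3)[of "\<lambda>_. 1"] 0(4) by (simp add: e_monom_def)
next
 case (Suc n)
 define k where "k = last b"
 have last: "b = butlast b @ [last b]" "length (butlast b) = n" if "b \<in> B" for b
 proof -
  have "length b = Suc n" using Suc.prems(2)[OF that] .
  thus "b = butlast b @ [last b]" "length (butlast b) = n" by (cases b rule: rev_cases; simp)+
 qed
 define K where "K = last ` B"
 define D where "D k = {b. length b = n \<and> b @ [k] \<in> B}" for k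
 have finD: "finite (D k)" for k
  by (rule finite_subset[of _ "butlast ` B"]) (use Suc.prems(1) in \<open>force simp: D_def\<close>)+
 have Bdec: "(\<Sum>b\<in>B. g b) = (\<Sum>k\<in>K. \<Sum>b\<in>D k. g (b @ [k]))" for g :: "nat list => real"
 proof -
  have "(\<Sum>k\<in>K. \<Sum>b\<in>D k. g (b @ [k])) = (\<Sum>(k, b)\<in>Sigma K D. g (b @ [k]))"
   using Suc.prems(1) finD by (subst sum.Sigma) (auto simp: K_def)
  also have "... = (\<Sum>b\<in>B. g b)"
   by (rule sum.reindex_bij_witness[of _ "\<lambda>b. (last b, butlast b)" "\<lambda>(k, b). b @ [k]"])
    (use last in \<open>auto simp: D_def K_def\<close>)
  finally show ?thesis ..
 qed
 have "x (b' @ [k]) = 0" if b': "b' \<in> D k" for b'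
 proof (rule Suc.IH[where B = "D k" and x = "\<lambda>b'. x (b' @ [k])"])
  fix L :: "nat => real" assume L: "\<And>i. i < n ==> 0 < L i"
  show "(\<Sum>b\<in>D k. x (b @ [k]) * e_monom b L) = 0"
  proof (rule dpow_sum_zero[where K = K and y = "\<lambda>k. \<Sum>b\<in>D k. x (b @ [k]) * e_monom b L"])
   show "finite K" using Suc.prems(1) by (simp add: K_def)
   show "k \<in> K" using Suc.prems(4) by (simp add: K_def k_def)
   fix t :: real assume t: "0 < t"
   have "0 = (\<Sum>k\<in>K. \<Sum>b\<in>D k. x (b @ [k]) * e_monom (b @ [k]) (L(n := t)))"
   proof -
    have "(\<Sum>b\<in>B. x b * e_monom b (L(n := t))) = 0"
     by (rule Suc.prems(3)) (use L t in \<open>auto simp: less_Suc_eq\<close>)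
    thus ?thesis unfolding Bdec by simp
   qed
   also have "... = (\<Sum>k\<in>K. (\<Sum>b\<in>D k. x (b @ [k]) * e_monom b L) * dpow k t)"
   proof (intro sum.cong refl)
    fix k
    have "e_monom (b @ [k]) (L(n := t)) = e_monom b L * dpow k t" if "b \<in> D k" for b
    proof -
     have "length b = n" using that by (simp add: D_def)
     hence "e_monom b (L(n := t)) = e_monom b L" by (simp add: e_monom_def)
     thus ?thesis using \<open>length b = n\<close> by (simp add: e_monom_snoc)
    qed
    thus "(\<Sum>b\<in>D k. x (b @ [k]) * e_monom (b @ [k]) (L(n := t))) =
     (\<Sum>b\<in>D k. x (b @ [k]) * e_monom b L) * dpow k t"
     by (simp add: sum_distrib_right mult.assoc)
   qed
   finally show "(\<Sum>k\<in>K. (\<Sum>b\<in>D k. x (b @ [k]) * e_monom b L) * dpow k t) = 0" ..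
  qed
 qed (use finD that in \<open>auto simp: D_def\<close>)
 moreover have "butlast b \<in> D k" using last[OF Suc.prems(4)] Suc.prems(4) by (simp add: D_def k_def)
 ultimately show ?case using last[OF Suc.prems(4)] by (metis k_def)
qed

lemma e_coeffs_eqI:
 assumes fin: "finite {b. c b \<noteq> 0}" and len: "\<And>b. c b \<noteq> 0 ==> length b = n"
  and f: "\<And>L. (\<And>i. i < n ==> 0 < L i) ==> f L = (\<Sum>b | c b \<noteq> 0. of_rat (c b) * e_monom b L)"
 shows "e_coeffs n f = c"
 unfolding e_coeffs_def
proof (rule the_equality)
 show "finite {b. c b \<noteq> 0} \<and> (\<forall>b. c b \<noteq> 0 --> length b = n) \<and>
  (\<forall>L. (\<forall>i<n. 0 < L i) --> f L = (\<Sum>b | c b \<noteq> 0. of_rat (c b) * e_monom b L))"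
  using assms by blast
 fix c' assume c': "finite {b. c' b \<noteq> 0} \<and> (\<forall>b. c' b \<noteq> 0 --> length b = n) \<and>
  (\<forall>L. (\<forall>i<n. 0 < L i) --> f L = (\<Sum>b | c' b \<noteq> 0. of_rat (c' b) * e_monom b L))"
 define B where "B = {b. c b \<noteq> 0} \<union> {b. c' b \<noteq> 0}"
 have B: "finite B" using fin c' by (simp add: B_def)
 have "(\<Sum>b\<in>B. (of_rat (c' b) - of_rat (c b)) * e_monom b L) = (0 :: real)" if L: "\<And>i. i < n ==> 0 < L i" for L
 proof -
  have "(\<Sum>b | c b \<noteq> 0. of_rat (c b) * e_monom b L) = (\<Sum>b\<in>B. of_rat (c b) * e_monom b L)"
   using B by (intro sum.mono_neutral_left) (auto simp: B_def)
  moreover have "(\<Sum>b | c' b \<noteq> 0. of_rat (c' b) * e_monom b L) = (\<Sum>b\<in>B. of_rat (c' b) * e_monom b L)"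
   using B by (intro sum.mono_neutral_left) (auto simp: B_def)
  moreover have "f L = (\<Sum>b | c' b \<noteq> 0. of_rat (c' b) * e_monom b L)" using c' L by blast
  ultimately show ?thesis using f[OF L] by (simp add: left_diff_distrib sum_subtractf)
 qed
 hence eq0: "of_rat (c' b) - of_rat (c b) = (0 :: real)" if "b \<in> B" for b
  using e_monom_sum_zero[OF B, of n "\<lambda>b. of_rat (c' b) - of_rat (c b)" b] that len c' by (auto simp: B_def)
 show "c' = c"
 proof
  fix b show "c' b = c b" using eq0[of b] by (cases "b \<in> B") (auto simp: B_def)
 qed
qed

lemma e_monom_map: "e_monom (map f [0..<n]) L = (\<Prod>i<n. dpow (f i) (L i))"
 by (simp add: e_monom_dpow)

definition rep :: "'a set => 'a" where "rep C = (SOME G. G \<in> C)"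

lemma equiv_iso_rel: "equiv (directed_graphs g np nm) (iso_rel g np nm)"
proof (rule equivI)
 show "iso_rel g np nm \<subseteq> directed_graphs g np nm \<times> directed_graphs g np nm" by (auto simp: iso_rel_def)
 show "refl_on (directed_graphs g np nm) (iso_rel g np nm)"
 proof (rule refl_onI)
  fix G assume "G \<in> directed_graphs g np nm"
  moreover have "is_rg_iso G G id" by (simp add: is_rg_iso_def)
  ultimately show "(G, G) \<in> iso_rel g np nm" unfolding iso_rel_def by blast
 qed
 show "sym (iso_rel g np nm)"
 proof (rule symI)
  fix G G' assume "(G, G') \<in> iso_rel g np nm"
  then obtain f where G: "G \<in> directed_graphs g np nm" "G' \<in> directed_graphs g np nm" and f: "is_rg_iso G G' f"
   by (auto simp: iso_rel_def)
  interpret G: directed_graph np nm G using G by (simp add: directed_graphs_iff)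
  let ?g = "inv_into (half_edges G) f"
  have b: "bij_betw f (half_edges G) (half_edges G')" using f by (simp add: is_rg_iso_def)
  have fg: "?g h \<in> half_edges G" "f (?g h) = h" if "h \<in> half_edges G'" for h
   using b that by (auto simp: bij_betw_def inv_into_into f_inv_into_f)
  have gf: "?g (f h) = h" if "h \<in> half_edges G" for h using b that by (simp add: bij_betw_def)
  have "is_rg_iso G' G ?g"
   unfolding is_rg_iso_def
  proof (intro conjI ballI)
   show "bij_betw ?g (half_edges G') (half_edges G)" using b by (rule bij_betw_inv_into)
   fix h assume h: "h \<in> half_edges G'"
   have f': "f (vperm G (?g h)) = vperm G' h" "f (einv G (?g h)) = einv G' h" "bdry G' h = bdry G (?g h)"
    using f fg[OF h] by (auto simp: is_rg_iso_def)
   show "?g (vperm G' h) = vperm G (?g h)" "?g (einv G' h) = einv G (?g h)" "bdry G (?g h) = bdry G' h"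
    using f' gf G.vperm_in G.einv_in fg[OF h] by metis+
  qed
  thus "(G', G) \<in> iso_rel g np nm" using G unfolding iso_rel_def by blast
 qed
 show "trans (iso_rel g np nm)"
 proof (rule transI)
  fix G G' G'' assume "(G, G') \<in> iso_rel g np nm" "(G', G'') \<in> iso_rel g np nm"
  then obtain f f' where G: "G \<in> directed_graphs g np nm" "G'' \<in> directed_graphs g np nm"
   and f: "is_rg_iso G G' f" "is_rg_iso G' G'' f'" by (auto simp: iso_rel_def)
  have "is_rg_iso G G'' (f' \<circ> f)"
   using f bij_betw_trans[of f _ _ f'] bij_betwE[of f] by (auto simp: is_rg_iso_def)
  thus "(G, G'') \<in> iso_rel g np nm" using G unfolding iso_rel_def by blast
 qed
qed

lemma rep_in:
 assumes "C \<in> directed_graphs g np nm // iso_rel g np nm"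
 shows "rep C \<in> C" "rep C \<in> directed_graphs g np nm"
proof -
 have "C \<noteq> {}" using in_quotient_imp_non_empty[OF equiv_iso_rel assms] .
 thus "rep C \<in> C" unfolding rep_def by (auto intro: someI)
 thus "rep C \<in> directed_graphs g np nm" using in_quotient_imp_subset[OF equiv_iso_rel assms] by blast
qed

definition neg_sums :: "nat => 'h ribbon_graph => ('h set => nat) => nat list" where
 "neg_sums nm G c = map (\<lambda>j. sum c {e\<in>edges G. neg_label G e = j}) [0..<nm]"

text \<open>Each edge adds its exponent plus 1, the 1 being its integration in Dirichlet's formula;
  for the one edge per boundary that is solved for, the 1 comes from the factor \<open>L i\<close>
  of the kernel.\<close>

definition pos_sums :: "nat => 'h ribbon_graph => ('h set => nat) => nat list" where
 "pos_sums np G c = map (\<lambda>i. \<Sum>e\<in>{e\<in>edges G. pos_label G e = i}. c e + 1) [0..<np]"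

definition edge_coeffs :: "'h ribbon_graph => ('h set => nat) set" where
 "edge_coeffs G = edges G \<rightarrow>\<^sub>E UNIV"

lemma (in directed_graph) cell_coeffs_eq:
 "length a = nm ==> I.cell_coeffs a = {c \<in> edge_coeffs G. neg_sums nm G c = a}"
 unfolding distributions_def edge_coeffs_def neg_sums_def by (auto simp: list_eq_iff_nth_eq)

lemma (in directed_graph) finite_coeffs:
 "finite {c \<in> edge_coeffs G. neg_sums nm G c = a}" "finite {c \<in> edge_coeffs G. pos_sums np G c = b}"
proof -
 show "finite {c \<in> edge_coeffs G. neg_sums nm G c = a}"
 proof (cases "length a = nm")
  case True
  thus ?thesis using finite_distributions[OF I.E I.m] by (simp flip: cell_coeffs_eq)
 next
  case False
  hence "{c \<in> edge_coeffs G. neg_sums nm G c = a} = {}" by (auto simp: neg_sums_def)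
  thus ?thesis by (simp only: finite.emptyI)
 qed
 have "{c \<in> edge_coeffs G. pos_sums np G c = b} \<subseteq> edges G \<rightarrow>\<^sub>E {..sum_list b}"
 proof
  fix c assume "c \<in> {c \<in> edge_coeffs G. pos_sums np G c = b}"
  hence c: "c \<in> edges G \<rightarrow>\<^sub>E UNIV" "pos_sums np G c = b" by (auto simp: edge_coeffs_def)
  have "c e \<le> sum_list b" if e: "e \<in> edges G" for e
  proof -
   have i: "pos_label G e < np" using I.p e by auto
   have "c e \<le> (\<Sum>e\<in>{e'\<in>edges G. pos_label G e' = pos_label G e}. c e)"
    using e finite_edges by (intro member_le_sum) auto
   also have "... \<le> (\<Sum>e\<in>{e'\<in>edges G. pos_label G e' = pos_label G e}. c e + 1)" by (intro sum_mono) auto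
   also have "... = pos_sums np G c ! pos_label G e" using i by (simp add: pos_sums_def)
   also have "... \<le> sum_list b"
    unfolding c(2) using i c(2) by (intro elem_le_sum_list) (auto simp: pos_sums_def)
   finally show ?thesis .
  qed
  thus "c \<in> edges G \<rightarrow>\<^sub>E {..sum_list b}" using c(1) by (auto simp: PiE_iff)
 qed
 thus "finite {c \<in> edge_coeffs G. pos_sums np G c = b}"
  by (rule finite_subset) (use finite_edges in \<open>auto intro!: finite_PiE\<close>)
qed

lemma (in directed_graph) graph_integral:
 assumes L: "\<And>i. i < np ==> 0 < L i" and a: "length a = nm"
 defines "s \<equiv> \<Sum>i<np. L i"
 defines "\<mu> \<equiv> affine_measure {..<nm} (sum_plane nm s)" and "X \<equiv> {x \<in> sum_plane nm s. \<forall>j<nm. 0 \<le> x j}"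
 shows "set_integrable \<mu> X (\<lambda>M. cell_volume np nm G L M * e_monom a M)"
  and "(\<Prod>i<np. L i) * set_lebesgue_integral \<mu> X (\<lambda>M. cell_volume np nm G L M * e_monom a M) =
   (\<Sum>c\<in>{c \<in> edge_coeffs G. neg_sums nm G c = a}. real (prod_list (pos_sums np G c)) * e_monom (pos_sums np G c) L)"
proof -
 show "set_integrable \<mu> X (\<lambda>M. cell_volume np nm G L M * e_monom a M)"
  unfolding \<mu>_def X_def s_def cell_volume_eq by (rule I.fiber_integral(1)[where L = L, OF L a])
 have fi: "set_lebesgue_integral \<mu> X (\<lambda>M. cell_volume np nm G L M * e_monom a M) =
   (\<Sum>c\<in>I.cell_coeffs a. \<Prod>i<np. dpow (I.exponent c i - 1) (L i))"
  unfolding \<mu>_def X_def s_def cell_volume_eq by (rule I.fiber_integral(2)[where L = L, OF L a])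
 have "(\<Prod>i<np. L i) * (\<Prod>i<np. dpow (I.exponent c i - 1) (L i)) =
   real (prod_list (pos_sums np G c)) * e_monom (pos_sums np G c) L" for c
 proof -
  \<comment> \<open>Multiplying a divided power by the length raises its degree and produces the
    degree as a factor; this is the origin of \<open>prod_list b\<close>.\<close>
  have "L i * dpow (I.exponent c i - 1) (L i) = real (I.exponent c i) * dpow (I.exponent c i) (L i)" if i: "i < np" for i
  proof -
   obtain h where "h \<in> pos_half G" "pos_label G (edge_at G h) = i" using pos_surj[OF i] by blast
   hence "{e\<in>edges G. pos_label G e = i} \<noteq> {}" by (auto simp: edges_pos)
   hence "0 < I.exponent c i" unfolding I.exponent_def using finite_edges by (intro sum_pos) auto
   then obtain n where "I.exponent c i = Suc n" using gr0_implies_Suc by blast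
   thus ?thesis by (simp add: dpow_def del: of_nat_Suc)
  qed
  hence "(\<Prod>i<np. L i * dpow (I.exponent c i - 1) (L i)) = (\<Prod>i<np. real (I.exponent c i) * dpow (I.exponent c i) (L i))"
   by (intro prod.cong) auto
  moreover have "pos_sums np G c = map (I.exponent c) [0..<np]"
   by (simp add: pos_sums_def I.exponent_def)
  moreover have "prod_list (map f [0..<n]) = (\<Prod>i<n. f i)" for f :: "nat => nat" and n
   by (induction n) (auto simp: mult.commute)
  ultimately show ?thesis by (simp add: prod.distrib e_monom_map)
 qed
 thus "(\<Prod>i<np. L i) * set_lebesgue_integral \<mu> X (\<lambda>M. cell_volume np nm G L M * e_monom a M) =
   (\<Sum>c\<in>{c \<in> edge_coeffs G. neg_sums nm G c = a}. real (prod_list (pos_sums np G c)) * e_monom (pos_sums np G c) L)"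
  unfolding fi by (simp add: sum_distrib_left flip: cell_coeffs_eq[OF a])
qed

lemma K_integral_eq:
 assumes L: "\<And>i. i < np ==> 0 < L i" and a: "length a = nm"
 shows "K_integral g np nm (e_monom a) L =
  (\<Sum>C\<in>directed_graphs g np nm // iso_rel g np nm. \<Sum>c\<in>{c \<in> edge_coeffs (rep C). neg_sums nm (rep C) c = a}.
    real (prod_list (pos_sums np (rep C) c)) / (fact nm * real (card (rg_aut (rep C)))) * e_monom (pos_sums np (rep C) c) L)"
proof -
 let ?Q = "directed_graphs g np nm // iso_rel g np nm"
 define s where "s = (\<Sum>i<np. L i)"
 define \<mu> where "\<mu> = affine_measure {..<nm} (sum_plane nm s)"
 define X where "X = {x \<in> sum_plane nm s. \<forall>j<nm. 0 \<le> x j}"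
 define A where "A C = real (card (rg_aut (rep C)))" for C :: "nat ribbon_graph set"
 have dg: "directed_graph np nm (rep C)" if "C \<in> ?Q" for C
  using rep_in(2)[OF that] by (simp add: directed_graphs_iff)
 have gi: "set_integrable \<mu> X (\<lambda>M. cell_volume np nm (rep C) L M * e_monom a M)"
  "(\<Prod>i<np. L i) * set_lebesgue_integral \<mu> X (\<lambda>M. cell_volume np nm (rep C) L M * e_monom a M) =
   (\<Sum>c\<in>{c \<in> edge_coeffs (rep C). neg_sums nm (rep C) c = a}.
    real (prod_list (pos_sums np (rep C) c)) * e_monom (pos_sums np (rep C) c) L)" if "C \<in> ?Q" for C
  unfolding \<mu>_def X_def s_def
  by (rule directed_graph.graph_integral[where L = L, OF dg[OF that] L a]; assumption)+
 have int: "set_integrable \<mu> X (\<lambda>M. (\<Prod>i<np. L i) / A C * (cell_volume np nm (rep C) L M * e_monom a M))" if "C \<in> ?Q" for C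
  using gi(1)[OF that] by (intro set_integrable_mult_right) auto
 have "K_integral g np nm (e_monom a) L =
   1 / fact nm * set_lebesgue_integral \<mu> X (\<lambda>M. \<Sum>C\<in>?Q. (\<Prod>i<np. L i) / A C * (cell_volume np nm (rep C) L M * e_monom a M))"
  unfolding K_integral_def simplex_integral_def volume_def Let_def s_def[symmetric] \<mu>_def[symmetric] X_def[symmetric]
   rep_def[symmetric] A_def by (simp add: sum_distrib_left sum_distrib_right mult.assoc)
 also have "set_lebesgue_integral \<mu> X (\<lambda>M. \<Sum>C\<in>?Q. (\<Prod>i<np. L i) / A C * (cell_volume np nm (rep C) L M * e_monom a M)) =
   (\<Sum>C\<in>?Q. set_lebesgue_integral \<mu> X (\<lambda>M. (\<Prod>i<np. L i) / A C * (cell_volume np nm (rep C) L M * e_monom a M)))"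
  unfolding set_lebesgue_integral_def scaleR_sum_right
  using int by (intro Bochner_Integration.integral_sum) (auto simp: set_integrable_def)
 also have "... = (\<Sum>C\<in>?Q. (\<Sum>c\<in>{c \<in> edge_coeffs (rep C). neg_sums nm (rep C) c = a}.
    real (prod_list (pos_sums np (rep C) c)) * e_monom (pos_sums np (rep C) c) L) / A C)"
 proof (rule sum.cong[OF refl])
  fix C assume C: "C \<in> ?Q"
  have "set_lebesgue_integral \<mu> X (\<lambda>M. (\<Prod>i<np. L i) / A C * (cell_volume np nm (rep C) L M * e_monom a M)) =
   (\<Prod>i<np. L i) / A C * set_lebesgue_integral \<mu> X (\<lambda>M. cell_volume np nm (rep C) L M * e_monom a M)"
   by (rule set_integral_mult_right)
  also have "... = (\<Prod>i<np. L i) * set_lebesgue_integral \<mu> X (\<lambda>M. cell_volume np nm (rep C) L M * e_monom a M) / A C" by simp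
  finally show "set_lebesgue_integral \<mu> X (\<lambda>M. (\<Prod>i<np. L i) / A C * (cell_volume np nm (rep C) L M * e_monom a M)) =
   (\<Sum>c\<in>{c \<in> edge_coeffs (rep C). neg_sums nm (rep C) c = a}.
    real (prod_list (pos_sums np (rep C) c)) * e_monom (pos_sums np (rep C) c) L) / A C"
   unfolding gi(2)[OF C] .
 qed
 finally show ?thesis unfolding A_def
  by (simp add: sum_distrib_left sum_divide_distrib mult.commute divide_simps)
qed

lemma finite_classes: "finite (directed_graphs g np nm // iso_rel g np nm)"
 by (rule finite_quotient[OF finite_directed_graphs]) (auto simp: iso_rel_def)

text \<open>The definition of \<open>K_op\<close> sums over inputs a. Regrouped by integral metrics,
  only those with positive sums b remain, and these are finitely many.\<close>

lemma K_op_classes: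
 assumes "(g, np, nm) \<noteq> (0, 1, 1)"
 shows "K_op g np nm F b = (if length b = np then
  (\<Sum>C\<in>directed_graphs g np nm // iso_rel g np nm. \<Sum>c\<in>{c \<in> edge_coeffs (rep C). pos_sums np (rep C) c = b}.
    of_nat (prod_list b) / (fact nm * of_nat (card (rg_aut (rep C)))) * F (neg_sums nm (rep C) c)) else 0)"
proof -
 let ?Q = "directed_graphs g np nm // iso_rel g np nm"
 define w where "w C = (1 / (fact nm * of_nat (card (rg_aut (rep C)))) :: rat)" for C :: "nat ribbon_graph set"
 define N where "N C a = {c \<in> edge_coeffs (rep C). neg_sums nm (rep C) c = a}" for C :: "nat ribbon_graph set" and a
 define P where "P C b = {c \<in> edge_coeffs (rep C). pos_sums np (rep C) c = b}" for C :: "nat ribbon_graph set" and b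
 have fin: "finite (N C a)" "finite (P C b)" if "C \<in> ?Q" for C a b
  using directed_graph.finite_coeffs rep_in(2)[OF that] unfolding N_def P_def directed_graphs_iff by blast+
 \<comment> \<open>The matrix entry at (a, b), written as a sum over metrics with negative sums a
   and filtered by b; later the same sum is read the other way round.\<close>
 define \<kappa> where "\<kappa> a b = (\<Sum>C\<in>?Q. \<Sum>c\<in>N C a. if pos_sums np (rep C) c = b then of_nat (prod_list b) * w C else 0)" for a b
 have coeffs: "e_coeffs np (K_integral g np nm (e_monom a)) = \<kappa> a" if a: "length a = nm" for a
 proof (rule e_coeffs_eqI)
  define B where "B = (\<Union>C\<in>?Q. pos_sums np (rep C) ` N C a)"
  have B: "finite B" unfolding B_def using finite_classes fin by blast
  have nz: "b \<in> B" if "\<kappa> a b \<noteq> 0" for b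
  proof (rule ccontr)
   assume "b \<notin> B"
   hence "\<kappa> a b = 0" unfolding \<kappa>_def B_def by (intro sum.neutral ballI) auto
   thus False using that by simp
  qed
  hence sub: "{b. \<kappa> a b \<noteq> 0} \<subseteq> B" by blast
  thus "finite {b. \<kappa> a b \<noteq> 0}" using B finite_subset by blast
  show "length b = np" if "\<kappa> a b \<noteq> 0" for b using nz[OF that] by (auto simp: B_def pos_sums_def)
  fix L :: "nat => real" assume L: "\<And>i. i < np ==> 0 < L i"
  have "(\<Sum>b | \<kappa> a b \<noteq> 0. of_rat (\<kappa> a b) * e_monom b L) = (\<Sum>b\<in>B. of_rat (\<kappa> a b) * e_monom b L)"
   using B sub by (intro sum.mono_neutral_left) auto
  also have "... = (\<Sum>b\<in>B. \<Sum>C\<in>?Q. \<Sum>c\<in>N C a. if pos_sums np (rep C) c = b then real (prod_list b) * of_rat (w C) * e_monom b L else 0)"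
   unfolding \<kappa>_def of_rat_sum sum_distrib_right by (intro sum.cong refl) (auto simp: of_rat_mult)
  also have "... = (\<Sum>C\<in>?Q. \<Sum>b\<in>B. \<Sum>c\<in>N C a. if pos_sums np (rep C) c = b then real (prod_list b) * of_rat (w C) * e_monom b L else 0)"
   by (rule sum.swap)
  also have "... = (\<Sum>C\<in>?Q. \<Sum>c\<in>N C a. \<Sum>b\<in>B. if pos_sums np (rep C) c = b then real (prod_list b) * of_rat (w C) * e_monom b L else 0)"
   by (intro sum.cong refl sum.swap)
  also have "... = (\<Sum>C\<in>?Q. \<Sum>c\<in>N C a. real (prod_list (pos_sums np (rep C) c)) * of_rat (w C) * e_monom (pos_sums np (rep C) c) L)"
   using B by (intro sum.cong refl) (auto simp: B_def)
  also have "... = K_integral g np nm (e_monom a) L"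
  proof -
   have *: "K_integral g np nm (e_monom a) L =
    (\<Sum>C\<in>?Q. \<Sum>c\<in>N C a. real (prod_list (pos_sums np (rep C) c)) /
     (fact nm * real (card (rg_aut (rep C)))) * e_monom (pos_sums np (rep C) c) L)"
    unfolding N_def by (rule K_integral_eq) (use L a in auto)
   have "of_rat (w C) = 1 / (fact nm * real (card (rg_aut (rep C))))" for C
   proof -
    have "real_of_rat (fact nm) = fact nm" by (metis of_nat_fact of_rat_of_nat_eq)
    thus ?thesis by (simp add: w_def of_rat_divide of_rat_mult)
   qed
   thus ?thesis unfolding * by simp
  qed
  finally show "K_integral g np nm (e_monom a) L = (\<Sum>b | \<kappa> a b \<noteq> 0. of_rat (\<kappa> a b) * e_monom b L)" ..
 qed
 have "K_op g np nm F b = (\<Sum>a | length a = nm \<and> \<kappa> a b \<noteq> 0. \<kappa> a b * F a)"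
 proof -
  have "(length a = nm \<and> e_coeffs np (K_integral g np nm (e_monom a)) b \<noteq> 0) = (length a = nm \<and> \<kappa> a b \<noteq> 0)" for a
   using coeffs by (cases "length a = nm") auto
  thus ?thesis unfolding K_op_def if_not_P[OF assms] by (intro sum.cong) (auto simp only: coeffs mem_Collect_eq)
 qed
 also have "... = (if length b = np then \<Sum>C\<in>?Q. \<Sum>c\<in>P C b. of_nat (prod_list b) * w C * F (neg_sums nm (rep C) c) else 0)"
 proof (cases "length b = np")
  case False
  hence "\<kappa> a b = 0" for a unfolding \<kappa>_def by (intro sum.neutral ballI) (auto simp: pos_sums_def)
  thus ?thesis using False by simp
 next
  case True
  define S where "S = (\<Union>C\<in>?Q. neg_sums nm (rep C) ` P C b)"
  have S: "finite S" unfolding S_def using finite_classes fin by blast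
  have \<kappa>P: "\<kappa> a b = (\<Sum>C\<in>?Q. \<Sum>c\<in>P C b. if neg_sums nm (rep C) c = a then of_nat (prod_list b) * w C else 0)" for a
   unfolding \<kappa>_def
  proof (rule sum.cong[OF refl])
   fix C assume C: "C \<in> ?Q"
   have "(\<Sum>c\<in>N C a. if pos_sums np (rep C) c = b then of_nat (prod_list b) * w C else 0) = (\<Sum>c\<in>N C a \<inter> P C b. of_nat (prod_list b) * w C)"
    using fin[OF C] by (intro sum.mono_neutral_cong_right) (auto simp: N_def P_def)
   also have "... = (\<Sum>c\<in>P C b. if neg_sums nm (rep C) c = a then of_nat (prod_list b) * w C else 0)"
    using fin[OF C] by (intro sum.mono_neutral_cong_left) (auto simp: N_def P_def)
   finally show "(\<Sum>c\<in>N C a. if pos_sums np (rep C) c = b then of_nat (prod_list b) * w C else 0) =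
    (\<Sum>c\<in>P C b. if neg_sums nm (rep C) c = a then of_nat (prod_list b) * w C else 0)" .
  qed
  have "(\<Sum>a | length a = nm \<and> \<kappa> a b \<noteq> 0. \<kappa> a b * F a) = (\<Sum>a\<in>S. \<kappa> a b * F a)"
  proof (rule sum.mono_neutral_left[OF S])
   have "\<kappa> a b = 0" if "a \<notin> S" for a
    unfolding \<kappa>P using that by (intro sum.neutral ballI) (auto simp: S_def)
   thus "{a. length a = nm \<and> \<kappa> a b \<noteq> 0} \<subseteq> S" by auto
   show "\<forall>a\<in>S - {a. length a = nm \<and> \<kappa> a b \<noteq> 0}. \<kappa> a b * F a = 0"
    by (auto simp: S_def neg_sums_def)
  qed
  also have "... = (\<Sum>a\<in>S. \<Sum>C\<in>?Q. \<Sum>c\<in>P C b. if neg_sums nm (rep C) c = a then of_nat (prod_list b) * w C * F a else 0)"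
   unfolding \<kappa>P sum_distrib_right by (intro sum.cong refl) auto
  also have "... = (\<Sum>C\<in>?Q. \<Sum>a\<in>S. \<Sum>c\<in>P C b. if neg_sums nm (rep C) c = a then of_nat (prod_list b) * w C * F a else 0)"
   by (rule sum.swap)
  also have "... = (\<Sum>C\<in>?Q. \<Sum>c\<in>P C b. \<Sum>a\<in>S. if neg_sums nm (rep C) c = a then of_nat (prod_list b) * w C * F a else 0)"
   by (intro sum.cong refl sum.swap)
  also have "... = (\<Sum>C\<in>?Q. \<Sum>c\<in>P C b. of_nat (prod_list b) * w C * F (neg_sums nm (rep C) c))"
   using S by (intro sum.cong refl) (auto simp: S_def)
  finally show ?thesis using True by simp
 qed
 finally show ?thesis by (simp add: w_def P_def)
qed

section \<open>Relabelling of ribbon graphs\<close>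

definition relabel :: "('h => 'k) => 'k set => 'h ribbon_graph => 'k ribbon_graph" where
 "relabel f K G = (let g = inv_into (half_edges G) f in
   \<lparr>half_edges = K, vperm = (\<lambda>k. if k \<in> K then f (vperm G (g k)) else k),
   einv = (\<lambda>k. if k \<in> K then f (einv G (g k)) else k), bdry = (\<lambda>k\<in>K. bdry G (g k))\<rparr>)"

text \<open>Fixes the values outside the half-edges, so that an isomorphism and the set of
  half-edges of its target determine the target as a record; see \<open>iso_relabel\<close>.\<close>

definition standard_graph :: "'h ribbon_graph => bool" where
 "standard_graph G \<longleftrightarrow> vperm G permutes half_edges G \<and> einv G permutes half_edges G \<and>
   bdry G \<in> extensional (half_edges G)"

context directed_graph
begin

lemma standard: "standard_graph G"
 using vperm einv lab by (simp add: standard_graph_def boundary_labelled_def)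

lemma iso_directed:
 assumes f: "is_rg_iso G G' f" and G': "standard_graph G'"
 shows "directed_graph np nm G'"
proof -
 let ?H' = "half_edges G'"
 have b: "bij_betw f H ?H'" and fv: "\<And>h. h \<in> H ==> f (vperm G h) = vperm G' (f h)"
  and fe: "\<And>h. h \<in> H ==> f (einv G h) = einv G' (f h)" and fb: "\<And>h. h \<in> H ==> bdry G' (f h) = bdry G h"
  using f by (auto simp: is_rg_iso_def)
 have H': "?H' = f ` H" using b by (simp add: bij_betw_def)
 have inj: "inj_on f H" using b by (simp add: bij_betw_def)
 have vp: "vperm G' permutes ?H'" and ep: "einv G' permutes ?H'" using G' by (auto simp: standard_graph_def)
 have fbp: "f (bperm G h) = bperm G' (f h)" if "h \<in> H" for h
  using that by (simp add: bperm_def fe fv einv_in)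
 have "is_ribbon_graph G'"
  unfolding is_ribbon_graph_def
 proof (intro conjI ballI)
  show "finite ?H'" "?H' \<noteq> {}" using finH H0 by (auto simp: H')
  fix h' assume "h' \<in> ?H'"
  then obtain h where h: "h \<in> H" "h' = f h" by (auto simp: H')
  show "einv G' h' \<noteq> h'"
   using h einv_neq[OF h(1)] inj einv_in[OF h(1)] by (simp flip: fe) (metis inj_onD)
  show "einv G' (einv G' h') = h'" using h einv_in[OF h(1)] einv_einv[OF h(1)] by (metis fe)
 qed (use vp ep in auto)
 moreover have "rg_connected G'"
  unfolding rg_connected_def
 proof (intro ballI)
  fix x' y' assume "x' \<in> ?H'" "y' \<in> ?H'"
  then obtain x y where xy: "x \<in> H" "x' = f x" "y \<in> H" "y' = f y" by (auto simp: H')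
  have "(x, y) \<in> {(x, y). x \<in> H \<and> (y = vperm G x \<or> y = einv G x)}\<^sup>*"
   using conn xy by (auto simp: rg_connected_def)
  hence "(f x, f y) \<in> {(x, y). x \<in> ?H' \<and> (y = vperm G' x \<or> y = einv G' x)}\<^sup>*"
  proof induction
   case (step y z)
   hence "(f y, f z) \<in> {(x, y). x \<in> ?H' \<and> (y = vperm G' x \<or> y = einv G' x)}"
    by (auto simp: H' fv fe)
   thus ?case using step.IH by (rule rtrancl_into_rtrancl[rotated])
  qed simp
  thus "(x', y') \<in> {(x, y). x \<in> ?H' \<and> (y = vperm G' x \<or> y = einv G' x)}\<^sup>*" using xy by simp
 qed
 moreover have "boundary_labelled np nm G'"
  unfolding boundary_labelled_def
 proof (intro conjI ballI)
  show "bdry G' \<in> extensional ?H'" using G' by (simp add: standard_graph_def)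
  have "bdry G' ` ?H' = bdry G ` H" unfolding H' image_image by (intro image_cong refl) (simp add: fb)
  thus "bdry G' ` ?H' = {..<np} <+> {..<nm}" by (simp add: bdry_image)
  fix x' y' assume "x' \<in> ?H'" "y' \<in> ?H'"
  then obtain x y where xy: "x \<in> H" "x' = f x" "y \<in> H" "y' = f y" by (auto simp: H')
  have "orbit (bperm G') (f x) = f ` orbit (bperm G) x"
   by (rule orbit_image_on[where S = H]) (use xy bperm_in fbp in auto)
  moreover have "f y \<in> f ` orbit (bperm G) x \<longleftrightarrow> y \<in> orbit (bperm G) x"
   using inj xy permutes_orbit_sub[OF bperm xy(1)] by (auto simp: inj_on_def)
  ultimately show "bdry G' x' = bdry G' y' \<longleftrightarrow> y' \<in> orbit (bperm G') x'"
   using xy by (simp add: fb bdry_eq_iff)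
 qed
 moreover have "directed G'"
  unfolding directed_def by (auto simp: H' fb isl_einv einv_in simp flip: fe)
 moreover have "four_valent G'"
  unfolding four_valent_def verts_def H'
 proof clarify
  fix x assume x: "x \<in> H"
  have "orbit (vperm G') (f x) = f ` orbit (vperm G) x"
   by (rule orbit_image_on[where S = H]) (use x vperm_in fv in auto)
  moreover have "card (f ` orbit (vperm G) x) = card (orbit (vperm G) x)"
   using inj permutes_orbit_sub[OF vperm x] by (intro card_image) (rule inj_on_subset)
  ultimately show "card (orbit (vperm G') (f x)) = 4" using four x by (auto simp: four_valent_def verts_def)
 qed
 ultimately show ?thesis by unfold_locales
qed

lemma relabel_iso:
 assumes b: "bij_betw f H K"
 shows "is_rg_iso G (relabel f K G) f" "standard_graph (relabel f K G)" "half_edges (relabel f K G) = K"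
proof -
 let ?g = "inv_into H f"
 have gf: "?g (f h) = h" if "h \<in> H" for h using b that by (simp add: bij_betw_def)
 have fK: "f h \<in> K" if "h \<in> H" for h using b that by (auto simp: bij_betw_def)
 have bg: "bij_betw ?g K H" using b by (rule bij_betw_inv_into)
 show "half_edges (relabel f K G) = K" by (simp add: relabel_def Let_def)
 show "is_rg_iso G (relabel f K G) f"
  using b by (auto simp: is_rg_iso_def relabel_def Let_def gf fK)
 have perm: "(\<lambda>k. if k \<in> K then f (v (?g k)) else k) permutes K" if v: "v permutes H" for v
 proof -
  have "bij_betw (f \<circ> (v \<circ> ?g)) K K"
   by (intro bij_betw_trans[OF bij_betw_trans[OF bg permutes_imp_bij[OF v]] b])
  hence "bij_betw (\<lambda>k. if k \<in> K then f (v (?g k)) else k) K K"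
   by (rule bij_betw_cong[THEN iffD1, rotated]) simp
  thus ?thesis by (rule bij_imp_permutes) simp
 qed
 show "standard_graph (relabel f K G)"
  using perm[OF vperm] perm[OF einv] by (simp add: standard_graph_def relabel_def Let_def)
qed

lemma iso_relabel:
 assumes f: "is_rg_iso G G' f" and G': "standard_graph (G' :: 'k ribbon_graph)"
 shows "G' = relabel f (half_edges G') G"
proof -
 let ?K = "half_edges G'" let ?g = "inv_into H f"
 have b: "bij_betw f H ?K" using f by (simp add: is_rg_iso_def)
 have g: "?g k \<in> H" "f (?g k) = k" if "k \<in> ?K" for k
  using b that by (auto simp: bij_betw_def inv_into_into f_inv_into_f)
 have f': "f (vperm G (?g k)) = vperm G' k" "f (einv G (?g k)) = einv G' k" "bdry G (?g k) = bdry G' k" if "k \<in> ?K" for k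
  using f g[OF that] by (auto simp: is_rg_iso_def)
 have v: "vperm G' = (\<lambda>k. if k \<in> ?K then f (vperm G (?g k)) else k)"
  using f' G' by (auto simp: fun_eq_iff standard_graph_def permutes_def)
 have e: "einv G' = (\<lambda>k. if k \<in> ?K then f (einv G (?g k)) else k)"
  using f' G' by (auto simp: fun_eq_iff standard_graph_def permutes_def)
 have d: "bdry G' = (\<lambda>k\<in>?K. bdry G (?g k))"
  using f' G' by (auto simp: fun_eq_iff standard_graph_def extensional_def)
 show ?thesis
  by (rule ribbon_graph.equality) (simp_all add: relabel_def Let_def flip: v e d)
qed

end

section \<open>Sums over isomorphism classes\<close>

lemma rg_iso_comp:
 assumes "is_rg_iso G G' f" "is_rg_iso G' G'' f'" shows "is_rg_iso G G'' (f' \<circ> f)"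
 using assms bij_betw_trans[of f _ _ f'] bij_betwE[of f] by (auto simp: is_rg_iso_def)

lemma (in directed_graph) rg_iso_inv:
 assumes f: "is_rg_iso G G' f"
 shows "is_rg_iso G' G (inv_into H f)"
proof -
 let ?g = "inv_into H f"
 have b: "bij_betw f H (half_edges G')" using f by (simp add: is_rg_iso_def)
 have fg: "?g h \<in> H" "f (?g h) = h" if "h \<in> half_edges G'" for h
  using b that by (auto simp: bij_betw_def inv_into_into f_inv_into_f)
 have gf: "?g (f h) = h" if "h \<in> H" for h using b that by (simp add: bij_betw_def)
 show ?thesis
  unfolding is_rg_iso_def
 proof (intro conjI ballI)
  show "bij_betw ?g (half_edges G') H" using b by (rule bij_betw_inv_into)
  fix h assume h: "h \<in> half_edges G'"
  have f': "f (vperm G (?g h)) = vperm G' h" "f (einv G (?g h)) = einv G' h" "bdry G' h = bdry G (?g h)"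
   using f fg[OF h] by (auto simp: is_rg_iso_def)
  show "?g (vperm G' h) = vperm G (?g h)" "?g (einv G' h) = einv G (?g h)" "bdry G (?g h) = bdry G' h"
   using f' gf vperm_in einv_in fg[OF h] by metis+
 qed
qed

lemma (in directed_graph) rg_iso_cong:
 assumes "is_rg_iso G G' f" and e: "\<And>h. h \<in> H ==> f' h = f h"
 shows "is_rg_iso G G' f'"
proof -
 have "bij_betw f' H (half_edges G') = bij_betw f H (half_edges G')" by (rule bij_betw_cong[OF e])
 thus ?thesis using assms(1) vperm_in einv_in by (simp add: is_rg_iso_def e)
qed

text \<open>Orbit-stabiliser: every permutation of the half-edges carries G to exactly one member of
  its class, and the permutations leading to a given member form a coset of
  \<open>rg_aut G\<close>.\<close>

lemma card_class_aut:
 assumes C: "C \<in> directed_graphs g np nm // iso_rel g np nm" and G: "G \<in> C"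
 shows "card C * card (rg_aut G) = fact (4 * (2 * g + np + nm - 2))"
proof -
 let ?D = "directed_graphs g np nm"
 define N where "N = 4 * (2 * g + np + nm - 2)"
 let ?P = "{f. f permutes {..<N}}"
 have GD: "G \<in> ?D" using G in_quotient_imp_subset[OF equiv_iso_rel C] by blast
 interpret directed_graph np nm G using GD by (simp add: directed_graphs_iff)
 have HN: "half_edges G' = {..<N}" if "G' \<in> ?D" for G' using that by (simp add: directed_graphs_iff N_def)
 have N0: "2 * g + np + nm > 2" using GD by (simp add: directed_graphs_iff)
 have Cmem: "G' \<in> C \<longleftrightarrow> G' \<in> ?D \<and> (\<exists>f. is_rg_iso G G' f)" for G'
 proof -
  obtain G0 where "C = iso_rel g np nm `` {G0}" using C by (auto elim: quotientE)
  hence "C = iso_rel g np nm `` {G}" using G by (metis Image_singleton_iff equiv_class_eq_iff equiv_iso_rel)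
  thus ?thesis using GD by (auto simp: iso_rel_def)
 qed
 define I where "I G' = {f \<in> ?P. is_rg_iso G G' f}" for G'
 have finP: "finite ?P" by (simp add: finite_permutations)
 have finC: "finite C" using in_quotient_imp_subset[OF equiv_iso_rel C] finite_directed_graphs finite_subset by blast
 have std: "standard_graph G'" if "G' \<in> ?D" for G'
  using directed_graph.standard that by (auto simp: directed_graphs_iff)
 have "?P = (\<Union>G'\<in>C. I G')"
 proof (intro equalityI subsetI)
  fix f assume f: "f \<in> ?P"
  hence b: "bij_betw f H {..<N}" using permutes_imp_bij by (auto simp: HN[OF GD])
  note r = relabel_iso[OF b]
  have "directed_graph np nm (relabel f {..<N} G)" by (rule iso_directed[OF r(1,2)])
  hence "relabel f {..<N} G \<in> C"
   using r N0 unfolding Cmem by (auto simp: directed_graphs_iff N_def)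
  thus "f \<in> (\<Union>G'\<in>C. I G')" using r(1) f by (auto simp: I_def)
 qed (auto simp: I_def)
 hence "card ?P = card (\<Union>G'\<in>C. I G')" by simp
 also have "... = (\<Sum>G'\<in>C. card (I G'))"
 proof (rule card_UN_disjoint)
  show "\<forall>G'\<in>C. \<forall>G''\<in>C. G' \<noteq> G'' --> I G' \<inter> I G'' = {}"
  proof (intro ballI impI)
   fix G' G'' assume *: "G' \<in> C" "G'' \<in> C" "G' \<noteq> G''"
   hence "G' \<in> ?D" "G'' \<in> ?D" by (auto simp: Cmem)
   hence "G' = G''" if "f \<in> I G'" "f \<in> I G''" for f
    using that iso_relabel[OF _ std] HN by (metis (no_types, lifting) I_def mem_Collect_eq)
   thus "I G' \<inter> I G'' = {}" using * by blast
  qed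
 qed (use finC finP in \<open>auto simp: I_def\<close>)
 also have "... = (\<Sum>G'\<in>C. card (rg_aut G))"
 proof (rule sum.cong[OF refl])
  fix G' assume G': "G' \<in> C"
  then obtain f0 where f0: "is_rg_iso G G' f0" and G'D: "G' \<in> ?D" by (auto simp: Cmem)
  \<comment> \<open>The given isomorphism, changed to the identity off the half-edges so as to
    become a permutation.\<close>
  define f1 where "f1 h = (if h < N then f0 h else h)" for h
  have f1: "is_rg_iso G G' f1"
   by (rule rg_iso_cong[OF f0]) (simp add: f1_def HN[OF GD])
  have p1: "f1 permutes {..<N}"
  proof (rule bij_imp_permutes)
   show "bij_betw f1 {..<N} {..<N}" using f1 by (simp add: is_rg_iso_def HN[OF GD] HN[OF G'D])
  qed (simp add: f1_def)
  have i1: "is_rg_iso G' G (inv f1)"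
  proof -
   have e: "inv_into H f1 h = inv f1 h" if "h \<in> half_edges G'" for h
   proof (rule inv_into_f_eq)
    show "inj_on f1 H" using permutes_inj[OF p1] by (rule inj_on_subset) simp
    show "inv f1 h \<in> H"
     using that permutes_in_image[OF permutes_inv[OF p1], of h] by (simp add: HN[OF GD] HN[OF G'D])
    show "f1 (inv f1 h) = h" using permutes_inverses[OF p1] by simp
   qed
   interpret G': directed_graph np nm G' using G'D by (simp add: directed_graphs_iff)
   show ?thesis by (rule G'.rg_iso_cong[OF rg_iso_inv[OF f1]]) (simp add: e)
  qed
  have "bij_betw ((\<circ>) f1) (rg_aut G) (I G')"
  proof (rule bij_betw_byWitness[where f' = "(\<circ>) (inv f1)"])
   show "\<forall>a\<in>rg_aut G. inv f1 \<circ> (f1 \<circ> a) = a" "\<forall>a\<in>I G'. f1 \<circ> (inv f1 \<circ> a) = a"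
    using permutes_inv_o[OF p1] by (auto simp flip: comp_assoc)
   show "(\<circ>) f1 ` rg_aut G \<subseteq> I G'"
    using rg_iso_comp[OF _ f1] permutes_compose[OF _ p1] HN[OF GD] by (auto simp: rg_aut_def I_def)
   show "(\<circ>) (inv f1) ` I G' \<subseteq> rg_aut G"
    using rg_iso_comp[OF _ i1] permutes_compose[OF _ permutes_inv[OF p1]] HN[OF GD] by (auto simp: rg_aut_def I_def)
  qed
  thus "card (I G') = card (rg_aut G)" by (rule bij_betw_same_card[symmetric])
 qed
 finally show ?thesis by (simp add: card_permutations N_def)
qed

text \<open>By \<open>card_class_aut\<close> the weight 1/|Aut| of a class is its size divided by
  the number of permutations of the half-edges; automorphism groups thus disappear from the
  count.\<close>

lemma sum_classes:
 fixes \<Phi> :: "nat ribbon_graph => rat"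
 assumes inv: "\<And>G G' f. G \<in> directed_graphs g np nm ==> G' \<in> directed_graphs g np nm ==> is_rg_iso G G' f ==> \<Phi> G = \<Phi> G'"
 shows "(\<Sum>C\<in>directed_graphs g np nm // iso_rel g np nm. \<Phi> (rep C) / of_nat (card (rg_aut (rep C)))) =
   (\<Sum>G\<in>directed_graphs g np nm. \<Phi> G) / fact (4 * (2 * g + np + nm - 2))"
proof -
 let ?D = "directed_graphs g np nm" let ?Q = "?D // iso_rel g np nm"
 define N where "N = 4 * (2 * g + np + nm - 2)"
 have "(\<Sum>G\<in>?D. \<Phi> G) = (\<Sum>G\<in>\<Union>?Q. \<Phi> G)" by (simp add: Union_quotient[OF equiv_iso_rel])
 also have "... = (\<Sum>C\<in>?Q. \<Sum>G\<in>C. \<Phi> G)"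
 proof (subst sum.Union_disjoint)
  show "\<forall>C\<in>?Q. finite C"
  proof
   fix C assume "C \<in> ?Q"
   hence "C \<subseteq> ?D" by (rule in_quotient_imp_subset[OF equiv_iso_rel])
   thus "finite C" by (rule finite_subset[OF _ finite_directed_graphs])
  qed
  show "\<forall>A\<in>?Q. \<forall>B\<in>?Q. A \<noteq> B --> A \<inter> B = {}"
  proof (intro ballI impI)
   fix A B assume AB: "A \<in> ?Q" "B \<in> ?Q" "A \<noteq> B"
   from quotient_disj[OF equiv_iso_rel AB(1,2)] AB(3) show "A \<inter> B = {}" by simp
  qed
 qed simp
 also have "... = (\<Sum>C\<in>?Q. \<Phi> (rep C) / of_nat (card (rg_aut (rep C))) * fact N)"
 proof (rule sum.cong[OF refl])
  fix C assume C: "C \<in> ?Q"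
  have "\<Phi> G = \<Phi> (rep C)" if G: "G \<in> C" for G
  proof -
   have "(G, rep C) \<in> iso_rel g np nm" using quotient_eq_iff[OF equiv_iso_rel C C G rep_in(1)[OF C]] by simp
   thus ?thesis using inv by (auto simp: iso_rel_def)
  qed
  hence "(\<Sum>G\<in>C. \<Phi> G) = of_nat (card C) * \<Phi> (rep C)" by simp
  moreover have c: "of_nat (card C) * of_nat (card (rg_aut (rep C))) = (fact N :: rat)"
   using card_class_aut[OF C rep_in(1)[OF C]] unfolding N_def by (metis of_nat_fact of_nat_mult)
  moreover have "of_nat (card (rg_aut (rep C))) \<noteq> (0 :: rat)" using c by (metis fact_nonzero mult_zero_right)
  ultimately show "(\<Sum>G\<in>C. \<Phi> G) = \<Phi> (rep C) / of_nat (card (rg_aut (rep C))) * fact N"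
   by (simp add: field_simps flip: c)
 qed
 finally have "(\<Sum>G\<in>?D. \<Phi> G) = (\<Sum>C\<in>?Q. \<Phi> (rep C) / of_nat (card (rg_aut (rep C)))) * fact N"
  unfolding sum_distrib_right .
 thus ?thesis unfolding N_def by simp
qed

text \<open>Metrics indexed by positive half-edges instead of edges, which are sets; isomorphisms
  transport them by plain composition.\<close>

definition half_coeffs :: "'h ribbon_graph => nat list => ('h => nat) set" where
 "half_coeffs G b = {c \<in> pos_half G \<rightarrow>\<^sub>E UNIV.
   \<forall>i<length b. (\<Sum>h\<in>{h\<in>pos_half G. bdry G h = Inl i}. c h + 1) = b ! i}"

definition half_neg_sums :: "nat => 'h ribbon_graph => ('h => nat) => nat list" where
 "half_neg_sums nm G c = map (\<lambda>j. sum c {h\<in>pos_half G. bdry G (einv G h) = Inr j}) [0..<nm]"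

lemma bij_betw_funcset:
 assumes "bij_betw \<phi> X Y"
 shows "bij_betw (\<lambda>c. \<lambda>x\<in>X. c (\<phi> x)) (Y \<rightarrow>\<^sub>E UNIV) (X \<rightarrow>\<^sub>E (UNIV :: 'z set))"
proof (rule bij_betw_byWitness[where f' = "\<lambda>c. \<lambda>y\<in>Y. c (inv_into X \<phi> y)"])
 have 1: "inv_into X \<phi> (\<phi> x) = x" "\<phi> x \<in> Y" if "x \<in> X" for x using assms that by (auto simp: bij_betw_def)
 have 2: "inv_into X \<phi> y \<in> X" "\<phi> (inv_into X \<phi> y) = y" if "y \<in> Y" for y
  using assms that by (auto simp: bij_betw_def inv_into_into f_inv_into_f)
 show "\<forall>c\<in>Y \<rightarrow>\<^sub>E UNIV. (\<lambda>y\<in>Y. (\<lambda>x\<in>X. c (\<phi> x)) (inv_into X \<phi> y)) = c"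
  using 2 by (auto simp: fun_eq_iff PiE_iff extensional_def)
 show "\<forall>c\<in>X \<rightarrow>\<^sub>E UNIV. (\<lambda>x\<in>X. (\<lambda>y\<in>Y. c (inv_into X \<phi> y)) (\<phi> x)) = c"
  using 1 by (auto simp: fun_eq_iff PiE_iff extensional_def)
qed auto

lemma (in directed_graph) sum_edge_half:
 assumes "length b = np"
 shows "(\<Sum>c\<in>{c \<in> edge_coeffs G. pos_sums np G c = b}. \<Phi> (neg_sums nm G c)) =
  (\<Sum>c\<in>half_coeffs G b. \<Phi> (half_neg_sums nm G c))"
proof -
 define \<psi> where "\<psi> = (\<lambda>c :: 'h set => nat. \<lambda>h\<in>pos_half G. c (edge_at G h))"
 have bij: "bij_betw \<psi> (edge_coeffs G) (pos_half G \<rightarrow>\<^sub>E UNIV)"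
  unfolding \<psi>_def edge_coeffs_def by (rule bij_betw_funcset[OF edge_bij])
 have neg: "half_neg_sums nm G (\<psi> c) = neg_sums nm G c" for c
  unfolding half_neg_sums_def neg_sums_def sum_neg_label by (auto simp: \<psi>_def intro!: sum.cong)
 have "(\<Sum>h\<in>{h\<in>pos_half G. bdry G h = Inl i}. \<psi> c h + 1) = (\<Sum>e\<in>{e\<in>edges G. pos_label G e = i}. c e + 1)" for c i
  unfolding sum_pos_label by (auto simp: \<psi>_def intro!: sum.cong)
 hence pos: "\<psi> c \<in> half_coeffs G b \<longleftrightarrow> pos_sums np G c = b" if "c \<in> edge_coeffs G" for c
  using assms bij_betwE[OF bij] that by (auto simp: half_coeffs_def pos_sums_def list_eq_iff_nth_eq)
 have "bij_betw \<psi> {c \<in> edge_coeffs G. pos_sums np G c = b} (half_coeffs G b)"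
 proof (rule bij_betw_subset[OF bij])
  show "\<psi> ` {c \<in> edge_coeffs G. pos_sums np G c = b} = half_coeffs G b"
  proof (intro equalityI subsetI)
   fix c assume c: "c \<in> half_coeffs G b"
   then obtain c' where "c' \<in> edge_coeffs G" "\<psi> c' = c"
    using bij_betw_ex[OF bij, of c] by (auto simp: half_coeffs_def)
   thus "c \<in> \<psi> ` {c \<in> edge_coeffs G. pos_sums np G c = b}" using pos c by auto
  qed (use pos in auto)
 qed auto
 from sum.reindex_bij_betw[OF this, of "\<lambda>c. \<Phi> (half_neg_sums nm G c)"] show ?thesis by (simp add: neg)
qed

lemma (in directed_graph) sum_half_iso:
 assumes f: "is_rg_iso G G' f"
 shows "(\<Sum>c\<in>half_coeffs G b. \<Phi> (half_neg_sums nm G c)) = (\<Sum>c\<in>half_coeffs G' b. \<Phi> (half_neg_sums nm G' c))"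
proof -
 have b: "bij_betw f H (half_edges G')" and
  fe: "\<And>h. h \<in> H ==> f (einv G h) = einv G' (f h)" and fb: "\<And>h. h \<in> H ==> bdry G' (f h) = bdry G h"
  using f by (auto simp: is_rg_iso_def)
 have bs: "bij_betw f {h\<in>pos_half G. P (bdry G h) (bdry G (einv G h))} {h\<in>pos_half G'. P (bdry G' h) (bdry G' (einv G' h))}" for P
 proof (rule bij_betw_subset[OF b])
  show "f ` {h\<in>pos_half G. P (bdry G h) (bdry G (einv G h))} = {h\<in>pos_half G'. P (bdry G' h) (bdry G' (einv G' h))}"
  proof -
   have "half_edges G' = f ` H" using b by (simp add: bij_betw_def)
   moreover have "bdry G' (einv G' (f h)) = bdry G (einv G h)" if "h \<in> H" for h
    using fb[OF einv_in[OF that]] fe[OF that] by simp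
   ultimately show ?thesis by (auto simp: pos_half_def fb)
  qed
 qed (auto simp: pos_half_def)
 define \<psi> where "\<psi> = (\<lambda>c :: _ => nat. \<lambda>h\<in>pos_half G. c (f h))"
 have bij: "bij_betw \<psi> (pos_half G' \<rightarrow>\<^sub>E UNIV) (pos_half G \<rightarrow>\<^sub>E UNIV)"
  unfolding \<psi>_def by (rule bij_betw_funcset) (use bs[of "\<lambda>_ _. True"] in simp)
 have sums: "(\<Sum>h\<in>{h\<in>pos_half G. P (bdry G h) (bdry G (einv G h))}. \<psi> c h + k) =
   (\<Sum>h\<in>{h\<in>pos_half G'. P (bdry G' h) (bdry G' (einv G' h))}. c h + k)" for P c k
 proof -
  have "(\<Sum>h\<in>{h\<in>pos_half G. P (bdry G h) (bdry G (einv G h))}. \<psi> c h + k) =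
    (\<Sum>h\<in>{h\<in>pos_half G. P (bdry G h) (bdry G (einv G h))}. c (f h) + k)"
   by (intro sum.cong) (auto simp: \<psi>_def)
  also have "... = (\<Sum>h\<in>{h\<in>pos_half G'. P (bdry G' h) (bdry G' (einv G' h))}. c h + k)"
   by (rule sum.reindex_bij_betw[OF bs])
  finally show ?thesis .
 qed
 have neg: "half_neg_sums nm G (\<psi> c) = half_neg_sums nm G' c" for c
  unfolding half_neg_sums_def using sums[where P = "\<lambda>_ x. x = Inr j" and c = c and k = 0 for j] by simp
 have pos: "\<psi> c \<in> half_coeffs G b \<longleftrightarrow> c \<in> half_coeffs G' b" if "c \<in> pos_half G' \<rightarrow>\<^sub>E UNIV" for c
  using bij_betwE[OF bij] that sums[where P = "\<lambda>x _. x = Inl i" and c = c and k = 1 for i] by (auto simp: half_coeffs_def)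
 have "bij_betw \<psi> (half_coeffs G' b) (half_coeffs G b)"
 proof (rule bij_betw_subset[OF bij])
  show "\<psi> ` half_coeffs G' b = half_coeffs G b"
  proof (intro equalityI subsetI)
   fix c assume "c \<in> \<psi> ` half_coeffs G' b" thus "c \<in> half_coeffs G b" using pos by (auto simp: half_coeffs_def)
  next
   fix c assume c: "c \<in> half_coeffs G b"
   then obtain c' where "c' \<in> pos_half G' \<rightarrow>\<^sub>E UNIV" "\<psi> c' = c"
    using bij_betw_ex[OF bij, of c] by (auto simp: half_coeffs_def)
   thus "c \<in> \<psi> ` half_coeffs G' b" using pos c by auto
  qed
 qed (auto simp: half_coeffs_def)
 from sum.reindex_bij_betw[OF this, of "\<lambda>c. \<Phi> (half_neg_sums nm G c)"] show ?thesis by (simp add: neg)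
qed

lemma K_op_graphs:
 assumes "(g, np, nm) \<noteq> (0, 1, 1)"
 shows "K_op g np nm F b = (if length b = np then of_nat (prod_list b) / (fact nm * fact (4 * (2 * g + np + nm - 2))) *
  (\<Sum>G\<in>directed_graphs g np nm. \<Sum>c\<in>half_coeffs G b. F (half_neg_sums nm G c)) else 0)"
proof (cases "length b = np")
 case False thus ?thesis by (simp add: K_op_classes[OF assms])
next
 case True
 let ?D = "directed_graphs g np nm" let ?Q = "?D // iso_rel g np nm"
 define \<Phi> where "\<Phi> G = (\<Sum>c\<in>half_coeffs G b. F (half_neg_sums nm G c))" for G :: "nat ribbon_graph"
 have "K_op g np nm F b = (\<Sum>C\<in>?Q. \<Sum>c\<in>{c \<in> edge_coeffs (rep C). pos_sums np (rep C) c = b}.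
    of_nat (prod_list b) / (fact nm * of_nat (card (rg_aut (rep C)))) * F (neg_sums nm (rep C) c))"
  using True by (simp add: K_op_classes[OF assms])
 also have "... = (\<Sum>C\<in>?Q. of_nat (prod_list b) / fact nm * (\<Phi> (rep C) / of_nat (card (rg_aut (rep C)))))"
 proof (rule sum.cong[OF refl])
  fix C assume "C \<in> ?Q"
  then interpret directed_graph np nm "rep C" using rep_in(2) by (auto simp: directed_graphs_iff)
  show "(\<Sum>c\<in>{c \<in> edge_coeffs (rep C). pos_sums np (rep C) c = b}.
    of_nat (prod_list b) / (fact nm * of_nat (card (rg_aut (rep C)))) * F (neg_sums nm (rep C) c)) =
    of_nat (prod_list b) / fact nm * (\<Phi> (rep C) / of_nat (card (rg_aut (rep C))))"
   unfolding sum_distrib_left[symmetric] sum_edge_half[OF True, of F] \<Phi>_def by simp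
 qed
 also have "... = of_nat (prod_list b) / fact nm * (\<Sum>C\<in>?Q. \<Phi> (rep C) / of_nat (card (rg_aut (rep C))))"
  by (simp add: sum_distrib_left)
 also have "(\<Sum>C\<in>?Q. \<Phi> (rep C) / of_nat (card (rg_aut (rep C)))) = (\<Sum>G\<in>?D. \<Phi> G) / fact (4 * (2 * g + np + nm - 2))"
 proof (rule sum_classes)
  fix G G' :: "nat ribbon_graph" and f
  assume G: "G \<in> ?D" and f: "is_rg_iso G G' f"
  interpret directed_graph np nm G using G by (simp add: directed_graphs_iff)
  show "\<Phi> G = \<Phi> G'" unfolding \<Phi>_def by (rule sum_half_iso[OF f])
 qed
 finally show ?thesis using True by (simp add: \<Phi>_def)
qed

section \<open>The cut-and-join operator acting on cycle types\<close>

section \<open>Symmetric series as functions of multisets\<close>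

definition mfun :: "series => nat multiset => rat" where
 "mfun F M = F (sorted_list_of_multiset M)"

lemma fock_mfun: "F \<in> fock ==> F xs = mfun F (mset xs)"
 unfolding fock_def mfun_def by (metis (mono_tags, lifting) mem_Collect_eq mset_sorted_list_of_multiset)

lemma fockI: "(\<And>xs. F xs = g (mset xs)) ==> F \<in> fock"
 unfolding fock_def by simp

lemma mfun_eqI: "(\<And>xs. F xs = g (mset xs)) ==> mfun F M = g M"
 unfolding mfun_def by simp

text \<open>Here u = i + 1 and v = j + 1: the multiplications remove u and v, and the derivative
  inserts i + j = u + v - 2. Truncated subtraction is safe because the factor u * v vanishes when u
  or v is 0. In \<open>P_minus_mset\<close>, likewise, u = i + j + 2.\<close>

definition P_plus_mset :: "(nat multiset => rat) => nat multiset => rat" where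
 "P_plus_mset g M = 1 / 2 * (\<Sum>u\<in>#M. \<Sum>v\<in>#M - {#u#}. of_nat (u * v) * g (M - {#u#} - {#v#} + {#u + v - 2#}))"

definition P_minus_mset :: "(nat multiset => rat) => nat multiset => rat" where
 "P_minus_mset g M = 1 / 2 * (\<Sum>u\<in>#M. of_nat u * (\<Sum>i<u - 1. g (M - {#u#} + {#i#} + {#u - 2 - i#})))"

lemma mset_remove_nth:
 assumes "i < length xs" shows "mset (take i xs @ drop (Suc i) xs) = mset xs - {#xs ! i#}"
proof -
 have "mset xs = mset (take i xs @ xs ! i # drop (Suc i) xs)" using assms by (simp flip: id_take_nth_drop)
 thus ?thesis by simp
qed

lemma count_mset_nth: "count (mset xs) k = card {i. i < length xs \<and> xs ! i = k}"
 by (simp add: count_mset count_list_eq_length_filter length_filter_conv_card eq_commute)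

lemma t_mult_mset:
 assumes "\<And>ys. H ys = h (mset ys)"
 shows "t_mult k H xs = of_nat (count (mset xs) k) * h (mset xs - {#k#})"
proof -
 have "t_mult k H xs = (\<Sum>i | i < length xs \<and> xs ! i = k. h (mset xs - {#k#}))"
  unfolding t_mult_def by (intro sum.cong refl) (simp only: assms mem_Collect_eq mset_remove_nth)
 thus ?thesis by (simp add: count_mset_nth)
qed

lemma sum_mset_count:
 fixes f :: "nat => rat"
 assumes "\<And>u. u \<in># M ==> u \<noteq> 0 ==> u \<le> Suc n"
 shows "(\<Sum>i\<le>n. of_nat (count M (Suc i)) * f (Suc i)) = (\<Sum>u\<in>#M. if u = 0 then 0 else f u)"
 using assms
proof (induction M)
 case empty thus ?case by simp
next
 case (add x M)
 have "(\<Sum>i\<le>n. of_nat (count (add_mset x M) (Suc i)) * f (Suc i)) =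
   (\<Sum>i\<le>n. of_nat (count M (Suc i)) * f (Suc i) + (if Suc i = x then f x else 0))"
  by (intro sum.cong) (auto simp: algebra_simps)
 also have "... = (\<Sum>u\<in>#M. if u = 0 then 0 else f u) + (\<Sum>i\<le>n. if Suc i = x then f x else 0)"
  using add by (simp add: sum.distrib)
 also have "(\<Sum>i\<le>n. if Suc i = x then f x else 0) = (if x = 0 then 0 else f x)"
 proof (cases x)
  case (Suc y)
  hence "y \<le> n" using add.prems[of x] by simp
  thus ?thesis using Suc by simp
 qed simp
 finally show ?case by simp
qed

lemma sum_mset_le: "u \<in># M ==> u \<le> sum_mset M" for u :: nat
 by (metis multi_member_split sum_mset.add_mset le_add1)

lemma P_plus_eq:
 assumes "F \<in> fock" shows "P_plus F xs = P_plus_mset (mfun F) (mset xs)"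
proof -
 define M where "M = mset xs"
 define g where "g = mfun F"
 have F: "F ys = g (mset ys)" for ys unfolding g_def by (rule fock_mfun[OF assms])
 let ?n = "sum_list xs"
 have n: "?n = sum_mset M" by (simp add: M_def sum_mset_sum_list)
 have 1: "t_mult k (t_deriv m F) ys = of_nat (count (mset ys) k) * g (mset ys - {#k#} + {#m#})" for k m ys
  by (rule t_mult_mset) (simp add: t_deriv_def F)
 have 2: "t_mult l (t_mult k (t_deriv m F)) xs =
   of_nat (count M l) * (of_nat (count (M - {#l#}) k) * g (M - {#l#} - {#k#} + {#m#}))" for k l m
  unfolding M_def by (rule t_mult_mset) (simp add: 1)
 have "P_plus F xs = 1 / 2 * (\<Sum>i\<le>?n. of_nat (count M (Suc i)) * (\<Sum>j\<le>?n. of_nat (count (M - {#Suc i#}) (Suc j)) *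
   (of_nat (Suc i * Suc j) * g (M - {#Suc i#} - {#Suc j#} + {#Suc i + Suc j - 2#}))))"
  unfolding P_plus_def 2 by (simp add: sum_distrib_left algebra_simps)
 also have "(\<Sum>i\<le>?n. of_nat (count M (Suc i)) * (\<Sum>j\<le>?n. of_nat (count (M - {#Suc i#}) (Suc j)) *
   (of_nat (Suc i * Suc j) * g (M - {#Suc i#} - {#Suc j#} + {#Suc i + Suc j - 2#})))) =
   (\<Sum>u\<in>#M. if u = 0 then 0 else \<Sum>j\<le>?n. of_nat (count (M - {#u#}) (Suc j)) *
   (of_nat (u * Suc j) * g (M - {#u#} - {#Suc j#} + {#u + Suc j - 2#})))"
  by (rule sum_mset_count) (use sum_mset_le n le_SucI in metis)
 also have "... = (\<Sum>u\<in>#M. \<Sum>v\<in>#M - {#u#}. of_nat (u * v) * g (M - {#u#} - {#v#} + {#u + v - 2#}))"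
 proof (intro arg_cong[where f = sum_mset] image_mset_cong)
  fix u assume u: "u \<in># M"
  have "(\<Sum>j\<le>?n. of_nat (count (M - {#u#}) (Suc j)) *
   (of_nat (u * Suc j) * g (M - {#u#} - {#Suc j#} + {#u + Suc j - 2#}))) =
   (\<Sum>v\<in>#M - {#u#}. if v = 0 then 0 else of_nat (u * v) * g (M - {#u#} - {#v#} + {#u + v - 2#}))"
   by (rule sum_mset_count) (use sum_mset_le n le_SucI in \<open>metis in_diffD\<close>)
  also have "... = (\<Sum>v\<in>#M - {#u#}. of_nat (u * v) * g (M - {#u#} - {#v#} + {#u + v - 2#}))"
   by (intro arg_cong[where f = sum_mset] image_mset_cong) auto
  finally show "(if u = 0 then 0 else \<Sum>j\<le>?n. of_nat (count (M - {#u#}) (Suc j)) *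
   (of_nat (u * Suc j) * g (M - {#u#} - {#Suc j#} + {#u + Suc j - 2#}))) =
   (\<Sum>v\<in>#M - {#u#}. of_nat (u * v) * g (M - {#u#} - {#v#} + {#u + v - 2#}))" by simp
 qed
 finally show ?thesis unfolding P_plus_mset_def M_def g_def .
qed

lemma P_minus_eq:
 assumes "F \<in> fock" shows "P_minus F xs = P_minus_mset (mfun F) (mset xs)"
proof -
 define M where "M = mset xs"
 define g where "g = mfun F"
 have F: "F ys = g (mset ys)" for ys unfolding g_def by (rule fock_mfun[OF assms])
 let ?n = "sum_list xs"
 have n: "?n = sum_mset M" by (simp add: M_def sum_mset_sum_list)
 have 1: "t_mult k (t_deriv i (t_deriv j F)) xs = of_nat (count M k) * g (M - {#k#} + {#i#} + {#j#})" for k i j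
  unfolding M_def by (rule t_mult_mset) (simp add: t_deriv_def F)
 have cnt: "of_nat (count M k) * f = (\<Sum>u\<in>#M. if u = k then f else 0)" for k and f :: rat
  by (induction M) (auto simp: algebra_simps)
 have swap: "(\<Sum>i\<le>?n. \<Sum>u\<in>#M. f u i) = (\<Sum>u\<in>#M. \<Sum>i\<le>?n. f u i)" for f :: "nat => nat => rat"
  by (induction M) (simp_all add: sum.distrib)
 have "(\<Sum>i\<le>?n. \<Sum>j\<le>?n. of_nat (i + j + 2) * t_mult (i + j + 2) (t_deriv i (t_deriv j F)) xs) =
   (\<Sum>i\<le>?n. \<Sum>j\<le>?n. \<Sum>u\<in>#M. if u = i + j + 2 then of_nat u * g (M - {#u#} + {#i#} + {#j#}) else 0)"
 proof (intro sum.cong refl)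
  fix i j
  have "of_nat (i + j + 2) * t_mult (i + j + 2) (t_deriv i (t_deriv j F)) xs =
   of_nat (count M (i + j + 2)) * (of_nat (i + j + 2) * g (M - {#i + j + 2#} + {#i#} + {#j#}))"
   unfolding 1 by (simp only: mult.left_commute)
  also have "... = (\<Sum>u\<in>#M. if u = i + j + 2 then of_nat u * g (M - {#u#} + {#i#} + {#j#}) else 0)"
   unfolding cnt by (intro arg_cong[where f = sum_mset] image_mset_cong) auto
  finally show "of_nat (i + j + 2) * t_mult (i + j + 2) (t_deriv i (t_deriv j F)) xs =
   (\<Sum>u\<in>#M. if u = i + j + 2 then of_nat u * g (M - {#u#} + {#i#} + {#j#}) else 0)" .
 qed
 also have "... = (\<Sum>u\<in>#M. \<Sum>i\<le>?n. \<Sum>j\<le>?n. if u = i + j + 2 then of_nat u * g (M - {#u#} + {#i#} + {#j#}) else 0)"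
  unfolding swap ..
 also have "... = (\<Sum>u\<in>#M. of_nat u * (\<Sum>i<u - 1. g (M - {#u#} + {#i#} + {#u - 2 - i#})))"
 proof (intro arg_cong[where f = sum_mset] image_mset_cong)
  fix u assume "u \<in># M"
  hence u: "u \<le> ?n" using sum_mset_le n by simp
  have "(\<Sum>i\<le>?n. \<Sum>j\<le>?n. if u = i + j + 2 then of_nat u * g (M - {#u#} + {#i#} + {#j#}) else 0) =
    (\<Sum>i\<le>?n. if i < u - 1 then of_nat u * g (M - {#u#} + {#i#} + {#u - 2 - i#}) else 0)"
  proof (intro sum.cong refl)
   fix i
   have "(\<Sum>j\<le>?n. if u = i + j + 2 then of_nat u * g (M - {#u#} + {#i#} + {#j#}) else 0) =
    (\<Sum>j\<le>?n. if i < u - 1 \<and> j = u - 2 - i then of_nat u * g (M - {#u#} + {#i#} + {#u - 2 - i#}) else 0)"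
    by (intro sum.cong refl) (auto split: if_splits)
   also have "... = (if i < u - 1 then of_nat u * g (M - {#u#} + {#i#} + {#u - 2 - i#}) else 0)"
    using u by (cases "i < u - 1") auto
   finally show "(\<Sum>j\<le>?n. if u = i + j + 2 then of_nat u * g (M - {#u#} + {#i#} + {#j#}) else 0) =
    (if i < u - 1 then of_nat u * g (M - {#u#} + {#i#} + {#u - 2 - i#}) else 0)" .
  qed
  also have "... = (\<Sum>i<u - 1. of_nat u * g (M - {#u#} + {#i#} + {#u - 2 - i#}))"
   using u by (intro sum.mono_neutral_cong_right) auto
  finally show "(\<Sum>i\<le>?n. \<Sum>j\<le>?n. if u = i + j + 2 then of_nat u * g (M - {#u#} + {#i#} + {#j#}) else 0) =
   of_nat u * (\<Sum>i<u - 1. g (M - {#u#} + {#i#} + {#u - 2 - i#}))" by (simp add: sum_distrib_left)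
 qed
 finally show ?thesis unfolding P_minus_def P_minus_mset_def M_def g_def by simp
qed

lemma W1_fock: "F \<in> fock ==> W1 F \<in> fock"
 by (rule fockI[of _ "\<lambda>M. P_plus_mset (mfun F) M + P_minus_mset (mfun F) M"])
  (simp add: W1_def P_plus_eq P_minus_eq)

section \<open>Composing a permutation with a transposition\<close>

abbreviation "swap \<equiv> Transposition.transpose"

text \<open>Write the cycle as the powers of \<sigma> applied to x, with y at position s.
  Precomposing with the transposition sends x to the successor of y and y to the successor of x. So
  positions 1, ..., s close up to a cycle through y, and position 0 together with the positions
  after s to a cycle through x.\<close>

lemma split_orbit:
 fixes \<sigma> :: "'a => 'a"
 assumes S: "finite S" "\<sigma> permutes S" and x: "x \<in> S"
  and n: "n = card (orbit \<sigma> x)" and s: "0 < s" "s < n" and y: "y = (\<sigma> ^^ s) x"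
 defines "\<sigma>' \<equiv> \<sigma> \<circ> swap x y"
 shows "orbit \<sigma> x = (\<lambda>t. (\<sigma> ^^ t) x) ` {..<n}" "inj_on (\<lambda>t. (\<sigma> ^^ t) x) {..<n}"
  "orbit \<sigma>' x = insert x ((\<lambda>t. (\<sigma> ^^ t) x) ` {s<..<n})"
  "orbit \<sigma>' y = (\<lambda>t. (\<sigma> ^^ t) x) ` {1..s}"
  "orbit \<sigma>' ` S = orbit \<sigma> ` S - {orbit \<sigma> x} \<union> {orbit \<sigma>' x, orbit \<sigma>' y}"
  "orbit \<sigma>' x \<union> orbit \<sigma>' y = orbit \<sigma> x" "orbit \<sigma>' x \<inter> orbit \<sigma>' y = {}"
proof -
 define d where "d = funpow_dist1 \<sigma> x x"
 have xx: "x \<in> orbit \<sigma> x" by (rule permutes_orbit_self[OF S])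
 have im: "orbit \<sigma> x = (\<lambda>t. (\<sigma> ^^ t) x) ` {0..<d}" unfolding d_def by (rule orbit_conv_funpow_dist1[OF xx])
 have inj: "inj_on (\<lambda>t. (\<sigma> ^^ t) x) {0..<d}" unfolding d_def by (rule inj_on_funpow_dist1[OF xx])
 have dn: "d = n" unfolding n im using inj by (simp add: card_image)
 have per: "(\<sigma> ^^ n) x = x" using funpow_dist1_prop[OF xx] by (simp add: d_def[symmetric] dn)
 show im': "orbit \<sigma> x = (\<lambda>t. (\<sigma> ^^ t) x) ` {..<n}" using im by (simp add: dn lessThan_atLeast0)
 show inj': "inj_on (\<lambda>t. (\<sigma> ^^ t) x) {..<n}" using inj by (simp add: dn lessThan_atLeast0)
 have neq: "(\<sigma> ^^ t) x \<noteq> (\<sigma> ^^ t') x" if "t < n" "t' < n" "t \<noteq> t'" for t t'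
  using inj' that by (auto simp: inj_on_def)
 have xy: "x \<noteq> y" using neq[of 0 s] s y by auto
 have sx: "\<sigma>' x = (\<sigma> ^^ Suc s) x" and sy: "\<sigma>' y = \<sigma> x"
  by (simp_all add: \<sigma>'_def y)
 have so: "\<sigma>' z = \<sigma> z" if "z \<noteq> x" "z \<noteq> y" for z using that by (simp add: \<sigma>'_def)
 have st: "\<sigma>' ((\<sigma> ^^ t) x) = (\<sigma> ^^ Suc t) x" if "t < n" "t \<noteq> 0" "t \<noteq> s" for t
  using so[of "(\<sigma> ^^ t) x"] neq[of t 0] neq[of t s] that s by (simp add: y)
 have per': "(\<sigma> ^^ Suc t) x \<in> insert x ((\<lambda>t. (\<sigma> ^^ t) x) ` {s<..<n})" if "s \<le> t" "t < n" for t
 proof (cases "Suc t < n")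
  case True thus ?thesis using that by (intro insertI2 imageI) auto
 next
  case False hence "Suc t = n" using that by simp
  thus ?thesis using per by simp
 qed
 show A: "orbit \<sigma>' x = insert x ((\<lambda>t. (\<sigma> ^^ t) x) ` {s<..<n})"
 proof (intro equalityI subsetI)
  fix z assume z: "z \<in> orbit \<sigma>' x"
  have "orbit \<sigma>' x \<subseteq> insert x ((\<lambda>t. (\<sigma> ^^ t) x) ` {s<..<n})"
  proof (rule orbit_invariant)
   fix z assume "z \<in> insert x ((\<lambda>t. (\<sigma> ^^ t) x) ` {s<..<n})"
   then consider "z = x" | t where "s < t" "t < n" "z = (\<sigma> ^^ t) x" by auto
   thus "\<sigma>' z \<in> insert x ((\<lambda>t. (\<sigma> ^^ t) x) ` {s<..<n})"
   proof cases
    case 1 thus ?thesis using per'[of s] s by (simp only: sx)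
   next
    case 2 thus ?thesis using per'[of t] st[of t] by (simp only:)
   qed
  qed simp
  thus "z \<in> insert x ((\<lambda>t. (\<sigma> ^^ t) x) ` {s<..<n})" using z by blast
 next
  have r: "(\<sigma> ^^ t) x \<in> orbit \<sigma>' x" if "Suc s \<le> t" "t \<le> n" for t
   using that
  proof (induction t rule: dec_induct)
   case base
   thus ?case using orbit.base[of \<sigma>' x] by (simp only: sx)
  next
   case (step t)
   hence "(\<sigma> ^^ t) x \<in> orbit \<sigma>' x" by simp
   hence "\<sigma>' ((\<sigma> ^^ t) x) \<in> orbit \<sigma>' x" by (rule orbit.step)
   thus ?case using st[of t] step by simp
  qed
  fix z assume "z \<in> insert x ((\<lambda>t. (\<sigma> ^^ t) x) ` {s<..<n})"
  then consider "z = x" | t where "s < t" "t < n" "z = (\<sigma> ^^ t) x" by auto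
  thus "z \<in> orbit \<sigma>' x"
  proof cases
   case 1 thus ?thesis using r[of n] per s by simp
  next
   case 2 thus ?thesis using r[of t] by simp
  qed
 qed
 show B: "orbit \<sigma>' y = (\<lambda>t. (\<sigma> ^^ t) x) ` {1..s}"
 proof (intro equalityI subsetI)
  fix z assume z: "z \<in> orbit \<sigma>' y"
  have "orbit \<sigma>' y \<subseteq> (\<lambda>t. (\<sigma> ^^ t) x) ` {1..s}"
  proof (rule orbit_invariant)
   fix z assume "z \<in> (\<lambda>t. (\<sigma> ^^ t) x) ` {1..s}"
   then obtain t where t: "1 \<le> t" "t \<le> s" "z = (\<sigma> ^^ t) x" by auto
   show "\<sigma>' z \<in> (\<lambda>t. (\<sigma> ^^ t) x) ` {1..s}"
   proof (cases "t = s")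
    case True
    hence "\<sigma>' z = (\<sigma> ^^ 1) x" using sy y t by simp
    thus ?thesis using s by (intro image_eqI[of _ _ 1]) auto
   next
    case False
    hence "\<sigma>' z = (\<sigma> ^^ Suc t) x" using st[of t] t s by simp
    thus ?thesis using t False by (intro image_eqI[of _ _ "Suc t"]) auto
   qed
  qed (use s y in \<open>auto intro!: image_eqI[of _ _ s]\<close>)
  thus "z \<in> (\<lambda>t. (\<sigma> ^^ t) x) ` {1..s}" using z by blast
 next
  fix z assume "z \<in> (\<lambda>t. (\<sigma> ^^ t) x) ` {1..s}"
  then obtain t where t: "1 \<le> t" "t \<le> s" "z = (\<sigma> ^^ t) x" by auto
  have "(\<sigma> ^^ t) x \<in> orbit \<sigma>' y" using t(1,2)
  proof (induction t rule: dec_induct)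
   case base
   thus ?case using orbit.base[of \<sigma>' y] by (simp add: sy)
  next
   case (step t)
   hence "(\<sigma> ^^ t) x \<in> orbit \<sigma>' y" by simp
   hence "\<sigma>' ((\<sigma> ^^ t) x) \<in> orbit \<sigma>' y" by (rule orbit.step)
   thus ?case using st[of t] step s by simp
  qed
  thus "z \<in> orbit \<sigma>' y" using t by simp
 qed
 show U: "orbit \<sigma>' x \<union> orbit \<sigma>' y = orbit \<sigma> x"
 proof -
  have "{..<n} = insert 0 {s<..<n} \<union> {1..s}" using s by auto
  thus ?thesis unfolding A B im' by (auto simp: image_Un)
 qed
 show disj: "orbit \<sigma>' x \<inter> orbit \<sigma>' y = {}"
 proof -
  have eq: "insert x ((\<lambda>t. (\<sigma> ^^ t) x) ` {s<..<n}) = (\<lambda>t. (\<sigma> ^^ t) x) ` (insert 0 {s<..<n})" by simp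
  have "insert 0 {s<..<n} \<subseteq> {..<n}" "{1..s} \<subseteq> {..<n}" using s by auto
  note inj_on_image_Int[OF inj' this]
  moreover have "insert 0 {s<..<n} \<inter> {1..s} = {}" by auto
  ultimately show ?thesis unfolding A B eq by (metis image_empty)
 qed
 have other: "orbit \<sigma>' z = orbit \<sigma> z" if z: "z \<in> S" "z \<notin> orbit \<sigma> x" for z
 proof -
  have d: "w \<noteq> x \<and> w \<noteq> y" if "w \<in> orbit \<sigma> z" for w
  proof -
   have "y \<in> orbit \<sigma> x" using im' s y by auto
   thus ?thesis using permutes_orbit_eq[OF S that] permutes_orbit_eq[OF S, of y x] xx z
     permutes_orbit_self[OF S, of z] by auto
  qed
  have "orbit \<sigma>' (id z) = id ` orbit \<sigma> z"
  proof (rule orbit_image_on[where S = "orbit \<sigma> z"])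
   fix w assume "w \<in> orbit \<sigma> z"
   thus "\<sigma> w \<in> orbit \<sigma> z" "id (\<sigma> w) = \<sigma>' (id w)" using so d by (auto intro: orbit.step)
  qed (rule permutes_orbit_self[OF S])
  thus ?thesis by simp
 qed
 have p': "\<sigma>' permutes S"
 proof -
  have "y \<in> S" using permutes_orbit_sub[OF S(2) x] im' s y by auto
  thus ?thesis unfolding \<sigma>'_def using x by (intro permutes_compose[OF _ S(2)] permutes_swap_id)
 qed
 show "orbit \<sigma>' ` S = orbit \<sigma> ` S - {orbit \<sigma> x} \<union> {orbit \<sigma>' x, orbit \<sigma>' y}"
 proof (intro equalityI subsetI)
  fix c assume "c \<in> orbit \<sigma>' ` S"
  then obtain z where z: "z \<in> S" "c = orbit \<sigma>' z" by blast
  show "c \<in> orbit \<sigma> ` S - {orbit \<sigma> x} \<union> {orbit \<sigma>' x, orbit \<sigma>' y}"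
  proof (cases "z \<in> orbit \<sigma> x")
   case True
   hence "z \<in> orbit \<sigma>' x \<or> z \<in> orbit \<sigma>' y" using U by blast
   thus ?thesis using permutes_orbit_eq[OF S(1) p'] z by blast
  next
   case False
   thus ?thesis using other[OF z(1)] z permutes_orbit_self[OF S, of z] by auto
  qed
 next
  fix c assume "c \<in> orbit \<sigma> ` S - {orbit \<sigma> x} \<union> {orbit \<sigma>' x, orbit \<sigma>' y}"
  then consider z where "z \<in> S" "c = orbit \<sigma> z" "c \<noteq> orbit \<sigma> x" | "c = orbit \<sigma>' x" | "c = orbit \<sigma>' y" by blast
  thus "c \<in> orbit \<sigma>' ` S"
  proof cases
   case 1
   thus ?thesis using other[of z] permutes_orbit_eq[OF S, of z x] by (metis imageI)
  next
   case 2 thus ?thesis using x by blast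
  next
   case 3
   thus ?thesis using permutes_orbit_sub[OF S(2) x] im' s y by auto
  qed
 qed
qed

text \<open>Walking from x under the new permutation runs through the cycle of y and so meets y.
  Composing with the transposition once more gives \<sigma> back, so \<open>split_orbit\<close> can
  be read backwards.\<close>

lemma merge_orbit:
 fixes \<sigma> :: "'a => 'a"
 assumes S: "finite S" "\<sigma> permutes S" and x: "x \<in> S" and y: "y \<in> S" "y \<notin> orbit \<sigma> x"
 defines "\<sigma>' \<equiv> \<sigma> \<circ> swap x y"
 shows "orbit \<sigma>' x = orbit \<sigma> x \<union> orbit \<sigma> y"
  "orbit \<sigma>' ` S = orbit \<sigma> ` S - {orbit \<sigma> x, orbit \<sigma> y} \<union> {orbit \<sigma> x \<union> orbit \<sigma> y}"
proof -
 have p': "\<sigma>' permutes S" unfolding \<sigma>'_def using x y by (intro permutes_compose[OF _ S(2)] permutes_swap_id)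
 have xy: "x \<noteq> y" using y permutes_orbit_self[OF S] by auto
 define d where "d = funpow_dist1 \<sigma> y y"
 have yy: "y \<in> orbit \<sigma> y" by (rule permutes_orbit_self[OF S])
 have per: "(\<sigma> ^^ d) y = y" unfolding d_def by (rule funpow_dist1_prop[OF yy])
 have "(\<sigma> ^^ t) y \<in> orbit \<sigma>' x" if "1 \<le> t" "t \<le> d" for t
  using that
 proof (induction t rule: dec_induct)
  case base
  have "\<sigma>' x = \<sigma> y" by (simp add: \<sigma>'_def)
  thus ?case using orbit.base[of \<sigma>' x] by simp
 next
  case (step t)
  hence o: "(\<sigma> ^^ t) y \<in> orbit \<sigma>' x" by simp
  have "(\<sigma> ^^ t) y \<noteq> y" using funpow_dist1_least[of t \<sigma> y y] step by (simp add: d_def)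
  moreover have "(\<sigma> ^^ t) y \<noteq> x"
  proof
   assume "(\<sigma> ^^ t) y = x"
   hence "x \<in> orbit \<sigma> y" using funpow_in_orbit[OF yy] by metis
   thus False using y(2) orbit_swap[OF yy] by blast
  qed
  ultimately have "\<sigma>' ((\<sigma> ^^ t) y) = (\<sigma> ^^ Suc t) y" by (simp add: \<sigma>'_def)
  thus ?case using orbit.step[OF o] by simp
 qed
 from this[of d] have yo: "y \<in> orbit \<sigma>' x" using per by (simp add: d_def)
 define n where "n = card (orbit \<sigma>' x)"
 have xo: "x \<in> orbit \<sigma>' x" by (rule permutes_orbit_self[OF S(1) p'])
 define d' where "d' = funpow_dist1 \<sigma>' x x"
 have im: "orbit \<sigma>' x = (\<lambda>t. (\<sigma>' ^^ t) x) ` {0..<d'}" unfolding d'_def by (rule orbit_conv_funpow_dist1[OF xo])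
 have "inj_on (\<lambda>t. (\<sigma>' ^^ t) x) {0..<d'}" unfolding d'_def by (rule inj_on_funpow_dist1[OF xo])
 hence "d' = n" unfolding n_def im by (simp add: card_image)
 then obtain s where s: "s < n" "y = (\<sigma>' ^^ s) x" using yo im by auto
 have s0: "0 < s" using s xy by (cases s) auto
 have bck: "\<sigma>' \<circ> swap x y = \<sigma>" by (simp add: \<sigma>'_def comp_assoc)
 note sp = split_orbit[OF S(1) p' x n_def s0 s(1,2), unfolded bck]
 show A: "orbit \<sigma>' x = orbit \<sigma> x \<union> orbit \<sigma> y" using sp(6) by simp
 have ne: "orbit \<sigma>' x \<notin> orbit \<sigma>' ` S - {orbit \<sigma>' x}" by simp
 have x1: "orbit \<sigma> x \<notin> orbit \<sigma>' ` S - {orbit \<sigma>' x}" and y1: "orbit \<sigma> y \<notin> orbit \<sigma>' ` S - {orbit \<sigma>' x}"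
 proof -
  have False if c: "c \<in> orbit \<sigma>' ` S" "c \<noteq> orbit \<sigma>' x" "c \<subseteq> orbit \<sigma>' x" for c
  proof -
   obtain z where z: "z \<in> S" "c = orbit \<sigma>' z" using c by blast
   hence "z \<in> orbit \<sigma>' x" using permutes_orbit_self[OF S(1) p'] c by blast
   thus False using permutes_orbit_eq[OF S(1) p'] z c by blast
  qed
  thus "orbit \<sigma> x \<notin> orbit \<sigma>' ` S - {orbit \<sigma>' x}" "orbit \<sigma> y \<notin> orbit \<sigma>' ` S - {orbit \<sigma>' x}"
   using A by blast+
 qed
 have "orbit \<sigma>' ` S = insert (orbit \<sigma>' x) (orbit \<sigma>' ` S - {orbit \<sigma>' x})" using x by blast
 also have "orbit \<sigma>' ` S - {orbit \<sigma>' x} = orbit \<sigma> ` S - {orbit \<sigma> x, orbit \<sigma> y}"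
  unfolding sp(5) using x1 y1 by blast
 finally show "orbit \<sigma>' ` S = orbit \<sigma> ` S - {orbit \<sigma> x, orbit \<sigma> y} \<union> {orbit \<sigma> x \<union> orbit \<sigma> y}"
  unfolding A by blast
qed

section \<open>The Cut-and-Join operator on permutations\<close>

text \<open>Dead cells \<open>D\<close> keep their place in the cycles of \<open>\<sigma>\<close> but do not count; in this way
 a cycle may have length 0.\<close>

definition ctype :: "'a set => 'a set => ('a => 'a) => nat multiset" where
 "ctype S D \<sigma> = image_mset (\<lambda>c. card (c - D)) (mset_set (orbit \<sigma> ` S))"

text \<open>The rank of an element within V takes every value below \<open>card V\<close> exactly
  once. In \<open>ctype_split\<close> the rank is the live length of one of the two new
  cycles.\<close>

lemma sum_rank:
 fixes V :: "nat set" and \<phi> :: "nat => 'b :: comm_monoid_add"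
 assumes "finite V"
 shows "(\<Sum>s\<in>V. \<phi> (card {t\<in>V. t < s})) = (\<Sum>i<card V. \<phi> i)"
 using assms
proof (induction V rule: finite_linorder_max_induct)
 case (insert b A)
 have "(\<Sum>s\<in>A. \<phi> (card {t \<in> insert b A. t < s})) = (\<Sum>s\<in>A. \<phi> (card {t\<in>A. t < s}))"
  using insert.hyps by (intro sum.cong refl arg_cong[where f = \<phi>] arg_cong[where f = card]) force
 moreover have "{t \<in> insert b A. t < b} = A" using insert.hyps by auto
 moreover have "b \<notin> A" using insert.hyps by auto
 ultimately show ?case using insert by (simp add: add.commute)
qed simp

locale cells =
 fixes S D :: "'a set" and \<sigma> :: "'a => 'a"
 assumes S: "finite S" and \<sigma>: "\<sigma> permutes S" and D: "D \<subseteq> S"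
begin

abbreviation "cyc \<equiv> orbit \<sigma> ` S"
abbreviation "live c \<equiv> card (c - D)"

lemma fin_cyc: "finite cyc" using S by simp

lemma cyc_fin: "c \<in> cyc ==> finite c" using S permutes_orbit_sub[OF \<sigma>] finite_subset by blast

lemma ctype_remove: "c \<in> cyc ==> ctype S D \<sigma> - {#live c#} = image_mset live (mset_set (cyc - {c}))"
 unfolding ctype_def using fin_cyc by (simp add: mset_set.remove[of cyc c])

lemma live_cong:
 assumes "x \<notin> c" "y \<notin> c" shows "card (c - (D \<union> {x, y})) = live c"
 using assms by (intro arg_cong[where f = card]) auto

lemma live_remove_sum:
 assumes "x \<in> cyc"
 shows "(\<Sum>c\<in>cyc - {x}. \<phi> (live c)) = (\<Sum>v\<in>#ctype S D \<sigma> - {#live x#}. \<phi> v)"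
 unfolding ctype_remove[OF assms] by (simp add: sum_unfold_sum_mset image_mset.compositionality comp_def)

lemma live_sum: "(\<Sum>c\<in>cyc. \<phi> (live c)) = (\<Sum>v\<in>#ctype S D \<sigma>. \<phi> v)"
 unfolding ctype_def by (simp add: sum_unfold_sum_mset image_mset.compositionality comp_def)

lemma mset_other:
 assumes "\<And>c. c \<in> cyc - X ==> x \<notin> c \<and> y \<notin> c"
 shows "image_mset (\<lambda>c. card (c - (D \<union> {x, y}))) (mset_set (cyc - X)) = image_mset live (mset_set (cyc - X))"
 using fin_cyc assms by (intro image_mset_cong live_cong) auto

text \<open>The joined cycle has the live cells of both cycles except x and y, which have just died;
  hence the - 2.\<close>

lemma ctype_merge:
 assumes x: "x \<in> S - D" and y: "y \<in> S - D" and ne: "orbit \<sigma> x \<noteq> orbit \<sigma> y"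
 shows "ctype S (D \<union> {x, y}) (\<sigma> \<circ> swap x y) =
  ctype S D \<sigma> - {#live (orbit \<sigma> x)#} - {#live (orbit \<sigma> y)#} + {#live (orbit \<sigma> x) + live (orbit \<sigma> y) - 2#}"
proof -
 let ?A = "orbit \<sigma> x" and ?B = "orbit \<sigma> y"
 have xA: "x \<in> ?A" and yB: "y \<in> ?B" by (rule permutes_orbit_self[OF S \<sigma>])+
 have AB: "?A \<in> cyc" "?B \<in> cyc" using x y by auto
 have disj: "?A \<inter> ?B = {}" by (rule orbits_disjoint[OF S \<sigma> AB ne])
 hence yA: "y \<notin> ?A" using yB by blast
 have notin: "x \<notin> c \<and> y \<notin> c" if "c \<in> cyc - {?A, ?B}" for c
  using that orbits_disjoint[OF S \<sigma>, of c ?A] orbits_disjoint[OF S \<sigma>, of c ?B] AB xA yB by blast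
 have nin: "?A \<union> ?B \<notin> cyc - {?A, ?B}" using notin xA by blast
 have "card (?A \<union> ?B - (D \<union> {x, y})) = card ((?A - D) - {x}) + card ((?B - D) - {y})"
 proof -
  have "?A \<union> ?B - (D \<union> {x, y}) = ((?A - D) - {x}) \<union> ((?B - D) - {y})" using disj xA yB by blast
  thus ?thesis using disj cyc_fin[OF AB(1)] cyc_fin[OF AB(2)] by (simp add: card_Un_disjoint disjoint_iff)
 qed
 also have "... = live ?A + live ?B - 2"
 proof -
  have "x \<in> ?A - D" "y \<in> ?B - D" using xA yB x y by auto
  moreover from this have "live ?A > 0" "live ?B > 0"
   using cyc_fin[OF AB(1)] cyc_fin[OF AB(2)] by (auto simp: card_gt_0_iff)
  ultimately show ?thesis using cyc_fin[OF AB(1)] cyc_fin[OF AB(2)] by simp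
 qed
 finally have l: "card (?A \<union> ?B - (D \<union> {x, y})) = live ?A + live ?B - 2" .
 have 1: "ctype S (D \<union> {x, y}) (\<sigma> \<circ> swap x y) =
  image_mset (\<lambda>c. card (c - (D \<union> {x, y}))) (mset_set (insert (?A \<union> ?B) (cyc - {?A, ?B})))"
  unfolding ctype_def using merge_orbit(2)[OF S \<sigma> _ _ yA] x y by simp
 also have "... = {#live ?A + live ?B - 2#} + image_mset live (mset_set (cyc - {?A, ?B}))"
 proof -
  have "mset_set (insert (?A \<union> ?B) (cyc - {?A, ?B})) = add_mset (?A \<union> ?B) (mset_set (cyc - {?A, ?B}))"
   by (rule mset_set.insert) (use fin_cyc nin in auto)
  moreover have "image_mset (\<lambda>c. card (c - (D \<union> {x, y}))) (mset_set (cyc - {?A, ?B})) = image_mset live (mset_set (cyc - {?A, ?B}))"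
   by (rule mset_other) (rule notin)
  ultimately show ?thesis by (simp only: image_mset_add_mset l) simp
 qed
 also have "image_mset live (mset_set (cyc - {?A, ?B})) = ctype S D \<sigma> - {#live ?A#} - {#live ?B#}"
 proof -
  have "mset_set (cyc - {?A}) = add_mset ?B (mset_set (cyc - {?A} - {?B}))"
   by (rule mset_set.remove) (use fin_cyc AB ne in auto)
  moreover have "cyc - {?A} - {?B} = cyc - {?A, ?B}" by auto
  ultimately show ?thesis unfolding ctype_remove[OF AB(1)] by simp
 qed
 finally show ?thesis by (simp only: add.commute)
qed

text \<open>The new cycle through y keeps the live cells strictly between x and y. As y runs through
  the other live cells of the old cycle, of live length n, their number runs through 0, ..., n -
  2.\<close>

lemma ctype_split:
 assumes x: "x \<in> S - D"
 shows "(\<Sum>y\<in>orbit \<sigma> x - D - {x}. g (ctype S (D \<union> {x, y}) (\<sigma> \<circ> swap x y))) =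
  (\<Sum>i<live (orbit \<sigma> x) - 1. g (ctype S D \<sigma> - {#live (orbit \<sigma> x)#} + {#i#} + {#live (orbit \<sigma> x) - 2 - i#}))"
proof -
 let ?O = "orbit \<sigma> x"
 have xO: "x \<in> ?O" by (rule permutes_orbit_self[OF S \<sigma>])
 have Oc: "?O \<in> cyc" using x by auto
 define n where "n = card ?O"
 define f where "f t = (\<sigma> ^^ t) x" for t
 define V where "V = {t. 0 < t \<and> t < n \<and> f t \<notin> D}"
 have finV: "finite V" by (simp add: V_def)
 have dd: "?O = f ` {..<n}" and inj: "inj_on f {..<n}"
 proof -
  define d where "d = funpow_dist1 \<sigma> x x"
  have im: "orbit \<sigma> x = f ` {0..<d}" unfolding d_def f_def by (rule orbit_conv_funpow_dist1[OF xO])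
  moreover have i: "inj_on f {0..<d}" unfolding d_def f_def by (rule inj_on_funpow_dist1[OF xO])
  ultimately have "d = n" unfolding n_def by (simp add: card_image)
  thus "?O = f ` {..<n}" "inj_on f {..<n}" using im i by (simp_all add: lessThan_atLeast0)
 qed
 have f0: "f 0 = x" by (simp add: f_def)
 have n0: "0 < n" using xO cyc_fin[OF Oc] by (auto simp: n_def card_gt_0_iff)
 have fx: "f t \<noteq> x" if "0 < t" "t < n" for t using inj that f0 n0 by (metis inj_onD lessThan_iff less_irrefl)
 have bV: "bij_betw f V (?O - D - {x})"
 proof (rule bij_betw_imageI)
  show "inj_on f V" using inj by (rule inj_on_subset) (auto simp: V_def)
  show "f ` V = ?O - D - {x}"
  proof (intro equalityI subsetI)
   fix z assume "z \<in> f ` V" thus "z \<in> ?O - D - {x}" using fx by (auto simp: V_def dd)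
  next
   fix z assume z: "z \<in> ?O - D - {x}"
   then obtain t where t: "t < n" "z = f t" using dd by auto
   hence "0 < t" using z f0 by (cases t) auto
   thus "z \<in> f ` V" using t z by (auto simp: V_def)
  qed
 qed
 have cardV: "card V = live ?O - 1"
  using bij_betw_same_card[OF bV] xO x cyc_fin[OF Oc] by simp
 have "(\<Sum>y\<in>?O - D - {x}. g (ctype S (D \<union> {x, y}) (\<sigma> \<circ> swap x y)))
   = (\<Sum>s\<in>V. g (ctype S (D \<union> {x, f s}) (\<sigma> \<circ> swap x (f s))))"
  by (rule sum.reindex_bij_betw[OF bV, symmetric])
 also have "... = (\<Sum>s\<in>V. g (ctype S D \<sigma> - {#live ?O#} + {#card {t\<in>V. t < s}#} + {#live ?O - 2 - card {t\<in>V. t < s}#}))"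
 proof (rule sum.cong[OF refl])
  fix s assume s: "s \<in> V"
  define y where "y = f s"
  have s0: "0 < s" "s < n" using s by (auto simp: V_def)
  have yO: "y \<in> ?O" "y \<notin> D" using s by (auto simp: y_def dd V_def)
  define \<sigma>' where "\<sigma>' = \<sigma> \<circ> swap x y"
  note sp = split_orbit[OF S \<sigma> _ n_def s0, of y, folded f_def, folded \<sigma>'_def]
  have sp': "orbit \<sigma>' x = insert x (f ` {s<..<n})" "orbit \<sigma>' y = f ` {1..s}"
   "orbit \<sigma>' ` S = cyc - {?O} \<union> {orbit \<sigma>' x, orbit \<sigma>' y}"
   "orbit \<sigma>' x \<union> orbit \<sigma>' y = ?O" "orbit \<sigma>' x \<inter> orbit \<sigma>' y = {}"
   using sp(3-7) x by (simp_all add: y_def f_def[abs_def])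
  let ?A = "orbit \<sigma>' x" and ?B = "orbit \<sigma>' y"
  have notin: "z \<notin> c" if "c \<in> cyc - {?O}" "z \<in> ?O" for c z
   using that orbits_disjoint[OF S \<sigma>, of c ?O] Oc by blast
  have AB: "?A \<noteq> {}" "?B \<noteq> {}" using sp'(1,2) s0 by auto
  have nin: "?A \<notin> cyc - {?O}" "?B \<notin> cyc - {?O}" "?A \<noteq> ?B" using notin sp'(4,5) AB by blast+
  have "card (?B - (D \<union> {x, y})) = card {t\<in>V. t < s}"
  proof -
   have "?B - (D \<union> {x, y}) = f ` {t\<in>V. t < s}"
   proof (intro equalityI subsetI)
    fix z assume z: "z \<in> ?B - (D \<union> {x, y})"
    then obtain t where t: "1 \<le> t" "t \<le> s" "z = f t" using sp'(2) by auto
    thus "z \<in> f ` {t\<in>V. t < s}" using z s0 by (cases "t = s") (auto simp: V_def y_def)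
   next
    fix z assume "z \<in> f ` {t\<in>V. t < s}"
    then obtain t where t: "t \<in> V" "t < s" "z = f t" by blast
    have "f t \<noteq> y" using inj t s0 unfolding y_def by (metis inj_onD lessThan_iff less_trans nat_neq_iff)
    thus "z \<in> ?B - (D \<union> {x, y})" using t fx[of t] s0 by (auto simp: sp'(2) V_def)
   qed
   moreover have "inj_on f {t\<in>V. t < s}" using inj by (rule inj_on_subset) (auto simp: V_def)
   ultimately show ?thesis by (simp add: card_image)
  qed
  moreover have "card (?A - (D \<union> {x, y})) + card (?B - (D \<union> {x, y})) = live ?O - 2"
  proof -
   have fin: "finite ?A" "finite ?B" using cyc_fin[OF Oc] sp'(4) by (metis finite_Un)+
   have "card (?A - (D \<union> {x, y})) + card (?B - (D \<union> {x, y})) = card ((?A - (D \<union> {x, y})) \<union> (?B - (D \<union> {x, y})))"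
    using fin sp'(5) by (intro card_Un_disjoint[symmetric]) auto
   also have "(?A - (D \<union> {x, y})) \<union> (?B - (D \<union> {x, y})) = (?O - D) - {x, y}" using sp'(4) by blast
   also have "card ... = live ?O - card {x, y}"
    by (rule card_Diff_subset) (use xO x yO in auto)
   also have "card {x, y} = 2" using fx[OF s0] by (simp add: y_def)
   finally show ?thesis .
  qed
  ultimately have l: "card (?B - (D \<union> {x, y})) = card {t\<in>V. t < s}"
   "card (?A - (D \<union> {x, y})) = live ?O - 2 - card {t\<in>V. t < s}" by simp_all
  have "ctype S (D \<union> {x, y}) \<sigma>' = image_mset (\<lambda>c. card (c - (D \<union> {x, y}))) (mset_set (insert ?A (insert ?B (cyc - {?O}))))"
   unfolding ctype_def sp'(3) by (simp add: insert_commute)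
  also have "... = {#card (?A - (D \<union> {x, y}))#} + {#card (?B - (D \<union> {x, y}))#} + image_mset live (mset_set (cyc - {?O}))"
  proof -
   have "mset_set (insert ?A (insert ?B (cyc - {?O}))) = add_mset ?A (mset_set (insert ?B (cyc - {?O})))"
    by (rule mset_set.insert) (use fin_cyc nin in blast)+
   moreover have "mset_set (insert ?B (cyc - {?O})) = add_mset ?B (mset_set (cyc - {?O}))"
    by (rule mset_set.insert) (use fin_cyc nin in blast)+
   moreover have "image_mset (\<lambda>c. card (c - (D \<union> {x, y}))) (mset_set (cyc - {?O})) = image_mset live (mset_set (cyc - {?O}))"
    by (rule mset_other) (use notin xO yO in blast)
   ultimately show ?thesis by (simp only: image_mset_add_mset) simp
  qed
  finally show "g (ctype S (D \<union> {x, f s}) (\<sigma> \<circ> swap x (f s))) =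
   g (ctype S D \<sigma> - {#live ?O#} + {#card {t\<in>V. t < s}#} + {#live ?O - 2 - card {t\<in>V. t < s}#})"
   unfolding ctype_remove[OF Oc] l y_def[symmetric] \<sigma>'_def[symmetric] by (simp add: add_mset_commute)
 qed
 also have "... = (\<Sum>i<card V. g (ctype S D \<sigma> - {#live ?O#} + {#i#} + {#live ?O - 2 - i#}))"
  by (rule sum_rank[OF finV])
 finally show ?thesis unfolding cardV .
qed

text \<open>Ordered pairs of live cells either lie on different cycles, u * v of them for live
  lengths u and v, and join these; or they lie on one cycle, with u choices of x, and cut it as in
  \<open>ctype_split\<close>.\<close>

lemma cut_and_join:
 fixes g :: "nat multiset => rat"
 shows "P_plus_mset g (ctype S D \<sigma>) + P_minus_mset g (ctype S D \<sigma>) =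
  1 / 2 * (\<Sum>x\<in>S - D. \<Sum>y\<in>S - D - {x}. g (ctype S (D \<union> {x, y}) (\<sigma> \<circ> swap x y)))"
proof -
 let ?M = "ctype S D \<sigma>"
 define G where "G x y = g (ctype S (D \<union> {x, y}) (\<sigma> \<circ> swap x y))" for x y
 have finO: "finite c" if "c \<in> cyc" for c by (rule cyc_fin[OF that])
 have byc: "(\<Sum>x\<in>S - D. \<phi> x) = (\<Sum>c\<in>cyc. \<Sum>x\<in>c - D. \<phi> x)" for \<phi> :: "'a => rat"
 proof -
  have "(\<Sum>x\<in>S - D. \<phi> x) = (\<Sum>c\<in>cyc. sum \<phi> (c \<inter> (S - D)))" by (rule sum_over_orbits[OF S \<sigma>]) auto
  moreover have "c \<inter> (S - D) = c - D" if "c \<in> cyc" for c using that permutes_orbit_sub[OF \<sigma>] by blast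
  ultimately show ?thesis by simp
 qed
 have orb: "orbit \<sigma> x = c" if "c \<in> cyc" "x \<in> c" for c x using that permutes_orbit_eq[OF S \<sigma>] by blast
 have cS: "x \<in> S" if "c \<in> cyc" "x \<in> c" for c x using that permutes_orbit_sub[OF \<sigma>] by blast
 have inner: "(\<Sum>y\<in>S - D - {x}. G x y) = (\<Sum>c'\<in>cyc - {c}. \<Sum>y\<in>c' - D. G x y) + (\<Sum>y\<in>c - D - {x}. G x y)"
  if c: "c \<in> cyc" "x \<in> c - D" for c x
 proof -
  have "(\<Sum>y\<in>S - D - {x}. G x y) = (\<Sum>y\<in>S - D. if y = x then 0 else G x y)"
   using S by (intro sum.mono_neutral_cong_left) auto
  also have "... = (\<Sum>c'\<in>cyc. \<Sum>y\<in>c' - D. if y = x then 0 else G x y)" by (rule byc)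
  also have "... = (\<Sum>y\<in>c - D. if y = x then 0 else G x y) + (\<Sum>c'\<in>cyc - {c}. \<Sum>y\<in>c' - D. if y = x then 0 else G x y)"
   by (rule sum.remove[OF fin_cyc c(1)])
  also have "(\<Sum>y\<in>c - D. if y = x then 0 else G x y) = (\<Sum>y\<in>c - D - {x}. G x y)"
   using finO[OF c(1)] by (intro sum.mono_neutral_cong_right) auto
  also have "(\<Sum>c'\<in>cyc - {c}. \<Sum>y\<in>c' - D. if y = x then 0 else G x y) = (\<Sum>c'\<in>cyc - {c}. \<Sum>y\<in>c' - D. G x y)"
  proof (intro sum.cong refl)
   fix c' y assume "c' \<in> cyc - {c}" "y \<in> c' - D"
   hence "y \<noteq> x" using orbits_disjoint[OF S \<sigma>, of c' c] c by blast
   thus "(if y = x then 0 else G x y) = G x y" by simp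
  qed
  finally show ?thesis by simp
 qed
 have join: "(\<Sum>x\<in>c - D. \<Sum>c'\<in>cyc - {c}. \<Sum>y\<in>c' - D. G x y) =
   (\<Sum>v\<in>#?M - {#live c#}. of_nat (live c * v) * g (?M - {#live c#} - {#v#} + {#live c + v - 2#}))" if c: "c \<in> cyc" for c
 proof -
  have "(\<Sum>c'\<in>cyc - {c}. \<Sum>y\<in>c' - D. G x y) =
    (\<Sum>c'\<in>cyc - {c}. of_nat (live c') * g (?M - {#live c#} - {#live c'#} + {#live c + live c' - 2#}))" if x: "x \<in> c - D" for x
  proof (rule sum.cong[OF refl])
   fix c' assume c': "c' \<in> cyc - {c}"
   have "G x y = g (?M - {#live c#} - {#live c'#} + {#live c + live c' - 2#})" if "y \<in> c' - D" for y
   proof -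
    have m: "x \<in> S - D" "y \<in> S - D" using x that cS[OF c, of x] cS[of c' y] c' by auto
    have o: "orbit \<sigma> x = c" "orbit \<sigma> y = c'" using orb[OF c, of x] orb[of c' y] x that c' by auto
    have "orbit \<sigma> x \<noteq> orbit \<sigma> y" unfolding o using c' by blast
    from ctype_merge[OF m this] show ?thesis unfolding G_def o by (rule arg_cong)
   qed
   thus "(\<Sum>y\<in>c' - D. G x y) = of_nat (live c') * g (?M - {#live c#} - {#live c'#} + {#live c + live c' - 2#})"
    by simp
  qed
  hence "(\<Sum>x\<in>c - D. \<Sum>c'\<in>cyc - {c}. \<Sum>y\<in>c' - D. G x y) =
    of_nat (live c) * (\<Sum>c'\<in>cyc - {c}. of_nat (live c') * g (?M - {#live c#} - {#live c'#} + {#live c + live c' - 2#}))"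
   by simp
  also have "... = (\<Sum>c'\<in>cyc - {c}. of_nat (live c * live c') * g (?M - {#live c#} - {#live c'#} + {#live c + live c' - 2#}))"
   by (simp add: sum_distrib_left mult.assoc)
  also have "... = (\<Sum>v\<in>#?M - {#live c#}. of_nat (live c * v) * g (?M - {#live c#} - {#v#} + {#live c + v - 2#}))"
   by (rule live_remove_sum[OF c])
  finally show ?thesis .
 qed
 have cut: "(\<Sum>x\<in>c - D. \<Sum>y\<in>c - D - {x}. G x y) =
   of_nat (live c) * (\<Sum>i<live c - 1. g (?M - {#live c#} + {#i#} + {#live c - 2 - i#}))" if c: "c \<in> cyc" for c
 proof -
  have "(\<Sum>y\<in>c - D - {x}. G x y) = (\<Sum>i<live c - 1. g (?M - {#live c#} + {#i#} + {#live c - 2 - i#}))" if "x \<in> c - D" for x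
  proof -
   have m: "x \<in> S - D" using that cS[OF c, of x] by auto
   have o: "orbit \<sigma> x = c" using orb[OF c, of x] that by auto
   show ?thesis using ctype_split[OF m, of g] unfolding G_def o .
  qed
  thus ?thesis by simp
 qed
 have "(\<Sum>x\<in>S - D. \<Sum>y\<in>S - D - {x}. G x y) =
   (\<Sum>c\<in>cyc. \<Sum>x\<in>c - D. (\<Sum>c'\<in>cyc - {c}. \<Sum>y\<in>c' - D. G x y) + (\<Sum>y\<in>c - D - {x}. G x y))"
  unfolding byc[of "\<lambda>x. \<Sum>y\<in>S - D - {x}. G x y"] by (intro sum.cong refl inner)
 also have "... = (\<Sum>c\<in>cyc. (\<Sum>v\<in>#?M - {#live c#}. of_nat (live c * v) * g (?M - {#live c#} - {#v#} + {#live c + v - 2#})) +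
   of_nat (live c) * (\<Sum>i<live c - 1. g (?M - {#live c#} + {#i#} + {#live c - 2 - i#})))"
  by (intro sum.cong refl) (simp only: sum.distrib join cut)
 also have "... = (\<Sum>u\<in>#?M. (\<Sum>v\<in>#?M - {#u#}. of_nat (u * v) * g (?M - {#u#} - {#v#} + {#u + v - 2#})) +
   of_nat u * (\<Sum>i<u - 1. g (?M - {#u#} + {#i#} + {#u - 2 - i#})))"
  by (rule live_sum)
 finally show ?thesis
  unfolding P_plus_mset_def P_minus_mset_def G_def by (simp add: sum_mset.distrib distrib_left)
qed

end

section \<open>Powers of the Cut-and-Join operator and matchings\<close>

definition moved :: "('a => 'a) => 'a set" where
 "moved \<tau> = {x. \<tau> x \<noteq> x}"

text \<open>Fixed points are the unmatched cells; k counts the pairs.\<close>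

definition matchings :: "'a set => nat => ('a => 'a) set" where
 "matchings X k = {\<tau>. \<tau> permutes X \<and> (\<forall>x. \<tau> (\<tau> x) = x) \<and> card (moved \<tau>) = 2 * k}"

lemma matchings_sub: "\<tau> \<in> matchings X k ==> moved \<tau> \<subseteq> X"
 by (auto simp: matchings_def moved_def permutes_def)

lemma finite_matchings: "finite X ==> finite (matchings X k)"
 by (rule finite_subset[OF _ finite_permutations[of X]]) (auto simp: matchings_def)

lemma involution_permutes:
 assumes "\<And>x. \<tau> (\<tau> x) = x" "moved \<tau> \<subseteq> X" shows "\<tau> permutes X"
proof (rule bij_imp_permutes)
 have "\<tau> x \<in> X" if "x \<in> X" for x
 proof (cases "\<tau> x = x")
  case False
  hence "\<tau> x \<in> moved \<tau>" using assms(1) by (auto simp: moved_def)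
  thus ?thesis using assms(2) by blast
 qed (use that in simp)
 thus "bij_betw \<tau> X X" using assms(1) by (intro bij_betw_byWitness[where f' = \<tau>]) auto
 show "\<tau> x = x" if "x \<notin> X" for x using assms(2) that by (auto simp: moved_def)
qed

lemma matchingsI: "(\<And>x. \<tau> (\<tau> x) = x) ==> moved \<tau> \<subseteq> X ==> card (moved \<tau>) = 2 * k ==> \<tau> \<in> matchings X k"
 using involution_permutes by (auto simp: matchings_def)

lemma moved_transpose_comp:
 assumes "\<And>x. \<tau> (\<tau> x) = x" "x \<noteq> y" "x \<notin> moved \<tau>" "y \<notin> moved \<tau>"
 defines "\<tau>' \<equiv> swap x y \<circ> \<tau>"
 shows "moved \<tau>' = insert x (insert y (moved \<tau>))" "\<tau>' (\<tau>' z) = z" "\<tau>' x = y"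
proof -
 have m: "\<tau> x = x" "\<tau> y = y" using assms by (auto simp: moved_def)
 have o: "\<tau> z \<noteq> x \<and> \<tau> z \<noteq> y" if "z \<noteq> x" "z \<noteq> y" for z using m that assms(1) by metis
 have v: "\<tau>' z = (if z = x then y else if z = y then x else \<tau> z)" for z
  using m o by (auto simp: \<tau>'_def)
 show "moved \<tau>' = insert x (insert y (moved \<tau>))" using assms(2) by (auto simp: moved_def v)
 show "\<tau>' (\<tau>' z) = z" using o assms(1,2) by (auto simp: v)
 show "\<tau>' x = y" by (simp add: v)
qed

lemma moved_transpose_remove:
 assumes "\<And>x. \<tau> (\<tau> x) = x" "x \<in> moved \<tau>"
 defines "\<tau>' \<equiv> swap x (\<tau> x) \<circ> \<tau>"
 shows "moved \<tau>' = moved \<tau> - {x, \<tau> x}" "\<tau>' (\<tau>' z) = z"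
proof -
 have o: "\<tau> z \<noteq> x \<and> \<tau> z \<noteq> \<tau> x" if "z \<noteq> x" "z \<noteq> \<tau> x" for z using that assms(1) by metis
 have v: "\<tau>' z = (if z = x \<or> z = \<tau> x then z else \<tau> z)" for z
  using o assms(1) by (auto simp: \<tau>'_def)
 show "moved \<tau>' = moved \<tau> - {x, \<tau> x}" by (auto simp: moved_def v)
 show "\<tau>' (\<tau>' z) = z" using o assms(1) by (auto simp: v)
qed

text \<open>The left side runs over matchings with k + 1 pairs together with a moved point x: then y
  is the partner of x, and x has 2(k + 1) choices.\<close>

lemma sum_matchings_Suc:
 fixes \<Phi> :: "('a => 'a) => rat"
 assumes X: "finite X"
 shows "(\<Sum>x\<in>X. \<Sum>y\<in>X - {x}. \<Sum>\<tau>\<in>matchings (X - {x, y}) k. \<Phi> (swap x y \<circ> \<tau>)) =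
  of_nat (2 * Suc k) * (\<Sum>\<tau>\<in>matchings X (Suc k). \<Phi> \<tau>)"
proof -
 define I where "I = (SIGMA x:X. SIGMA y:X - {x}. matchings (X - {x, y}) k)"
 have "(\<Sum>x\<in>X. \<Sum>y\<in>X - {x}. \<Sum>\<tau>\<in>matchings (X - {x, y}) k. \<Phi> (swap x y \<circ> \<tau>)) =
  (\<Sum>(x, y, \<tau>)\<in>I. \<Phi> (swap x y \<circ> \<tau>))"
  unfolding I_def using X by (simp add: sum.Sigma finite_matchings)
 also have "... = (\<Sum>(\<tau>, x)\<in>(SIGMA \<tau>:matchings X (Suc k). moved \<tau>). \<Phi> \<tau>)"
 proof (rule sum.reindex_bij_witness[of _ "\<lambda>(\<tau>, x). (x, \<tau> x, swap x (\<tau> x) \<circ> \<tau>)"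
    "\<lambda>(x, y, \<tau>). (swap x y \<circ> \<tau>, x)"])
  fix a assume "a \<in> I"
  then obtain x y \<tau> where a: "a = (x, y, \<tau>)" and xy: "x \<in> X" "y \<in> X" "x \<noteq> y"
   and t: "\<tau> \<in> matchings (X - {x, y}) k" by (auto simp: I_def)
  have tt: "\<tau> (\<tau> z) = z" for z using t by (simp add: matchings_def)
  have xm: "x \<notin> moved \<tau>" "y \<notin> moved \<tau>" using matchings_sub[OF t] by auto
  note mv = moved_transpose_comp[OF tt xy(3) xm]
  have fin: "finite (moved \<tau>)" using matchings_sub[OF t] X by (meson finite_Diff finite_subset)
  have "swap x y \<circ> \<tau> \<in> matchings X (Suc k)"
  proof (rule matchingsI)
   show "moved (swap x y \<circ> \<tau>) \<subseteq> X" using mv(1) matchings_sub[OF t] xy by auto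
   show "card (moved (swap x y \<circ> \<tau>)) = 2 * Suc k"
    using t xm xy fin by (simp add: mv(1) matchings_def)
  qed (rule mv(2))
  thus "(case a of (x, y, \<tau>) => (swap x y \<circ> \<tau>, x)) \<in> (SIGMA \<tau>:matchings X (Suc k). moved \<tau>)"
   using a mv(1) by auto
  show "(case case a of (x, y, \<tau>) => (swap x y \<circ> \<tau>, x) of
    (\<tau>, x) => (x, \<tau> x, swap x (\<tau> x) \<circ> \<tau>)) = a"
   using mv(3) by (simp add: a flip: comp_assoc)
  show "(case case a of (x, y, \<tau>) => (swap x y \<circ> \<tau>, x) of (\<tau>, x) => \<Phi> \<tau>) =
    (case a of (x, y, \<tau>) => \<Phi> (swap x y \<circ> \<tau>))" by (simp add: a)
 next
  fix b assume "b \<in> (SIGMA \<tau>:matchings X (Suc k). moved \<tau>)"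
  then obtain \<tau> x where b: "b = (\<tau>, x)" and t: "\<tau> \<in> matchings X (Suc k)" and x: "x \<in> moved \<tau>" by auto
  have tt: "\<tau> (\<tau> z) = z" for z using t by (simp add: matchings_def)
  note mv = moved_transpose_remove[OF tt x]
  have xx: "\<tau> x \<in> moved \<tau>" "\<tau> x \<noteq> x" using x tt by (auto simp: moved_def)
  have fin: "finite (moved \<tau>)" using matchings_sub[OF t] X by (meson finite_subset)
  have "swap x (\<tau> x) \<circ> \<tau> \<in> matchings (X - {x, \<tau> x}) k"
  proof (rule matchingsI)
   show "moved (swap x (\<tau> x) \<circ> \<tau>) \<subseteq> X - {x, \<tau> x}" using mv(1) matchings_sub[OF t] by auto
   have "card (moved \<tau> - {x, \<tau> x}) = card (moved \<tau>) - card {x, \<tau> x}" by (rule card_Diff_subset) (use x xx in auto)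
   thus "card (moved (swap x (\<tau> x) \<circ> \<tau>)) = 2 * k"
    using t xx by (simp add: mv(1) matchings_def)
  qed (rule mv(2))
  thus "(case b of (\<tau>, x) => (x, \<tau> x, swap x (\<tau> x) \<circ> \<tau>)) \<in> I"
   using matchings_sub[OF t] x xx by (auto simp: b I_def)
  show "(case case b of (\<tau>, x) => (x, \<tau> x, swap x (\<tau> x) \<circ> \<tau>) of
    (x, y, \<tau>) => (swap x y \<circ> \<tau>, x)) = b"
   by (simp add: b flip: comp_assoc)
 qed
 also have "... = (\<Sum>\<tau>\<in>matchings X (Suc k). \<Sum>x\<in>moved \<tau>. \<Phi> \<tau>)"
 proof (rule sum.Sigma[symmetric])
  show "finite (matchings X (Suc k))" by (rule finite_matchings[OF X])
  show "\<forall>\<tau>\<in>matchings X (Suc k). finite (moved \<tau>)" using finite_subset[OF matchings_sub X] by blast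
 qed
 also have "... = (\<Sum>\<tau>\<in>matchings X (Suc k). of_nat (2 * Suc k) * \<Phi> \<tau>)"
  by (intro sum.cong refl) (simp add: matchings_def)
 finally show ?thesis by (simp add: sum_distrib_left)
qed

definition Msum :: "series => nat => 'a set => 'a set => ('a => 'a) => rat" where
 "Msum F k S D \<sigma> = (\<Sum>\<tau>\<in>matchings (S - D) k. mfun F (ctype S (D \<union> moved \<tau>) (\<sigma> \<circ> \<tau>)))"

lemma matchings_0: "finite X ==> matchings X 0 = {id}"
proof -
 assume X: "finite X"
 have "\<tau> = id" if "\<tau> \<in> matchings X 0" for \<tau>
 proof -
  have "finite (moved \<tau>)" using matchings_sub[OF that] X finite_subset by blast
  hence "moved \<tau> = {}" using that by (simp add: matchings_def)
  thus ?thesis by (auto simp: moved_def)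
 qed
 moreover have "id \<in> matchings X 0" by (rule matchingsI) (auto simp: moved_def)
 ultimately show ?thesis by blast
qed

text \<open>Induction on k with D and \<sigma> free: one application of \<open>W1\<close> multiplies
  \<sigma> by a transposition of live cells and kills these, and the induction hypothesis matches
  the survivors. The 1/2 in the operator against the factor 2(k + 1) of
  \<open>sum_matchings_Suc\<close> leaves k + 1.\<close>

theorem W1_power:
 assumes "cells S D \<sigma>" "F \<in> fock" "mset xs = ctype S D \<sigma>"
 shows "(W1 ^^ k) F xs = fact k * Msum F k S D \<sigma>"
 using assms(1,3)
proof (induction k arbitrary: D \<sigma> xs)
 case 0
 interpret cells S D \<sigma> by fact
 have "finite (S - D)" using S by simp
 thus ?case using 0 fock_mfun[OF assms(2), of xs] by (simp add: Msum_def matchings_0 moved_def)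
next
 case (Suc k)
 interpret cells S D \<sigma> by fact
 let ?G = "(W1 ^^ k) F"
 have G: "?G \<in> fock" by (induction k) (simp_all add: assms(2) W1_fock)
 have step: "mfun ?G (ctype S (D \<union> {x, y}) (\<sigma> \<circ> swap x y)) =
   fact k * (\<Sum>\<tau>\<in>matchings (S - D - {x, y}) k. mfun F (ctype S (D \<union> moved (swap x y \<circ> \<tau>)) (\<sigma> \<circ> (swap x y \<circ> \<tau>))))"
  if xy: "x \<in> S - D" "y \<in> S - D - {x}" for x y
 proof -
  have c: "cells S (D \<union> {x, y}) (\<sigma> \<circ> swap x y)"
   using S D xy by (intro cells.intro permutes_compose[OF _ \<sigma>] permutes_swap_id) auto
  have "mfun ?G (ctype S (D \<union> {x, y}) (\<sigma> \<circ> swap x y)) =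
   fact k * Msum F k S (D \<union> {x, y}) (\<sigma> \<circ> swap x y)"
   unfolding mfun_def[of ?G] by (rule Suc.IH[OF c mset_sorted_list_of_multiset])
  also have "Msum F k S (D \<union> {x, y}) (\<sigma> \<circ> swap x y) =
   (\<Sum>\<tau>\<in>matchings (S - D - {x, y}) k. mfun F (ctype S (D \<union> moved (swap x y \<circ> \<tau>)) (\<sigma> \<circ> (swap x y \<circ> \<tau>))))"
   unfolding Msum_def
  proof (rule sum.cong)
   show e: "matchings (S - (D \<union> {x, y})) k = matchings (S - D - {x, y}) k" by (simp add: Diff_Diff_Int set_diff_eq conj_ac)
   fix \<tau> assume t: "\<tau> \<in> matchings (S - D - {x, y}) k"
   have "moved (swap x y \<circ> \<tau>) = insert x (insert y (moved \<tau>))"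
    using t xy matchings_sub[OF t] by (intro moved_transpose_comp) (auto simp: matchings_def)
   hence "D \<union> {x, y} \<union> moved \<tau> = D \<union> moved (swap x y \<circ> \<tau>)" by auto
   thus "mfun F (ctype S (D \<union> {x, y} \<union> moved \<tau>) (\<sigma> \<circ> swap x y \<circ> \<tau>)) =
    mfun F (ctype S (D \<union> moved (swap x y \<circ> \<tau>)) (\<sigma> \<circ> (swap x y \<circ> \<tau>)))"
    by (simp only: comp_assoc)
  qed
  finally show ?thesis .
 qed
 have "(W1 ^^ Suc k) F xs = P_plus ?G xs + P_minus ?G xs" by (simp add: W1_def)
 also have "... = 1 / 2 * (\<Sum>x\<in>S - D. \<Sum>y\<in>S - D - {x}. mfun ?G (ctype S (D \<union> {x, y}) (\<sigma> \<circ> swap x y)))"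
  unfolding P_plus_eq[OF G] P_minus_eq[OF G] Suc.prems(2) by (rule cut_and_join)
 also have "(\<Sum>x\<in>S - D. \<Sum>y\<in>S - D - {x}. mfun ?G (ctype S (D \<union> {x, y}) (\<sigma> \<circ> swap x y))) =
   fact k * (\<Sum>x\<in>S - D. \<Sum>y\<in>S - D - {x}. \<Sum>\<tau>\<in>matchings (S - D - {x, y}) k.
    mfun F (ctype S (D \<union> moved (swap x y \<circ> \<tau>)) (\<sigma> \<circ> (swap x y \<circ> \<tau>))))"
  unfolding sum_distrib_left by (intro sum.cong refl) (simp only: step sum_distrib_left)
 also have "... = fact k * (of_nat (2 * Suc k) * Msum F (Suc k) S D \<sigma>)"
  unfolding Msum_def using S by (subst sum_matchings_Suc[where \<Phi> = "\<lambda>\<tau>. mfun F (ctype S (D \<union> moved \<tau>) (\<sigma> \<circ> \<tau>))"]) auto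
 finally show ?case by (simp add: algebra_simps)
qed

section \<open>Connected and disconnected structures\<close>

section \<open>The exponential formula\<close>

locale connected_structures =
 fixes conn :: "nat set => 'c set" and val :: "nat set => 'c => 'v :: comm_monoid_add"
 assumes conn_empty: "conn {} = {}"
begin

definition csum :: "nat set => ('v => rat) => rat" where
 "csum J g = (\<Sum>\<tau>\<in>conn J. g (val J \<tau>))"

text \<open>Sums over ordered m-tuples of connected structures on disjoint sets with union I; an
  empty set carries none. The recursion mirrors \<open>disj_power\<close>.\<close>

primrec dsum :: "nat => nat set => ('v => rat) => rat" where
 "dsum 0 I g = (if I = {} then g 0 else 0)"
| "dsum (Suc m) I g = (\<Sum>J\<in>Pow I. csum J (\<lambda>M. dsum m (I - J) (\<lambda>N. g (M + N))))"

lemma csum_sum: "csum J (\<lambda>M. \<Sum>a\<in>A. h a M) = (\<Sum>a\<in>A. csum J (h a))"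
 unfolding csum_def by (rule sum.swap)

lemma dsum_sum: "dsum m I (\<lambda>N. \<Sum>a\<in>A. h a N) = (\<Sum>a\<in>A. dsum m I (h a))"
proof (induction m arbitrary: I h)
 case (Suc m)
 thus ?case by (simp add: csum_sum) (rule sum.swap)
qed simp

lemma csum_swap: "csum J (\<lambda>M. csum J' (\<lambda>M'. h M M')) = csum J' (\<lambda>M'. csum J (\<lambda>M. h M M'))"
 unfolding csum_def by (rule sum.swap)

lemma csum_scale: "csum J (\<lambda>M. c * h M) = c * csum J h"
 by (simp add: csum_def sum_distrib_left)

lemma dsum_zero: "finite I ==> card I < m ==> dsum m I g = 0"
proof (induction m arbitrary: I g)
 case (Suc m)
 have "csum J (\<lambda>M. dsum m (I - J) (\<lambda>N. g (M + N))) = 0" if "J \<subseteq> I" for J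
 proof (cases "J = {}")
  case True thus ?thesis by (simp add: csum_def conn_empty)
 next
  case False
  hence "card (I - J) < card I" using that Suc.prems(1) by (intro psubset_card_mono) auto
  hence "dsum m (I - J) h = 0" for h using Suc by simp
  thus ?thesis by (simp add: csum_def)
 qed
 thus ?case by simp
qed simp

text \<open>The factor containing \<open>i\<^sub>0\<close> can be any of the \<open>m + 1\<close> factors.\<close>

lemma dsum_point:
 assumes "finite I" "i0 \<in> I"
 shows "dsum (Suc m) I g = of_nat (Suc m) *
  (\<Sum>J\<in>{J \<in> Pow I. i0 \<in> J}. csum J (\<lambda>M. dsum m (I - J) (\<lambda>N. g (M + N))))"
 using assms
proof (induction m arbitrary: I g)
 case 0
 have "(\<Sum>J\<in>Pow I. csum J (\<lambda>M. dsum 0 (I - J) (\<lambda>N. g (M + N)))) =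
  (\<Sum>J\<in>{J \<in> Pow I. i0 \<in> J}. csum J (\<lambda>M. dsum 0 (I - J) (\<lambda>N. g (M + N))))"
 proof (rule sum.mono_neutral_right)
  show "\<forall>J\<in>Pow I - {J \<in> Pow I. i0 \<in> J}. csum J (\<lambda>M. dsum 0 (I - J) (\<lambda>N. g (M + N))) = 0"
  proof
   fix J assume "J \<in> Pow I - {J \<in> Pow I. i0 \<in> J}"
   hence "I - J \<noteq> {}" using 0 by blast
   thus "csum J (\<lambda>M. dsum 0 (I - J) (\<lambda>N. g (M + N))) = 0" by (simp add: csum_def)
  qed
 qed (use 0 in auto)
 thus ?case by simp
next
 case (Suc m)
 have fin: "finite (Pow I)" using Suc.prems by simp
 have split: "Pow I = {J \<in> Pow I. i0 \<in> J} \<union> {J \<in> Pow I. i0 \<notin> J}" by blast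
 let ?X = "\<Sum>J\<in>{J \<in> Pow I. i0 \<in> J}. csum J (\<lambda>M. dsum (Suc m) (I - J) (\<lambda>N. g (M + N)))"
 define h where "h J J' = csum J' (\<lambda>M'. csum J (\<lambda>M. dsum m (I - J - J') (\<lambda>N. g (M + M' + N))))" for J J'
 have "(\<Sum>J\<in>{J \<in> Pow I. i0 \<notin> J}. csum J (\<lambda>M. dsum (Suc m) (I - J) (\<lambda>N. g (M + N)))) =
   (\<Sum>J\<in>{J \<in> Pow I. i0 \<notin> J}. of_nat (Suc m) * (\<Sum>J'\<in>{J' \<in> Pow (I - J). i0 \<in> J'}. h J J'))"
 proof (rule sum.cong[OF refl])
  fix J assume J: "J \<in> {J \<in> Pow I. i0 \<notin> J}"
  have "dsum (Suc m) (I - J) (\<lambda>N. g (M + N)) = of_nat (Suc m) *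
   (\<Sum>J'\<in>{J' \<in> Pow (I - J). i0 \<in> J'}. csum J' (\<lambda>M'. dsum m (I - J - J') (\<lambda>N. g (M + M' + N))))" for M
   using Suc.IH[of "I - J" "\<lambda>N. g (M + N)"] Suc.prems J by (simp add: add.assoc)
  thus "csum J (\<lambda>M. dsum (Suc m) (I - J) (\<lambda>N. g (M + N))) =
   of_nat (Suc m) * (\<Sum>J'\<in>{J' \<in> Pow (I - J). i0 \<in> J'}. h J J')"
   unfolding h_def by (simp only: csum_scale csum_sum csum_swap[of J])
 qed
 also have "... = of_nat (Suc m) * (\<Sum>J\<in>{J \<in> Pow I. i0 \<notin> J}. \<Sum>J'\<in>{J' \<in> Pow (I - J). i0 \<in> J'}. h J J')"
  by (simp only: sum_distrib_left)
 also have "(\<Sum>J\<in>{J \<in> Pow I. i0 \<notin> J}. \<Sum>J'\<in>{J' \<in> Pow (I - J). i0 \<in> J'}. h J J') =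
   (\<Sum>J'\<in>{J \<in> Pow I. i0 \<in> J}. \<Sum>J\<in>Pow (I - J'). h J J')"
 proof -
  have "(\<Sum>J\<in>{J \<in> Pow I. i0 \<notin> J}. \<Sum>J'\<in>{J' \<in> Pow (I - J). i0 \<in> J'}. h J J') =
   (\<Sum>(J, J')\<in>(SIGMA J:{J \<in> Pow I. i0 \<notin> J}. {J' \<in> Pow (I - J). i0 \<in> J'}). h J J')"
   using Suc.prems by (intro sum.Sigma) auto
  also have "... = (\<Sum>(J', J)\<in>(SIGMA J':{J \<in> Pow I. i0 \<in> J}. Pow (I - J')). h J J')"
   by (rule sum.reindex_bij_witness[of _ "\<lambda>(a, b). (b, a)" "\<lambda>(a, b). (b, a)"]) auto
  also have "... = (\<Sum>J'\<in>{J \<in> Pow I. i0 \<in> J}. \<Sum>J\<in>Pow (I - J'). h J J')"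
   using Suc.prems by (intro sum.Sigma[symmetric]) auto
  finally show ?thesis .
 qed
 also have "... = ?X"
 proof (rule sum.cong[OF refl])
  fix J' assume "J' \<in> {J \<in> Pow I. i0 \<in> J}"
  have "I - J - J' = I - J' - J" for J by blast
  thus "(\<Sum>J\<in>Pow (I - J'). h J J') = csum J' (\<lambda>M. dsum (Suc m) (I - J') (\<lambda>N. g (M + N)))"
   unfolding h_def by (simp add: csum_sum add_ac)
 qed
 finally have "(\<Sum>J\<in>{J \<in> Pow I. i0 \<notin> J}. csum J (\<lambda>M. dsum (Suc m) (I - J) (\<lambda>N. g (M + N)))) = of_nat (Suc m) * ?X" .
 moreover have "dsum (Suc (Suc m)) I g = ?X + (\<Sum>J\<in>{J \<in> Pow I. i0 \<notin> J}. csum J (\<lambda>M. dsum (Suc m) (I - J) (\<lambda>N. g (M + N))))"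
  unfolding dsum.simps(2)[of "Suc m"]
  by (subst split, rule sum.union_disjoint) (use Suc.prems in auto)
 ultimately show ?case by (simp only: of_nat_Suc) (simp only: algebra_simps)
qed

text \<open>Both sides obey the recursion that removes the component of a chosen point: the left one
  by \<open>dsum_point\<close>, since (m + 1)/(m + 1)! = 1/m!, the right one by assumption. Stopping
  at \<open>card I\<close> loses nothing by \<open>dsum_zero\<close> and agrees with the cutoff in
  \<open>disj_exp\<close>.\<close>

lemma exponential_formula:
 assumes E0: "\<And>g. E {} g = g 0"
  and E: "\<And>I i0 g. finite I ==> i0 \<in> I ==>
   E I g = (\<Sum>J\<in>{J \<in> Pow I. i0 \<in> J}. csum J (\<lambda>M. E (I - J) (\<lambda>N. g (M + N))))"
  and I: "finite I"
 shows "(\<Sum>m\<le>card I. dsum m I g / fact m) = E I g"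
 using I
proof (induction "card I" arbitrary: I g rule: less_induct)
 case less
 show ?case
 proof (cases "I = {}")
  case True thus ?thesis by (simp add: E0)
 next
  case False
  then obtain i0 where i0: "i0 \<in> I" by blast
  obtain n where n: "card I = Suc n" using less.prems False by (metis card_0_eq not0_implies_Suc)
  have "(\<Sum>m\<le>card I. dsum m I g / fact m) = (\<Sum>m\<le>n. dsum (Suc m) I g / fact (Suc m))"
   unfolding n using False by (simp only: sum.atMost_Suc_shift) simp
  also have "... = (\<Sum>m\<le>n. \<Sum>J\<in>{J \<in> Pow I. i0 \<in> J}. csum J (\<lambda>M. dsum m (I - J) (\<lambda>N. g (M + N)) / fact m))"
  proof (rule sum.cong[OF refl])
   fix m
   have "dsum (Suc m) I g / fact (Suc m) =
    1 / fact m * (\<Sum>J\<in>{J \<in> Pow I. i0 \<in> J}. csum J (\<lambda>M. dsum m (I - J) (\<lambda>N. g (M + N))))"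
    unfolding dsum_point[OF less.prems i0] by (simp add: divide_simps del: of_nat_Suc)
   also have "... = (\<Sum>J\<in>{J \<in> Pow I. i0 \<in> J}. csum J (\<lambda>M. dsum m (I - J) (\<lambda>N. g (M + N)) / fact m))"
    by (simp add: sum_distrib_left csum_def sum_divide_distrib)
   finally show "dsum (Suc m) I g / fact (Suc m) = (\<Sum>J\<in>{J \<in> Pow I. i0 \<in> J}. csum J (\<lambda>M. dsum m (I - J) (\<lambda>N. g (M + N)) / fact m))" .
  qed
  also have "... = (\<Sum>J\<in>{J \<in> Pow I. i0 \<in> J}. csum J (\<lambda>M. \<Sum>m\<le>n. dsum m (I - J) (\<lambda>N. g (M + N)) / fact m))"
   unfolding csum_sum by (rule sum.swap)
  also have "... = (\<Sum>J\<in>{J \<in> Pow I. i0 \<in> J}. csum J (\<lambda>M. E (I - J) (\<lambda>N. g (M + N))))"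
  proof (intro sum.cong refl arg_cong[where f = "csum _"] ext)
   fix J M assume J: "J \<in> {J \<in> Pow I. i0 \<in> J}"
   have fin: "finite (I - J)" using less.prems by simp
   have lt: "card (I - J) < card I" using J i0 less.prems by (intro psubset_card_mono) auto
   have "(\<Sum>m\<le>n. dsum m (I - J) (\<lambda>N. g (M + N)) / fact m) = (\<Sum>m\<le>card (I - J). dsum m (I - J) (\<lambda>N. g (M + N)) / fact m)"
    using lt n fin by (intro sum.mono_neutral_right) (auto simp: dsum_zero)
   thus "(\<Sum>m\<le>n. dsum m (I - J) (\<lambda>N. g (M + N)) / fact m) = E (I - J) (\<lambda>N. g (M + N))"
    using less.hyps[OF lt fin] by simp
  qed
  also have "... = E I g" by (rule E[OF less.prems i0, symmetric])
  finally show ?thesis .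
 qed
qed

end

section \<open>The disjoint union product on sublists\<close>

definition sublist :: "(nat => nat) => nat set => nat list" where
 "sublist len I = map len (sorted_list_of_set I)"

lemma mset_sublist: "finite I ==> mset (sublist len I) = image_mset len (mset_set I)"
 using mset_set_set[of "sorted_list_of_set I"] by (simp add: sublist_def)

text \<open>Positions in a list are replaced by fixed labels, so that distributing variables means
  taking subsets and can be iterated without renumbering.\<close>

lemma disj_union_sublist:
 assumes I: "finite I"
 shows "disj_union A B F (sublist len I) =
  (\<Sum>J\<in>Pow I. B (\<lambda>ys. A (\<lambda>zs. F (zs @ ys)) (sublist len J)) (sublist len (I - J)))"
proof -
 define l where "l = sorted_list_of_set I"
 have l: "sorted l" "distinct l" "set l = I" using I by (simp_all add: l_def)
 have bij: "bij_betw ((!) l) {..<length l} I" using bij_betw_nth[OF l(2)] l(3) by simp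
 have nths: "nths l X = sorted_list_of_set ((!) l ` (X \<inter> {..<length l}))" for X
 proof -
  have "set (nths l X) = (!) l ` (X \<inter> {..<length l})" by (auto simp: set_nths)
  moreover have "sorted (nths l X)" "distinct (nths l X)" using l by (simp_all add: sorted_nths)
  ultimately show ?thesis by (metis sorted_list_of_set.idem_if_sorted_distinct)
 qed
 have sub: "nths (sublist len I) X = sublist len ((!) l ` X)" if "X \<subseteq> {..<length l}" for X
  unfolding sublist_def l_def[symmetric] nths_map nths using that by (simp add: Int_absorb2)
 have compl: "nths (sublist len I) (- X) = sublist len (I - (!) l ` X)" if X: "X \<subseteq> {..<length l}" for X
 proof -
  have "(!) l ` (- X \<inter> {..<length l}) = I - (!) l ` X"
  proof -
   have "(!) l ` ({..<length l} - X) = (!) l ` {..<length l} - (!) l ` X"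
    using bij X by (intro inj_on_image_set_diff[of _ "{..<length l}"]) (auto simp: bij_betw_def)
   moreover have "- X \<inter> {..<length l} = {..<length l} - X" by blast
   ultimately show ?thesis using bij by (simp add: bij_betw_def)
  qed
  thus ?thesis unfolding sublist_def l_def[symmetric] nths_map nths by simp
 qed
 have len: "length (sublist len I) = length l" by (simp add: sublist_def l_def)
 have "disj_union A B F (sublist len I) =
  (\<Sum>X\<in>Pow {..<length l}. B (\<lambda>ys. A (\<lambda>zs. F (zs @ ys)) (sublist len ((!) l ` X))) (sublist len (I - (!) l ` X)))"
  unfolding disj_union_def len by (intro sum.cong refl) (simp add: sub compl)
 also have "... = (\<Sum>J\<in>Pow I. B (\<lambda>ys. A (\<lambda>zs. F (zs @ ys)) (sublist len J)) (sublist len (I - J)))"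
  by (rule sum.reindex_bij_betw[OF bij_betw_Pow[OF bij]])
 finally show ?thesis .
qed

lemma fock_append_eq: "F \<in> fock ==> F (zs @ ys) = mfun F (mset zs + mset ys)"
 using fock_mfun[of F "zs @ ys"] by simp

lemma fock_append: "F \<in> fock ==> (\<lambda>zs. F (zs @ ys)) \<in> fock"
 by (rule fockI) (rule fock_append_eq)

lemma mfun_append: "F \<in> fock ==> mfun (\<lambda>zs. F (zs @ ys)) M = mfun F (M + mset ys)"
 by (rule mfun_eqI[of _ "\<lambda>M. mfun F (M + mset ys)"]) (rule fock_append_eq)

text \<open>The value of a structure records its number of vertices and the lengths of its negative
 boundaries.\<close>

definition degree_part :: "nat => (nat multiset => rat) => nat \<times> nat multiset => rat" where
 "degree_part k g = (\<lambda>(k', M). if k' = k then g M else 0)"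

text \<open>The degree is a component of the value of a structure, so the Cauchy product over
  degrees collapses: for a first factor of degree a only the term i = a survives.\<close>

lemma disj_power_dsum:
 assumes "connected_structures conn"
  and C: "\<And>k F J. finite J ==> F \<in> fock ==>
   A k F (sublist len J) = connected_structures.csum conn val J (degree_part k (mfun F))"
 shows "finite I ==> F \<in> fock ==>
  disj_power A m k F (sublist len I) = connected_structures.dsum conn val m I (degree_part k (mfun F))"
proof (induction m arbitrary: k F I)
 interpret connected_structures conn val by (rule assms(1))
 {
  case 0
  have "sublist len I = [] \<longleftrightarrow> I = {}" using 0 by (simp add: sublist_def)
  thus ?case using 0 fock_mfun[of F "[]"] by (auto simp: vacuum_op_def degree_part_def zero_prod_def)
 next
  case (Suc m)
  have "disj_power A (Suc m) k F (sublist len I) =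
   (\<Sum>i\<le>k. \<Sum>J\<in>Pow I. disj_power A m (k - i) (\<lambda>ys. A i (\<lambda>zs. F (zs @ ys)) (sublist len J)) (sublist len (I - J)))"
   by (simp add: disj_union_series_def disj_union_sublist[OF Suc.prems(1)])
  also have "... = (\<Sum>i\<le>k. \<Sum>J\<in>Pow I. \<Sum>\<tau>\<in>conn J. dsum m (I - J)
    (\<lambda>N. degree_part (k - i) (\<lambda>N. degree_part i (\<lambda>M. mfun F (M + N)) (val J \<tau>)) N))"
  proof (intro sum.cong refl)
   fix i J assume J: "J \<in> Pow I"
   hence fJ: "finite J" "finite (I - J)" using Suc.prems finite_subset by auto
   define H where "H ys = A i (\<lambda>zs. F (zs @ ys)) (sublist len J)" for ys
   have H: "H ys = (\<Sum>\<tau>\<in>conn J. degree_part i (\<lambda>M. mfun F (M + mset ys)) (val J \<tau>))" for ys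
   proof -
    have "mfun (\<lambda>zs. F (zs @ ys)) = (\<lambda>M. mfun F (M + mset ys))" using mfun_append[OF Suc.prems(2)] by auto
    thus ?thesis unfolding H_def C[OF fJ(1) fock_append[OF Suc.prems(2)]] csum_def by simp
   qed
   have "H \<in> fock" by (rule fockI) (rule H)
   hence "disj_power A m (k - i) H (sublist len (I - J)) = dsum m (I - J) (degree_part (k - i) (mfun H))"
    by (rule Suc.IH[OF fJ(2)])
   also have "mfun H = (\<lambda>N. \<Sum>\<tau>\<in>conn J. degree_part i (\<lambda>M. mfun F (M + N)) (val J \<tau>))"
    by (intro ext mfun_eqI) (rule H)
   also have "degree_part (k - i) ... =
    (\<lambda>N. \<Sum>\<tau>\<in>conn J. degree_part (k - i) (\<lambda>N. degree_part i (\<lambda>M. mfun F (M + N)) (val J \<tau>)) N)"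
    by (auto simp: degree_part_def fun_eq_iff)
   finally show "disj_power A m (k - i) (\<lambda>ys. A i (\<lambda>zs. F (zs @ ys)) (sublist len J)) (sublist len (I - J)) =
    (\<Sum>\<tau>\<in>conn J. dsum m (I - J) (\<lambda>N. degree_part (k - i) (\<lambda>N. degree_part i (\<lambda>M. mfun F (M + N)) (val J \<tau>)) N))"
    unfolding H_def dsum_sum .
  qed
  also have "... = (\<Sum>J\<in>Pow I. \<Sum>\<tau>\<in>conn J. dsum m (I - J)
    (\<lambda>N. \<Sum>i\<le>k. degree_part (k - i) (\<lambda>N. degree_part i (\<lambda>M. mfun F (M + N)) (val J \<tau>)) N))"
   unfolding dsum_sum by (subst sum.swap, intro sum.cong refl, rule sum.swap)
  also have "... = (\<Sum>J\<in>Pow I. \<Sum>\<tau>\<in>conn J. dsum m (I - J) (\<lambda>N. degree_part k (mfun F) (val J \<tau> + N)))"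
  proof (intro sum.cong refl arg_cong[where f = "dsum m _"] ext)
   fix J \<tau> and N :: "nat \<times> nat multiset"
   obtain a M where v: "val J \<tau> = (a, M)" by force
   obtain b N' where N: "N = (b, N')" by force
   have "(\<Sum>i\<le>k. degree_part (k - i) (\<lambda>N. degree_part i (\<lambda>M. mfun F (M + N)) (val J \<tau>)) N) =
    (\<Sum>i\<le>k. if i = a then (if a + b = k then mfun F (M + N') else 0) else 0)"
    by (intro sum.cong refl) (auto simp: degree_part_def v N)
   also have "... = (if a + b = k then mfun F (M + N') else 0)" by auto
   finally show "(\<Sum>i\<le>k. degree_part (k - i) (\<lambda>N. degree_part i (\<lambda>M. mfun F (M + N)) (val J \<tau>)) N) =
    degree_part k (mfun F) (val J \<tau> + N)" by (simp add: degree_part_def v N)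
  qed
  finally show ?case by (simp add: csum_def)
 }
qed

section \<open>Connected components of matchings\<close>

definition involutions :: "'a set => ('a => 'a) set" where
 "involutions X = {\<tau>. (\<forall>x. \<tau> (\<tau> x) = x) \<and> moved \<tau> \<subseteq> X}"

lemma involutionsD:
 assumes "\<tau> \<in> involutions X" shows "\<tau> (\<tau> x) = x" "moved \<tau> \<subseteq> X"
 using assms by (simp_all add: involutions_def)

lemma finite_involutions: "finite X ==> finite (involutions X)"
 by (rule finite_subset[OF _ finite_permutations[of X]]) (auto simp: involutions_def intro: involution_permutes)

lemma even_moved:
 assumes "\<tau> \<in> involutions X" "finite X" shows "even (card (moved \<tau>))"
 using assms
proof (induction "card (moved \<tau>)" arbitrary: \<tau> rule: less_induct)
 case less
 have fin: "finite (moved \<tau>)" using less.prems finite_subset by (auto simp: involutions_def)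
 have tt: "\<tau> (\<tau> x) = x" for x using less.prems by (simp add: involutions_def)
 show ?case
 proof (cases "moved \<tau> = {}")
  case False
  then obtain x where x: "x \<in> moved \<tau>" by blast
  hence xx: "\<tau> x \<in> moved \<tau>" "\<tau> x \<noteq> x" using tt by (auto simp: moved_def)
  define \<tau>' where "\<tau>' = swap x (\<tau> x) \<circ> \<tau>"
  note mv = moved_transpose_remove[OF tt x, folded \<tau>'_def]
  have "\<tau>' \<in> involutions X" using mv less.prems by (auto simp: involutions_def)
  moreover have c: "card (moved \<tau>') = card (moved \<tau>) - card {x, \<tau> x}"
   unfolding mv(1) by (rule card_Diff_subset) (use x xx in auto)
  moreover have "card {x, \<tau> x} \<le> card (moved \<tau>)" using x xx fin by (intro card_mono) auto
  ultimately have "even (card (moved \<tau>'))" "card (moved \<tau>) = card (moved \<tau>') + 2"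
   using less.hyps[of \<tau>'] less.prems(2) xx by auto
  thus ?thesis by simp
 qed simp
qed

lemma matchings_involutions:
 "finite X ==> matchings X k = {\<tau> \<in> involutions X. card (moved \<tau>) div 2 = k}"
proof (intro equalityI subsetI)
 fix \<tau> assume X: "finite X" and t: "\<tau> \<in> {\<tau> \<in> involutions X. card (moved \<tau>) div 2 = k}"
 have "even (card (moved \<tau>))" using even_moved t X by blast
 hence "card (moved \<tau>) = 2 * k" using t by auto
 thus "\<tau> \<in> matchings X k" using t by (intro matchingsI) (auto simp: involutions_def)
qed (auto simp: involutions_def matchings_def moved_def permutes_def)

definition keeps :: "('b \<times> 'c => 'b \<times> 'c) => 'b set => bool" where
 "keeps \<tau> J \<longleftrightarrow> (\<forall>x. fst x \<in> J --> fst (\<tau> x) \<in> J)"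

definition part :: "'b set => ('b \<times> 'c => 'b \<times> 'c) => 'b \<times> 'c => 'b \<times> 'c" where
 "part J \<tau> = (\<lambda>x. if fst x \<in> J then \<tau> x else x)"

definition glue :: "'b set => ('b \<times> 'c => 'b \<times> 'c) => ('b \<times> 'c => 'b \<times> 'c) => 'b \<times> 'c => 'b \<times> 'c" where
 "glue J \<tau> \<tau>' = (\<lambda>x. if fst x \<in> J then \<tau> x else \<tau>' x)"

lemma keepsD: "keeps \<tau> J ==> fst x \<in> J ==> fst (\<tau> x) \<in> J"
 unfolding keeps_def by blast

locale circles =
 fixes len :: "nat => nat"
begin

text \<open>The maximum with 1 gives a circle of length 0 a single cell, which \<open>dset\<close>
  declares dead, so that every circle is a cycle of \<open>rot\<close>.\<close>

definition cset :: "nat set => (nat \<times> nat) set" where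
 "cset I = (SIGMA i:I. {..<max 1 (len i)})"

definition dset :: "nat set => (nat \<times> nat) set" where
 "dset I = {x \<in> cset I. len (fst x) = 0}"

definition live :: "nat set => (nat \<times> nat) set" where
 "live I = (SIGMA i:I. {..<len i})"

definition rot :: "nat set => nat \<times> nat => nat \<times> nat" where
 "rot I x = (if x \<in> cset I then (fst x, Suc (snd x) mod max 1 (len (fst x))) else x)"

lemma live_eq: "cset I - dset I = live I"
 by (auto simp: cset_def dset_def live_def)

lemma finite_cset: "finite I ==> finite (cset I)" and finite_live: "finite I ==> finite (live I)"
 by (auto simp: cset_def live_def)

lemma rot_in: "x \<in> cset I ==> rot I x \<in> cset I"
 by (auto simp: rot_def cset_def)

lemma fst_rot: "fst (rot I x) = fst x"
 by (simp add: rot_def)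

lemma rot_permutes:
 assumes "finite I" shows "rot I permutes cset I"
proof (rule bij_imp_permutes)
 have "inj_on (rot I) (cset I)"
  by (auto simp: inj_on_def rot_def cset_def mod_Suc split: if_splits)
 moreover have "rot I ` cset I \<subseteq> cset I" using rot_in by blast
 ultimately show "bij_betw (rot I) (cset I) (cset I)"
  using finite_cset[OF assms] by (simp add: bij_betw_def endo_inj_surj)
qed (simp add: rot_def)

lemma cells: "finite I ==> cells (cset I) (dset I) (rot I)"
 by (intro cells.intro finite_cset rot_permutes) (auto simp: dset_def)

lemma orbit_rot:
 assumes I: "finite I" and i: "(i, p) \<in> cset I"
 shows "orbit (rot I) (i, p) = {i} \<times> {..<max 1 (len i)}"
proof -
 have sub: "orbit (rot I) x \<subseteq> {i} \<times> {..<max 1 (len i)}" if "x \<in> {i} \<times> {..<max 1 (len i)}" for x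
  by (rule orbit_invariant) (use i that in \<open>auto simp: rot_def cset_def\<close>)
 have o0: "(i, t) \<in> orbit (rot I) (i, 0)" if "t < max 1 (len i)" for t
  using that
 proof (induction t)
  case 0 show ?case by (rule permutes_orbit_self[OF finite_cset[OF I] rot_permutes[OF I]])
 next
  case (Suc t)
  hence "rot I (i, t) \<in> orbit (rot I) (i, 0)" by (intro orbit.step) simp
  moreover have "rot I (i, t) = (i, Suc t)" using Suc.prems i by (simp add: rot_def cset_def)
  ultimately show ?case by simp
 qed
 have "orbit (rot I) (i, p) = orbit (rot I) (i, 0)"
  using i by (intro permutes_orbit_eq[OF finite_cset[OF I] rot_permutes[OF I]] o0) (auto simp: cset_def)
 moreover have "orbit (rot I) (i, 0) = {i} \<times> {..<max 1 (len i)}"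
 proof
  show "orbit (rot I) (i, 0) \<subseteq> {i} \<times> {..<max 1 (len i)}" by (rule sub) simp
  show "{i} \<times> {..<max 1 (len i)} \<subseteq> orbit (rot I) (i, 0)" using o0 by blast
 qed
 ultimately show ?thesis by simp
qed

lemma ctype_rot:
 assumes I: "finite I" shows "ctype (cset I) (dset I) (rot I) = image_mset len (mset_set I)"
proof -
 have orbs: "orbit (rot I) ` cset I = (\<lambda>i. {i} \<times> {..<max 1 (len i)}) ` I"
 proof (intro equalityI subsetI)
  fix c assume "c \<in> (\<lambda>i. {i} \<times> {..<max 1 (len i)}) ` I"
  then obtain i where i: "i \<in> I" "c = {i} \<times> {..<max 1 (len i)}" by blast
  hence "(i, 0) \<in> cset I" by (simp add: cset_def)
  thus "c \<in> orbit (rot I) ` cset I" using orbit_rot[OF I] i by (metis imageI)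
 next
  fix c assume "c \<in> orbit (rot I) ` cset I"
  then obtain i p where ip: "(i, p) \<in> cset I" "c = orbit (rot I) (i, p)" by auto
  thus "c \<in> (\<lambda>i. {i} \<times> {..<max 1 (len i)}) ` I" using orbit_rot[OF I ip(1)] by (auto simp: cset_def)
 qed
 have inj: "inj_on (\<lambda>i. {i} \<times> {..<max 1 (len i)}) I"
 proof (rule inj_onI)
  fix i j assume "{i} \<times> {..<max 1 (len i)} = {j} \<times> {..<max 1 (len j)}"
  moreover have "(i, 0) \<in> {i} \<times> {..<max 1 (len i)}" by simp
  ultimately show "i = j" by auto
 qed
 have card: "card ({i} \<times> {..<max 1 (len i)} - dset I) = len i" if "i \<in> I" for i
 proof (cases "len i = 0")
  case True
  hence "{i} \<times> {..<max 1 (len i)} - dset I = {}" using that by (auto simp: dset_def cset_def)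
  thus ?thesis using True by simp
 next
  case False
  hence "{i} \<times> {..<max 1 (len i)} - dset I = {i} \<times> {..<len i}" by (auto simp: dset_def)
  thus ?thesis by simp
 qed
 have "ctype (cset I) (dset I) (rot I) = image_mset (\<lambda>c. card (c - dset I)) (image_mset (\<lambda>i. {i} \<times> {..<max 1 (len i)}) (mset_set I))"
  unfolding ctype_def orbs by (subst image_mset_mset_set[OF inj]) simp
 also have "... = image_mset len (mset_set I)"
  unfolding image_mset.compositionality comp_def using I card by (intro image_mset_cong) auto
 finally show ?thesis .
qed

definition vtype :: "nat set => (nat \<times> nat => nat \<times> nat) => nat multiset" where
 "vtype I \<tau> = ctype (cset I) (dset I \<union> moved \<tau>) (rot I \<circ> \<tau>)"

definition vval :: "nat set => (nat \<times> nat => nat \<times> nat) => nat \<times> nat multiset" where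
 "vval I \<tau> = (card (moved \<tau>) div 2, vtype I \<tau>)"

text \<open>Connectedness of the graph whose vertices are the circles and in which matched cells
  join their circles.\<close>

definition conn :: "nat set => (nat \<times> nat => nat \<times> nat) set" where
 "conn I = {\<tau> \<in> involutions (live I). I \<noteq> {} \<and> (\<forall>J\<subseteq>I. J \<noteq> {} \<and> keeps \<tau> J --> J = I)}"

sublocale C: connected_structures conn vval
 by unfold_locales (simp add: conn_def)

definition total :: "nat set => (nat \<times> nat multiset => rat) => rat" where
 "total I g = (\<Sum>\<tau>\<in>involutions (live I). g (vval I \<tau>))"

lemma total_empty: "total {} g = g 0"
proof -
 have "\<tau> = id" if "\<tau> \<in> involutions (live {})" for \<tau> :: "nat \<times> nat => nat \<times> nat"
  using that by (auto simp: involutions_def live_def moved_def)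
 moreover have "id \<in> involutions (live {})" by (auto simp: involutions_def moved_def)
 ultimately have "involutions (live {}) = {id}" by blast
 thus ?thesis
  by (simp add: total_def vval_def vtype_def ctype_def cset_def moved_def zero_prod_def)
qed

lemma inv_fst:
 assumes "\<tau> \<in> involutions (live I)" shows "keeps \<tau> I" "fst x \<notin> I ==> \<tau> x = x"
proof -
 have m: "\<tau> (\<tau> x) = x" "\<tau> x \<noteq> x ==> x \<in> live I" for x
  using involutionsD[OF assms] by (auto simp only: moved_def)
 have "fst (\<tau> x) \<in> I" if "fst x \<in> I" for x
 proof (cases "\<tau> x = x")
  case False
  hence "\<tau> (\<tau> x) \<noteq> \<tau> x" using m(1)[of x] by simp
  hence "\<tau> x \<in> live I" using m by blast
  thus ?thesis by (auto simp: live_def)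
 qed (use that in simp)
 thus "keeps \<tau> I" by (simp add: keeps_def)
 show "fst x \<notin> I ==> \<tau> x = x" using m(2)[of x] by (cases x) (auto simp: live_def)
qed

lemma glue_props:
 assumes J: "J \<subseteq> I" and t1: "\<tau>1 \<in> involutions (live J)" and t2: "\<tau>2 \<in> involutions (live (I - J))"
 shows "glue J \<tau>1 \<tau>2 \<in> involutions (live I)" "keeps (glue J \<tau>1 \<tau>2) J"
  "part J (glue J \<tau>1 \<tau>2) = \<tau>1" "part (I - J) (glue J \<tau>1 \<tau>2) = \<tau>2"
  "moved (glue J \<tau>1 \<tau>2) = moved \<tau>1 \<union> moved \<tau>2" "moved \<tau>1 \<inter> moved \<tau>2 = {}"
proof -
 note i1 = inv_fst[OF t1] and i2 = inv_fst[OF t2]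
 note l = involutionsD(2)[OF t1] involutionsD(2)[OF t2]
 note tt = involutionsD(1)[OF t1] involutionsD(1)[OF t2]
 have k1: "fst (\<tau>1 x) \<in> J \<longleftrightarrow> fst x \<in> J" for x using i1(1) tt(1)[of x] unfolding keeps_def by metis
 have k2: "fst (\<tau>2 x) \<in> J \<longleftrightarrow> fst x \<in> J" for x
 proof (cases "fst x \<in> I - J")
  case True thus ?thesis using keepsD[OF i2(1), of x] by auto
 next
  case False thus ?thesis using i2(2)[of x] by simp
 qed
 show "keeps (glue J \<tau>1 \<tau>2) J" using k1 by (simp add: keeps_def glue_def)
 show m: "moved (glue J \<tau>1 \<tau>2) = moved \<tau>1 \<union> moved \<tau>2"
  using l by (auto simp: moved_def glue_def live_def)
 show "moved \<tau>1 \<inter> moved \<tau>2 = {}" using l by (auto simp: live_def)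
 have "live J \<subseteq> live I" "live (I - J) \<subseteq> live I" using J by (auto simp: live_def)
 thus "glue J \<tau>1 \<tau>2 \<in> involutions (live I)"
  unfolding involutions_def using l by (auto simp: m) (auto simp: glue_def k1 k2 tt)
 show "part J (glue J \<tau>1 \<tau>2) = \<tau>1" using i1(2) by (auto simp: part_def glue_def fun_eq_iff)
 show "part (I - J) (glue J \<tau>1 \<tau>2) = \<tau>2" using i2(2) by (auto simp: part_def glue_def fun_eq_iff)
qed

lemma part_props:
 assumes J: "J \<subseteq> I" and t: "\<tau> \<in> involutions (live I)" and k: "keeps \<tau> J"
 shows "part J \<tau> \<in> involutions (live J)" "part (I - J) \<tau> \<in> involutions (live (I - J))"
  "glue J (part J \<tau>) (part (I - J) \<tau>) = \<tau>"
proof -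
 note tt = involutionsD(1)[OF t]
 have l: "\<tau> x \<noteq> x ==> x \<in> live I" for x using involutionsD(2)[OF t] by (auto simp only: moved_def)
 have kJ: "fst (\<tau> x) \<in> J \<longleftrightarrow> fst x \<in> J" for x using k tt unfolding keeps_def by metis
 have kI: "fst (\<tau> x) \<in> I \<longleftrightarrow> fst x \<in> I" for x using inv_fst(1)[OF t] tt unfolding keeps_def by metis
 show "part J \<tau> \<in> involutions (live J)"
  using l by (auto simp: involutions_def part_def moved_def kJ tt live_def split: if_splits)
 show "part (I - J) \<tau> \<in> involutions (live (I - J))"
  using l by (auto simp: involutions_def part_def moved_def kJ kI tt live_def split: if_splits)
 show "glue J (part J \<tau>) (part (I - J) \<tau>) = \<tau>"
  using inv_fst(2)[OF t] by (auto simp: glue_def part_def fun_eq_iff)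
qed

text \<open>Over J the involution \<tau> agrees with \<tau>1, which preserves the cells over J; so
  the cycles through these cells are the same for both.\<close>

lemma vtype_sub:
 assumes I: "finite I" and J: "J \<subseteq> I" and t: "\<tau> \<in> involutions (live I)" and t1: "\<tau>1 \<in> involutions (live J)"
  and eqJ: "\<forall>x. fst x \<in> J --> \<tau> x = \<tau>1 x"
 shows "orbit (rot I \<circ> \<tau>) ` cset J = orbit (rot J \<circ> \<tau>1) ` cset J"
  "\<And>c. c \<in> orbit (rot I \<circ> \<tau>) ` cset J ==> c \<subseteq> cset J \<and> c \<noteq> {} \<and> card (c - (dset I \<union> moved \<tau>)) = card (c - (dset J \<union> moved \<tau>1))"
proof -
 have eq: "\<tau> x = \<tau>1 x" if "fst x \<in> J" for x using eqJ that by blast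
 have fJ: "finite J" using I J finite_subset by blast
 have p1: "(rot J \<circ> \<tau>1) permutes cset J"
 proof (rule permutes_compose[OF _ rot_permutes[OF fJ]])
  have "live J \<subseteq> cset J" by (auto simp: live_def cset_def)
  thus "\<tau>1 permutes cset J" using t1 by (intro involution_permutes) (auto simp: involutions_def)
 qed
 have step: "(rot I \<circ> \<tau>) x = (rot J \<circ> \<tau>1) x" if "x \<in> cset J" for x
 proof -
  have x: "fst x \<in> J" using that by (auto simp: cset_def)
  hence "fst (\<tau>1 x) \<in> J" using keepsD[OF inv_fst(1)[OF t1]] by blast
  hence "\<tau>1 x \<in> cset I \<longleftrightarrow> \<tau>1 x \<in> cset J" using J by (auto simp: cset_def)
  thus ?thesis using eq[OF x] by (simp add: rot_def)
 qed
 have orb: "orbit (rot I \<circ> \<tau>) x = orbit (rot J \<circ> \<tau>1) x" if "x \<in> cset J" for x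
 proof -
  have "orbit (rot I \<circ> \<tau>) (id x) = id ` orbit (rot J \<circ> \<tau>1) x"
   by (rule orbit_image_on[where S = "cset J"]) (use that step permutes_in_image[OF p1] in auto)
  thus ?thesis by simp
 qed
 thus "orbit (rot I \<circ> \<tau>) ` cset J = orbit (rot J \<circ> \<tau>1) ` cset J" by (intro image_cong) auto
 fix c assume "c \<in> orbit (rot I \<circ> \<tau>) ` cset J"
 then obtain x where x: "x \<in> cset J" "c = orbit (rot J \<circ> \<tau>1) x" using orb by blast
 have sub: "c \<subseteq> cset J" using permutes_orbit_sub[OF p1] x by blast
 moreover have "c \<noteq> {}" using x permutes_orbit_self[OF finite_cset[OF fJ] p1] by blast
 moreover have "c - (dset I \<union> moved \<tau>) = c - (dset J \<union> moved \<tau>1)"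
 proof -
  have "x \<in> dset I \<union> moved \<tau> \<longleftrightarrow> x \<in> dset J \<union> moved \<tau>1" if "x \<in> cset J" for x
  proof -
   have "fst x \<in> J" using that by (auto simp: cset_def)
   thus ?thesis using eq J that by (auto simp: dset_def moved_def cset_def)
  qed
  thus ?thesis using sub by blast
 qed
 ultimately show "c \<subseteq> cset J \<and> c \<noteq> {} \<and> card (c - (dset I \<union> moved \<tau>)) = card (c - (dset J \<union> moved \<tau>1))" by simp
qed

lemma vtype_glue:
 assumes I: "finite I" and J: "J \<subseteq> I" and t1: "\<tau>1 \<in> involutions (live J)" and t2: "\<tau>2 \<in> involutions (live (I - J))"
 shows "vtype I (glue J \<tau>1 \<tau>2) = vtype J \<tau>1 + vtype (I - J) \<tau>2"
proof -
 let ?t = "glue J \<tau>1 \<tau>2"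
 note gp = glue_props[OF J t1 t2]
 have e1: "\<forall>x. fst x \<in> J --> ?t x = \<tau>1 x" and e2: "\<forall>x. fst x \<in> I - J --> ?t x = \<tau>2 x"
  by (auto simp: glue_def)
 note v1 = vtype_sub[OF I J gp(1) t1 e1] and v2 = vtype_sub[OF I Diff_subset gp(1) t2 e2]
 let ?O = "orbit (rot I \<circ> ?t)"
 have cs: "cset I = cset J \<union> cset (I - J)" "cset J \<inter> cset (I - J) = {}" using J by (auto simp: cset_def)
 have disj: "?O ` cset J \<inter> ?O ` cset (I - J) = {}"
  using v1(2) v2(2) cs(2) by (meson Int_emptyI disjoint_iff subset_empty subset_iff)
 have fin: "finite (cset J)" "finite (cset (I - J))" using finite_cset finite_subset[OF J I] I by auto
 have "vtype I ?t = image_mset (\<lambda>c. card (c - (dset I \<union> moved ?t))) (mset_set (?O ` cset J)) +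
   image_mset (\<lambda>c. card (c - (dset I \<union> moved ?t))) (mset_set (?O ` cset (I - J)))"
  unfolding vtype_def ctype_def cs(1) image_Un using fin disj by (simp add: mset_set_Union)
 also have "image_mset (\<lambda>c. card (c - (dset I \<union> moved ?t))) (mset_set (?O ` cset J)) = vtype J \<tau>1"
  unfolding vtype_def ctype_def v1(1)[symmetric] using fin v1(2) by (intro image_mset_cong) auto
 also have "image_mset (\<lambda>c. card (c - (dset I \<union> moved ?t))) (mset_set (?O ` cset (I - J))) = vtype (I - J) \<tau>2"
  unfolding vtype_def ctype_def v2(1)[symmetric] using fin v2(2) by (intro image_mset_cong) auto
 finally show ?thesis .
qed

lemma vval_glue:
 assumes I: "finite I" and J: "J \<subseteq> I" and t1: "\<tau>1 \<in> involutions (live J)" and t2: "\<tau>2 \<in> involutions (live (I - J))"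
 shows "vval I (glue J \<tau>1 \<tau>2) = vval J \<tau>1 + vval (I - J) \<tau>2"
proof -
 note gp = glue_props[OF J t1 t2]
 have fin: "finite (live J)" "finite (live (I - J))" using finite_live finite_subset[OF J I] I by auto
 have "even (card (moved \<tau>1))" "even (card (moved \<tau>2))" using even_moved t1 t2 fin by blast+
 moreover have "finite (moved \<tau>1)" "finite (moved \<tau>2)" using t1 t2 fin finite_subset by (auto simp: involutions_def)
 ultimately have "card (moved (glue J \<tau>1 \<tau>2)) div 2 = card (moved \<tau>1) div 2 + card (moved \<tau>2) div 2"
  unfolding gp(5) using gp(6) by (simp add: card_Un_disjoint)
 thus ?thesis by (simp add: vval_def vtype_glue[OF assms])
qed

text \<open>The component of i0 is the least kept set containing i0. As \<tau> is an involution,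
  removing a kept subset from a kept set leaves a kept set; so the restriction of \<tau> to the
  least one is connected. Off the component \<tau> is an arbitrary involution.\<close>

lemma total_component:
 assumes I: "finite I" and i0: "i0 \<in> I"
 shows "total I g = (\<Sum>J\<in>{J \<in> Pow I. i0 \<in> J}. C.csum J (\<lambda>M. total (I - J) (\<lambda>N. g (M + N))))"
proof -
 define comp where "comp \<tau> = \<Inter>{J \<in> Pow I. i0 \<in> J \<and> keeps \<tau> J}" for \<tau> :: "nat \<times> nat => nat \<times> nat"
 let ?T = "SIGMA J:{J \<in> Pow I. i0 \<in> J}. conn J \<times> involutions (live (I - J))"
 have fins: "finite (conn J)" "finite (involutions (live (I - J)))" if "J \<subseteq> I" for J
 proof -
  have "finite J" using finite_subset[OF that I] .
  thus "finite (conn J)" using finite_involutions[OF finite_live] by (simp add: conn_def)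
  show "finite (involutions (live (I - J)))" using I by (intro finite_involutions finite_live) simp
 qed
 have comp: "comp \<tau> \<subseteq> I" "i0 \<in> comp \<tau>" "keeps \<tau> (comp \<tau>)" "part (comp \<tau>) \<tau> \<in> conn (comp \<tau>)"
  if t: "\<tau> \<in> involutions (live I)" for \<tau>
 proof -
  have kI: "keeps \<tau> I" by (rule inv_fst(1)[OF t])
  show sub: "comp \<tau> \<subseteq> I" and ic: "i0 \<in> comp \<tau>" using kI i0 by (auto simp: comp_def)
  show k: "keeps \<tau> (comp \<tau>)" by (auto simp: comp_def keeps_def)
  note tt = involutionsD(1)[OF t]
  have "J = comp \<tau>" if J: "J \<subseteq> comp \<tau>" "J \<noteq> {}" "keeps (part (comp \<tau>) \<tau>) J" for J
  proof -
   have kJ: "keeps \<tau> J" unfolding keeps_def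
   proof (intro allI impI)
    fix x :: "nat \<times> nat" assume x: "fst x \<in> J"
    hence "fst (part (comp \<tau>) \<tau> x) \<in> J" by (rule keepsD[OF J(3)])
    thus "fst (\<tau> x) \<in> J" using x J(1) by (auto simp: part_def)
   qed
   show ?thesis
   proof (cases "i0 \<in> J")
    case True
    hence "comp \<tau> \<subseteq> J" unfolding comp_def using J(1) kJ sub by blast
    thus ?thesis using J(1) by blast
   next
    case False
    have "keeps \<tau> (comp \<tau> - J)" unfolding keeps_def
    proof (intro allI impI)
     fix x :: "nat \<times> nat" assume x: "fst x \<in> comp \<tau> - J"
     hence "fst (\<tau> x) \<in> comp \<tau>" using keepsD[OF k] by blast
     moreover have "fst (\<tau> x) \<notin> J"
     proof
      assume "fst (\<tau> x) \<in> J"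
      hence "fst (\<tau> (\<tau> x)) \<in> J" using kJ unfolding keeps_def by blast
      thus False using x by (simp add: tt)
     qed
     ultimately show "fst (\<tau> x) \<in> comp \<tau> - J" by blast
    qed
    moreover have "comp \<tau> - J \<in> Pow I" "i0 \<in> comp \<tau> - J" using sub ic False by auto
    ultimately have "comp \<tau> \<subseteq> comp \<tau> - J" by (subst comp_def) blast
    thus ?thesis using J(1,2) by blast
   qed
  qed
  thus "part (comp \<tau>) \<tau> \<in> conn (comp \<tau>)"
   using part_props(1)[OF sub t k] ic unfolding conn_def by blast
 qed
 have comp_glue: "comp (glue J \<tau>1 \<tau>2) = J"
  if J: "J \<subseteq> I" "i0 \<in> J" and t1: "\<tau>1 \<in> conn J" and t2: "\<tau>2 \<in> involutions (live (I - J))" for J \<tau>1 \<tau>2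
 proof -
  have t1': "\<tau>1 \<in> involutions (live J)" using t1 by (simp add: conn_def)
  note gp = glue_props[OF J(1) t1' t2]
  note c = comp[OF gp(1)]
  have sub: "comp (glue J \<tau>1 \<tau>2) \<subseteq> J" unfolding comp_def using J gp(2) by blast
  have "keeps \<tau>1 (comp (glue J \<tau>1 \<tau>2))" unfolding keeps_def
  proof (intro allI impI)
   fix x :: "nat \<times> nat" assume x: "fst x \<in> comp (glue J \<tau>1 \<tau>2)"
   hence "fst (glue J \<tau>1 \<tau>2 x) \<in> comp (glue J \<tau>1 \<tau>2)" using c(3) unfolding keeps_def by blast
   moreover have "glue J \<tau>1 \<tau>2 x = \<tau>1 x" using x sub by (auto simp: glue_def)
   ultimately show "fst (\<tau>1 x) \<in> comp (glue J \<tau>1 \<tau>2)" by simp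
  qed
  thus ?thesis using t1 sub c(2) unfolding conn_def by blast
 qed
 have "(\<Sum>J\<in>{J \<in> Pow I. i0 \<in> J}. C.csum J (\<lambda>M. total (I - J) (\<lambda>N. g (M + N)))) =
  (\<Sum>J\<in>{J \<in> Pow I. i0 \<in> J}. \<Sum>(\<tau>1, \<tau>2)\<in>conn J \<times> involutions (live (I - J)). g (vval J \<tau>1 + vval (I - J) \<tau>2))"
  unfolding C.csum_def total_def by (intro sum.cong refl sum.cartesian_product)
 also have "... = (\<Sum>(J, \<tau>1, \<tau>2)\<in>?T. g (vval J \<tau>1 + vval (I - J) \<tau>2))"
  using I fins by (subst sum.Sigma) (auto intro!: finite_cartesian_product)
 also have "... = (\<Sum>\<tau>\<in>involutions (live I). g (vval I \<tau>))"
 proof (rule sum.reindex_bij_witness[of _ "\<lambda>\<tau>. (comp \<tau>, part (comp \<tau>) \<tau>, part (I - comp \<tau>) \<tau>)" "\<lambda>(J, \<tau>1, \<tau>2). glue J \<tau>1 \<tau>2"])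
  fix a assume "a \<in> ?T"
  then obtain J \<tau>1 \<tau>2 where a: "a = (J, \<tau>1, \<tau>2)" and J: "J \<subseteq> I" "i0 \<in> J"
   and t: "\<tau>1 \<in> conn J" "\<tau>2 \<in> involutions (live (I - J))" by auto
  have t1: "\<tau>1 \<in> involutions (live J)" using t by (simp add: conn_def)
  note gp = glue_props[OF J(1) t1 t(2)]
  show "(case a of (J, \<tau>1, \<tau>2) => glue J \<tau>1 \<tau>2) \<in> involutions (live I)" using gp(1) by (simp add: a)
  show "(comp (case a of (J, \<tau>1, \<tau>2) => glue J \<tau>1 \<tau>2), part (comp (case a of (J, \<tau>1, \<tau>2) => glue J \<tau>1 \<tau>2)) (case a of (J, \<tau>1, \<tau>2) => glue J \<tau>1 \<tau>2),
   part (I - comp (case a of (J, \<tau>1, \<tau>2) => glue J \<tau>1 \<tau>2)) (case a of (J, \<tau>1, \<tau>2) => glue J \<tau>1 \<tau>2)) = a"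
   using comp_glue[OF J t] gp(3,4) by (simp add: a)
  show "g (vval I (case a of (J, \<tau>1, \<tau>2) => glue J \<tau>1 \<tau>2)) = (case a of (J, \<tau>1, \<tau>2) => g (vval J \<tau>1 + vval (I - J) \<tau>2))"
   using vval_glue[OF I J(1) t1 t(2)] by (simp add: a)
 next
  fix \<tau> assume t: "\<tau> \<in> involutions (live I)"
  note c = comp[OF t]
  show "(comp \<tau>, part (comp \<tau>) \<tau>, part (I - comp \<tau>) \<tau>) \<in> ?T"
   using c part_props(2)[OF c(1) t c(3)] by auto
  show "(case (comp \<tau>, part (comp \<tau>) \<tau>, part (I - comp \<tau>) \<tau>) of (J, \<tau>1, \<tau>2) => glue J \<tau>1 \<tau>2) = \<tau>"
   using part_props(3)[OF c(1) t c(3)] by simp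
 qed
 finally show ?thesis by (simp add: total_def)
qed

lemma total_degree:
 assumes "finite I"
 shows "total I (degree_part k (mfun F)) = Msum F k (cset I) (dset I) (rot I)"
proof -
 have fin: "finite (live I)" using finite_live assms by simp
 show ?thesis
  unfolding total_def Msum_def live_eq matchings_involutions[OF fin]
  using finite_involutions[OF fin]
  by (intro sum.mono_neutral_cong_right) (auto simp: degree_part_def vval_def vtype_def)
qed

text \<open>The exponential formula on one side and \<open>W1_power\<close> on the other lead to the
  same sum, over all matchings of the circles with k pairs.\<close>

theorem disj_exp_eq:
 assumes K: "\<And>k F J. finite J ==> F \<in> fock ==> A k F (sublist len J) = C.csum J (degree_part k (mfun F))"
  and I: "finite I" and F: "F \<in> fock"
 shows "disj_exp A k F (sublist len I) = (W1 ^^ k) F (sublist len I) / fact k"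
proof -
 have "disj_power A m k F (sublist len I) = C.dsum m I (degree_part k (mfun F))" for m
  by (rule disj_power_dsum[OF C.connected_structures_axioms _ I F]) (rule K)
 hence "disj_exp A k F (sublist len I) = (\<Sum>m\<le>card I. C.dsum m I (degree_part k (mfun F)) / fact m)"
  by (simp add: disj_exp_def) (simp add: sublist_def)
 also have "... = total I (degree_part k (mfun F))"
  by (rule C.exponential_formula[OF total_empty total_component I])
 also have "... = (W1 ^^ k) F (sublist len I) / fact k"
 proof -
  have "mset (sublist len I) = ctype (cset I) (dset I) (rot I)"
   by (simp add: ctype_rot[OF I] mset_sublist[OF I])
  from W1_power[OF cells[OF I] F this] show ?thesis by (simp add: total_degree[OF I])
 qed
 finally show ?thesis .
qed

end

section \<open>Integral metric graphs as matchings of cells\<close>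

section \<open>First return maps\<close>

locale first_return =
 fixes S U :: "'a set" and \<sigma> :: "'a => 'a"
 assumes finS: "finite S" and perm: "\<sigma> permutes S" and US: "U \<subseteq> S"
  and hits: "\<And>x. x \<in> S ==> \<exists>q. (\<sigma> ^^ q) x \<in> U"
begin

text \<open>In the application U consists of the last cells of the edges. Then \<open>ent x\<close>
  is the last cell of the edge containing x, \<open>nx s\<close> the last cell of the edge following
  s, and \<open>block s\<close> the edge ending at s.\<close>

definition hit :: "'a => nat" where "hit x = (LEAST q. (\<sigma> ^^ q) x \<in> U)"
definition ent :: "'a => 'a" where "ent x = (\<sigma> ^^ hit x) x"
definition nx :: "'a => 'a" where "nx s = ent (\<sigma> s)"
definition block :: "'a => 'a set" where "block s = {x \<in> S. ent x = s}"

lemma \<sigma>_in: "\<sigma> x \<in> S \<longleftrightarrow> x \<in> S" using perm by (rule permutes_in_image)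

lemma pow_in: "(\<sigma> ^^ n) x \<in> S \<longleftrightarrow> x \<in> S"
 by (induction n) (auto simp: \<sigma>_in)

lemma pow_inj: "(\<sigma> ^^ n) x = (\<sigma> ^^ n) y ==> x = y"
 using permutes_inj[OF perm] by (induction n) (auto dest: injD)

lemma finU: "finite U" using US finS finite_subset by blast

lemma ent_in: "x \<in> S ==> ent x \<in> U"
 unfolding ent_def hit_def using hits by (rule LeastI_ex)

lemma hit_least: "q < hit x ==> (\<sigma> ^^ q) x \<notin> U"
 unfolding hit_def by (rule not_less_Least)

lemma ent_U: "x \<in> U ==> ent x = x"
proof -
 assume "x \<in> U"
 hence "hit x = 0" unfolding hit_def by (intro Least_eq_0) simp
 thus ?thesis by (simp add: ent_def)
qed

lemma ent_step: "x \<in> S ==> x \<notin> U ==> ent (\<sigma> x) = ent x"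
proof -
 assume x: "x \<in> S" "x \<notin> U"
 obtain q where q: "(\<sigma> ^^ q) x \<in> U" using hits[OF x(1)] by blast
 have "hit x = Suc (LEAST q. (\<sigma> ^^ Suc q) x \<in> U)"
  unfolding hit_def by (rule Least_Suc[where P = "\<lambda>q. (\<sigma> ^^ q) x \<in> U", OF q]) (use x in simp)
 thus ?thesis by (simp add: ent_def hit_def funpow_swap1)
qed

lemma self_orbit: "x \<in> orbit \<sigma> x" by (rule permutes_orbit_self[OF finS perm])

lemma ent_orbit: "ent x \<in> orbit \<sigma> x"
 unfolding ent_def by (rule funpow_in_orbit[OF self_orbit])

lemma nx_in: "s \<in> S ==> nx s \<in> U"
 by (simp add: nx_def ent_in \<sigma>_in)

definition ret :: "'a => nat" where "ret s = Suc (hit (\<sigma> s))"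

lemma nx_ret: "nx s = (\<sigma> ^^ ret s) s"
 by (simp add: nx_def ent_def ret_def funpow_swap1)

lemma ret_least: "0 < q ==> q < ret s ==> (\<sigma> ^^ q) s \<notin> U"
 using hit_least[of "q - 1" "\<sigma> s"] by (cases q) (auto simp: ret_def funpow_swap1)

text \<open>The block consists of the cells after s up to the first return. A repetition among them,
  or a cell of the block outside this run, would contradict the minimality of a hitting
  time.\<close>

lemma block_nx:
 assumes s: "s \<in> U"
 shows "block (nx s) = (\<lambda>q. (\<sigma> ^^ q) s) ` {1..ret s}" "inj_on (\<lambda>q. (\<sigma> ^^ q) s) {1..ret s}"
  "card (block (nx s)) = ret s"
proof -
 have sS: "s \<in> S" using s US by blast
 show inj: "inj_on (\<lambda>q. (\<sigma> ^^ q) s) {1..ret s}"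
 proof (rule linorder_inj_onI)
  fix q q' assume q: "q < q'" "q \<in> {1..ret s}" "q' \<in> {1..ret s}"
  show "(\<sigma> ^^ q) s \<noteq> (\<sigma> ^^ q') s"
  proof
   assume "(\<sigma> ^^ q) s = (\<sigma> ^^ q') s"
   moreover have "(\<sigma> ^^ q') s = (\<sigma> ^^ q) ((\<sigma> ^^ (q' - q)) s)"
    using q by (simp flip: funpow_add[THEN fun_cong, unfolded comp_def])
   ultimately have "(\<sigma> ^^ q) s = (\<sigma> ^^ q) ((\<sigma> ^^ (q' - q)) s)" by (rule trans)
   hence "s = (\<sigma> ^^ (q' - q)) s" by (rule pow_inj)
   hence "(\<sigma> ^^ (q' - q)) s \<in> U" using s by (rule subst)
   moreover have "0 < q' - q" "q' - q < ret s" using q by auto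
   ultimately show False using ret_least by blast
  qed
 qed (use nat_le_linear in auto)
 have "(\<sigma> ^^ q) s \<in> block (nx s)" if "1 \<le> q" "q \<le> ret s" for q
  using that(2,1)
 proof (induction q rule: inc_induct)
  case base
  have "nx s \<in> U" using nx_in[OF sS] .
  thus ?case using US by (auto simp: block_def ent_U simp flip: nx_ret)
 next
  case (step q)
  hence "ent ((\<sigma> ^^ q) s) = ent (\<sigma> ((\<sigma> ^^ q) s))"
   using ret_least[of q s] sS by (intro ent_step[symmetric]) (auto simp: pow_in)
  thus ?case using step sS by (simp add: block_def \<sigma>_in pow_in)
 qed
 moreover have "x \<in> (\<lambda>q. (\<sigma> ^^ q) s) ` {1..ret s}" if x: "x \<in> block (nx s)" for x
 proof -
  have e: "(\<sigma> ^^ hit x) x = (\<sigma> ^^ ret s) s" using x by (simp add: block_def ent_def nx_ret)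
  have "hit x < ret s"
  proof (rule ccontr)
   assume "\<not> hit x < ret s"
   hence "(\<sigma> ^^ hit x) x = (\<sigma> ^^ ret s) ((\<sigma> ^^ (hit x - ret s)) x)"
    by (simp flip: funpow_add[THEN fun_cong, unfolded comp_def])
   hence "(\<sigma> ^^ ret s) ((\<sigma> ^^ (hit x - ret s)) x) = (\<sigma> ^^ ret s) s" by (rule trans[OF sym e])
   hence "(\<sigma> ^^ (hit x - ret s)) x = s" by (rule pow_inj)
   thus False using hit_least[of "hit x - ret s" x] s \<open>\<not> hit x < ret s\<close> by (simp add: ret_def)
  qed
  hence "(\<sigma> ^^ ret s) s = (\<sigma> ^^ hit x) ((\<sigma> ^^ (ret s - hit x)) s)"
   by (simp flip: funpow_add[THEN fun_cong, unfolded comp_def])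
  hence "(\<sigma> ^^ hit x) x = (\<sigma> ^^ hit x) ((\<sigma> ^^ (ret s - hit x)) s)" by (rule trans[OF e])
  hence "x = (\<sigma> ^^ (ret s - hit x)) s" by (rule pow_inj)
  thus ?thesis using \<open>hit x < ret s\<close> by (intro image_eqI[of _ _ "ret s - hit x"]) auto
 qed
 ultimately show b: "block (nx s) = (\<lambda>q. (\<sigma> ^^ q) s) ` {1..ret s}" by auto
 show "card (block (nx s)) = ret s" unfolding b using inj by (simp add: card_image)
qed

lemma nx_bij: "bij_betw nx U U"
proof -
 have "s = s'" if "s \<in> U" "s' \<in> U" "nx s = nx s'" "ret s \<le> ret s'" for s s'
 proof -
  have "(\<sigma> ^^ ret s') s' = (\<sigma> ^^ ret s) ((\<sigma> ^^ (ret s' - ret s)) s')"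
   using that(4) by (simp flip: funpow_add[THEN fun_cong, unfolded comp_def])
  moreover have "(\<sigma> ^^ ret s') s' = (\<sigma> ^^ ret s) s" using that(3) by (simp only: nx_ret)
  ultimately have "(\<sigma> ^^ ret s) ((\<sigma> ^^ (ret s' - ret s)) s') = (\<sigma> ^^ ret s) s" by (rule trans[OF sym])
  hence e: "(\<sigma> ^^ (ret s' - ret s)) s' = s" by (rule pow_inj)
  have "ret s' - ret s = 0"
  proof (rule ccontr)
   assume "ret s' - ret s \<noteq> 0"
   hence "0 < ret s' - ret s" "ret s' - ret s < ret s'" by (simp_all add: ret_def)
   thus False using ret_least[of "ret s' - ret s" s'] e that(1) by simp
  qed
  thus ?thesis using e by simp
 qed
 hence "inj_on nx U" by (intro inj_onI) (metis nat_le_linear)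
 moreover have "nx ` U \<subseteq> U" using nx_in US by blast
 ultimately show ?thesis using finU by (simp add: bij_betw_def endo_inj_surj)
qed

lemma orbit_nx: "s \<in> U ==> orbit nx s = orbit \<sigma> s \<inter> U"
proof (intro equalityI subsetI)
 fix y assume s: "s \<in> U" and y: "y \<in> orbit nx s"
 have "orbit nx s \<subseteq> orbit \<sigma> s \<inter> U"
 proof -
  have n: "nx z \<in> orbit \<sigma> z" for z unfolding nx_ret by (rule funpow_in_orbit[OF self_orbit])
  show ?thesis
  proof (rule orbit_invariant)
   fix z assume z: "z \<in> orbit \<sigma> s \<inter> U"
   thus "nx z \<in> orbit \<sigma> s \<inter> U" using orbit_trans[OF n, of z] nx_in US by blast
  qed (use s self_orbit in auto)
 qed
 thus "y \<in> orbit \<sigma> s \<inter> U" using y by blast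
next
 fix y assume s: "s \<in> U" and y: "y \<in> orbit \<sigma> s \<inter> U"
 then obtain n where n: "0 < n" "y = (\<sigma> ^^ n) s" by (auto simp: orbit_altdef)
 have "y \<in> U" using y by blast
 thus "y \<in> orbit nx s" using n s
 proof (induction n arbitrary: s rule: less_induct)
  case (less n)
  have r: "ret s \<le> n"
  proof (rule ccontr)
   assume "\<not> ret s \<le> n" thus False using ret_least[of n s] less.prems by auto
  qed
  show ?case
  proof (cases "ret s = n")
   case True
   hence "nx s = y" using less.prems by (simp add: nx_ret)
   thus ?thesis using orbit.base[of nx s] by (simp only:)
  next
   case False
   have e: "y = (\<sigma> ^^ (n - ret s)) (nx s)"
    using r less.prems(3) by (simp add: nx_ret flip: funpow_add[THEN fun_cong, unfolded comp_def])
   have "nx s \<in> U" using nx_in less.prems(4) US by blast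
   hence "y \<in> orbit nx (nx s)"
    using less.IH[of "n - ret s" "nx s"] False r e less.prems(1) by (simp add: ret_def)
   thus ?thesis by (rule orbit_subset)
  qed
 qed
qed

text \<open>Each block contains exactly one element of U, its end, so leaving out U costs one cell
  per block. The second count will be the sum of the exponents c of edges with c + 1 cells.\<close>

lemma card_by_blocks:
 assumes O: "O' \<subseteq> S" and clo: "\<And>x. x \<in> S ==> x \<in> O' \<longleftrightarrow> ent x \<in> O'"
 shows "card O' = (\<Sum>s\<in>O' \<inter> U. card (block s))" "card (O' - U) = (\<Sum>s\<in>O' \<inter> U. card (block s) - 1)"
proof -
 have fin: "finite (O' \<inter> U)" "finite O'" using finU O finS finite_subset by auto
 have fb: "finite (block s)" for s using finS by (simp add: block_def)
 have eq: "O' = (\<Union>s\<in>O' \<inter> U. block s)"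
 proof (intro equalityI subsetI)
  fix x assume "x \<in> O'"
  thus "x \<in> (\<Union>s\<in>O' \<inter> U. block s)" using O clo[of x] ent_in[of x] by (auto simp: block_def)
 next
  fix x assume "x \<in> (\<Union>s\<in>O' \<inter> U. block s)"
  thus "x \<in> O'" using clo[of x] by (auto simp: block_def)
 qed
 have "card (\<Union>s\<in>O' \<inter> U. block s) = (\<Sum>s\<in>O' \<inter> U. card (block s))"
  by (rule card_UN_disjoint) (use fin fb in \<open>auto simp: block_def\<close>)
 thus c: "card O' = (\<Sum>s\<in>O' \<inter> U. card (block s))" using eq by simp
 have pos: "1 \<le> card (block s)" if "s \<in> U" for s
 proof -
  have "s \<in> block s" using that US ent_U by (auto simp: block_def)
  thus ?thesis using fb[of s] by (metis One_nat_def Suc_leI card_gt_0_iff empty_iff)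
 qed
 have "card (O' - U) = card O' - card (O' \<inter> U)" by (rule card_Diff_subset_Int[OF fin(1)])
 also have "... = (\<Sum>s\<in>O' \<inter> U. card (block s)) - (\<Sum>s\<in>O' \<inter> U. 1)" by (simp add: c)
 also have "... = (\<Sum>s\<in>O' \<inter> U. card (block s) - 1)"
  using pos by (intro sum_subtractf_nat[symmetric]) auto
 finally show "card (O' - U) = (\<Sum>s\<in>O' \<inter> U. card (block s) - 1)" .
qed

lemma ent_orbit_iff: "x \<in> S ==> x \<in> orbit \<sigma> z \<longleftrightarrow> ent x \<in> orbit \<sigma> z"
 using permutes_orbit_eq[OF finS perm] ent_orbit self_orbit by metis

end

text \<open>Composing with an involution supported on \<open>U\<close> changes the order of the blocks, not the
 blocks themselves.\<close>

locale matched_return = first_return +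
 fixes \<tau> :: "'a => 'a"
 assumes \<tau>\<tau>: "\<tau> (\<tau> x) = x" and moved: "moved \<tau> = U"
begin

lemma \<tau>_id: "x \<notin> U ==> \<tau> x = x" using moved by (auto simp: moved_def)

lemma \<tau>_U: "x \<in> U ==> \<tau> x \<in> U" "x \<in> U ==> \<tau> x \<noteq> x"
 using moved \<tau>\<tau> by (auto simp: moved_def)

lemma \<tau>_perm: "\<tau> permutes S"
 by (rule involution_permutes[OF \<tau>\<tau>]) (use moved US in auto)

text \<open>Before its first visit to U a trajectory meets only cells fixed by \<tau>.\<close>

lemma pow_eq: "q \<le> hit x ==> ((\<sigma> \<circ> \<tau>) ^^ q) x = (\<sigma> ^^ q) x"
 by (induction q) (auto simp: \<tau>_id hit_least)

sublocale M: first_return S U "\<sigma> \<circ> \<tau>"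
proof
 show "finite S" "U \<subseteq> S" by (rule finS US)+
 show "\<sigma> \<circ> \<tau> permutes S" by (rule permutes_compose[OF \<tau>_perm perm])
 fix x assume "x \<in> S"
 hence "((\<sigma> \<circ> \<tau>) ^^ hit x) x \<in> U" using ent_in[of x] pow_eq[of "hit x" x] by (simp add: ent_def)
 thus "\<exists>q. ((\<sigma> \<circ> \<tau>) ^^ q) x \<in> U" ..
qed

lemma M_ent: "x \<in> S ==> M.ent x = ent x"
proof -
 assume x: "x \<in> S"
 have "M.hit x = hit x"
  unfolding M.hit_def
 proof (rule Least_equality)
  show "((\<sigma> \<circ> \<tau>) ^^ hit x) x \<in> U" using ent_in[OF x] pow_eq[of "hit x" x] by (simp add: ent_def)
  fix q assume "((\<sigma> \<circ> \<tau>) ^^ q) x \<in> U"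
  thus "hit x \<le> q" using hit_least[of q x] pow_eq[of q x] by (metis not_le_imp_less order.strict_implies_order)
 qed
 thus ?thesis by (simp add: M.ent_def ent_def pow_eq)
qed

lemma M_block: "M.block s = block s"
 by (auto simp: M.block_def block_def M_ent)

lemma M_nx: "s \<in> U ==> M.nx s = nx (\<tau> s)"
proof -
 assume "s \<in> U"
 hence "\<sigma> (\<tau> s) \<in> S" using \<tau>_U(1) US by (auto simp: \<sigma>_in)
 thus ?thesis by (simp add: M.nx_def nx_def M_ent)
qed

lemma orbit_M_nx: "s \<in> U ==> orbit (\<lambda>s. nx (\<tau> s)) s = orbit (\<sigma> \<circ> \<tau>) s \<inter> U"
proof -
 assume s: "s \<in> U"
 have "orbit (\<lambda>s. nx (\<tau> s)) (id s) = id ` orbit M.nx s"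
 proof (rule orbit_image_on[where S = U])
  fix x assume x: "x \<in> U"
  hence xS: "x \<in> S" using US by blast
  show "M.nx x \<in> U" by (rule M.nx_in[OF xS])
  show "id (M.nx x) = nx (\<tau> (id x))" using M_nx[OF x] by simp
 qed (rule s)
 thus ?thesis using M.orbit_nx[OF s] by simp
qed

lemma card_orbit_rest:
 assumes "z \<in> S"
 shows "card (orbit (\<sigma> \<circ> \<tau>) z - U) = (\<Sum>s\<in>orbit (\<sigma> \<circ> \<tau>) z \<inter> U. card (block s) - 1)"
 using M.card_by_blocks(2)[of "orbit (\<sigma> \<circ> \<tau>) z"] M.ent_orbit_iff permutes_orbit_sub[OF M.perm assms]
 by (simp add: M_block)

end

section \<open>The ribbon graph of a connected matching\<close>

text \<open>Needed because the graph follows its negative boundaries against the first return map of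
  \<open>\<sigma> \<circ> \<tau>\<close>.\<close>

lemma orbit_inverse_on:
 assumes U: "finite U" and fg: "\<And>x. x \<in> U ==> f x \<in> U" "\<And>x. x \<in> U ==> g x \<in> U"
  "\<And>x. x \<in> U ==> g (f x) = x" "\<And>x. x \<in> U ==> f (g x) = x" and x: "x \<in> U"
 shows "orbit g x = orbit f x"
proof -
 have sub: "orbit h y \<subseteq> orbit h' y"
  if h: "\<And>x. x \<in> U ==> h x \<in> U" "\<And>x. x \<in> U ==> h' x \<in> U" "\<And>x. x \<in> U ==> h' (h x) = x" and y: "y \<in> U"
  for h h' y
 proof -
  define f' where "f' x = (if x \<in> U then h' x else x)" for x
  have inj: "inj_on h U" using h(3) by (metis inj_onI)
  hence bh: "bij_betw h U U" using h(1) U by (simp add: bij_betw_def endo_inj_surj image_subsetI)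
  have p: "f' permutes U"
  proof (rule bij_imp_permutes)
   have "h (h' z) = z" if "z \<in> U" for z
    using bij_betw_ex[OF bh that] h(3) by metis
   thus "bij_betw f' U U"
    using h by (intro bij_betw_byWitness[where f' = h]) (auto simp: f'_def)
  qed (simp add: f'_def)
  have "orbit h' (id y) = id ` orbit f' y"
   by (rule orbit_image_on[where S = U]) (use y h in \<open>auto simp: f'_def\<close>)
  hence o: "orbit h' y = orbit f' y" by simp
  have "orbit h y \<subseteq> orbit f' y \<inter> U"
  proof (rule orbit_invariant)
   show "y \<in> orbit f' y \<inter> U" using y permutes_orbit_self[OF U p] by blast
   fix z assume z: "z \<in> orbit f' y \<inter> U"
   have "f' (h z) = z" using h z by (simp add: f'_def)
   hence "z \<in> orbit f' (h z)" by (metis orbit.base)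
   hence "orbit f' (h z) = orbit f' y" using permutes_orbit_eq[OF U p] z by (metis IntD1)
   thus "h z \<in> orbit f' y \<inter> U" using permutes_orbit_self[OF U p, of "h z"] h z by simp
  qed
  thus ?thesis using o by blast
 qed
 show ?thesis using sub[of g f x] sub[of f g x] fg x by blast
qed

text \<open>The generic situation: every circle has live cells and at least one pair is matched. The
  remaining cases are settled in \<open>K_connected_csum\<close>.\<close>

locale index_set = circles +
 fixes J :: "nat set" and k :: nat
 assumes finJ: "finite J" and J0: "J \<noteq> {}" and len0: "\<And>i. i \<in> J ==> 0 < len i" and k0: "0 < k"
begin

abbreviation "S \<equiv> cset J"
abbreviation "\<sigma> \<equiv> rot J"

definition en :: "nat => nat" where "en i = sorted_list_of_set J ! i"
definition idx :: "nat => nat" where "idx = inv_into {..<card J} en"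

lemma en_bij: "bij_betw en {..<card J} J"
proof -
 have "bij_betw ((!) (sorted_list_of_set J)) {..<length (sorted_list_of_set J)} J"
  using finJ by (intro bij_betw_nth) auto
 thus ?thesis by (simp add: en_def[abs_def])
qed

lemma idx: "j \<in> J ==> idx j < card J" "j \<in> J ==> en (idx j) = j" "i < card J ==> idx (en i) = i"
 "i < card J ==> en i \<in> J"
proof -
 show "j \<in> J ==> idx j < card J" "j \<in> J ==> en (idx j) = j"
  using en_bij inv_into_into[of j en "{..<card J}"] f_inv_into_f[of j en "{..<card J}"]
  by (auto simp: idx_def bij_betw_def)
 show "i < card J ==> idx (en i) = i" "i < card J ==> en i \<in> J"
  using en_bij by (auto simp: idx_def bij_betw_def inv_into_f_f)
qed

lemma S_eq: "S = (SIGMA i:J. {..<len i})"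
 using len0 by (force simp: cset_def)

lemma live_S: "live J = S" by (simp add: S_eq live_def)

lemma dset_empty: "dset J = {}" using len0 by (auto simp: dset_def cset_def)

lemma finS: "finite S" by (rule finite_cset[OF finJ])

lemma perm\<sigma>: "\<sigma> permutes S" by (rule rot_permutes[OF finJ])

lemma fst_S: "x \<in> S ==> fst x \<in> J" by (auto simp: S_eq)

lemma orbit\<sigma>_iff: "x \<in> S ==> y \<in> S ==> y \<in> orbit \<sigma> x \<longleftrightarrow> fst y = fst x"
proof -
 assume x: "x \<in> S" and y: "y \<in> S"
 obtain i p where ip: "x = (i, p)" by force
 have "i \<in> J" using fst_S[OF x] ip by simp
 hence "max 1 (len i) = len i" using len0[of i] by simp
 thus ?thesis using orbit_rot[OF finJ, of i p] x y ip by (cases y) (auto simp: S_eq)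
qed

definition conn_matchings :: "(nat \<times> nat => nat \<times> nat) set" where
 "conn_matchings = {\<tau> \<in> conn J. card (moved \<tau>) = 2 * k}"

end

locale connected_matching = index_set +
 fixes \<tau> :: "nat \<times> nat => nat \<times> nat"
 assumes \<tau>: "\<tau> \<in> conn_matchings"
begin

abbreviation "U \<equiv> moved \<tau>"

lemma inv\<tau>: "\<tau> \<in> involutions S" using \<tau> by (simp add: conn_matchings_def conn_def live_S)

lemma cardU: "card U = 2 * k" using \<tau> by (simp add: conn_matchings_def)

lemma U0: "U \<noteq> {}" using cardU k0 by auto

lemma US: "U \<subseteq> S" by (rule involutionsD(2)[OF inv\<tau>])

lemma connectedD: "I \<subseteq> J ==> I \<noteq> {} ==> keeps \<tau> I ==> I = J"
 using \<tau> by (auto simp: conn_matchings_def conn_def)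

text \<open>A circle without matched cells would be a component by itself, hence the only circle,
  and then no cell at all would be matched.\<close>

lemma fibre_U: assumes i: "i \<in> J" shows "\<exists>s\<in>U. fst s = i"
proof (rule ccontr)
 assume n: "\<not> (\<exists>s\<in>U. fst s = i)"
 have "keeps \<tau> {i}" unfolding keeps_def
 proof (intro allI impI)
  fix x :: "nat \<times> nat" assume "fst x \<in> {i}"
  hence "\<tau> x = x" using n by (cases x) (auto simp: moved_def)
  thus "fst (\<tau> x) \<in> {i}" using \<open>fst x \<in> {i}\<close> by simp
 qed
 hence "{i} = J" using connectedD[of "{i}"] i by blast
 thus False using n U0 US fst_S by blast
qed

sublocale R: matched_return S U \<sigma> \<tau>
proof
 show "finite S" "\<sigma> permutes S" "U \<subseteq> S" by (rule finS perm\<sigma> US)+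
 show "\<tau> (\<tau> x) = x" for x by (rule involutionsD(1)[OF inv\<tau>])
 show "U = U" ..
 fix x assume x: "x \<in> S"
 obtain s where s: "s \<in> U" "fst s = fst x" using fibre_U[OF fst_S[OF x]] by blast
 hence "s \<in> orbit \<sigma> x" using orbit\<sigma>_iff[OF x, of s] US by blast
 thus "\<exists>q. (\<sigma> ^^ q) x \<in> U" using s(1) by (auto simp: orbit_altdef)
qed

text \<open>\<open>nxm\<close> is the first return map of \<open>\<sigma> \<circ> \<tau>\<close> to
  the matched cells. The ribbon graph uses its inverse \<open>pm\<close>, because the two boundaries
  along an edge traverse it in opposite directions.\<close>

definition nxm :: "nat \<times> nat => nat \<times> nat" where "nxm s = R.nx (\<tau> s)"
definition pm :: "nat \<times> nat => nat \<times> nat" where "pm = inv_into U nxm"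

lemma nx_in: "s \<in> U ==> R.nx s \<in> U" using R.nx_in US by blast

lemma nxm_bij: "bij_betw nxm U U"
proof -
 have "bij_betw \<tau> U U" using R.\<tau>_U(1) R.\<tau>\<tau> by (intro bij_betw_byWitness[where f' = \<tau>]) auto
 hence "bij_betw (R.nx \<circ> \<tau>) U U" using R.nx_bij by (rule bij_betw_trans)
 thus ?thesis by (simp add: nxm_def[abs_def] comp_def)
qed

lemma pm: "s \<in> U ==> pm s \<in> U" "s \<in> U ==> nxm (pm s) = s" "s \<in> U ==> pm (nxm s) = s"
 "s \<in> U ==> nxm s \<in> U"
 using nxm_bij by (auto simp: pm_def bij_betw_def inv_into_into f_inv_into_f)

lemma pm_nx: "s \<in> U ==> pm (R.nx s) = \<tau> s"
 using pm(3)[of "\<tau> s"] R.\<tau>_U(1) by (simp add: nxm_def R.\<tau>\<tau>)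

text \<open>Connectedness as transitivity on cells: a set stable under \<sigma> is a union of whole
  circles, and stability under \<tau> makes this set of circles kept.\<close>

lemma invariant_all:
 assumes A: "A \<subseteq> S" "A \<noteq> {}" and cl: "\<And>x. x \<in> A ==> \<sigma> x \<in> A" "\<And>x. x \<in> A ==> \<tau> x \<in> A"
 shows "A = S"
proof -
 have full: "y \<in> A" if x: "x \<in> A" and y: "y \<in> S" "fst y = fst x" for x y
 proof -
  have "y \<in> orbit \<sigma> x" using orbit\<sigma>_iff[of x y] x y A by blast
  thus ?thesis using orbit_invariant[of A \<sigma> x] cl(1) x by blast
 qed
 have "keeps \<tau> (fst ` A)" unfolding keeps_def
 proof (intro allI impI)
  fix x :: "nat \<times> nat" assume "fst x \<in> fst ` A"
  then obtain a where a: "a \<in> A" "fst x = fst a" by blast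
  show "fst (\<tau> x) \<in> fst ` A"
  proof (cases "x \<in> S")
   case True thus ?thesis using full[OF a(1)] a(2) cl(2) by blast
  next
   case False hence "\<tau> x = x" using R.\<tau>_id US by blast
   thus ?thesis using a by simp
  qed
 qed
 moreover have "fst ` A \<subseteq> J" using A fst_S by blast
 ultimately have "fst ` A = J" using connectedD A(2) by blast
 hence "S \<subseteq> A" using full fst_S by (metis (no_types, opaque_lifting) imageE subsetI)
 thus ?thesis using A(1) by blast
qed

lemma neg_orbit: "s \<in> U ==> orbit pm s = orbit (\<sigma> \<circ> \<tau>) s \<inter> U"
proof -
 assume s: "s \<in> U"
 have "orbit pm s = orbit nxm s" using pm by (intro orbit_inverse_on[OF R.finU _ _ _ _ s]) auto
 thus ?thesis using R.orbit_M_nx[OF s] by (simp add: nxm_def[abs_def])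
qed

end

locale labelled_matching = connected_matching +
 fixes nm :: nat and lam :: "(nat \<times> nat) set => nat"
 assumes lam: "bij_betw lam (orbit (rot J \<circ> \<tau>) ` cset J) {..<nm}"
begin

text \<open>\<open>(s, True)\<close> and \<open>(s, False)\<close> are the positive and the negative
  side of the edge with last cell s. The boundary permutation is to be \<open>nx\<close> on positive
  and \<open>pm\<close> on negative sides; \<open>vperm\<close> is then forced by the definition of
  \<open>bperm\<close>.\<close>

definition gamma :: "((nat \<times> nat) \<times> bool) ribbon_graph" where
 "gamma = \<lparr>half_edges = U \<times> UNIV,
   vperm = (\<lambda>(s, p). if s \<in> U then if p then (pm s, False) else (R.nx s, True) else (s, p)),
   einv = (\<lambda>(s, p). if s \<in> U then (s, \<not> p) else (s, p)),
   bdry = (\<lambda>x\<in>U \<times> UNIV. if snd x then Inl (idx (fst (fst x))) else Inr (lam (orbit (\<sigma> \<circ> \<tau>) (fst x))))\<rparr>"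

lemma gamma_simps:
 "half_edges gamma = U \<times> UNIV"
 "s \<in> U ==> vperm gamma (s, True) = (pm s, False)" "s \<in> U ==> vperm gamma (s, False) = (R.nx s, True)"
 "s \<in> U ==> einv gamma (s, p) = (s, \<not> p)"
 "s \<in> U ==> bdry gamma (s, True) = Inl (idx (fst s))"
 "s \<in> U ==> bdry gamma (s, False) = Inr (lam (orbit (\<sigma> \<circ> \<tau>) s))"
 "s \<in> U ==> bperm gamma (s, True) = (R.nx s, True)" "s \<in> U ==> bperm gamma (s, False) = (pm s, False)"
 by (simp_all add: gamma_def bperm_def)

lemma gamma_standard: "standard_graph gamma"
 unfolding standard_graph_def
proof (intro conjI)
 show "bdry gamma \<in> extensional (half_edges gamma)" by (simp add: gamma_def)
 show "einv gamma permutes half_edges gamma"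
 proof (rule bij_imp_permutes)
  show "bij_betw (einv gamma) (half_edges gamma) (half_edges gamma)"
   by (rule bij_betw_byWitness[where f' = "einv gamma"]) (auto simp: gamma_simps)
 qed (auto simp: gamma_def split: if_splits)
 show "vperm gamma permutes half_edges gamma"
 proof (rule bij_imp_permutes)
  have i: "inv_into U R.nx s \<in> U" "R.nx (inv_into U R.nx s) = s" "inv_into U R.nx (R.nx s) = s" if "s \<in> U" for s
   using R.nx_bij that by (auto simp: bij_betw_def inv_into_into f_inv_into_f)
  show "bij_betw (vperm gamma) (half_edges gamma) (half_edges gamma)"
  proof (rule bij_betw_byWitness[where f' = "\<lambda>(s, p). if p then (inv_into U R.nx s, False) else (nxm s, True)"])
   show "\<forall>a\<in>half_edges gamma. (case vperm gamma a of (s, p) => if p then (inv_into U R.nx s, False) else (nxm s, True)) = a"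
    using i pm by (auto simp: gamma_simps gamma_def)
   show "\<forall>a\<in>half_edges gamma. vperm gamma (case a of (s, p) => if p then (inv_into U R.nx s, False) else (nxm s, True)) = a"
    using i pm by (auto simp: gamma_simps gamma_def)
   show "vperm gamma ` half_edges gamma \<subseteq> half_edges gamma"
    using pm nx_in by (auto simp: gamma_def split: if_splits)
   show "(\<lambda>(s, p). if p then (inv_into U R.nx s, False) else (nxm s, True)) ` half_edges gamma \<subseteq> half_edges gamma"
    using pm i by (auto simp: gamma_def split: if_splits)
  qed
 qed (auto simp: gamma_def split: if_splits)
qed

lemma gamma_ribbon: "is_ribbon_graph gamma"
 using gamma_standard U0 R.finU
 by (auto simp: is_ribbon_graph_def standard_graph_def gamma_simps(1,4))

lemma gamma_connected: "rg_connected gamma"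
proof -
 let ?E = "{(x, y). x \<in> half_edges gamma \<and> (y = vperm gamma x \<or> y = einv gamma x)}"
 have e: "((s, p), (s, \<not> p)) \<in> ?E\<^sup>*" if "s \<in> U" for s p
  using that by (intro r_into_rtrancl) (auto simp: gamma_simps)
 have v: "((s, False), (R.nx s, True)) \<in> ?E\<^sup>*" "((s, True), (pm s, False)) \<in> ?E\<^sup>*" if "s \<in> U" for s
  using that by (auto simp: gamma_simps intro!: r_into_rtrancl)
 have nxs: "((s, True), (R.nx s, True)) \<in> ?E\<^sup>*" if "s \<in> U" for s
  using e[OF that, of True] v(1)[OF that] by simp
 \<comment> \<open>From s to \<open>nx s\<close> along the positive boundary, then around the
   vertex: \<open>pm\<close> undoes \<open>nx\<close> up to \<tau>.\<close>
 have ts: "((s, True), (\<tau> s, True)) \<in> ?E\<^sup>*" if s: "s \<in> U" for s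
 proof -
  have "((R.nx s, True), (\<tau> s, False)) \<in> ?E\<^sup>*" using v(2)[OF nx_in[OF s]] by (simp add: pm_nx[OF s])
  moreover have "((\<tau> s, False), (\<tau> s, True)) \<in> ?E\<^sup>*" using e[OF R.\<tau>_U(1)[OF s], of False] by simp
  ultimately show ?thesis by (rule rtrancl_trans[OF nxs[OF s] rtrancl_trans])
 qed
 have reach: "(h, (s', True)) \<in> ?E\<^sup>*" if h: "h \<in> half_edges gamma" and s': "s' \<in> U" for h s'
 proof -
  obtain s p where sp: "h = (s, p)" "s \<in> U" using h by (auto simp: gamma_simps)
  have h0: "(h, (s, True)) \<in> ?E\<^sup>*" using e[OF sp(2), of False] sp by (cases p) auto
  \<comment> \<open>The cells whose edge can be reached from h; the set is stable under \<sigma> and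
    \<tau>, so it contains every cell.\<close>
  define A where "A = {x \<in> S. (h, (R.ent x, True)) \<in> ?E\<^sup>*}"
  have "A = S"
  proof (rule invariant_all)
   have "s \<in> A" using h0 sp US R.ent_U by (auto simp: A_def)
   thus "A \<noteq> {}" by blast
   show "A \<subseteq> S" by (auto simp: A_def)
   fix x assume "x \<in> A"
   hence x: "x \<in> S" "(h, (R.ent x, True)) \<in> ?E\<^sup>*" by (auto simp: A_def)
   show "\<sigma> x \<in> A"
   proof (cases "x \<in> U")
    case True
    have "(h, (R.nx x, True)) \<in> ?E\<^sup>*" by (rule rtrancl_trans[OF x(2)[unfolded R.ent_U[OF True]] nxs[OF True]])
    thus ?thesis using x by (simp add: A_def R.\<sigma>_in R.nx_def)
   next
    case False
    thus ?thesis using x R.ent_step by (simp add: A_def R.\<sigma>_in)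
   qed
   show "\<tau> x \<in> A"
   proof (cases "x \<in> U")
    case True
    have "(h, (\<tau> x, True)) \<in> ?E\<^sup>*" by (rule rtrancl_trans[OF x(2)[unfolded R.ent_U[OF True]] ts[OF True]])
    thus ?thesis using R.\<tau>_U(1)[OF True] US R.ent_U by (auto simp: A_def)
   next
    case False
    thus ?thesis using \<open>x \<in> A\<close> R.\<tau>_id by simp
   qed
  qed
  hence "s' \<in> A" using s' US by blast
  thus ?thesis using R.ent_U[OF s'] by (simp add: A_def)
 qed
 have "(h, h') \<in> ?E\<^sup>*" if h: "h \<in> half_edges gamma" "h' \<in> half_edges gamma" for h h'
 proof -
  obtain s p where sp: "h' = (s, p)" "s \<in> U" using h by (auto simp: gamma_simps)
  have "((s, True), h') \<in> ?E\<^sup>*" using e[OF sp(2), of True] sp by (cases p) auto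
  thus ?thesis by (rule rtrancl_trans[OF reach[OF h(1) sp(2)]])
 qed
 thus ?thesis by (simp add: rg_connected_def)
qed

lemma gamma_labelled: "boundary_labelled (card J) nm gamma"
 unfolding boundary_labelled_def
proof (intro conjI ballI)
 let ?O = "orbit (\<sigma> \<circ> \<tau>)"
 show "bdry gamma \<in> extensional (half_edges gamma)" using gamma_standard by (simp add: standard_graph_def)
 show "bdry gamma ` half_edges gamma = {..<card J} <+> {..<nm}"
 proof (intro equalityI subsetI)
  fix l assume "l \<in> bdry gamma ` half_edges gamma"
  then obtain s p where s: "s \<in> U" "l = bdry gamma (s, p)" by (auto simp: gamma_simps(1))
  have "idx (fst s) < card J" using idx(1) fst_S US s by blast
  moreover have "lam (?O s) < nm" using bij_betwE[OF lam] US s by blast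
  ultimately show "l \<in> {..<card J} <+> {..<nm}" using s by (cases p) (auto simp: gamma_simps)
 next
  fix l assume "l \<in> {..<card J} <+> {..<nm}"
  then consider i where "i < card J" "l = Inl i" | j where "j < nm" "l = Inr j" by auto
  thus "l \<in> bdry gamma ` half_edges gamma"
  proof cases
   case 1
   obtain s where s: "s \<in> U" "fst s = en i" using fibre_U[OF idx(4)[OF 1(1)]] by blast
   hence "l = bdry gamma (s, True)" using 1 by (simp add: gamma_simps idx)
   thus ?thesis using s by (auto simp: gamma_simps(1))
  next
   case 2
   obtain x where x: "x \<in> S" "lam (?O x) = j" using bij_betw_ex[OF lam, of j] 2 by auto
   have "R.M.ent x \<in> U" by (rule R.M.ent_in[OF x(1)])
   moreover have "?O (R.M.ent x) = ?O x" by (rule permutes_orbit_eq[OF finS R.M.perm R.M.ent_orbit])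
   ultimately have "l = bdry gamma (R.M.ent x, False)" using x 2 by (simp add: gamma_simps)
   thus ?thesis using \<open>R.M.ent x \<in> U\<close> by (auto simp: gamma_simps(1))
  qed
 qed
 fix h h' assume h: "h \<in> half_edges gamma" "h' \<in> half_edges gamma"
 then obtain s p s' p' where sp: "h = (s, p)" "h' = (s', p')" and s: "s \<in> U" "s' \<in> U" by (auto simp: gamma_simps(1))
 have oT: "orbit (bperm gamma) (s, True) = (\<lambda>s. (s, True)) ` (orbit \<sigma> s \<inter> U)"
  unfolding R.orbit_nx[OF s(1), symmetric]
  by (rule orbit_image_on[where S = U]) (use s nx_in in \<open>auto simp: gamma_simps\<close>)
 have oF: "orbit (bperm gamma) (s, False) = (\<lambda>s. (s, False)) ` (?O s \<inter> U)"
  unfolding neg_orbit[OF s(1), symmetric]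
  by (rule orbit_image_on[where S = U]) (use s pm in \<open>auto simp: gamma_simps\<close>)
 have 1: "idx (fst s) = idx (fst s') \<longleftrightarrow> s' \<in> orbit \<sigma> s"
 proof -
  have "s \<in> S" "s' \<in> S" using s US by auto
  thus ?thesis using orbit\<sigma>_iff idx(2) fst_S by metis
 qed
 have 2: "lam (?O s) = lam (?O s') \<longleftrightarrow> s' \<in> ?O s"
 proof -
  have "?O s \<in> ?O ` S" "?O s' \<in> ?O ` S" using s US by auto
  hence a: "(lam (?O s) = lam (?O s')) = (?O s = ?O s')"
   by (rule inj_on_eq_iff[OF bij_betw_imp_inj_on[OF lam]])
  show ?thesis by (rule trans[OF a trans[OF eq_commute permutes_orbit_eq_iff[OF finS R.M.perm]]])
 qed
 show "bdry gamma h = bdry gamma h' \<longleftrightarrow> h' \<in> orbit (bperm gamma) h"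
  using s 1 2 unfolding sp by (cases p; cases p') (auto simp: gamma_simps oT oF)
qed

text \<open>Two steps around a vertex lead to the other edge arriving there, that is, to the matched
  cell; this recovers \<tau> from the graph.\<close>

lemma gamma_vperm2: "s \<in> U ==> vperm gamma (vperm gamma (s, False)) = (\<tau> s, False)"
 by (simp add: gamma_simps nx_in pm_nx)

lemma gamma_four_valent: "four_valent gamma"
 unfolding four_valent_def verts_def
proof clarify
 let ?v = "vperm gamma"
 have v: "?v permutes half_edges gamma" using gamma_standard by (simp add: standard_graph_def)
 have fin: "finite (half_edges gamma)" using R.finU by (simp add: gamma_simps(1))
 have F: "card (orbit ?v (s, False)) = 4" if s: "s \<in> U" for s
 proof -
  \<comment> \<open>The edges ending at s and at \<tau> s arrive at the vertex and their successors
    leave it; arriving and leaving sides alternate.\<close>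
  let ?X = "{(s, False), (R.nx s, True), (\<tau> s, False), (R.nx (\<tau> s), True)}"
  have t: "\<tau> s \<in> U" "\<tau> s \<noteq> s" using R.\<tau>_U s by auto
  have st: "?v (s, False) = (R.nx s, True)" "?v (R.nx s, True) = (\<tau> s, False)"
    "?v (\<tau> s, False) = (R.nx (\<tau> s), True)" "?v (R.nx (\<tau> s), True) = (s, False)"
   using s t by (simp_all add: gamma_simps nx_in pm_nx R.\<tau>\<tau>)
  have "orbit ?v (s, False) \<subseteq> ?X" by (rule orbit_invariant) (use st in auto)
  moreover have "?X \<subseteq> orbit ?v (s, False)"
  proof -
   have 1: "(R.nx s, True) \<in> orbit ?v (s, False)" using orbit.base[of ?v "(s, False)"] by (simp only: st)
   have 2: "(\<tau> s, False) \<in> orbit ?v (s, False)" using orbit.step[OF 1] by (simp only: st)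
   have 3: "(R.nx (\<tau> s), True) \<in> orbit ?v (s, False)" using orbit.step[OF 2] by (simp only: st)
   have 4: "(s, False) \<in> orbit ?v (s, False)" using orbit.step[OF 3] by (simp only: st)
   show ?thesis using 1 2 3 4 by blast
  qed
  ultimately have "orbit ?v (s, False) = ?X" by (rule subset_antisym)
  moreover have "R.nx s \<noteq> R.nx (\<tau> s)" using R.nx_bij s t by (auto simp: bij_betw_def inj_on_def)
  ultimately show ?thesis using t by auto
 qed
 fix s p assume "(s, p) \<in> half_edges gamma"
 hence s: "s \<in> U" by (simp add: gamma_simps(1))
 show "card (orbit ?v (s, p)) = 4"
 proof (cases p)
  case True
  have "orbit ?v (s, p) = orbit ?v (?v (s, p))" by (rule orbit_image_step[OF fin v, symmetric])
  thus ?thesis using F[OF pm(1)[OF s]] s True by (simp add: gamma_simps)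
 next
  case False thus ?thesis using F[OF s] by simp
 qed
qed

lemma gamma_directed_graph: "directed_graph (card J) nm gamma"
proof
 show "directed gamma" by (auto simp: directed_def gamma_simps) (metis (full_types) gamma_simps(5,6) sum.disc)+
qed (rule gamma_ribbon gamma_connected gamma_labelled gamma_four_valent)+

end

section \<open>Integral metric ribbon graphs and matchings\<close>

context index_set
begin

definition b :: "nat list" where "b = sublist len J"

lemma b: "length b = card J" "i < card J ==> b ! i = len (en i)"
 by (simp_all add: b_def sublist_def en_def)

text \<open>\<open>pos h\<close> is the last cell of the edge containing the positive half-edge \<open>h\<close>.\<close>

definition positions :: "nat ribbon_graph => (nat => nat) => (nat => nat \<times> nat) set" where
 "positions G c = {pos \<in> pos_half G \<rightarrow>\<^sub>E S. \<forall>h\<in>pos_half G. bdry G h = Inl (idx (fst (pos h))) \<and>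
   pos (bperm G h) = (\<sigma> ^^ Suc (c (bperm G h))) (pos h)}"

definition metric_graphs :: "nat => (nat ribbon_graph \<times> (nat => nat) \<times> (nat => nat \<times> nat)) set" where
 "metric_graphs nm = {(G, c, pos). directed_graph (card J) nm G \<and> half_edges G = {..<4 * k} \<and>
   c \<in> half_coeffs G b \<and> pos \<in> positions G c}"

text \<open>Labellings and \<open>numberings\<close> are the choices that make a matching a graph
  with numbered boundaries on the half-edges below 4k. If \<open>\<sigma> \<circ> \<tau>\<close> has
  nm cycles there are \<open>fact nm\<close> and \<open>fact (4 * k)\<close> of them, the
  denominators in \<open>K_op_graphs\<close>.\<close>

definition labellings :: "nat => (nat \<times> nat => nat \<times> nat) => ((nat \<times> nat) set => nat) set" where
 "labellings nm \<tau> = {lam \<in> extensional (orbit (\<sigma> \<circ> \<tau>) ` S). bij_betw lam (orbit (\<sigma> \<circ> \<tau>) ` S) {..<nm}}"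

definition numberings :: "(nat \<times> nat => nat \<times> nat) => ((nat \<times> nat) \<times> bool => nat) set" where
 "numberings \<tau> = {\<beta> \<in> extensional (moved \<tau> \<times> UNIV). bij_betw \<beta> (moved \<tau> \<times> UNIV) {..<4 * k}}"

definition labelled_matchings where
 "labelled_matchings nm = {(\<tau>, lam, \<beta>). \<tau> \<in> conn_matchings \<and> lam \<in> labellings nm \<tau> \<and> \<beta> \<in> numberings \<tau>}"

end

locale numbered_matching = labelled_matching +
 fixes \<beta> :: "(nat \<times> nat) \<times> bool => nat"
 assumes \<beta>: "bij_betw \<beta> (moved \<tau> \<times> UNIV) {..<4 * k}"
begin

definition graph :: "nat ribbon_graph" where "graph = relabel \<beta> {..<4 * k} gamma"
definition gpos :: "nat => nat \<times> nat" where "gpos = (\<lambda>h\<in>pos_half graph. fst (inv_into (U \<times> UNIV) \<beta> h))"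
definition gcoeffs :: "nat => nat" where "gcoeffs = (\<lambda>h\<in>pos_half graph. card (R.block (gpos h)) - 1)"

sublocale \<Gamma>: directed_graph "card J" nm gamma by (rule gamma_directed_graph)

lemma \<beta>': "bij_betw \<beta> (half_edges gamma) {..<4 * k}" using \<beta> by (simp add: gamma_simps(1))

lemma iso: "is_rg_iso gamma graph \<beta>" "standard_graph graph" "half_edges graph = {..<4 * k}"
 unfolding graph_def by (rule \<Gamma>.relabel_iso[OF \<beta>'])+

sublocale G: directed_graph "card J" nm graph by (rule \<Gamma>.iso_directed[OF iso(1,2)])

lemma iso_simps: assumes "s \<in> U"
 shows "vperm graph (\<beta> (s, p)) = \<beta> (vperm gamma (s, p))" "einv graph (\<beta> (s, p)) = \<beta> (s, \<not> p)"
  "bdry graph (\<beta> (s, p)) = bdry gamma (s, p)" "\<beta> (s, p) \<in> half_edges graph"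
  "inv_into (U \<times> UNIV) \<beta> (\<beta> (s, p)) = (s, p)"
 using iso(1,3) assms \<beta> by (auto simp: is_rg_iso_def gamma_simps(1,4) bij_betw_def)

lemma pos_half_graph: "pos_half graph = (\<lambda>s. \<beta> (s, True)) ` U"
proof (intro equalityI subsetI)
 fix h assume h: "h \<in> pos_half graph"
 hence "h \<in> {..<4 * k}" using iso(3) by (auto simp: pos_half_def)
 then obtain x where x: "x \<in> U \<times> UNIV" "\<beta> x = h" using bij_betw_ex[OF \<beta>] by blast
 then obtain s p where sp: "s \<in> U" "h = \<beta> (s, p)" by (metis SigmaE)
 thus "h \<in> (\<lambda>s. \<beta> (s, True)) ` U" using h iso_simps[of s p] by (cases p) (auto simp: pos_half_def gamma_simps)
qed (auto simp: pos_half_def iso_simps gamma_simps)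

lemma inj_pos: "inj_on (\<lambda>s. \<beta> (s, True)) U"
 using \<beta> by (auto simp: inj_on_def bij_betw_def)

lemma gpos: "s \<in> U ==> gpos (\<beta> (s, True)) = s"
 by (simp add: gpos_def pos_half_graph iso_simps)

lemma gcoeffs: "s \<in> U ==> gcoeffs (\<beta> (s, True)) = card (R.block s) - 1"
 by (simp add: gcoeffs_def pos_half_graph gpos)

lemma card_block_pos: "s \<in> U ==> 0 < card (R.block s)"
proof -
 assume s: "s \<in> U"
 hence "s \<in> R.block s" using US R.ent_U by (auto simp: R.block_def)
 moreover have "finite (R.block s)" using finS by (simp add: R.block_def)
 ultimately show ?thesis by (auto simp: card_gt_0_iff)
qed

lemma graph_bperm: "s \<in> U ==> bperm graph (\<beta> (s, True)) = \<beta> (R.nx s, True)"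
 by (simp add: bperm_def iso_simps gamma_simps)

lemma metric_graph: "(graph, gcoeffs, gpos) \<in> metric_graphs nm"
proof -
 have "gpos \<in> positions graph gcoeffs"
  unfolding positions_def
 proof (intro CollectI conjI ballI)
  show "gpos \<in> pos_half graph \<rightarrow>\<^sub>E S" using US by (auto simp: pos_half_graph gpos) (simp add: gpos_def pos_half_graph)
  fix h assume "h \<in> pos_half graph"
  then obtain s where s: "s \<in> U" "h = \<beta> (s, True)" by (auto simp: pos_half_graph)
  show "bdry graph h = Inl (idx (fst (gpos h)))" using s by (simp add: gpos iso_simps gamma_simps)
  have "Suc (gcoeffs (\<beta> (R.nx s, True))) = R.ret s"
   using gcoeffs[OF nx_in[OF s(1)]] card_block_pos[OF nx_in[OF s(1)]] R.block_nx(3)[OF s(1)] by simp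
  thus "gpos (bperm graph h) = (\<sigma> ^^ Suc (gcoeffs (bperm graph h))) (gpos h)"
   using s nx_in by (simp only: graph_bperm gpos R.nx_ret[symmetric])
 qed
 moreover have "gcoeffs \<in> half_coeffs graph b"
  unfolding half_coeffs_def
 proof (intro CollectI conjI allI impI)
  show "gcoeffs \<in> pos_half graph \<rightarrow>\<^sub>E UNIV" by (simp add: gcoeffs_def)
  fix i assume "i < length b"
  hence i: "i < card J" by (simp add: b)
  let ?O = "{x \<in> S. fst x = en i}"
  have "{h \<in> pos_half graph. bdry graph h = Inl i} = (\<lambda>s. \<beta> (s, True)) ` (?O \<inter> U)"
  proof -
   have "idx (fst s) = i \<longleftrightarrow> fst s = en i" if "s \<in> U" for s
    using idx(2)[of "fst s"] idx(3)[OF i] fst_S US that by (metis subsetD)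
   thus ?thesis using US by (auto simp: pos_half_graph iso_simps gamma_simps)
  qed
  hence "(\<Sum>h\<in>{h \<in> pos_half graph. bdry graph h = Inl i}. gcoeffs h + 1) = (\<Sum>s\<in>?O \<inter> U. gcoeffs (\<beta> (s, True)) + 1)"
   using inj_on_subset[OF inj_pos, of "?O \<inter> U"] by (simp add: sum.reindex)
  also have "... = (\<Sum>s\<in>?O \<inter> U. card (R.block s))"
   using card_block_pos gcoeffs by (intro sum.cong) auto
  also have "... = card ?O"
  proof (rule R.card_by_blocks(1)[symmetric])
   fix x assume x: "x \<in> S"
   have "R.ent x \<in> S" using R.ent_in[OF x] US by blast
   moreover have "fst (R.ent x) = fst x" using orbit\<sigma>_iff[OF x \<open>R.ent x \<in> S\<close>] R.ent_orbit by blast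
   ultimately show "x \<in> ?O \<longleftrightarrow> R.ent x \<in> ?O" using x by simp
  qed auto
  also have "?O = {en i} \<times> {..<len (en i)}" using idx(4)[OF i] by (auto simp: S_eq)
  finally show "(\<Sum>h\<in>{h \<in> pos_half graph. bdry graph h = Inl i}. gcoeffs h + 1) = b ! i" using b(2)[OF i] by simp
 qed
 ultimately show ?thesis using iso(3) G.directed_graph_axioms by (simp add: metric_graphs_def)
qed

text \<open>The edges along a negative boundary are the blocks of a cycle of
  \<open>\<sigma> \<circ> \<tau>\<close>. An edge with c + 1 cells contributes c, all its cells but
  the matched last one.\<close>

lemma mset_neg_sums: "mset (half_neg_sums nm graph gcoeffs) = vtype J \<tau>"
proof -
 let ?O = "orbit (\<sigma> \<circ> \<tau>)"
 define f where "f j = sum gcoeffs {h \<in> pos_half graph. bdry graph (einv graph h) = Inr j}" for j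
 have f: "f (lam c) = card (c - U)" if c: "c \<in> ?O ` S" for c
 proof -
  obtain z where z: "z \<in> S" "c = ?O z" using c by blast
  have "lam (?O s) = lam c \<longleftrightarrow> s \<in> c" if s: "s \<in> U" for s
  proof -
   have "?O s \<in> ?O ` S" using s US by blast
   hence "(lam (?O s) = lam c) = (?O s = c)" by (rule inj_on_eq_iff[OF bij_betw_imp_inj_on[OF lam] _ c])
   thus ?thesis unfolding z(2) permutes_orbit_eq_iff[OF finS R.M.perm] .
  qed
  hence "{h \<in> pos_half graph. bdry graph (einv graph h) = Inr (lam c)} = (\<lambda>s. \<beta> (s, True)) ` (c \<inter> U)"
   by (auto simp: pos_half_graph iso_simps gamma_simps)
  hence "f (lam c) = (\<Sum>s\<in>c \<inter> U. gcoeffs (\<beta> (s, True)))"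
   unfolding f_def using inj_on_subset[OF inj_pos, of "c \<inter> U"] by (simp add: sum.reindex)
  also have "... = (\<Sum>s\<in>c \<inter> U. card (R.block s) - 1)" by (intro sum.cong) (auto simp: gcoeffs)
  also have "... = card (c - U)" unfolding z(2) by (rule R.card_orbit_rest[OF z(1), symmetric])
  finally show ?thesis .
 qed
 have "mset (half_neg_sums nm graph gcoeffs) = image_mset f (mset_set {..<nm})"
  by (simp add: half_neg_sums_def f_def[abs_def] lessThan_atLeast0)
 also have "mset_set {..<nm} = image_mset lam (mset_set (?O ` S))"
  using lam by (simp add: image_mset_mset_set bij_betw_def)
 also have "image_mset f (image_mset lam (mset_set (?O ` S))) = image_mset (\<lambda>c. card (c - U)) (mset_set (?O ` S))"
  unfolding image_mset.compositionality
 proof (rule image_mset_cong)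
  fix c assume "c \<in># mset_set (?O ` S)"
  hence "c \<in> ?O ` S" using finS by (metis elem_mset_set finite_imageI)
  thus "(f \<circ> lam) c = card (c - U)" by (simp only: comp_apply f)
 qed
 finally show ?thesis by (simp add: vtype_def ctype_def dset_empty)
qed

end

lemma (in index_set) labelled_matchings_D:
 "(\<tau>, lam, \<beta>) \<in> labelled_matchings nm ==> numbered_matching len J k \<tau> nm lam \<beta>"
 by (auto simp: labelled_matchings_def labellings_def numberings_def connected_matching_def connected_matching_axioms_def
   labelled_matching_def labelled_matching_axioms_def numbered_matching_def numbered_matching_axioms_def index_set_axioms)

definition (in index_set) to_graph where
 "to_graph nm = (\<lambda>(\<tau>, lam, \<beta>). (numbered_matching.graph len J k \<tau> lam \<beta>,
   numbered_matching.gcoeffs len J k \<tau> lam \<beta>, numbered_matching.gpos len J k \<tau> lam \<beta>))"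

text \<open>Everything can be read off: the matched cells are the positions of the positive
  half-edges, which also fixes the numbering; two steps around a vertex give \<tau>, and the
  negative labels give \<open>lam\<close>.\<close>

lemma (in index_set) to_graph_inj: "inj_on (to_graph nm) (labelled_matchings nm)"
proof (rule inj_onI)
 fix x y assume x: "x \<in> labelled_matchings nm" and y: "y \<in> labelled_matchings nm" and eq: "to_graph nm x = to_graph nm y"
 obtain \<tau> lam \<beta> where x': "x = (\<tau>, lam, \<beta>)" by (metis prod_cases3)
 obtain \<tau>' lam' \<beta>' where y': "y = (\<tau>', lam', \<beta>')" by (metis prod_cases3)
 interpret A: numbered_matching len J k \<tau> nm lam \<beta> using x unfolding x' by (rule labelled_matchings_D)
 interpret B: numbered_matching len J k \<tau>' nm lam' \<beta>' using y unfolding y' by (rule labelled_matchings_D)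
 have e: "A.graph = B.graph" "A.gpos = B.gpos" using eq by (auto simp: to_graph_def x' y')
 have U: "moved \<tau> = moved \<tau>'"
 proof -
  have "A.gpos ` pos_half A.graph = moved \<tau>" by (auto simp: A.pos_half_graph image_image A.gpos)
  moreover have "B.gpos ` pos_half B.graph = moved \<tau>'" by (auto simp: B.pos_half_graph image_image B.gpos)
  ultimately show ?thesis by (simp add: e)
 qed
 have \<beta>T: "\<beta> (s, True) = \<beta>' (s, True)" if s: "s \<in> moved \<tau>" for s
 proof -
  have "\<beta> (s, True) \<in> pos_half A.graph" using s by (simp add: A.pos_half_graph)
  then obtain s' where s': "s' \<in> moved \<tau>'" "\<beta> (s, True) = \<beta>' (s', True)" by (auto simp: e B.pos_half_graph)
  have "s = s'" using A.gpos[OF s] B.gpos[OF s'(1)] s'(2) by (simp add: e)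
  thus ?thesis using s' by simp
 qed
 have \<beta>p: "\<beta> (s, p) = \<beta>' (s, p)" if s: "s \<in> moved \<tau>" for s p
  using \<beta>T[OF s] A.iso_simps(2)[OF s, of True] B.iso_simps(2)[of s True] s U e by (cases p) auto
 have \<beta>: "\<beta> = \<beta>'"
  using x y \<beta>p U unfolding x' y' labelled_matchings_def numberings_def
  by (intro extensionalityI[of _ "moved \<tau> \<times> UNIV"]) auto
 have v: "vperm A.gamma (s, p) = vperm B.gamma (s, p)" if s: "s \<in> moved \<tau>" for s p
 proof -
  have "\<beta> (vperm A.gamma (s, p)) = \<beta> (vperm B.gamma (s, p))"
   using A.iso_simps(1)[OF s, of p] B.iso_simps(1)[of s p] s U \<beta> e by simp
  moreover have "vperm A.gamma (s, p) \<in> moved \<tau> \<times> UNIV" "vperm B.gamma (s, p) \<in> moved \<tau> \<times> UNIV"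
   using A.\<Gamma>.vperm_in[of "(s, p)"] B.\<Gamma>.vperm_in[of "(s, p)"] s U by (auto simp: A.gamma_simps(1) B.gamma_simps(1))
  ultimately show ?thesis by (rule inj_onD[OF bij_betw_imp_inj_on[OF A.\<beta>]])
 qed
 have \<tau>: "\<tau> = \<tau>'"
 proof
  fix s show "\<tau> s = \<tau>' s"
  proof (cases "s \<in> moved \<tau>")
   case True
   have "vperm A.gamma (vperm A.gamma (s, False)) = vperm B.gamma (vperm B.gamma (s, False))"
    using v True A.nx_in by (simp add: A.gamma_simps flip: v)
   thus ?thesis using True U by (simp add: A.gamma_vperm2 B.gamma_vperm2)
  next
   case False thus ?thesis using U by (simp add: A.R.\<tau>_id B.R.\<tau>_id)
  qed
 qed
 have "lam = lam'"
 proof (rule extensionalityI[of _ "orbit (\<sigma> \<circ> \<tau>) ` S"])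
  show "lam \<in> extensional (orbit (\<sigma> \<circ> \<tau>) ` S)" using x by (simp add: x' labelled_matchings_def labellings_def)
  show "lam' \<in> extensional (orbit (\<sigma> \<circ> \<tau>) ` S)" using y by (simp add: y' labelled_matchings_def labellings_def \<tau>)
  fix c assume "c \<in> orbit (\<sigma> \<circ> \<tau>) ` S"
  then obtain z where z: "z \<in> S" "c = orbit (\<sigma> \<circ> \<tau>) z" by blast
  let ?s = "A.R.M.ent z"
  have s: "?s \<in> moved \<tau>" by (rule A.R.M.ent_in[OF z(1)])
  have c: "orbit (\<sigma> \<circ> \<tau>) ?s = c" unfolding z(2) by (rule permutes_orbit_eq[OF finS A.R.M.perm A.R.M.ent_orbit])
  have "bdry A.gamma (?s, False) = bdry B.gamma (?s, False)"
   using A.iso_simps(3)[OF s, of False] B.iso_simps(3)[of ?s False] s U \<beta> e by simp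
  moreover have "bdry A.gamma (?s, False) = Inr (lam (orbit (\<sigma> \<circ> \<tau>) ?s))" using s by (simp add: A.gamma_simps)
  moreover have "bdry B.gamma (?s, False) = Inr (lam' (orbit (\<sigma> \<circ> \<tau>') ?s))" using s U by (simp add: B.gamma_simps)
  ultimately have "lam (orbit (\<sigma> \<circ> \<tau>) ?s) = lam' (orbit (\<sigma> \<circ> \<tau>') ?s)" by (metis sum.inject(2))
  thus "lam c = lam' c" unfolding \<tau>[symmetric] c .
 qed
 thus "x = y" by (simp add: x' y' \<tau> \<beta>)
qed

lemma funpow_card_orbit:
 assumes "finite S" "f permutes S"
 shows "(f ^^ card (orbit f x)) x = x" "0 < q ==> q < card (orbit f x) ==> (f ^^ q) x \<noteq> x"
proof -
 define d where "d = funpow_dist1 f x x"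
 have xx: "x \<in> orbit f x" by (rule permutes_orbit_self[OF assms])
 have "orbit f x = (\<lambda>t. (f ^^ t) x) ` {0..<d}" unfolding d_def by (rule orbit_conv_funpow_dist1[OF xx])
 moreover have "inj_on (\<lambda>t. (f ^^ t) x) {0..<d}" unfolding d_def by (rule inj_on_funpow_dist1[OF xx])
 ultimately have "card (orbit f x) = d" by (simp add: card_image)
 thus "(f ^^ card (orbit f x)) x = x" "0 < q ==> q < card (orbit f x) ==> (f ^^ q) x \<noteq> x"
  using funpow_dist1_prop[OF xx] funpow_dist1_least[of q f x x] by (simp_all add: d_def)
qed

text \<open>The inverse of \<open>to_graph\<close>: the matched cells are recovered from the
  positions, and their pairing from the vertices.\<close>

locale metric_graph = index_set +
 fixes nm :: nat and G :: "nat ribbon_graph" and c :: "nat => nat" and pos :: "nat => nat \<times> nat"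
 assumes mg: "(G, c, pos) \<in> metric_graphs nm"
begin

sublocale G: directed_graph "card J" nm G using mg by (simp add: metric_graphs_def)

abbreviation "P \<equiv> pos_half G"

lemma H_eq: "half_edges G = {..<4 * k}" using mg by (simp add: metric_graphs_def)

lemma finP: "finite P" using G.finH by (simp add: pos_half_def)

lemma P_H: "h \<in> P ==> h \<in> half_edges G" by (simp add: pos_half_def)

lemma posD: assumes "h \<in> P"
 shows "pos h \<in> S" "bdry G h = Inl (idx (fst (pos h)))" "pos (bperm G h) = (\<sigma> ^^ Suc (c (bperm G h))) (pos h)"
 using mg assms unfolding metric_graphs_def positions_def by auto

lemma bperm_P: "h \<in> P ==> bperm G h \<in> P"
 using G.bperm_in G.bdry_bperm by (auto simp: pos_half_def)

lemma bperm_bij: "bij_betw (bperm G) P P"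
proof -
 have "inj_on (bperm G) P" using permutes_inj[OF G.bperm] by (rule inj_on_subset) simp
 moreover have "bperm G ` P \<subseteq> P" using bperm_P by blast
 ultimately show ?thesis using finP by (simp add: bij_betw_def endo_inj_surj)
qed

lemma fst_bperm: "h \<in> P ==> fst (pos (bperm G h)) = fst (pos h)"
proof -
 assume h: "h \<in> P"
 have "idx (fst (pos (bperm G h))) = idx (fst (pos h))"
  using posD(2)[OF h] posD(2)[OF bperm_P[OF h]] G.bdry_bperm[OF P_H[OF h]] by simp
 thus ?thesis using idx(2) fst_S posD(1) h bperm_P by metis
qed

lemma pos_fibre: assumes "i \<in> J" shows "\<exists>h\<in>P. fst (pos h) = i"
proof -
 obtain h where h: "h \<in> P" "pos_label G (edge_at G h) = idx i" using G.pos_surj[OF idx(1)[OF assms]] by blast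
 hence "idx (fst (pos h)) = idx i" using G.edge_labels(1)[OF h(1)] posD(2)[OF h(1)] by simp
 thus ?thesis using idx(2) fst_S posD(1) h(1) assms by metis
qed

lemma total_length: "(\<Sum>h\<in>P. Suc (c h)) = card S"
proof -
 have lt: "idx (fst (pos h)) < card J" if "h \<in> P" for h using idx(1) fst_S posD(1)[OF that] by blast
 have "(\<Sum>h\<in>P. Suc (c h)) = (\<Sum>i<card J. \<Sum>h\<in>{h \<in> P. idx (fst (pos h)) = i}. Suc (c h))"
  by (rule sum.group[symmetric]) (use lt finP in auto)
 also have "... = (\<Sum>i<card J. len (en i))"
 proof (rule sum.cong[OF refl])
  fix i assume "i \<in> {..<card J}"
  hence i: "i < card J" by simp
  have "{h \<in> P. idx (fst (pos h)) = i} = {h \<in> P. bdry G h = Inl i}" using posD(2) by auto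
  moreover have "(\<Sum>h\<in>{h \<in> P. bdry G h = Inl i}. c h + 1) = b ! i"
   using mg i by (simp add: metric_graphs_def half_coeffs_def b(1))
  ultimately show "(\<Sum>h\<in>{h \<in> P. idx (fst (pos h)) = i}. Suc (c h)) = len (en i)" by (simp add: b(2)[OF i])
 qed
 also have "... = (\<Sum>j\<in>J. len j)" by (rule sum.reindex_bij_betw[OF en_bij])
 also have "... = card S" using finJ by (simp add: S_eq)
 finally show ?thesis .
qed

text \<open>\<open>\<phi> (h, q)\<close> is the q-th cell after the last cell of edge h, hence the
  q-th cell of the next edge \<open>bperm G h\<close>, which has \<open>c (bperm G h) + 1\<close>
  cells.\<close>

definition Sg :: "(nat \<times> nat) set" where "Sg = (SIGMA h:P. {1..Suc (c (bperm G h))})"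
definition \<phi> :: "nat \<times> nat => nat \<times> nat" where "\<phi> = (\<lambda>(h, q). (\<sigma> ^^ q) (pos h))"

lemma pow_S: "x \<in> S ==> (\<sigma> ^^ n) x \<in> S"
 using permutes_in_image[OF perm\<sigma>] by (induction n) auto

text \<open>The image is closed under \<sigma> and meets every circle, so it is everything.
  Injectivity follows by counting, because the edge lengths along the circles add up to the number
  of cells.\<close>

lemma \<phi>_bij: "bij_betw \<phi> Sg S"
proof -
 have finSg: "finite Sg" using finP by (simp add: Sg_def)
 have "\<phi> ` Sg = S"
 proof (intro equalityI subsetI)
  fix x assume "x \<in> \<phi> ` Sg"
  then obtain h q where "x = (\<sigma> ^^ q) (pos h)" "h \<in> P" by (auto simp: Sg_def \<phi>_def)
  thus "x \<in> S" using pow_S[OF posD(1)] by blast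
 next
  fix x assume x: "x \<in> S"
  obtain h where h: "h \<in> P" "fst (pos h) = fst x" using pos_fibre[OF fst_S[OF x]] by blast
  have "orbit \<sigma> (pos h) \<subseteq> \<phi> ` Sg"
  proof
   fix y assume "y \<in> orbit \<sigma> (pos h)"
   thus "y \<in> \<phi> ` Sg"
   proof induction
    case base
    have "(h, 1) \<in> Sg" using h by (simp add: Sg_def)
    moreover have "\<phi> (h, 1) = \<sigma> (pos h)" by (simp add: \<phi>_def)
    ultimately show ?case by (metis imageI)
   next
    case (step y)
    then obtain g q where gq: "g \<in> P" "1 \<le> q" "q \<le> Suc (c (bperm G g))" "y = (\<sigma> ^^ q) (pos g)"
     by (auto simp: Sg_def \<phi>_def)
    show ?case
    proof (cases "q = Suc (c (bperm G g))")
     case True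
     hence "y = pos (bperm G g)" using gq posD(3) by simp
     hence "\<sigma> y = \<phi> (bperm G g, 1)" by (simp add: \<phi>_def)
     moreover have "(bperm G g, 1) \<in> Sg" using bperm_P gq by (simp add: Sg_def)
     ultimately show ?thesis by (metis imageI)
    next
     case False
     have "\<sigma> y = \<phi> (g, Suc q)" using gq by (simp add: \<phi>_def)
     moreover have "(g, Suc q) \<in> Sg" using gq False by (simp add: Sg_def)
     ultimately show ?thesis by (metis imageI)
    qed
   qed
  qed
  moreover have "x \<in> orbit \<sigma> (pos h)" using orbit\<sigma>_iff[OF posD(1)[OF h(1)] x] h by simp
  ultimately show "x \<in> \<phi> ` Sg" by blast
 qed
 moreover have "card Sg = card S"
 proof -
  have "card Sg = (\<Sum>h\<in>P. Suc (c (bperm G h)))" using finP by (simp add: Sg_def)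
  also have "... = (\<Sum>h\<in>P. Suc (c h))" by (rule sum.reindex_bij_betw[OF bperm_bij])
  finally show ?thesis by (simp add: total_length)
 qed
 ultimately show ?thesis using finSg by (simp add: bij_betw_def eq_card_imp_inj_on)
qed

lemma \<phi>_inj: "(h, q) \<in> Sg ==> (h', q') \<in> Sg ==> \<phi> (h, q) = \<phi> (h', q') ==> h = h' \<and> q = q'"
 using \<phi>_bij unfolding bij_betw_def inj_on_def by blast

lemma pos_\<phi>: "h \<in> P ==> pos (bperm G h) = \<phi> (h, Suc (c (bperm G h)))" "h \<in> P ==> (h, Suc (c (bperm G h))) \<in> Sg"
 using posD(3) by (simp_all add: \<phi>_def Sg_def)

lemma pos_inj: "inj_on pos P"
proof (rule inj_onI)
 fix h h' assume h: "h \<in> P" "h' \<in> P" "pos h = pos h'"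
 obtain g g' where g: "g \<in> P" "bperm G g = h" "g' \<in> P" "bperm G g' = h'"
  using bij_betw_ex[OF bperm_bij h(1)] bij_betw_ex[OF bperm_bij h(2)] by blast
 hence "g = g'" using \<phi>_inj pos_\<phi>[OF g(1)] pos_\<phi>[OF g(3)] h(3) by metis
 thus "h = h'" using g by simp
qed

definition ip :: "nat \<times> nat => nat" where "ip = inv_into P pos"

lemma ip: "h \<in> P ==> ip (pos h) = h" by (simp add: ip_def inv_into_f_f[OF pos_inj])

text \<open>The matching on the level of half-edges, modelled on \<open>gamma_vperm2\<close>: two
  steps around the vertex from the negative half of an edge, then back to a positive half.\<close>

definition tG :: "nat => nat" where "tG h = einv G (vperm G (vperm G (einv G h)))"

lemma vperm_bperm: "h \<in> half_edges G ==> vperm G h = bperm G (einv G h)"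
 by (simp add: bperm_def G.einv_einv)

text \<open>\<open>vperm\<close> is \<open>einv\<close>, which flips the sign of the boundary in a
  directed graph, followed by \<open>bperm\<close>, which keeps it; so signs alternate around a
  vertex.\<close>

lemma alternate: "h \<in> half_edges G ==> einv G h \<in> P \<longleftrightarrow> h \<notin> P"
  "h \<in> half_edges G ==> vperm G h \<in> P \<longleftrightarrow> h \<notin> P"
proof -
 show e: "h \<in> half_edges G ==> einv G h \<in> P \<longleftrightarrow> h \<notin> P"
  using G.isl_einv G.einv_in by (auto simp: pos_half_def)
 assume h: "h \<in> half_edges G"
 have "vperm G h \<in> P \<longleftrightarrow> einv G h \<in> P"
  using G.bdry_bperm[OF G.einv_in[OF h]] G.vperm_in[OF h] G.einv_in[OF h] vperm_bperm[OF h] by (simp add: pos_half_def)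
 thus "vperm G h \<in> P \<longleftrightarrow> h \<notin> P" using e[OF h] by simp
qed

lemma vperm4: assumes h: "h \<in> half_edges G"
 shows "vperm G (vperm G (vperm G (vperm G h))) = h" "vperm G (vperm G h) \<noteq> h"
proof -
 have "card (orbit (vperm G) h) = 4" using G.four h by (auto simp: four_valent_def verts_def)
 thus "vperm G (vperm G (vperm G (vperm G h))) = h" "vperm G (vperm G h) \<noteq> h"
  using funpow_card_orbit[OF G.finH G.vperm, of h] funpow_card_orbit(2)[OF G.finH G.vperm, of 2 h]
  by (simp_all add: eval_nat_numeral)
qed

lemma tG: assumes h: "h \<in> P"
 shows "tG h \<in> P" "tG (tG h) = h" "tG h \<noteq> h" "bperm G (tG (einv G (vperm G h))) = h"
proof -
 have H: "h \<in> half_edges G" using P_H[OF h] .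
 have e: "einv G h \<in> half_edges G" "einv G h \<notin> P" using G.einv_in[OF H] alternate(1)[OF H] h by auto
 have v1: "vperm G (einv G h) \<in> half_edges G" "vperm G (einv G h) \<in> P"
  using G.vperm_in[OF e(1)] alternate(2)[OF e(1)] e by auto
 have v2: "vperm G (vperm G (einv G h)) \<in> half_edges G" "vperm G (vperm G (einv G h)) \<notin> P"
  using G.vperm_in[OF v1(1)] alternate(2)[OF v1(1)] v1 by auto
 show "tG h \<in> P" unfolding tG_def using alternate(1)[OF v2(1)] v2 by simp
 show "tG (tG h) = h" unfolding tG_def using v2 e vperm4(1)[OF e(1)] G.einv_einv H by simp
 show "tG h \<noteq> h"
 proof
  assume "tG h = h"
  hence "vperm G (vperm G (einv G h)) = einv G h" unfolding tG_def using G.einv_einv[OF v2(1)] by simp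
  thus False using vperm4(2)[OF e(1)] by simp
 qed
 have y: "vperm G h \<in> half_edges G" using G.vperm_in[OF H] .
 show "bperm G (tG (einv G (vperm G h))) = h"
  unfolding tG_def bperm_def using G.einv_einv y G.vperm_in vperm4(1)[OF H] by simp
qed

definition \<tau> :: "nat \<times> nat => nat \<times> nat" where
 "\<tau> x = (if x \<in> pos ` P then pos (tG (ip x)) else x)"

lemma \<tau>_pos: "h \<in> P ==> \<tau> (pos h) = pos (tG h)"
 by (simp add: \<tau>_def ip)

lemma \<tau>\<tau>: "\<tau> (\<tau> x) = x"
proof (cases "x \<in> pos ` P")
 case True
 then obtain h where "h \<in> P" "x = pos h" by blast
 thus ?thesis by (simp add: \<tau>_pos tG)
next
 case False thus ?thesis by (simp add: \<tau>_def)
qed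

lemma moved_\<tau>: "moved \<tau> = pos ` P"
proof -
 have "\<tau> (pos h) \<noteq> pos h" if h: "h \<in> P" for h
  using inj_onD[OF pos_inj _ tG(1)[OF h] h] tG(3)[OF h] \<tau>_pos[OF h] by auto
 hence "pos ` P \<subseteq> moved \<tau>" unfolding moved_def by blast
 moreover have "moved \<tau> \<subseteq> pos ` P" unfolding moved_def \<tau>_def by auto
 ultimately show ?thesis by blast
qed

lemma \<tau>_conn: "\<tau> \<in> conn_matchings"
proof -
 have "moved \<tau> \<subseteq> S" using posD(1) by (auto simp: moved_\<tau>)
 hence inv: "\<tau> \<in> involutions (live J)" unfolding involutions_def live_S using \<tau>\<tau> by blast
 have "card (moved \<tau>) = card P" unfolding moved_\<tau> by (rule card_image[OF pos_inj])
 hence card: "card (moved \<tau>) = 2 * k" using G.card_pos by (simp add: H_eq)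
 have "I = J" if I: "I \<subseteq> J" "I \<noteq> {}" "keeps \<tau> I" for I
 proof -
  define half where "half h = (if h \<in> P then h else einv G h)" for h
  \<comment> \<open>The half-edges whose edge runs along a positive boundary in I. The set is closed
    under the moves of the graph, so by connectedness it contains all half-edges, and I contains all
    circles.\<close>
  define B where "B = {h \<in> half_edges G. fst (pos (half h)) \<in> I}"
  have stepB: "y \<in> B" if x: "x \<in> B" and y: "y = vperm G x \<or> y = einv G x" for x y
  proof -
   have xH: "x \<in> half_edges G" and xI: "fst (pos (half x)) \<in> I" using x by (auto simp: B_def)
   consider "y = einv G x" | "y = vperm G x" "x \<in> P" | "y = vperm G x" "x \<notin> P" using y by blast
   thus ?thesis
   proof cases
    case 1
    hence "half y = half x" using alternate(1)[OF xH] G.einv_einv[OF xH] by (simp add: half_def)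
    thus ?thesis using 1 xI G.einv_in[OF xH] by (simp add: B_def)
   next
    case 2
    let ?h = "einv G y"
    have yH: "y \<in> half_edges G" "y \<notin> P" using 2 G.vperm_in[OF xH] alternate(2)[OF xH] by auto
    hence hP: "?h \<in> P" using alternate(1) by blast
    have "bperm G (tG ?h) = x" using tG(4)[OF 2(2)] 2(1) by simp
    hence "fst (pos (tG ?h)) = fst (pos x)" using fst_bperm[OF tG(1)[OF hP]] by simp
    hence "fst (pos (tG ?h)) \<in> I" using xI 2 by (simp add: half_def)
    hence "fst (\<tau> (pos (tG ?h))) \<in> I" by (rule keepsD[OF I(3)])
    moreover have "\<tau> (pos (tG ?h)) = pos ?h" using \<tau>_pos[OF tG(1)[OF hP]] tG(2)[OF hP] by simp
    ultimately show ?thesis using yH by (simp add: B_def half_def)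
   next
    case 3
    have e: "einv G x \<in> P" using alternate(1)[OF xH] 3 by simp
    have "y = bperm G (einv G x)" using 3 vperm_bperm[OF xH] by simp
    hence "y \<in> P" "fst (pos y) = fst (pos (einv G x))" using bperm_P[OF e] fst_bperm[OF e] by auto
    thus ?thesis using xI 3 P_H by (simp add: B_def half_def)
   qed
  qed
  obtain i where "i \<in> I" using I(2) by blast
  then obtain h0 where h0: "h0 \<in> P" "fst (pos h0) \<in> I" using pos_fibre I(1) by blast
  have all: "h \<in> B" if h: "h \<in> half_edges G" for h
  proof -
   have "(h0, h) \<in> {(x, y). x \<in> half_edges G \<and> (y = vperm G x \<or> y = einv G x)}\<^sup>*"
    using G.conn h P_H[OF h0(1)] by (auto simp: rg_connected_def)
   thus ?thesis
   proof induction
    case base thus ?case using h0 P_H by (simp add: B_def half_def)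
   next
    case (step y z) thus ?case using stepB by blast
   qed
  qed
  have "j \<in> I" if j: "j \<in> J" for j
  proof -
   obtain h where h: "h \<in> P" "fst (pos h) = j" using pos_fibre[OF j] by blast
   thus ?thesis using all[OF P_H[OF h(1)]] by (simp add: B_def half_def)
  qed
  thus ?thesis using I(1) by blast
 qed
 thus ?thesis using inv card J0 by (simp add: conn_matchings_def conn_def)
qed

sublocale M: connected_matching len J k \<tau>
 by unfold_locales (rule \<tau>_conn)

text \<open>Descending induction from the last cell of the next edge; the earlier cells are not
  positions because \<phi> is injective.\<close>

lemma ent_\<phi>: assumes h: "h \<in> P" and q: "1 \<le> q" "q \<le> Suc (c (bperm G h))"
 shows "M.R.ent (\<phi> (h, q)) = pos (bperm G h)"
 using q(2,1)
proof (induction q rule: inc_induct)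
 case base
 have "pos (bperm G h) \<in> M.U" using bperm_P[OF h] by (simp add: moved_\<tau>)
 thus ?case using M.R.ent_U by (simp flip: pos_\<phi>(1)[OF h])
next
 case (step q)
 have gS: "(h, q) \<in> Sg" using h step by (simp add: Sg_def)
 have "\<phi> (h, q) \<notin> M.U"
 proof
  assume "\<phi> (h, q) \<in> M.U"
  then obtain h' where h': "h' \<in> P" "\<phi> (h, q) = pos h'" by (auto simp: moved_\<tau>)
  obtain g where g: "g \<in> P" "bperm G g = h'" using bij_betw_ex[OF bperm_bij h'(1)] by blast
  have "h = g \<and> q = Suc (c (bperm G g))" using \<phi>_inj[OF gS pos_\<phi>(2)[OF g(1)]] pos_\<phi>(1)[OF g(1)] g h' by simp
  thus False using step by simp
 qed
 moreover have "\<phi> (h, q) \<in> S" using pow_S posD(1)[OF h] by (simp add: \<phi>_def)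
 ultimately have "M.R.ent (\<phi> (h, q)) = M.R.ent (\<sigma> (\<phi> (h, q)))" by (simp add: M.R.ent_step)
 also have "\<sigma> (\<phi> (h, q)) = \<phi> (h, Suc q)" by (simp add: \<phi>_def)
 finally show ?case using step by simp
qed

lemma nx_pos: "h \<in> P ==> M.R.nx (pos h) = pos (bperm G h)"
 using ent_\<phi>[of h 1] by (simp add: M.R.nx_def \<phi>_def)

lemma card_block_pos: assumes h: "h \<in> P" shows "card (M.R.block (pos h)) = Suc (c h)"
proof -
 obtain g where g: "g \<in> P" "bperm G g = h" using bij_betw_ex[OF bperm_bij h] by blast
 have "M.R.block (pos h) = \<phi> ` ({g} \<times> {1..Suc (c h)})"
 proof (intro equalityI subsetI)
  fix x assume x: "x \<in> M.R.block (pos h)"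
  then obtain g' q where gq: "(g', q) \<in> Sg" "\<phi> (g', q) = x"
   using bij_betw_ex[OF \<phi>_bij, of x] by (auto simp: M.R.block_def)
  hence "pos (bperm G g') = pos h" using ent_\<phi>[of g' q] x by (simp add: M.R.block_def Sg_def)
  hence "bperm G g' = bperm G g" using inj_onD[OF pos_inj] bperm_P gq h g by (simp add: Sg_def)
  hence "g' = g" using inj_onD[OF bij_betw_imp_inj_on[OF bperm_bij]] gq g by (simp add: Sg_def)
  thus "x \<in> \<phi> ` ({g} \<times> {1..Suc (c h)})" using gq g by (auto simp: Sg_def)
 next
  fix x assume "x \<in> \<phi> ` ({g} \<times> {1..Suc (c h)})"
  then obtain q where q: "1 \<le> q" "q \<le> Suc (c h)" "x = \<phi> (g, q)" by auto
  hence "M.R.ent x = pos h" using ent_\<phi>[OF g(1), of q] g by simp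
  moreover have "x \<in> S" using q pow_S posD(1)[OF g(1)] by (simp add: \<phi>_def)
  ultimately show "x \<in> M.R.block (pos h)" by (simp add: M.R.block_def)
 qed
 moreover have "inj_on \<phi> ({g} \<times> {1..Suc (c h)})"
  using bij_betw_imp_inj_on[OF \<phi>_bij] by (rule inj_on_subset) (use g in \<open>auto simp: Sg_def\<close>)
 ultimately show ?thesis by (simp add: card_image)
qed

lemma pm_pos: assumes h: "h \<in> P" shows "M.pm (pos h) = pos (einv G (vperm G h))" "einv G (vperm G h) \<in> P"
proof -
 have H: "h \<in> half_edges G" using P_H[OF h] .
 show hP: "einv G (vperm G h) \<in> P" using alternate(1)[OF G.vperm_in[OF H]] alternate(2)[OF H] h by simp
 have "M.nxm (pos (einv G (vperm G h))) = pos h"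
  using nx_pos[OF tG(1)[OF hP]] tG(4)[OF h] by (simp add: M.nxm_def \<tau>_pos[OF hP])
 thus "M.pm (pos h) = pos (einv G (vperm G h))"
  using M.pm(3)[of "pos (einv G (vperm G h))"] hP by (simp add: moved_\<tau>)
qed

text \<open>The map \<open>pos \<circ> einv G\<close> carries the boundary permutation of the
  negative half-edges to \<open>pm\<close>, whose cycles are the traces on the matched cells of the
  cycles of \<open>\<sigma> \<circ> \<tau>\<close>.\<close>

lemma neg_orbit_iff: assumes h: "h \<in> P" "h' \<in> P"
 shows "pos h' \<in> orbit (\<sigma> \<circ> \<tau>) (pos h) \<longleftrightarrow> bdry G (einv G h) = bdry G (einv G h')"
proof -
 define N where "N = half_edges G - P"
 define f where "f y = pos (einv G y)" for y
 have Ne: "einv G y \<in> P" "y \<in> half_edges G" if "y \<in> N" for y using that alternate(1) by (auto simp: N_def)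
 have eN: "einv G g \<in> N" if "g \<in> P" for g using that alternate(1) P_H G.einv_in by (auto simp: N_def)
 have bN: "bperm G y \<in> N" if y: "y \<in> N" for y
  using y G.bperm_in G.bdry_bperm by (auto simp: N_def pos_half_def)
 have fe: "f (einv G g) = pos g" if "g \<in> P" for g using G.einv_einv[OF P_H[OF that]] by (simp add: f_def)
 have "orbit M.pm (f (einv G h)) = f ` orbit (bperm G) (einv G h)"
 proof (rule orbit_image_on[where S = N])
  fix y assume y: "y \<in> N"
  show "f (bperm G y) = M.pm (f y)"
   using pm_pos(1)[OF Ne(1)[OF y]] by (simp add: f_def bperm_def)
 qed (use bN eN h in auto)
 hence "orbit (\<sigma> \<circ> \<tau>) (pos h) \<inter> M.U = f ` orbit (bperm G) (einv G h)"
  using M.neg_orbit[of "pos h"] h fe by (simp add: moved_\<tau>)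
 moreover have "pos h' \<in> M.U" using h by (simp add: moved_\<tau>)
 ultimately have 1: "pos h' \<in> orbit (\<sigma> \<circ> \<tau>) (pos h) \<longleftrightarrow> pos h' \<in> f ` orbit (bperm G) (einv G h)" by blast
 have sub: "orbit (bperm G) (einv G h) \<subseteq> N" by (rule orbit_invariant[OF bN eN[OF h(1)]])
 have injf: "inj_on f N"
 proof (rule inj_onI)
  fix y y' assume y: "y \<in> N" "y' \<in> N" "f y = f y'"
  hence "einv G y = einv G y'" using inj_onD[OF pos_inj] Ne by (simp add: f_def)
  thus "y = y'" using permutes_inj[OF G.einv] by (simp add: inj_eq)
 qed
 have "pos h' \<in> f ` orbit (bperm G) (einv G h) \<longleftrightarrow> einv G h' \<in> orbit (bperm G) (einv G h)"
  using inj_on_image_mem_iff[OF injf eN[OF h(2)] sub] fe[OF h(2)] by simp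
 thus ?thesis using 1 G.bdry_eq_iff[OF Ne(2)[OF eN[OF h(1)]] Ne(2)[OF eN[OF h(2)]]] by simp
qed

definition lam :: "(nat \<times> nat) set => nat" where
 "lam = (\<lambda>X\<in>orbit (\<sigma> \<circ> \<tau>) ` S. projr (bdry G (einv G (SOME h. h \<in> P \<and> pos h \<in> X))))"

lemma lam_pos: assumes h: "h \<in> P" shows "bdry G (einv G h) = Inr (lam (orbit (\<sigma> \<circ> \<tau>) (pos h)))"
proof -
 let ?O = "orbit (\<sigma> \<circ> \<tau>) (pos h)"
 define h' where "h' = (SOME h. h \<in> P \<and> pos h \<in> ?O)"
 have "h \<in> P \<and> pos h \<in> ?O" using h permutes_orbit_self[OF finS M.R.M.perm] by blast
 hence "h' \<in> P \<and> pos h' \<in> ?O" unfolding h'_def by (rule someI)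
 hence "bdry G (einv G h) = bdry G (einv G h')" using neg_orbit_iff[OF h] by blast
 moreover have "lam ?O = projr (bdry G (einv G h'))" using posD(1)[OF h] by (simp add: lam_def h'_def)
 moreover obtain j where "bdry G (einv G h) = Inr j" using G.neg_cases[OF h] by blast
 ultimately show ?thesis by (metis sum.sel(2))
qed

lemma orbit_rep: "X \<in> orbit (\<sigma> \<circ> \<tau>) ` S ==> \<exists>h\<in>P. X = orbit (\<sigma> \<circ> \<tau>) (pos h)"
proof -
 assume "X \<in> orbit (\<sigma> \<circ> \<tau>) ` S"
 then obtain z where z: "z \<in> S" "X = orbit (\<sigma> \<circ> \<tau>) z" by blast
 have "M.R.M.ent z \<in> pos ` P" using M.R.M.ent_in[OF z(1)] by (simp only: moved_\<tau>)
 moreover have "orbit (\<sigma> \<circ> \<tau>) (M.R.M.ent z) = X"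
  unfolding z(2) by (rule permutes_orbit_eq[OF finS M.R.M.perm M.R.M.ent_orbit])
 ultimately show ?thesis by auto
qed

lemma lam_labellings: "lam \<in> labellings nm \<tau>"
proof -
 have "inj_on lam (orbit (\<sigma> \<circ> \<tau>) ` S)"
 proof (rule inj_onI)
  fix X Y assume "X \<in> orbit (\<sigma> \<circ> \<tau>) ` S" "Y \<in> orbit (\<sigma> \<circ> \<tau>) ` S" and eq: "lam X = lam Y"
  then obtain h h' where h: "h \<in> P" "X = orbit (\<sigma> \<circ> \<tau>) (pos h)" "h' \<in> P" "Y = orbit (\<sigma> \<circ> \<tau>) (pos h')"
   using orbit_rep by metis
  hence "pos h' \<in> orbit (\<sigma> \<circ> \<tau>) (pos h)" using lam_pos eq neg_orbit_iff by simp
  thus "X = Y" unfolding h by (rule permutes_orbit_eq[OF finS M.R.M.perm, symmetric])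
 qed
 moreover have "lam ` (orbit (\<sigma> \<circ> \<tau>) ` S) = {..<nm}"
 proof (intro equalityI subsetI)
  fix j assume "j \<in> lam ` (orbit (\<sigma> \<circ> \<tau>) ` S)"
  then obtain X where X: "X \<in> orbit (\<sigma> \<circ> \<tau>) ` S" "j = lam X" by blast
  obtain h where h: "h \<in> P" "j = lam (orbit (\<sigma> \<circ> \<tau>) (pos h))" using orbit_rep[OF X(1)] X(2) by blast
  thus "j \<in> {..<nm}" using G.neg_cases[OF h(1)] lam_pos[OF h(1)] by auto
 next
  fix j assume "j \<in> {..<nm}"
  then obtain h where h: "h \<in> P" "neg_label G (edge_at G h) = j" using G.neg_surj by auto
  hence "j = lam (orbit (\<sigma> \<circ> \<tau>) (pos h))" using G.edge_labels(2)[OF h(1)] lam_pos[OF h(1)] by simp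
  thus "j \<in> lam ` (orbit (\<sigma> \<circ> \<tau>) ` S)" using posD(1)[OF h(1)] by blast
 qed
 ultimately show ?thesis by (simp add: labellings_def bij_betw_def) (simp add: lam_def)
qed

definition \<beta> :: "(nat \<times> nat) \<times> bool => nat" where
 "\<beta> = (\<lambda>(s, p)\<in>moved \<tau> \<times> UNIV. if p then ip s else einv G (ip s))"

lemma \<beta>_pos: "h \<in> P ==> \<beta> (pos h, True) = h" "h \<in> P ==> \<beta> (pos h, False) = einv G h"
 by (simp_all add: \<beta>_def moved_\<tau> ip)

lemma \<beta>_numberings: "\<beta> \<in> numberings \<tau>"
proof -
 have "bij_betw \<beta> (moved \<tau> \<times> UNIV) (half_edges G)"
 proof (rule bij_betw_byWitness[where f' = "\<lambda>h. if h \<in> P then (pos h, True) else (pos (einv G h), False)"])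
  show "\<forall>a\<in>moved \<tau> \<times> UNIV. (if \<beta> a \<in> P then (pos (\<beta> a), True) else (pos (einv G (\<beta> a)), False)) = a"
  proof
   fix a assume "a \<in> moved \<tau> \<times> (UNIV :: bool set)"
   then obtain h p where h: "h \<in> P" "a = (pos h, p)" by (auto simp: moved_\<tau>)
   thus "(if \<beta> a \<in> P then (pos (\<beta> a), True) else (pos (einv G (\<beta> a)), False)) = a"
    using \<beta>_pos[OF h(1)] alternate(1)[OF P_H[OF h(1)]] G.einv_einv[OF P_H[OF h(1)]] by (cases p) auto
  qed
  show "\<forall>h\<in>half_edges G. \<beta> (if h \<in> P then (pos h, True) else (pos (einv G h), False)) = h"
   using \<beta>_pos alternate(1) G.einv_einv by auto
  show "\<beta> ` (moved \<tau> \<times> UNIV) \<subseteq> half_edges G"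
  proof
   fix x assume "x \<in> \<beta> ` (moved \<tau> \<times> UNIV)"
   then obtain h p where h: "h \<in> P" "x = \<beta> (pos h, p)" by (auto simp: moved_\<tau>)
   thus "x \<in> half_edges G" using \<beta>_pos[OF h(1)] P_H[OF h(1)] G.einv_in by (cases p) auto
  qed
  show "(\<lambda>h. if h \<in> P then (pos h, True) else (pos (einv G h), False)) ` half_edges G \<subseteq> moved \<tau> \<times> UNIV"
   using alternate(1) by (auto simp: moved_\<tau>)
 qed
 thus ?thesis by (simp add: numberings_def H_eq) (simp add: \<beta>_def)
qed

lemma in_labelled_matchings: "(\<tau>, lam, \<beta>) \<in> labelled_matchings nm"
 using \<tau>_conn lam_labellings \<beta>_numberings by (simp add: labelled_matchings_def)

sublocale N: numbered_matching len J k \<tau> nm lam \<beta>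
 by (rule labelled_matchings_D[OF in_labelled_matchings])

text \<open>The numbering \<beta> is itself an isomorphism from \<open>gamma\<close> onto G, so
  relabelling along it reproduces G and not merely an isomorphic copy.\<close>

lemma to_graph_eq: "to_graph nm (\<tau>, lam, \<beta>) = (G, c, pos)"
proof -
 have "is_rg_iso N.gamma G \<beta>"
  unfolding is_rg_iso_def
 proof (intro conjI ballI)
  show "bij_betw \<beta> (half_edges N.gamma) (half_edges G)" using N.\<beta>' by (simp add: H_eq)
  fix x assume "x \<in> half_edges N.gamma"
  then obtain h p where h: "h \<in> P" "x = (pos h, p)" by (auto simp: N.gamma_simps(1) moved_\<tau>)
  have U: "pos h \<in> moved \<tau>" using h by (simp add: moved_\<tau>)
  have H: "h \<in> half_edges G" using P_H[OF h(1)] .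
  show "\<beta> (vperm N.gamma x) = vperm G (\<beta> x)"
  proof (cases p)
   case True
   thus ?thesis
    using h U pm_pos[OF h(1)] \<beta>_pos by (simp add: N.gamma_simps G.einv_einv G.vperm_in[OF H])
  next
   case False
   thus ?thesis
    using h U nx_pos[OF h(1)] \<beta>_pos bperm_P[OF h(1)] by (simp add: N.gamma_simps bperm_def)
  qed
  show "\<beta> (einv N.gamma x) = einv G (\<beta> x)"
   using h U \<beta>_pos[OF h(1)] G.einv_einv[OF H] by (cases p) (simp_all add: N.gamma_simps)
  show "bdry G (\<beta> x) = bdry N.gamma x"
   using h U \<beta>_pos[OF h(1)] posD(2)[OF h(1)] lam_pos[OF h(1)] by (cases p) (simp_all add: N.gamma_simps)
 qed
 from N.\<Gamma>.iso_relabel[OF this G.standard] have G: "N.graph = G" by (simp add: N.graph_def H_eq)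
 have gp: "N.gpos h = pos h" if h: "h \<in> P" for h
 proof -
  have "pos h \<in> moved \<tau>" using h by (simp add: moved_\<tau>)
  from N.gpos[OF this] show ?thesis by (simp add: \<beta>_pos[OF h])
 qed
 have "N.gpos = pos"
 proof (rule extensionalityI[of _ P])
  show "N.gpos \<in> extensional P" by (simp add: N.gpos_def G)
  show "pos \<in> extensional P" using mg by (simp add: metric_graphs_def positions_def PiE_iff)
 qed (rule gp)
 moreover have "N.gcoeffs = c"
 proof (rule extensionalityI[of _ P])
  show "N.gcoeffs \<in> extensional P" by (simp add: N.gcoeffs_def G)
  show "c \<in> extensional P" using mg by (simp add: metric_graphs_def half_coeffs_def PiE_iff)
  fix h assume h: "h \<in> P"
  thus "N.gcoeffs h = c h" using card_block_pos[OF h] gp[OF h] by (simp add: N.gcoeffs_def G)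
 qed
 ultimately show ?thesis by (simp add: to_graph_def G)
qed

end

lemma (in index_set) to_graph_bij: "bij_betw (to_graph nm) (labelled_matchings nm) (metric_graphs nm)"
proof (rule bij_betw_imageI[OF to_graph_inj], intro equalityI subsetI)
 fix x assume "x \<in> to_graph nm ` labelled_matchings nm"
 then obtain \<tau> lam \<beta> where x: "(\<tau>, lam, \<beta>) \<in> labelled_matchings nm" "x = to_graph nm (\<tau>, lam, \<beta>)" by auto
 interpret numbered_matching len J k \<tau> nm lam \<beta> by (rule labelled_matchings_D[OF x(1)])
 show "x \<in> metric_graphs nm" using metric_graph by (simp add: x(2) to_graph_def)
next
 fix x assume "x \<in> metric_graphs nm"
 then obtain G c pos where x: "(G, c, pos) \<in> metric_graphs nm" "x = (G, c, pos)" by (metis prod_cases3)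
 interpret metric_graph len J k nm G c pos by unfold_locales (rule x(1))
 show "x \<in> to_graph nm ` labelled_matchings nm"
  using in_labelled_matchings to_graph_eq x(2) by (metis imageI)
qed

lemma card_numberings:
 assumes "finite A"
 shows "card {f \<in> extensional A. bij_betw f A {..<n}} = (if card A = n then fact n else 0)"
proof (cases "card A = n")
 case True
 have "{f \<in> extensional A. bij_betw f A {..<n}} = {f \<in> A \<rightarrow>\<^sub>E {..<n}. inj_on f A}"
 proof (intro equalityI subsetI)
  fix f assume "f \<in> {f \<in> A \<rightarrow>\<^sub>E {..<n}. inj_on f A}"
  hence f: "f \<in> extensional A" "inj_on f A" "f ` A \<subseteq> {..<n}" by (auto simp: PiE_iff)
  hence "f ` A = {..<n}" using True by (intro card_subset_eq) (auto simp: card_image)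
  thus "f \<in> {f \<in> extensional A. bij_betw f A {..<n}}" using f by (simp add: bij_betw_def)
 qed (auto simp: bij_betw_def PiE_iff)
 thus ?thesis
  using True card_inj_on_subset_funcset[OF assms, of "{..<n}" A] by (simp add: fact_prod_rev)
next
 case False
 hence "{f \<in> extensional A. bij_betw f A {..<n}} = {}" using bij_betw_same_card by fastforce
 thus ?thesis using False by (simp only: card.empty if_False)
qed

lemma orbit_parametrisation:
 assumes "finite S" "f permutes S"
 shows "bij_betw (\<lambda>t. (f ^^ t) x) {..<card (orbit f x)} (orbit f x)"
proof -
 have xx: "x \<in> orbit f x" by (rule permutes_orbit_self[OF assms])
 have "orbit f x = (\<lambda>t. (f ^^ t) x) ` {..<funpow_dist1 f x x}"
  unfolding lessThan_atLeast0 by (rule orbit_conv_funpow_dist1[OF xx])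
 moreover have "inj_on (\<lambda>t. (f ^^ t) x) {..<funpow_dist1 f x x}"
  unfolding lessThan_atLeast0 by (rule inj_on_funpow_dist1[OF xx])
 ultimately show ?thesis by (metis bij_betw_def card_image card_lessThan)
qed

text \<open>The position of one reference half-edge on boundary i fixes the others by walking along
  the boundary, and every one of the \<open>b ! i\<close> cells is allowed: one turn advances by the
  full length of the circle, so the walk closes up.\<close>

lemma (in index_set) card_positions:
 assumes dg: "directed_graph (card J) nm G" and cc: "c \<in> half_coeffs G b"
 shows "finite (positions G c)" "card (positions G c) = prod_list b"
proof -
 interpret G: directed_graph "card J" nm G by (rule dg)
 let ?P = "pos_half G" let ?\<pi> = "bperm G"
 define r where "r i = (SOME h. h \<in> ?P \<and> bdry G h = Inl i)" for i
 have r: "r i \<in> ?P" "bdry G (r i) = Inl i" if i: "i < card J" for i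
 proof -
  obtain h where "h \<in> ?P" "pos_label G (edge_at G h) = i" using G.pos_surj[OF i] by blast
  hence "h \<in> ?P \<and> bdry G h = Inl i" using G.edge_labels(1) by simp
  hence "r i \<in> ?P \<and> bdry G (r i) = Inl i" unfolding r_def by (rule someI)
  thus "r i \<in> ?P" "bdry G (r i) = Inl i" by auto
 qed
 have PH: "h \<in> half_edges G" if "h \<in> ?P" for h using that by (simp add: pos_half_def)
 have bP: "?\<pi> h \<in> ?P" if "h \<in> ?P" for h using that G.bperm_in G.bdry_bperm by (auto simp: pos_half_def)
 have lab: "\<exists>i<card J. bdry G h = Inl i" if "h \<in> ?P" for h using G.edge_labels(1,3)[OF that] by blast
 have O: "h \<in> orbit ?\<pi> (r i) \<longleftrightarrow> bdry G h = Inl i" if "h \<in> ?P" "i < card J" for h i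
  using G.bdry_eq_iff[OF PH[OF r(1)[OF that(2)]] PH[OF that(1)]] r(2)[OF that(2)] by auto
 have Oset: "{h \<in> ?P. bdry G h = Inl i} = orbit ?\<pi> (r i)" if i: "i < card J" for i
 proof -
  have "orbit ?\<pi> (r i) \<subseteq> ?P" by (rule orbit_invariant[OF bP r(1)[OF i]])
  thus ?thesis using O i by blast
 qed
 define f where "f i t = (?\<pi> ^^ t) (r i)" for i t
 define d where "d i = card (orbit ?\<pi> (r i))" for i
 \<comment> \<open>The number of cells passed on the way from the reference half-edge to the t-th
   half-edge of the boundary.\<close>
 define A where "A i t = (\<Sum>s<t. Suc (c (f i (Suc s))))" for i t
 have fb: "bij_betw (f i) {..<d i} (orbit ?\<pi> (r i))" for i
  using orbit_parametrisation[OF G.finH G.bperm, of "r i"] by (simp add: f_def[abs_def] d_def)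
 have fd: "f i (d i) = f i 0" for i
  using funpow_card_orbit(1)[OF G.finH G.bperm, of "r i"] by (simp add: f_def d_def)
 have Ad: "A i (d i) = len (en i)" if i: "i < card J" for i
 proof -
  have "b ! i = (\<Sum>h\<in>{h \<in> ?P. bdry G h = Inl i}. c h + 1)" using cc i by (simp add: half_coeffs_def b(1))
  also have "... = (\<Sum>t<d i. c (f i t) + 1)" unfolding Oset[OF i] by (rule sum.reindex_bij_betw[OF fb, symmetric])
  also have "... = A i (d i)"
  proof -
   \<comment> \<open>\<open>A\<close> sums over the indices 1, ..., d, the length of the boundary
     over 0, ..., d - 1; by periodicity they agree.\<close>
   have "Suc (c (f i 0)) + A i (d i) = (\<Sum>s<Suc (d i). Suc (c (f i s)))" by (simp only: A_def sum.lessThan_Suc_shift)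
   thus ?thesis by (simp add: fd)
  qed
  finally show ?thesis by (simp add: b(2)[OF i])
 qed
 have cyc: "(\<sigma> ^^ len (en i)) (en i, p) = (en i, p)" if "i < card J" "p < len (en i)" for i p
 proof -
  have "(en i, p) \<in> S" using idx(4) that by (simp add: S_eq)
  hence "card (orbit \<sigma> (en i, p)) = len (en i)" using orbit_rot[OF finJ, of "en i" p] that by simp
  thus ?thesis using funpow_card_orbit(1)[OF finS perm\<sigma>, of "(en i, p)"] by simp
 qed
 define Q where "Q = (\<Pi>\<^sub>E i\<in>{..<card J}. {..<len (en i)})"
 define R where "R pos = (\<lambda>i\<in>{..<card J}. snd (pos (r i) :: nat \<times> nat))" for pos
 have posr: "pos (r i) = (en i, R pos i)" "R pos i < len (en i)" if pos: "pos \<in> positions G c" and i: "i < card J" for pos i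
 proof -
  have s: "pos (r i) \<in> S" "idx (fst (pos (r i))) = i" using pos r[OF i] by (auto simp: positions_def)
  hence "fst (pos (r i)) = en i" using idx(2)[OF fst_S[OF s(1)]] by simp
  thus "pos (r i) = (en i, R pos i)" "R pos i < len (en i)" using s i by (auto simp: R_def S_eq prod_eq_iff)
 qed
 have "bij_betw R (positions G c) Q"
 proof (rule bij_betw_imageI[OF inj_onI])
  fix pos pos' assume p: "pos \<in> positions G c" "pos' \<in> positions G c" "R pos = R pos'"
  show "pos = pos'"
  proof (rule extensionalityI[of _ ?P])
   show "pos \<in> extensional ?P" "pos' \<in> extensional ?P" using p by (auto simp: positions_def PiE_iff)
   fix h assume h: "h \<in> ?P"
   obtain i where i: "i < card J" "bdry G h = Inl i" using lab[OF h] by blast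
   define B where "B = {h \<in> ?P. pos h = pos' h}"
   have "h \<in> orbit ?\<pi> (r i)" using O[OF h i(1)] i by simp
   moreover have "orbit ?\<pi> (r i) \<subseteq> B"
   proof (rule orbit_invariant)
    show "r i \<in> B" using posr(1)[OF p(1) i(1)] posr(1)[OF p(2) i(1)] p(3) r(1)[OF i(1)] by (simp add: B_def)
    fix g assume "g \<in> B"
    thus "?\<pi> g \<in> B" using p(1,2) bP by (auto simp: B_def positions_def)
   qed
   ultimately show "pos h = pos' h" by (auto simp: B_def)
  qed
 next
  show "R ` positions G c = Q"
  proof (intro equalityI subsetI)
   fix p assume "p \<in> R ` positions G c"
   then obtain pos where p: "pos \<in> positions G c" "p = R pos" by blast
   show "p \<in> Q" unfolding Q_def p(2) using posr(2)[OF p(1)] by (intro PiE_I) (auto simp: R_def)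
  next
   fix p assume p: "p \<in> Q"
   hence pl: "p i < len (en i)" if "i < card J" for i using that by (auto simp: Q_def)
   define x where "x i t = (\<sigma> ^^ A i t) (en i, p i)" for i t
   define l where "l h = projl (bdry G h)" for h
   define pos where "pos = (\<lambda>h\<in>?P. x (l h) (inv_into {..<d (l h)} (f (l h)) h))"
   have posf: "pos (f i t) = x i t" if i: "i < card J" and t: "t \<le> d i" for i t
   proof -
    have *: "pos (f i t) = x i t" if t: "t < d i" for t
    proof -
     have "f i t \<in> orbit ?\<pi> (r i)" using bij_betwE[OF fb] t by blast
     hence "f i t \<in> ?P" "l (f i t) = i" unfolding Oset[OF i, symmetric] by (auto simp: l_def)
     moreover have "inv_into {..<d i} (f i) (f i t) = t" using t by (simp add: inv_into_f_f bij_betw_imp_inj_on[OF fb])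
     ultimately show ?thesis by (simp add: pos_def)
    qed
    show ?thesis
    proof (cases "t = d i")
     case True
     have "r i \<in> f i ` {..<d i}"
      unfolding bij_betw_imp_surj_on[OF fb] by (rule permutes_orbit_self[OF G.finH G.bperm])
     hence "0 < d i" by (cases "d i") auto
     hence "pos (f i t) = x i 0" using *[of 0] True fd by simp
     also have "... = x i t" using True cyc[OF i pl[OF i]] Ad[OF i] by (simp add: x_def A_def)
     finally show ?thesis .
    next
     case False thus ?thesis using * t by simp
    qed
   qed
   have xS: "x i t \<in> S" "fst (x i t) = en i" if i: "i < card J" for i t
   proof -
    have "(\<sigma> ^^ m) (en i, p i) \<in> {y \<in> S. fst y = en i}" for m
    proof (induction m)
     case 0 thus ?case using idx(4)[OF i] pl[OF i] by (simp add: S_eq)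
    next
     case (Suc m) thus ?case by (simp add: fst_rot rot_in)
    qed
    hence "x i t \<in> {y \<in> S. fst y = en i}" unfolding x_def .
    thus "x i t \<in> S" "fst (x i t) = en i" by auto
   qed
   have "pos \<in> positions G c"
    unfolding positions_def
   proof (intro CollectI conjI ballI)
    have rep: "\<exists>i t. i < card J \<and> t < d i \<and> h = f i t \<and> bdry G h = Inl i" if h: "h \<in> ?P" for h
    proof -
     obtain i where i: "i < card J" "bdry G h = Inl i" using lab[OF h] by blast
     hence "h \<in> f i ` {..<d i}" using O[OF h i(1)] fb[of i] by (simp add: bij_betw_def)
     thus ?thesis using i by blast
    qed
    show "pos \<in> ?P \<rightarrow>\<^sub>E S"
    proof (rule PiE_I)
     fix h assume "h \<in> ?P"
     then obtain i t where "i < card J" "t < d i" "h = f i t" using rep by blast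
     thus "pos h \<in> S" using posf xS by simp
    qed (simp add: pos_def)
    fix h assume "h \<in> ?P"
    then obtain i t where i: "i < card J" "t < d i" "h = f i t" "bdry G h = Inl i" using rep by blast
    show "bdry G h = Inl (idx (fst (pos h)))" using i posf xS idx(3) by simp
    have "?\<pi> h = f i (Suc t)" by (simp add: i(3) f_def)
    moreover have "x i (Suc t) = (\<sigma> ^^ Suc (c (f i (Suc t)))) (x i t)"
     by (simp only: x_def A_def sum.lessThan_Suc funpow_add o_apply add.commute[of "\<Sum>s<t. Suc (c (f i (Suc s)))"])
    ultimately show "pos (?\<pi> h) = (\<sigma> ^^ Suc (c (?\<pi> h))) (pos h)"
     using posf[OF i(1), of t] posf[OF i(1), of "Suc t"] i(2,3) by simp
   qed
   moreover have "R pos = p"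
   proof (rule extensionalityI[of _ "{..<card J}"])
    show "R pos \<in> extensional {..<card J}" by (simp add: R_def)
    show "p \<in> extensional {..<card J}" using p by (simp add: Q_def PiE_iff)
    fix i assume "i \<in> {..<card J}"
    thus "R pos i = p i" using posf[of i 0] by (simp add: R_def f_def x_def A_def)
   qed
   ultimately show "p \<in> R ` positions G c" by blast
  qed
 qed
 moreover have "finite Q" by (simp add: Q_def finite_PiE)
 moreover have "card Q = prod_list b"
 proof -
  have "card Q = (\<Prod>i<card J. b ! i)" unfolding Q_def by (simp add: card_PiE b(2))
  also have "... = prod_list b"
   using prod.list_conv_set_nth[of b] by (simp add: b(1) lessThan_atLeast0)
  finally show ?thesis .
 qed
 ultimately show "finite (positions G c)" "card (positions G c) = prod_list b"
  by (auto simp: bij_betw_finite bij_betw_same_card)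
qed

context index_set
begin

lemma finite_conn: "finite (conn I)" if "finite I"
 by (rule finite_subset[OF _ finite_involutions[OF finite_live[OF that]]]) (auto simp: conn_def)

lemma b_pos: "0 < prod_list b"
proof -
 have "0 \<notin> set b" using finJ by (auto simp: b_def sublist_def dest: len0)
 thus ?thesis by (metis gr0I prod_list_zero_iff)
qed

text \<open>By \<open>card_positions\<close> the factor \<open>prod_list b\<close> turns the sum
  over metrics into one over metrics with positions. The bijection \<open>to_graph_bij\<close> makes
  it a sum over labelled and numbered matchings, and the numbers of labellings and numberings cancel
  the denominators.\<close>

lemma K_op_matchings:
 assumes F: "F \<in> fock" and gn: "2 * g + card J + nm = k + 2"
 shows "K_op g (card J) nm F b =
  (\<Sum>\<tau>\<in>{\<tau> \<in> conn_matchings. card (orbit (\<sigma> \<circ> \<tau>) ` S) = nm}. mfun F (vtype J \<tau>))"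
proof -
 let ?D = "directed_graphs g (card J) nm"
 let ?L = "labelled_matchings nm"
 define \<Phi> where "\<Phi> = (\<lambda>(G :: nat ribbon_graph, c, pos :: nat => nat \<times> nat). F (half_neg_sums nm G c))"
 have k: "2 * g + card J + nm - 2 = k" "2 * g + card J + nm > 2" using gn k0 by auto
 have D: "G \<in> ?D \<longleftrightarrow> directed_graph (card J) nm G \<and> half_edges G = {..<4 * k}" for G
  using k by (simp add: directed_graphs_iff)
 have fl: "finite (labellings nm \<tau>)" "finite (numberings \<tau>)"
   "card (labellings nm \<tau>) = (if card (orbit (\<sigma> \<circ> \<tau>) ` S) = nm then fact nm else 0)"
   "card (numberings \<tau>) = fact (4 * k)" if t: "\<tau> \<in> conn_matchings" for \<tau>
 proof -
  have fin: "finite (orbit (\<sigma> \<circ> \<tau>) ` S)" using finS by blast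
  have "moved \<tau> \<subseteq> S" using t involutionsD(2)[of \<tau>] by (auto simp: conn_matchings_def conn_def live_S)
  hence fm: "finite (moved \<tau> \<times> (UNIV :: bool set))"
   using finite_subset[OF _ finS] by (intro finite_cartesian_product) auto
  have cm: "card (moved \<tau> \<times> (UNIV :: bool set)) = 4 * k" using t by (simp add: conn_matchings_def card_cartesian_product)
  show "card (labellings nm \<tau>) = (if card (orbit (\<sigma> \<circ> \<tau>) ` S) = nm then fact nm else 0)"
   unfolding labellings_def by (rule card_numberings[OF fin])
  show c: "card (numberings \<tau>) = fact (4 * k)"
   unfolding numberings_def using card_numberings[OF fm, of "4 * k"] cm by simp
  thus "finite (numberings \<tau>)" by (metis card.infinite fact_nonzero)
  have "labellings nm \<tau> \<subseteq> orbit (\<sigma> \<circ> \<tau>) ` S \<rightarrow>\<^sub>E {..<nm}"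
   by (auto simp: labellings_def PiE_def bij_betw_def)
  thus "finite (labellings nm \<tau>)" using finite_PiE[OF fin, of "\<lambda>_. {..<nm}"] finite_subset by blast
 qed
 have L: "?L = Sigma conn_matchings (\<lambda>\<tau>. labellings nm \<tau> \<times> numberings \<tau>)"
  by (auto simp: labelled_matchings_def)
 have fC: "finite conn_matchings" using finite_conn[OF finJ] by (simp add: conn_matchings_def)
 have fL: "finite ?L" unfolding L using fC fl by blast
 have M: "metric_graphs nm = Sigma ?D (\<lambda>G. Sigma (half_coeffs G b) (positions G))"
 proof (intro equalityI subsetI)
  fix x assume "x \<in> metric_graphs nm"
  then obtain G c pos where "x = (G, c, pos)" "directed_graph (card J) nm G \<and> half_edges G = {..<4 * k}"
   "c \<in> half_coeffs G b" "pos \<in> positions G c" unfolding metric_graphs_def by blast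
  thus "x \<in> Sigma ?D (\<lambda>G. Sigma (half_coeffs G b) (positions G))" unfolding D[symmetric] by blast
 next
  fix x assume "x \<in> Sigma ?D (\<lambda>G. Sigma (half_coeffs G b) (positions G))"
  then obtain G c pos where "x = (G, c, pos)" "G \<in> ?D" "c \<in> half_coeffs G b" "pos \<in> positions G c" by blast
  thus "x \<in> metric_graphs nm" unfolding D metric_graphs_def by blast
 qed
 have fM: "finite (metric_graphs nm)" using bij_betw_finite[OF to_graph_bij] fL by blast
 have fp: "finite (positions G c)" "card (positions G c) = prod_list b" if "G \<in> ?D" "c \<in> half_coeffs G b" for G :: "nat ribbon_graph" and c
  using card_positions that D by blast+
 \<comment> \<open>Finiteness is inherited from the labelled matchings, because every metric admits
   a position.\<close>
 have fh: "finite (half_coeffs G b)" if G: "G \<in> ?D" for G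
 proof (rule finite_subset)
  show "half_coeffs G b \<subseteq> (fst \<circ> snd) ` metric_graphs nm"
  proof
   fix c assume c: "c \<in> half_coeffs G b"
   have "positions G c \<noteq> {}" using fp(2)[OF G c] b_pos by force
   then obtain pos where "(G, c, pos) \<in> metric_graphs nm" using G c by (auto simp: M)
   thus "c \<in> (fst \<circ> snd) ` metric_graphs nm" by force
  qed
 qed (use fM in blast)
 have "of_nat (prod_list b) * (\<Sum>G\<in>?D. \<Sum>c\<in>half_coeffs G b. F (half_neg_sums nm G c)) =
   (\<Sum>G\<in>?D. \<Sum>c\<in>half_coeffs G b. \<Sum>pos\<in>positions G c. \<Phi> (G, c, pos))"
  unfolding sum_distrib_left using fp by (intro sum.cong refl) (simp add: \<Phi>_def)
 also have "... = (\<Sum>G\<in>?D. \<Sum>(c, pos)\<in>Sigma (half_coeffs G b) (positions G). \<Phi> (G, c, pos))"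
  using fh fp(1) by (intro sum.cong refl sum.Sigma) auto
 also have "... = (\<Sum>(G, y)\<in>metric_graphs nm. (\<lambda>(c, pos). \<Phi> (G, c, pos)) y)"
  unfolding M using fh fp(1) by (intro sum.Sigma finite_directed_graphs) auto
 also have "... = (\<Sum>x\<in>metric_graphs nm. \<Phi> x)" by (intro sum.cong) auto
 also have "... = (\<Sum>x\<in>?L. \<Phi> (to_graph nm x))" by (rule sum.reindex_bij_betw[OF to_graph_bij, symmetric])
 also have "... = (\<Sum>(\<tau>, y)\<in>?L. mfun F (vtype J \<tau>))"
 proof (intro sum.cong refl)
  fix x assume x: "x \<in> ?L"
  obtain \<tau> lam \<beta> where x': "x = (\<tau>, lam, \<beta>)" by (metis prod_cases3)
  interpret numbered_matching len J k \<tau> nm lam \<beta> using x unfolding x' by (rule labelled_matchings_D)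
  show "\<Phi> (to_graph nm x) = (case x of (\<tau>, y) => mfun F (vtype J \<tau>))"
   by (simp add: x' to_graph_def \<Phi>_def fock_mfun[OF F] mset_neg_sums)
 qed
 also have "... = (\<Sum>\<tau>\<in>conn_matchings. \<Sum>y\<in>labellings nm \<tau> \<times> numberings \<tau>. mfun F (vtype J \<tau>))"
  unfolding L using fC fl by (intro sum.Sigma[symmetric]) auto
 also have "... = (\<Sum>\<tau>\<in>conn_matchings. if card (orbit (\<sigma> \<circ> \<tau>) ` S) = nm then fact nm * fact (4 * k) * mfun F (vtype J \<tau>) else 0)"
  using fl by (intro sum.cong refl) (simp add: card_cartesian_product)
 also have "... = fact nm * fact (4 * k) * (\<Sum>\<tau>\<in>{\<tau> \<in> conn_matchings. card (orbit (\<sigma> \<circ> \<tau>) ` S) = nm}. mfun F (vtype J \<tau>))"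
  using fC by (auto simp: sum_distrib_left sum.inter_filter intro!: sum.cong)
 finally have "of_nat (prod_list b) * (\<Sum>G\<in>?D. \<Sum>c\<in>half_coeffs G b. F (half_neg_sums nm G c)) =
  fact nm * fact (4 * k) * (\<Sum>\<tau>\<in>{\<tau> \<in> conn_matchings. card (orbit (\<sigma> \<circ> \<tau>) ` S) = nm}. mfun F (vtype J \<tau>))" .
 moreover have "(g, card J, nm) \<noteq> (0, 1, 1)" using k(2) by auto
 ultimately show ?thesis using K_op_graphs[of g "card J" nm F b] b(1) k by (simp add: field_simps)
qed

end

section \<open>Genus, the connected operator, and the final equation\<close>

section \<open>The genus of a connected matching\<close>

lemma card_orbits_merge:
 assumes S: "finite S" "f permutes S" and x: "x \<in> S" "y \<in> S" "y \<notin> orbit f x"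
 shows "Suc (card (orbit (f \<circ> swap x y) ` S)) = card (orbit f ` S)"
proof -
 let ?a = "orbit f x" let ?b = "orbit f y"
 have self: "z \<in> orbit f z" for z by (rule permutes_orbit_self[OF S])
 have ab: "?a \<noteq> ?b" using self[of y] x(3) by auto
 have "?a \<union> ?b \<notin> orbit f ` S - {?a, ?b}"
 proof
  assume *: "?a \<union> ?b \<in> orbit f ` S - {?a, ?b}"
  then obtain z where z: "?a \<union> ?b = orbit f z" by blast
  hence "x \<in> orbit f z" using self by blast
  hence "?a = orbit f z" by (rule permutes_orbit_eq[OF S])
  thus False using * z by simp
 qed
 hence "card (orbit (f \<circ> swap x y) ` S) = Suc (card (orbit f ` S - {?a, ?b}))"
  unfolding merge_orbit(2)[OF S x] using S(1) by simp
 moreover have "card (orbit f ` S - {?a, ?b}) = card (orbit f ` S) - 2"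
  using x(1,2) ab by (subst card_Diff_subset) auto
 moreover have "2 \<le> card (orbit f ` S)"
  using card_mono[of "orbit f ` S" "{?a, ?b}"] x(1,2) ab S(1) by simp
 ultimately show ?thesis by simp
qed

lemma card_orbits_split:
 assumes S: "finite S" "f permutes S" and x: "x \<in> S" "y \<in> S" "x \<noteq> y" "y \<in> orbit f x"
 shows "card (orbit (f \<circ> swap x y) ` S) = Suc (card (orbit f ` S))"
proof -
 let ?f = "f \<circ> swap x y"
 obtain s where s: "s < card (orbit f x)" "y = (f ^^ s) x"
  using bij_betw_imp_surj_on[OF orbit_parametrisation[OF S, of x]] x(4) by blast
 hence "0 < s" using x(3) by (cases s) auto
 note sp = split_orbit[OF S x(1) refl this s]
 have "y \<notin> orbit ?f x"
 proof
  assume "y \<in> orbit ?f x"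
  then obtain t where t: "t \<in> {s<..<card (orbit f x)}" "y = (f ^^ t) x" using sp(3) x(3) by auto
  hence "s = t" using inj_onD[OF sp(2), of s t] s by simp
  thus False using t by simp
 qed
 moreover have "?f permutes S" using x by (intro permutes_compose[OF _ S(2)] permutes_swap_id)
 ultimately have "Suc (card (orbit (?f \<circ> swap x y) ` S)) = card (orbit ?f ` S)"
  using card_orbits_merge[OF S(1) _ x(1,2)] by blast
 thus ?thesis by (simp add: comp_assoc)
qed

lemma matching_remove:
 assumes "\<And>x. \<tau> (\<tau> x) = x" "moved \<tau> \<subseteq> S" "card (moved \<tau>) = 2 * Suc k" "finite S" "x \<in> moved \<tau>"
 defines "\<tau>' \<equiv> swap x (\<tau> x) \<circ> \<tau>"
 shows "\<tau>' (\<tau>' z) = z" "moved \<tau>' \<subseteq> S" "card (moved \<tau>') = 2 * k" "\<tau> = \<tau>' \<circ> swap x (\<tau> x)"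
  "x \<in> S" "\<tau> x \<in> S" "x \<noteq> \<tau> x" "\<tau>' = (\<lambda>z. if z = x \<or> z = \<tau> x then z else \<tau> z)"
proof -
 note r = moved_transpose_remove[of \<tau> x, OF assms(1,5), folded \<tau>'_def]
 show "\<tau>' (\<tau>' z) = z" by (rule r(2))
 show "moved \<tau>' \<subseteq> S" using r(1) assms(2) by blast
 have x: "x \<noteq> \<tau> x" "\<tau> x \<in> moved \<tau>" using assms(1,5) by (auto simp: moved_def)
 thus "x \<in> S" "\<tau> x \<in> S" "x \<noteq> \<tau> x" using assms(2,5) by auto
 show "card (moved \<tau>') = 2 * k" unfolding r(1)
  using x assms(2-5) finite_subset by (subst card_Diff_subset) auto
 show v: "\<tau>' = (\<lambda>z. if z = x \<or> z = \<tau> x then z else \<tau> z)"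
 proof
  fix z
  have "\<tau> z \<noteq> x \<and> \<tau> z \<noteq> \<tau> x" if "z \<noteq> x" "z \<noteq> \<tau> x" using that assms(1) by metis
  thus "\<tau>' z = (if z = x \<or> z = \<tau> x then z else \<tau> z)"
   using assms(1) by (auto simp: \<tau>'_def Transposition.transpose_def)
 qed
 show "\<tau> = \<tau>' \<circ> swap x (\<tau> x)"
  unfolding v by (rule ext) (use x assms(1) in \<open>auto simp: Transposition.transpose_def\<close>)
qed

text \<open>Each pair of the matching is a transposition and changes the number of cycles by exactly
  one, up or down.\<close>

lemma card_orbits_matching:
 assumes S: "finite S" "\<sigma> permutes S"
 shows "(\<And>x. \<tau> (\<tau> x) = x) ==> moved \<tau> \<subseteq> S ==> card (moved \<tau>) = 2 * k ==>
  even (card (orbit (\<sigma> \<circ> \<tau>) ` S) + card (orbit \<sigma> ` S) + k) \<and>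
  card (orbit (\<sigma> \<circ> \<tau>) ` S) \<le> card (orbit \<sigma> ` S) + k"
proof (induction k arbitrary: \<tau>)
 case 0
 hence "moved \<tau> = {}" using S(1) finite_subset by fastforce
 hence "\<tau> = id" by (auto simp: moved_def)
 thus ?case by simp
next
 case (Suc k)
 have "moved \<tau> \<noteq> {}" using Suc.prems(3) by auto
 then obtain x where x: "x \<in> moved \<tau>" by blast
 define \<tau>' where "\<tau>' = swap x (\<tau> x) \<circ> \<tau>"
 note r = matching_remove[OF Suc.prems S(1) x, folded \<tau>'_def]
 have p: "\<sigma> \<circ> \<tau>' permutes S" using permutes_compose[OF involution_permutes S(2)] r(1,2) by blast
 have e: "\<sigma> \<circ> \<tau> = (\<sigma> \<circ> \<tau>') \<circ> swap x (\<tau> x)"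
  by (subst r(4)) (simp only: comp_assoc)
 have IH: "even (card (orbit (\<sigma> \<circ> \<tau>') ` S) + card (orbit \<sigma> ` S) + k) \<and>
  card (orbit (\<sigma> \<circ> \<tau>') ` S) \<le> card (orbit \<sigma> ` S) + k" by (rule Suc.IH) (use r in auto)
 have step: "even (n + s + Suc k) \<and> n \<le> s + Suc k"
  if "even (m + s + k) \<and> m \<le> s + k" "n = Suc m \<or> Suc n = m" for m n s :: nat
  using that by presburger
 show ?case
 proof (rule step[OF IH], cases "\<tau> x \<in> orbit (\<sigma> \<circ> \<tau>') x")
  case True
  have "card (orbit (\<sigma> \<circ> \<tau>) ` S) = Suc (card (orbit (\<sigma> \<circ> \<tau>') ` S))"
   unfolding e by (rule card_orbits_split[OF S(1) p r(5-7) True])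
  thus "card (orbit (\<sigma> \<circ> \<tau>) ` S) = Suc (card (orbit (\<sigma> \<circ> \<tau>') ` S)) \<or>
   Suc (card (orbit (\<sigma> \<circ> \<tau>) ` S)) = card (orbit (\<sigma> \<circ> \<tau>') ` S)" ..
 next
  case False
  have "Suc (card (orbit (\<sigma> \<circ> \<tau>) ` S)) = card (orbit (\<sigma> \<circ> \<tau>') ` S)"
   unfolding e by (rule card_orbits_merge[OF S(1) p r(5,6) False])
  thus "card (orbit (\<sigma> \<circ> \<tau>) ` S) = Suc (card (orbit (\<sigma> \<circ> \<tau>') ` S)) \<or>
   Suc (card (orbit (\<sigma> \<circ> \<tau>) ` S)) = card (orbit (\<sigma> \<circ> \<tau>') ` S)" ..
 qed
qed

text \<open>Non-negativity of the genus. A pair joining two cycles of \<sigma> is moved from \<tau>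
  into \<sigma>: the product is unchanged, while k and the number of cycles of \<sigma> drop by one.
  If there is no such pair, transitivity makes \<sigma> a single cycle and
  \<open>card_orbits_matching\<close> finishes.\<close>

lemma card_orbits_transitive:
 assumes "finite S" "S \<noteq> {}"
 shows "\<sigma> permutes S ==> (\<And>x. \<tau> (\<tau> x) = x) ==> moved \<tau> \<subseteq> S ==> card (moved \<tau>) = 2 * k ==>
  (\<And>A. A \<subseteq> S ==> A \<noteq> {} ==> \<sigma> ` A \<subseteq> A ==> \<tau> ` A \<subseteq> A ==> A = S) ==>
  card (orbit \<sigma> ` S) + card (orbit (\<sigma> \<circ> \<tau>) ` S) \<le> k + 2"
proof (induction k arbitrary: \<sigma> \<tau>)
 case (0 \<sigma> \<tau>)
 have "moved \<tau> = {}" using finite_subset[OF 0(3) assms(1)] 0(4) by simp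
 hence id: "\<tau> = id" by (auto simp: moved_def)
 obtain z where z: "z \<in> S" using assms(2) by blast
 have "orbit \<sigma> z = S"
 proof (rule 0(5))
  show "orbit \<sigma> z \<subseteq> S" using permutes_orbit_subset[OF 0(1) z] .
  show "orbit \<sigma> z \<noteq> {}" using orbit.base by fast
  show "\<sigma> ` orbit \<sigma> z \<subseteq> orbit \<sigma> z" using orbit.step by fast
 qed (simp add: id)
 hence "orbit \<sigma> ` S = {S}" using z permutes_orbit_eq[OF assms(1) 0(1)] by blast
 thus ?case by (simp add: id)
next
 case (Suc k \<sigma> \<tau>)
 note S = assms(1) Suc.prems(1)
 show ?case
 proof (cases "\<exists>x\<in>moved \<tau>. \<tau> x \<notin> orbit \<sigma> x")
  case False
  obtain z where z: "z \<in> S" using assms(2) by blast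
  have "orbit \<sigma> z = S"
  proof (rule Suc.prems(5))
   show "orbit \<sigma> z \<subseteq> S" using permutes_orbit_subset[OF S(2) z] .
   show "orbit \<sigma> z \<noteq> {}" using orbit.base by fast
   show "\<sigma> ` orbit \<sigma> z \<subseteq> orbit \<sigma> z" using orbit.step by fast
   show "\<tau> ` orbit \<sigma> z \<subseteq> orbit \<sigma> z"
   proof
    fix y assume "y \<in> \<tau> ` orbit \<sigma> z"
    then obtain x where x: "x \<in> orbit \<sigma> z" "y = \<tau> x" by blast
    have "y = x \<or> y \<in> orbit \<sigma> x" using False x(2) by (auto simp: moved_def)
    thus "y \<in> orbit \<sigma> z" using x(1) permutes_orbit_eq[OF S x(1)] by blast
   qed
  qed
  hence "orbit \<sigma> ` S = {S}" using z permutes_orbit_eq[OF S] by blast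
  hence "card (orbit \<sigma> ` S) = 1" by simp
  moreover have "card (orbit (\<sigma> \<circ> \<tau>) ` S) \<le> card (orbit \<sigma> ` S) + Suc k"
   using card_orbits_matching[OF S Suc.prems(2-4)] by blast
  ultimately show ?thesis by linarith
 next
  case True
  then obtain x where x: "x \<in> moved \<tau>" "\<tau> x \<notin> orbit \<sigma> x" by blast
  let ?T = "swap x (\<tau> x)"
  define \<tau>' where "\<tau>' = ?T \<circ> \<tau>"
  define \<sigma>' where "\<sigma>' = \<sigma> \<circ> ?T"
  note r = matching_remove[OF Suc.prems(2-4) S(1) x(1), folded \<tau>'_def]
  have p: "\<sigma>' permutes S" unfolding \<sigma>'_def using r by (intro permutes_compose[OF _ S(2)] permutes_swap_id)
  have e: "\<sigma>' \<circ> \<tau>' = \<sigma> \<circ> \<tau>" by (simp add: \<sigma>'_def \<tau>'_def fun_eq_iff)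
  have "card (orbit \<sigma>' ` S) + card (orbit (\<sigma>' \<circ> \<tau>') ` S) \<le> k + 2"
  proof (rule Suc.IH[OF p r(1-3)])
   fix A assume A: "A \<subseteq> S" "A \<noteq> {}" "\<sigma>' ` A \<subseteq> A" "\<tau>' ` A \<subseteq> A"
   have o: "orbit \<sigma>' z \<subseteq> A" if "z \<in> A" for z by (rule orbit_invariant[OF _ that]) (use A(3) in blast)
   have ox: "orbit \<sigma>' x = orbit \<sigma> x \<union> orbit \<sigma> (\<tau> x)"
    unfolding \<sigma>'_def by (rule merge_orbit(1)[OF S r(5,6) x(2)])
   have "\<tau> x \<in> orbit \<sigma>' x" using ox permutes_orbit_self[OF S] by blast
   hence "orbit \<sigma>' (\<tau> x) = orbit \<sigma>' x" by (rule permutes_orbit_eq[OF S(1) p])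
   \<comment> \<open>After the merge x and its partner lie on one cycle, so a set stable under
     \<sigma>' contains both or neither; this carries stability back to \<sigma> and \<tau>.\<close>
   hence xy: "x \<in> A \<longleftrightarrow> \<tau> x \<in> A"
    using o \<open>\<tau> x \<in> orbit \<sigma>' x\<close> permutes_orbit_self[OF S(1) p, of x] by blast
   show "A = S"
   proof (rule Suc.prems(5)[OF A(1,2)])
    show "\<tau> ` A \<subseteq> A"
    proof
     fix y assume "y \<in> \<tau> ` A"
     then obtain z where z: "z \<in> A" "y = \<tau> z" by blast
     show "y \<in> A"
     proof (cases "z = x \<or> z = \<tau> x")
      case True thus ?thesis using z xy Suc.prems(2) by metis
     next
      case False
      hence "\<tau>' z = y" using z by (simp add: r(8))
      thus ?thesis using z A(4) by blast
     qed
    qed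
    show "\<sigma> ` A \<subseteq> A"
    proof
     fix y assume "y \<in> \<sigma> ` A"
     then obtain z where z: "z \<in> A" "y = \<sigma> z" by blast
     have "?T z \<in> A"
     proof (cases "z = x \<or> z = \<tau> x")
      case True
      hence "x \<in> A" "\<tau> x \<in> A" using z(1) xy by blast+
      thus ?thesis using True by (elim disjE) simp_all
     next
      case False thus ?thesis using z(1) by simp
     qed
     moreover have "\<sigma>' (?T z) = y" by (simp add: \<sigma>'_def z)
     ultimately show "y \<in> A" using A(3) by blast
    qed
   qed
  qed
  moreover have "Suc (card (orbit \<sigma>' ` S)) = card (orbit \<sigma> ` S)"
   unfolding \<sigma>'_def by (rule card_orbits_merge[OF S r(5,6) x(2)])
  ultimately show ?thesis unfolding e by linarith
 qed
qed

section \<open>The connected operator\<close>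

lemma finite_types: "finite {(g, np, nm). 0 < np \<and> 0 < nm \<and> 2 * g + np + nm = k + (2 :: nat)}"
 by (rule finite_subset[of _ "{..k + 2} \<times> {..k + 2} \<times> {..k + 2}"]) auto

text \<open>Parity from \<open>card_orbits_matching\<close> and the bound from
  \<open>card_orbits_transitive\<close> make the genus in Euler's formula a natural number.\<close>

lemma (in index_set) conn_genus:
 assumes t: "\<tau> \<in> conn_matchings"
 defines "n \<equiv> card (orbit (\<sigma> \<circ> \<tau>) ` S)"
 shows "0 < n" "\<exists>g. 2 * g + card J + n = k + 2"
proof -
 interpret connected_matching len J k \<tau> by unfold_locales (rule t)
 have t': "\<tau> \<in> involutions (live J)" "card (moved \<tau>) = 2 * k" using t by (auto simp: conn_matchings_def conn_def)
 have i: "\<tau> (\<tau> x) = x" for x by (rule involutionsD(1)[OF t'(1)])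
 have m: "moved \<tau> \<subseteq> S" using involutionsD(2)[OF t'(1)] by (simp add: live_S)
 have S0: "S \<noteq> {}" using J0 len0 by (auto simp: S_eq)
 have "size (ctype S (dset J) \<sigma>) = card J" by (simp add: ctype_rot[OF finJ])
 hence c: "card (orbit \<sigma> ` S) = card J" by (simp add: ctype_def)
 show "0 < n" unfolding n_def using finS S0 by (simp add: card_gt_0_iff)
 have "even (n + card J + k)" using card_orbits_matching[OF finS perm\<sigma> i m t'(2)] by (simp add: c n_def)
 moreover have "card J + n \<le> k + 2"
  unfolding n_def c[symmetric]
  by (rule card_orbits_transitive[OF finS S0 perm\<sigma> i m t'(2)], rule invariant_all) auto
 ultimately show "\<exists>g. 2 * g + card J + n = k + 2" by presburger
qed

lemma K_op_length: "length b \<noteq> np ==> K_op g np nm F b = 0"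
 by (cases "(g, np, nm) = (0, 1, 1)") (simp add: K_op_def, simp add: K_op_graphs)

lemma K_connected_neutral:
 assumes "\<And>g np nm. 0 < np ==> 2 * g + np + nm = k + 2 ==> K_op g np nm F b = 0"
 shows "K_connected k F b = 0"
 unfolding K_connected_def by (rule sum.neutral) (auto simp: assms)

context index_set
begin

lemma K_connected_matchings:
 assumes F: "F \<in> fock"
 shows "K_connected k F b = (\<Sum>\<tau>\<in>conn_matchings. mfun F (vtype J \<tau>))"
proof -
 let ?T = "{(g, np, nm). 0 < np \<and> 0 < nm \<and> 2 * g + np + nm = k + 2}"
 define T where "T = {x \<in> ?T. fst (snd x) = card J}"
 define n where "n \<tau> = card (orbit (\<sigma> \<circ> \<tau>) ` S)" for \<tau>
 \<comment> \<open>The topological type of the surface of a connected matching; there the division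
   by 2 is exact, by \<open>conn_genus\<close>.\<close>
 define h where "h \<tau> = ((k + 2 - card J - n \<tau>) div 2, card J, n \<tau>)" for \<tau>
 have fin: "finite conn_matchings" using finite_conn[OF finJ] by (simp add: conn_matchings_def)
 have fT: "finite T" using finite_types[of k] by (simp add: T_def)
 have J: "0 < card J" using finJ J0 by (simp add: card_gt_0_iff)
 have hT: "h \<tau> \<in> T" if t: "\<tau> \<in> conn_matchings" for \<tau>
 proof -
  obtain g where "2 * g + card J + n \<tau> = k + 2" using conn_genus(2)[OF t] unfolding n_def by blast
  moreover from this have "k + 2 - card J - n \<tau> = 2 * g" by linarith
  ultimately have "2 * ((k + 2 - card J - n \<tau>) div 2) + card J + n \<tau> = k + 2" by simp
  thus ?thesis using conn_genus(1)[OF t] J by (simp add: T_def h_def n_def)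
 qed
 have "K_connected k F b = (\<Sum>(g, np, nm)\<in>T. K_op g np nm F b)"
  unfolding K_connected_def T_def using finite_types[of k] b(1)
  by (intro sum.mono_neutral_right) (auto intro!: K_op_length)
 also have "... = (\<Sum>x\<in>T. \<Sum>\<tau>\<in>{\<tau> \<in> conn_matchings. h \<tau> = x}. mfun F (vtype J \<tau>))"
 proof (intro sum.cong refl)
  fix x assume "x \<in> T"
  then obtain g nm where x: "x = (g, card J, nm)" "2 * g + card J + nm = k + 2" by (auto simp: T_def)
  have "h \<tau> = x \<longleftrightarrow> n \<tau> = nm" for \<tau> using x by (auto simp: h_def)
  thus "(case x of (g, np, nm) => K_op g np nm F b) = (\<Sum>\<tau>\<in>{\<tau> \<in> conn_matchings. h \<tau> = x}. mfun F (vtype J \<tau>))"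
   using K_op_matchings[OF F x(2)] by (simp add: x(1) n_def)
 qed
 also have "... = (\<Sum>\<tau>\<in>conn_matchings. mfun F (vtype J \<tau>))"
  by (rule sum.group[OF fin fT]) (use hT in blast)
 finally show ?thesis .
qed

end

context circles
begin

lemma csum_degree:
 assumes "finite J"
 shows "C.csum J (degree_part k g) = (\<Sum>\<tau>\<in>{\<tau> \<in> conn J. card (moved \<tau>) = 2 * k}. g (vtype J \<tau>))"
proof -
 have ev: "card (moved \<tau>) div 2 = k \<longleftrightarrow> card (moved \<tau>) = 2 * k" if "\<tau> \<in> conn J" for \<tau>
  using even_moved[OF _ finite_live[OF assms]] that by (auto simp: conn_def)
 have "finite (conn J)"
  by (rule finite_subset[OF _ finite_involutions[OF finite_live[OF assms]]]) (auto simp: conn_def)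
 thus ?thesis unfolding C.csum_def using ev
  by (intro sum.mono_neutral_cong_right) (auto simp: degree_part_def vval_def)
qed

text \<open>A circle without live cells is fixed pointwise and is therefore a component by
  itself.\<close>

lemma conn_zero:
 assumes "\<tau> \<in> conn J" "i \<in> J" "len i = 0" shows "J = {i}" "moved \<tau> = {}"
proof -
 have i: "\<tau> \<in> involutions (live J)" using assms(1) by (simp add: conn_def)
 have fix_i: "\<tau> (i, p) = (i, p)" for p
  using involutionsD(2)[OF i] assms(3) by (auto simp: moved_def live_def)
 have "fst (\<tau> x) \<noteq> i" if "fst x \<noteq> i" for x
  using that fix_i involutionsD(1)[OF i] by (metis prod.collapse fst_conv)
 hence "keeps \<tau> {i}" using fix_i by (auto simp: keeps_def)
 thus J: "J = {i}" using assms by (auto simp: conn_def)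
 have "moved \<tau> \<subseteq> live J" by (rule involutionsD(2)[OF i])
 thus "moved \<tau> = {}" using assms(3) by (auto simp: J live_def)
qed

text \<open>Outside \<open>index_set\<close> the two sides are compared directly. Without circles
  both are 0. For k = 0 only the cylinder occurs, the identity on one variable. With a circle of
  length 0 and k > 0 the factor \<open>prod_list b\<close> kills the operator, and there is no
  connected matching.\<close>

lemma K_connected_csum:
 assumes J: "finite J" and F: "F \<in> fock"
 shows "K_connected k F (sublist len J) = C.csum J (degree_part k (mfun F))"
proof -
 let ?b = "sublist len J"
 have lb: "length ?b = card J" by (simp add: sublist_def)
 consider "J = {}" | "J \<noteq> {}" "k = 0" | i where "i \<in> J" "len i = 0" "0 < k" |
  "J \<noteq> {}" "\<And>i. i \<in> J ==> 0 < len i" "0 < k" by blast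
 thus ?thesis
 proof cases
  case 1
  have "K_connected k F ?b = 0"
    by (rule K_connected_neutral, rule K_op_length) (use lb 1 in simp)
  thus ?thesis using 1 by (simp add: csum_degree conn_def)
 next
  case 2
  have T: "{(g, np, nm). 0 < np \<and> 0 < nm \<and> 2 * g + np + nm = k + 2} = {(0, 1, 1)}" using 2(2) by auto
  have K: "K_connected k F ?b = (if card J = 1 then mfun F (mset ?b) else 0)"
   unfolding K_connected_def T by (simp add: K_op_def lb fock_mfun[OF F])
  have mv: "moved \<tau> = {} \<longleftrightarrow> \<tau> = id" for \<tau> :: "nat \<times> nat => nat \<times> nat" by (auto simp: moved_def)
  have fm: "card (moved \<tau>) = 2 * k \<longleftrightarrow> \<tau> = id" if "\<tau> \<in> conn J" for \<tau>
  proof -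
   have "moved \<tau> \<subseteq> live J" using that by (intro involutionsD(2)) (simp add: conn_def)
   hence "finite (moved \<tau>)" by (rule finite_subset[OF _ finite_live[OF J]])
   thus ?thesis using mv 2 by simp
  qed
  have id: "id \<in> conn J \<longleftrightarrow> card J = 1"
  proof -
   have k: "keeps id I" for I :: "nat set" by (auto simp: keeps_def)
   have "id \<in> conn J \<longleftrightarrow> (\<forall>I\<subseteq>J. I \<noteq> {} --> I = J)"
    using 2 k by (auto simp: conn_def involutions_def moved_def)
   also have "... \<longleftrightarrow> card J = 1"
   proof
    assume *: "\<forall>I\<subseteq>J. I \<noteq> {} --> I = J"
    obtain j where "j \<in> J" using 2 by blast
    hence "{j} = J" using * by blast
    thus "card J = 1" by (metis is_singletonI is_singleton_altdef)
   next
    assume "card J = 1"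
    then obtain j where "J = {j}" by (rule card_1_singletonE)
    thus "\<forall>I\<subseteq>J. I \<noteq> {} --> I = J" by blast
   qed
   finally show ?thesis .
  qed
  have "vtype J id = mset ?b" by (simp add: vtype_def moved_def ctype_rot[OF J] mset_sublist[OF J])
  moreover have "{\<tau> \<in> conn J. card (moved \<tau>) = 2 * k} = (if card J = 1 then {id} else {})"
   using fm id by auto
  ultimately show ?thesis by (simp add: K csum_degree[OF J])
 next
  case 3
  have "prod_list ?b = 0"
   using 3 J by (auto simp: sublist_def prod_list_zero_iff image_iff)
  hence "K_op g np nm F ?b = 0" if "2 * g + np + nm = k + 2" for g np nm
   using K_op_graphs[of g np nm F ?b] that 3(3) by (cases "(g, np, nm) = (0, 1, 1)") auto
  hence "K_connected k F ?b = 0" by (rule K_connected_neutral)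
  moreover have "{\<tau> \<in> conn J. card (moved \<tau>) = 2 * k} = {}" using conn_zero(2)[OF _ 3(1,2)] 3(3) by auto
  ultimately show ?thesis by (simp only: csum_degree[OF J] sum.empty)
 next
  case 4
  interpret index_set len J k by unfold_locales (use J 4 in auto)
  show ?thesis using K_connected_matchings[OF F] by (simp add: b_def csum_degree[OF J] conn_matchings_def)
 qed
qed

end

section \<open>The cut-and-join equation\<close>

lemma sublist_nth: "sublist ((!) xs) {..<length xs} = xs"
 by (simp add: sublist_def lessThan_atLeast0 map_nth)

text \<open>The entries of xs are taken as the circle lengths, indexed by their positions.\<close>

lemma disj_exp_K_connected:
 assumes "F \<in> fock" shows "disj_exp K_connected k F xs = (W1 ^^ k) F xs / fact k"
proof -
 interpret circles "(!) xs" .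
 from disj_exp_eq[of K_connected "{..<length xs}" F k] K_connected_csum assms
 show ?thesis by (simp add: sublist_nth)
qed

lemma W1_divide: "W1 (\<lambda>ys. F ys / c) xs = W1 F xs / c"
proof -
 have "t_mult k (\<lambda>ys. G ys / c) = (\<lambda>ys. t_mult k G ys / c)" "t_deriv k (\<lambda>ys. G ys / c) = (\<lambda>ys. t_deriv k G ys / c)" for k G
  by (simp_all add: fun_eq_iff t_mult_def t_deriv_def sum_divide_distrib)
 thus ?thesis
  by (simp add: W1_def P_plus_def P_minus_def add_divide_distrib flip: sum_divide_distrib)
qed

text \<open>A connected matching with one pair on two circles is a transposition of one cell from
  each, and Euler's formula forces a single negative boundary. It contains all cells but the two
  matched ones.\<close>

lemma (in circles) K_op_join:
 assumes ij: "i \<noteq> j" and F: "F \<in> fock"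
 shows "K_op 0 2 1 F (sublist len {i, j}) = of_nat (len i * len j) * mfun F {#len i + len j - 2#}"
proof (cases "len i = 0 \<or> len j = 0")
 case True
 have "prod_mset (mset (sublist len {i, j})) = len i * len j"
  by (simp add: mset_sublist ij)
 hence "prod_list (sublist len {i, j}) = 0" using True by (metis mult_is_0 prod_mset_prod_list)
 thus ?thesis using True K_op_graphs[of 0 2 1 F] by auto
next
 case False
 let ?J = "{i, j}"
 interpret index_set len ?J "Suc 0" by unfold_locales (use False in auto)
 have c2: "card ?J = 2" using ij by simp
 have inv: "\<tau> \<in> involutions (live ?J)" "card (moved \<tau>) = 2" if "\<tau> \<in> conn_matchings" for \<tau>
  using that by (auto simp: conn_matchings_def conn_def)
 have one: "card (orbit (\<sigma> \<circ> \<tau>) ` S) = 1" if t: "\<tau> \<in> conn_matchings" for \<tau>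
 proof -
  have "0 < card (orbit (\<sigma> \<circ> \<tau>) ` S)" by (rule conn_genus(1)[OF t])
  moreover obtain g where "2 * g + card ?J + card (orbit (\<sigma> \<circ> \<tau>) ` S) = Suc 0 + 2" using conn_genus(2)[OF t] by blast
  ultimately show ?thesis unfolding c2 by linarith
 qed
 have v: "vtype ?J \<tau> = {#len i + len j - 2#}" if t: "\<tau> \<in> conn_matchings" for \<tau>
 proof -
  have m: "moved \<tau> \<subseteq> S" using involutionsD(2)[OF inv(1)[OF t]] by (simp add: live_S)
  have p: "\<sigma> \<circ> \<tau> permutes S"
   using permutes_compose[OF involution_permutes perm\<sigma>] involutionsD(1)[OF inv(1)[OF t]] m by blast
  obtain c where c: "orbit (\<sigma> \<circ> \<tau>) ` S = {c}" using one[OF t] by (rule card_1_singletonE)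
  have "x \<in> c" if "x \<in> S" for x using c that permutes_orbit_self[OF finS p, of x] by blast
  moreover have "c \<subseteq> S" using c permutes_orbit_sub[OF p] by blast
  ultimately have "c = S" by blast
  moreover have "card (S - moved \<tau>) = len i + len j - 2"
   using m inv(2)[OF t] finS finite_subset[OF m finS] ij by (simp add: card_Diff_subset) (simp add: S_eq)
  ultimately show ?thesis by (simp add: vtype_def ctype_def c dset_empty)
 qed
 let ?X = "({i} \<times> {..<len i}) \<times> ({j} \<times> {..<len j})"
 have "bij_betw (\<lambda>(x, y). swap x y) ?X conn_matchings"
 proof (rule bij_betw_imageI)
  show "inj_on (\<lambda>(x, y). swap x y) ?X"
  proof (rule inj_onI)
   fix u u' assume u: "u \<in> ?X" "u' \<in> ?X" "(case u of (x, y) => swap x y) = (case u' of (x, y) => swap x y)"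
   obtain x y x' y' where xy: "u = (x, y)" "u' = (x', y')" by (metis surj_pair)
   hence f: "fst x = i" "fst x' = i" "fst y = j" "fst y' = j" using u by auto
   have eq: "swap x y = swap x' y'" using u xy by simp
   have "x = x'"
   proof (rule ccontr)
    assume "x \<noteq> x'"
    hence "swap x' y' x = x" using f ij by (intro transpose_apply_other) auto
    thus False using eq f ij by (metis transpose_apply_first)
   qed
   moreover from this have "y = y'" using eq by (metis transpose_apply_first)
   ultimately show "u = u'" using xy by simp
  qed
  show "(\<lambda>(x, y). swap x y) ` ?X = conn_matchings"
  proof (intro equalityI subsetI)
   fix \<tau> assume "\<tau> \<in> (\<lambda>(x, y). swap x y) ` ?X"
   then obtain u where u: "u \<in> ?X" "\<tau> = (case u of (x, y) => swap x y)" by blast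
   obtain x y where "u = (x, y)" by (cases u)
   hence xy: "\<tau> = swap x y" "x \<in> {i} \<times> {..<len i}" "y \<in> {j} \<times> {..<len j}"
    using u by (simp_all only: prod.case mem_Sigma_iff)
   hence ne: "fst x = i" "fst y = j" "x \<noteq> y" using ij by auto
   have mv: "moved \<tau> = {x, y}" using ne(3) by (auto simp: moved_def xy(1) Transposition.transpose_def)
   moreover have "{x, y} \<subseteq> live ?J" using xy by (auto simp: live_def)
   ultimately have "\<tau> \<in> involutions (live ?J)" by (simp add: involutions_def xy(1))
   moreover have "I = ?J" if I: "I \<subseteq> ?J" "I \<noteq> {}" "keeps \<tau> I" for I
   proof -
    have "i \<in> I ==> j \<in> I" using keepsD[OF I(3), of x] ne by (simp add: xy(1))
    moreover have "j \<in> I ==> i \<in> I" using keepsD[OF I(3), of y] ne by (simp add: xy(1))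
    ultimately show ?thesis using I by blast
   qed
   ultimately have "\<tau> \<in> conn ?J" by (simp add: conn_def)
   thus "\<tau> \<in> conn_matchings" using ne(3) by (simp add: conn_matchings_def mv)
  next
   fix \<tau> assume t: "\<tau> \<in> conn_matchings"
   have ii: "\<tau> (\<tau> z) = z" for z by (rule involutionsD(1)[OF inv(1)[OF t]])
   have m: "moved \<tau> \<subseteq> S" using involutionsD(2)[OF inv(1)[OF t]] by (simp add: live_S)
   have "\<not> keeps \<tau> {i}" using t ij by (auto simp: conn_matchings_def conn_def)
   then obtain x where x: "fst x = i" "fst (\<tau> x) \<noteq> i" by (auto simp: keeps_def)
   have mx: "x \<in> moved \<tau>" "\<tau> x \<in> moved \<tau>" using x ii by (auto simp: moved_def)
   have "fst (\<tau> x) = j" using x(2) m mx fst_S[of "\<tau> x"] by blast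
   moreover have "snd z < len (fst z)" if "z \<in> S" for z using that by (auto simp: S_eq)
   ultimately have X: "(x, \<tau> x) \<in> ?X" using x m mx by (auto simp: mem_Times_iff)
   have "x \<noteq> \<tau> x" using x by metis
   hence "{x, \<tau> x} = moved \<tau>"
    using mx inv(2)[OF t] finite_subset[OF m finS] by (intro card_subset_eq) auto
   hence "\<tau> = swap x (\<tau> x)"
    using ii by (auto simp: fun_eq_iff Transposition.transpose_def moved_def)
   thus "\<tau> \<in> (\<lambda>(x, y). swap x y) ` ?X" using X by (metis (no_types, lifting) case_prod_conv imageI)
  qed
 qed
 hence card: "card conn_matchings = len i * len j" by (simp add: bij_betw_same_card[symmetric] card_cartesian_product)
 have "K_op 0 2 1 F b = (\<Sum>\<tau>\<in>{\<tau> \<in> conn_matchings. card (orbit (\<sigma> \<circ> \<tau>) ` S) = 1}. mfun F (vtype ?J \<tau>))"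
  using K_op_matchings[OF F, of 0 1] by (simp add: c2)
 also have "... = (\<Sum>\<tau>\<in>conn_matchings. mfun F {#len i + len j - 2#})"
  by (intro sum.cong) (use one v in auto)
 finally show ?thesis by (simp add: card b_def)
qed

text \<open>Read off from the coefficient of q in \<open>disj_exp_K_connected\<close> at a single
  variable: of the two surfaces with k = 1 only (0, 1, 2) has one output, and \<open>P_plus\<close>
  needs two entries.\<close>

lemma K_op_cut: assumes F: "F \<in> fock" shows "K_op 0 1 2 F [u] = P_minus F [u]"
proof -
 have T: "{(g, np, nm). 0 < np \<and> 0 < nm \<and> 2 * g + np + nm = (1 :: nat) + 2} = {(0, 1, 2), (0, 2, 1)}"
  by auto presburger
 have "disj_exp K_connected 1 F [u] = K_connected 1 F [u]"
  by (simp add: disj_exp_def disj_union_series_def disj_union_def vacuum_op_def lessThan_Suc Pow_insert)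
 also have "... = K_op 0 1 2 F [u]" unfolding K_connected_def T by (simp add: K_op_length)
 finally have "K_op 0 1 2 F [u] = W1 F [u]" using disj_exp_K_connected[OF F, of 1 "[u]"] by simp
 thus ?thesis by (simp add: W1_def P_plus_eq[OF F] P_plus_mset_def)
qed

text \<open>Each two-element subset comes from two ordered pairs.\<close>

lemma sum_card2_subsets:
 fixes f :: "'a set => rat"
 assumes A: "finite A"
 shows "(\<Sum>I\<in>{I \<in> Pow A. card I = 2}. f I) = 1 / 2 * (\<Sum>u\<in>A. \<Sum>v\<in>A - {u}. f {u, v})"
proof -
 let ?X = "Sigma A (\<lambda>u. A - {u})" let ?P = "{I \<in> Pow A. card I = 2}"
 have "(\<Sum>u\<in>A. \<Sum>v\<in>A - {u}. f {u, v}) = (\<Sum>x\<in>?X. f {fst x, snd x})"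
  using A by (simp add: sum.Sigma case_prod_beta)
 also have "... = (\<Sum>I\<in>?P. \<Sum>x\<in>{x \<in> ?X. {fst x, snd x} = I}. f {fst x, snd x})"
  by (rule sum.group[symmetric]) (use A in auto)
 also have "... = (\<Sum>I\<in>?P. 2 * f I)"
 proof (intro sum.cong refl)
  fix I assume "I \<in> ?P"
  then obtain u v where I: "I = {u, v}" "u \<noteq> v" "u \<in> A" "v \<in> A" by (auto simp: card_2_iff)
  hence "{x \<in> ?X. {fst x, snd x} = I} = {(u, v), (v, u)}" by (auto simp: doubleton_eq_iff)
  thus "(\<Sum>x\<in>{x \<in> ?X. {fst x, snd x} = I}. f {fst x, snd x}) = 2 * f I"
   using I by (simp add: insert_commute)
 qed
 finally show ?thesis by (simp flip: sum_distrib_left)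
qed

text \<open>\<open>K_op\<close> vanishes unless its output has the right number of variables, so the
  disjoint union splits off only pairs, respectively single variables; the others are passive
  parameters of F.\<close>

lemma disj_union_K_op:
 assumes F: "F \<in> fock"
 shows "P_plus F xs = disj_union (K_op 0 2 1) id F xs" "P_minus F xs = disj_union (K_op 0 1 2) id F xs"
proof -
 let ?l = "(!) xs" let ?A = "{..<length xs}" let ?M = "mset xs"
 interpret circles ?l .
 have M: "?M = image_mset ?l (mset_set ?A)" using mset_sublist[of ?A ?l] by (simp add: sublist_nth)
 have du: "disj_union B id F xs = (\<Sum>I\<in>Pow ?A. B (\<lambda>zs. F (zs @ sublist ?l (?A - I))) (sublist ?l I))" for B
  using disj_union_sublist[of ?A B id F ?l] by (simp add: sublist_nth)
 have rest: "mset (sublist ?l (?A - I)) = ?M - image_mset ?l (mset_set I)" if "I \<subseteq> ?A" for I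
  using that by (simp add: M mset_sublist mset_set_Diff image_mset_Diff finite_subset[OF that] subset_imp_msubset_mset_set)
 have red: "disj_union (K_op 0 c d) id F xs =
  (\<Sum>I\<in>{I \<in> Pow ?A. card I = c}. K_op 0 c d (\<lambda>zs. F (zs @ sublist ?l (?A - I))) (sublist ?l I))" for c d
  unfolding du by (intro sum.mono_neutral_right) (auto intro!: K_op_length simp: sublist_def)
 define g where "g = mfun F"
 have "disj_union (K_op 0 2 1) id F xs = 1 / 2 * (\<Sum>u\<in>?A. \<Sum>v\<in>?A - {u}.
   K_op 0 2 1 (\<lambda>zs. F (zs @ sublist ?l (?A - {u, v}))) (sublist ?l {u, v}))"
  unfolding red by (rule sum_card2_subsets) simp
 also have "... = 1 / 2 * (\<Sum>u\<in>?A. \<Sum>v\<in>?A - {u}.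
   of_nat (?l u * ?l v) * g (?M - {#?l u#} - {#?l v#} + {#?l u + ?l v - 2#}))"
 proof (intro arg_cong2[where f = "(*)"] sum.cong refl)
  fix u v assume uv: "u \<in> ?A" "v \<in> ?A - {u}"
  have "K_op 0 2 1 (\<lambda>zs. F (zs @ sublist ?l (?A - {u, v}))) (sublist ?l {u, v}) =
   of_nat (?l u * ?l v) * mfun (\<lambda>zs. F (zs @ sublist ?l (?A - {u, v}))) {#?l u + ?l v - 2#}"
   by (rule K_op_join) (use uv F fock_append in auto)
  also have "mfun (\<lambda>zs. F (zs @ sublist ?l (?A - {u, v}))) {#?l u + ?l v - 2#} =
   g ({#?l u + ?l v - 2#} + (?M - image_mset ?l (mset_set {u, v})))"
   unfolding g_def mfun_append[OF F] using rest[of "{u, v}"] uv by simp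
  also have "{#?l u + ?l v - 2#} + (?M - image_mset ?l (mset_set {u, v})) = ?M - {#?l u#} - {#?l v#} + {#?l u + ?l v - 2#}"
   using uv by (simp add: add_mset_commute)
  finally show "K_op 0 2 1 (\<lambda>zs. F (zs @ sublist ?l (?A - {u, v}))) (sublist ?l {u, v}) =
   of_nat (?l u * ?l v) * g (?M - {#?l u#} - {#?l v#} + {#?l u + ?l v - 2#})" .
 qed
 also have "... = P_plus_mset g ?M"
 proof -
  have "(\<Sum>v\<in>#?M - {#?l u#}. h v) = (\<Sum>v\<in>?A - {u}. h (?l v))" if u: "u \<in> ?A" for u and h :: "nat => rat"
  proof -
   have "?M - {#?l u#} = mset (sublist ?l (?A - {u}))" using rest[of "{u}"] u by simp
   thus ?thesis by (simp add: mset_sublist image_mset.compositionality comp_def sum_unfold_sum_mset)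
  qed
  thus ?thesis unfolding P_plus_mset_def
   by (simp add: M image_mset.compositionality comp_def flip: sum_unfold_sum_mset)
 qed
 finally show "P_plus F xs = disj_union (K_op 0 2 1) id F xs" by (simp add: P_plus_eq[OF F] g_def)
 have inj: "inj_on (\<lambda>u. {u}) ?A" by simp
 have "{I \<in> Pow ?A. card I = 1} = (\<lambda>u. {u}) ` ?A" by (auto simp: card_1_singleton_iff)
 hence "disj_union (K_op 0 1 2) id F xs =
  (\<Sum>u\<in>?A. K_op 0 1 2 (\<lambda>zs. F (zs @ sublist ?l (?A - {u}))) (sublist ?l {u}))"
  unfolding red by (simp add: sum.reindex[OF inj])
 also have "... = (\<Sum>u\<in>?A. 1 / 2 * (of_nat (?l u) * (\<Sum>i<?l u - 1. g (?M - {#?l u#} + {#i#} + {#?l u - 2 - i#}))))"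
 proof (intro sum.cong refl)
  fix u assume u: "u \<in> ?A"
  have e: "mfun (\<lambda>zs. F (zs @ sublist ?l (?A - {u}))) N = g (?M - {#?l u#} + N)" for N
   unfolding g_def mfun_append[OF F] using rest[of "{u}"] u by (simp add: add.commute)
  have "sublist ?l {u} = [?l u]" by (simp add: sublist_def)
  hence "K_op 0 1 2 (\<lambda>zs. F (zs @ sublist ?l (?A - {u}))) (sublist ?l {u}) =
   P_minus_mset (mfun (\<lambda>zs. F (zs @ sublist ?l (?A - {u})))) {#?l u#}"
   using K_op_cut[OF fock_append[OF F]] P_minus_eq[OF fock_append[OF F]] by simp
  thus "K_op 0 1 2 (\<lambda>zs. F (zs @ sublist ?l (?A - {u}))) (sublist ?l {u}) =
   1 / 2 * (of_nat (?l u) * (\<Sum>i<?l u - 1. g (?M - {#?l u#} + {#i#} + {#?l u - 2 - i#})))"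
   by (simp add: P_minus_mset_def e[abs_def] e)
 qed
 also have "... = P_minus_mset g ?M"
  unfolding P_minus_mset_def by (simp add: M image_mset.compositionality comp_def sum_distrib_left flip: sum_unfold_sum_mset)
 finally show "P_minus F xs = disj_union (K_op 0 1 2) id F xs" by (simp add: P_minus_eq[OF F] g_def)
qed

theorem mainTheorem1:
  fixes F :: series and xs :: "nat list"
  assumes "F \<in> fock"
  shows "P_plus F xs = disj_union (K_op 0 2 1) id F xs \<and>
         P_minus F xs = disj_union (K_op 0 1 2) id F xs \<and>
         fps_deriv (K_series F xs) = apply_q W1 (K_series F) xs \<and>
         fps_nth (K_series F xs) 0 = F xs \<and>
         K_series F xs = exp_q W1 F xs"
proof (intro conjI)
  show "P_plus F xs = disj_union (K_op 0 2 1) id F xs" "P_minus F xs = disj_union (K_op 0 1 2) id F xs"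
    by (rule disj_union_K_op[OF assms])+
  have K: "fps_nth (K_series F ys) k = (W1 ^^ k) F ys / fact k" for ys k
    by (simp add: K_series_def disj_exp_K_connected[OF assms])
  show "fps_nth (K_series F xs) 0 = F xs" by (simp add: K)
  show "K_series F xs = exp_q W1 F xs" by (rule fps_ext) (simp add: K exp_q_def)
  \<comment> \<open>The k-th coefficient of the derivative is (k + 1)/(k + 1)! = 1/k! times
    \<open>W1 ^^ Suc k\<close>, that is, \<open>W1\<close> applied to the k-th coefficient.\<close>
  show "fps_deriv (K_series F xs) = apply_q W1 (K_series F) xs"
    by (rule fps_ext) (simp add: K apply_q_def W1_divide field_simps del: of_nat_Suc)
qed

end
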